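(* Let $\bar t>0$, $I=(0,\bar t)$, let $\gamma_1,\gamma_2\in\mathrm{Lip}(I)$ (extended continuously to $\bar I$) with $\gamma_1<0<\gamma_2$ on $I$, $\gamma_1(0)=\gamma_1(\bar t)=\gamma_2(0)=\gamma_2(\bar t)=0$, and such that $D=\{(y,t)\in\mathbb W: t\in I,\ \gamma_1(t)<y<\gamma_2(t)\}$ is convex. Let $\phi\in C(\partial D)$ with $\phi_1,\phi_2\in\mathrm{Lip}(I)$, and assume $$\zeta<\frac{\sqrt{721}-25}{48}.$$ Let $u\in\mathrm{Lip}(D)$ be the function with $u=\phi$ on $\partial D$ and $S_u=R_\phi$, and let $D^r\subset\mathbb W$ open and $u^r\in\mathrm{Lip}_{loc}(D^r)$ be such that $S_u=S^r_{u^r}$. Then $$\mathcal A_H(u)=P_H(E_u;D\cdot\mathbb V)=P_H(E^r_{u^r};\mathbb V\cdot D^r)\le P_H(F;\mathbb V\cdot D^r)$$ for every Lebesgue measurable set $F\subset\mathbb H$ such that $E^r_{u^r}\,\Delta\,F\Subset\mathbb V\cdot D^r$.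
   Context: $\mathbb H$ is $\mathbb R^3$ with product $(x,y,t)\cdot(\xi,\eta,\tau)=(x+\xi,y+\eta,t+\tau+2(y\xi-x\eta))$; $X=\partial_x+2y\partial_t$, $Y=\partial_y-2x\partial_t$, $H_p=\mathrm{span}\{X(p),Y(p)\}$. $\mathbb W=\{x=0\}$ with coordinates $(y,t)$. For $D\subset\mathbb W$, $u:D\to\mathbb R$: $S_u=\{(u(y,t),y,t+2yu(y,t)):(y,t)\in D\}$, $E_u=\{(s,y,t+2ys):(y,t)\in D,\ s>u(y,t)\}$, $D\cdot\mathbb V=\{(s,y,t+2ys):(y,t)\in D,\ s\in\mathbb R\}$. For $D^r\subset\mathbb W$, $v:D^r\to\mathbb R$: $S^r_v=\{(v(y,t),y,t-2yv(y,t))\}$, $E^r_v=\{(s,y,t-2ys):(y,t)\in D^r,\ s>v(y,t)\}$, $\mathbb V\cdot D^r=\{(s,y,t-2ys):(y,t)\in D^r,\ s\in\mathbb R\}$. $H$-perimeter of a measurable $E$ in an open $\Omega$: $P_H(E;\Omega)=\sup\{\int_E (Xv_1+Yv_2)\,d\mathcal L: v_1,v_2\in C^1_c(\Omega),\ \sup(v_1^2+v_2^2)^{1/2}\le1\}$. Area: $\mathcal A_H(u)=\int_D\sqrt{1+(\mathcal Bu)^2}\,dy\,dt$ with $\mathcal Bu=\partial_yu-2\partial_t(u^2)$. Set $\phi_i(s)=\phi(\gamma_i(s),s)$, $\|\gamma\|_\infty=\max_i\|\gamma_i\|_\infty$, $\mathrm{Lip}(\gamma)=\max_i\mathrm{Lip}(\gamma_i)$,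 $\|\phi\|_\infty=\max_i\|\phi_i\|_\infty$, $\mathrm{Lip}(\phi)=\max_i\mathrm{Lip}(\phi_i)$, $\zeta=4(\|\gamma\|_\infty+\mathrm{Lip}(\gamma))(\|\phi\|_\infty+\mathrm{Lip}(\phi))$. Let $p_i(s)=(\phi_i(s),\gamma_i(s),s+2\gamma_i(s)\phi_i(s))$; for $\zeta<1$, $\lambda(s)\in\bar I$ is the unique point with $p_2(\lambda(s))-p_1(s)\in H_{p_1(s)}$, $\rho(h,s)=(1-h)p_1(s)+h\,p_2(\lambda(s))$ on $Q=(0,1)\times I$, and $R_\phi=\rho(Q)$. Under the stated smallness of $\zeta$ the paper shows that a Lipschitz $u$ with $u=\phi$ on $\partial D$ and $S_u=R_\phi$, and a right graph representation $S_u=S^r_{u^r}$ with $u^r$ locally Lipschitz on an open $D^r$, exist. *)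

theory Defs
  imports "HOL-Analysis.Analysis"
begin

text \<open>Points of the Heisenberg group H = R^3 are written (x, y, t) = (x, (y, t)).
  Points of the vertical plane W = {x = 0} are written (y, t).\<close>

type_synonym hpt = "real \<times> real \<times> real"

text \<open>Left-invariant horizontal vector fields X = d_x + 2y d_t, Y = d_y - 2x d_t
  applied to a differentiable function.\<close>
definition Xop :: "(hpt \<Rightarrow> real) \<Rightarrow> hpt \<Rightarrow> real" where
  "Xop f p = frechet_derivative f (at p) (1, 0, 2 * fst (snd p))"

definition Yop :: "(hpt \<Rightarrow> real) \<Rightarrow> hpt \<Rightarrow> real" where
  "Yop f p = frechet_derivative f (at p) (0, 1, - 2 * fst p)"

definition Hplane :: "hpt \<Rightarrow> hpt set" where
  "Hplane p = span {(1, 0, 2 * fst (snd p)), (0, 1, - 2 * fst p)}"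

definition C1c :: "(hpt \<Rightarrow> real) \<Rightarrow> hpt set \<Rightarrow> bool" where
  "C1c f \<Omega> \<longleftrightarrow> (\<forall>p. f differentiable (at p))
      \<and> (\<forall>h. continuous_on UNIV (\<lambda>p. frechet_derivative f (at p) h))
      \<and> compact (closure {p. f p \<noteq> 0}) \<and> closure {p. f p \<noteq> 0} \<subseteq> \<Omega>"

definition H_perimeter :: "hpt set \<Rightarrow> hpt set \<Rightarrow> ereal" where
  "H_perimeter E \<Omega> =
     (SUP v \<in> {(v1, v2). C1c v1 \<Omega> \<and> C1c v2 \<Omega> \<and> (\<forall>p. sqrt ((v1 p)\<^sup>2 + (v2 p)\<^sup>2) \<le> 1)}.
        ereal (LINT p:E|lebesgue. Xop (fst v) p + Yop (snd v) p))"

definition Sgraph :: "(real \<times> real) set \<Rightarrow> (real \<times> real \<Rightarrow> real) \<Rightarrow> hpt set" where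
  "Sgraph D u = {(u (y, t), y, t + 2 * y * u (y, t)) | y t. (y, t) \<in> D}"

definition Eepi :: "(real \<times> real) set \<Rightarrow> (real \<times> real \<Rightarrow> real) \<Rightarrow> hpt set" where
  "Eepi D u = {(s, y, t + 2 * y * s) | s y t. (y, t) \<in> D \<and> s > u (y, t)}"

definition cylL :: "(real \<times> real) set \<Rightarrow> hpt set" where
  "cylL D = {(s, y, t + 2 * y * s) | s y t. (y, t) \<in> D}"

definition SgraphR :: "(real \<times> real) set \<Rightarrow> (real \<times> real \<Rightarrow> real) \<Rightarrow> hpt set" where
  "SgraphR D v = {(v (y, t), y, t - 2 * y * v (y, t)) | y t. (y, t) \<in> D}"

definition EepiR :: "(real \<times> real) set \<Rightarrow> (real \<times> real \<Rightarrow> real) \<Rightarrow> hpt set" where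
  "EepiR D v = {(s, y, t - 2 * y * s) | s y t. (y, t) \<in> D \<and> s > v (y, t)}"

definition cylR :: "(real \<times> real) set \<Rightarrow> hpt set" where
  "cylR D = {(s, y, t - 2 * y * s) | s y t. (y, t) \<in> D}"

text \<open>B u = d_y u - 2 d_t (u^2), pointwise partial derivatives (exist a.e. for Lipschitz u).\<close>
definition Bop :: "(real \<times> real \<Rightarrow> real) \<Rightarrow> real \<times> real \<Rightarrow> real" where
  "Bop u q = deriv (\<lambda>y'. u (y', snd q)) (fst q) - 2 * deriv (\<lambda>t'. (u (fst q, t'))\<^sup>2) (snd q)"

definition H_area :: "(real \<times> real) set \<Rightarrow> (real \<times> real \<Rightarrow> real) \<Rightarrow> ereal" where
  "H_area D u = enn2ereal (\<integral>\<^sup>+ q\<in>D. ennreal (sqrt (1 + (Bop u q)\<^sup>2)) \<partial>lebesgue)"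

definition sup_norm :: "real set \<Rightarrow> (real \<Rightarrow> real) \<Rightarrow> real" where
  "sup_norm S f = Sup ((\<lambda>s. \<bar>f s\<bar>) ` S)"

definition lip_const :: "real set \<Rightarrow> (real \<Rightarrow> real) \<Rightarrow> real" where
  "lip_const S f = Inf {C. C-lipschitz_on S f}"

definition compactly_contained :: "'a::metric_space set \<Rightarrow> 'a set \<Rightarrow> bool" where
  "compactly_contained A B \<longleftrightarrow> compact (closure A) \<and> closure A \<subseteq> B"

definition bdry_fun :: "(real \<times> real \<Rightarrow> real) \<Rightarrow> (real \<Rightarrow> real) \<Rightarrow> real \<Rightarrow> real" where
  "bdry_fun \<phi> \<gamma> s = \<phi> (\<gamma> s, s)"

definition zeta :: "real \<Rightarrow> (real \<Rightarrow> real) \<Rightarrow> (real \<Rightarrow> real) \<Rightarrow> (real \<times> real \<Rightarrow> real) \<Rightarrow> real" where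
  "zeta tbar \<gamma>1 \<gamma>2 \<phi> =
     (let I = {0<..<tbar}; \<phi>1 = bdry_fun \<phi> \<gamma>1; \<phi>2 = bdry_fun \<phi> \<gamma>2 in
      4 * (max (sup_norm I \<gamma>1) (sup_norm I \<gamma>2) + max (lip_const I \<gamma>1) (lip_const I \<gamma>2))
        * (max (sup_norm I \<phi>1) (sup_norm I \<phi>2) + max (lip_const I \<phi>1) (lip_const I \<phi>2)))"

definition pcurve :: "(real \<times> real \<Rightarrow> real) \<Rightarrow> (real \<Rightarrow> real) \<Rightarrow> real \<Rightarrow> hpt" where
  "pcurve \<phi> \<gamma> s = (bdry_fun \<phi> \<gamma> s, \<gamma> s, s + 2 * \<gamma> s * bdry_fun \<phi> \<gamma> s)"

definition lam :: "real \<Rightarrow> (real \<Rightarrow> real) \<Rightarrow> (real \<Rightarrow> real) \<Rightarrow> (real \<times> real \<Rightarrow> real) \<Rightarrow> real \<Rightarrow> real" where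
  "lam tbar \<gamma>1 \<gamma>2 \<phi> s =
     (THE l. l \<in> {0..tbar} \<and> pcurve \<phi> \<gamma>2 l - pcurve \<phi> \<gamma>1 s \<in> Hplane (pcurve \<phi> \<gamma>1 s))"

definition rho :: "real \<Rightarrow> (real \<Rightarrow> real) \<Rightarrow> (real \<Rightarrow> real) \<Rightarrow> (real \<times> real \<Rightarrow> real) \<Rightarrow> real \<Rightarrow> real \<Rightarrow> hpt" where
  "rho tbar \<gamma>1 \<gamma>2 \<phi> h s =
     (1 - h) *\<^sub>R pcurve \<phi> \<gamma>1 s + h *\<^sub>R pcurve \<phi> \<gamma>2 (lam tbar \<gamma>1 \<gamma>2 \<phi> s)"

definition R_phi :: "real \<Rightarrow> (real \<Rightarrow> real) \<Rightarrow> (real \<Rightarrow> real) \<Rightarrow> (real \<times> real \<Rightarrow> real) \<Rightarrow> hpt set" where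
  "R_phi tbar \<gamma>1 \<gamma>2 \<phi> = (\<lambda>(h, s). rho tbar \<gamma>1 \<gamma>2 \<phi> h s) ` ({0<..<1} \<times> {0<..<tbar})"

end

theory Submission
  imports Defs
begin

text \<open>The rulings of $S_u$ are horizontal segments; projected to $\mathbb W$ along left cosets they are
  parabolic arcs on which $u$ is affine, and their slope $\beta$ is constant along each arc. Comparing
  two arcs shows that $\beta$ is unique and locally Lipschitz, and $\mathcal Bu=\beta$ almost everywhere. In
  the right coordinates $\beta$ is constant along the characteristics of $\partial_y+4y\beta\,\partial_\tau$,
  so the horizontal normal $\nu=(1,-\beta)/\sqrt{1+\beta^2}$ has zero flux through every small rectangle
  of $D^r$. Extending $\nu$ constantly along right cosets therefore calibrates $E^r_{u^r}$: box averages
  of $\nu$, cut off near a compact set, are admissible test fields of almost vanishing divergence on that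
  set whose Gauss-Green integral over the graph is almost $\int_D\sqrt{1+\beta^2}$, while the
  Cauchy-Schwarz inequality makes this number an upper bound for every test field.\<close>

section \<open>Derivatives of Lipschitz functions on the line\<close>

text \<open>The two coordinate systems have different merits. On functions constant along right
  cosets, X acts as 4y times the second partial derivative and Y as the first, with no trace of the
  first coordinate of the point, so a planar field without flux is divergence-free on the whole
  cylinder at once. The left coordinates carry u, its area and its rulings. The two systems share
  only the surface, and near it the two epigraphs have to be shown to lie on the same side. The
  other obstacle is regularity. Neither u nor \<beta> is known to be better than Lipschitz, and
  partial derivatives almost everywhere do not by themselves give derivatives in slanted directions.
  Differential identities are therefore reached in integrated form on boxes: an arc differs from its
  tangent step by O(h^2), which a Lipschitz function does not see to first order, and difference
  quotients pass to the limit under the integral. The smallness of zeta enters through the ruling: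
  it makes the endpoint on the second curve exist, be unique and lie in the open parameter
  interval.\<close>

lemma set_integrable_lborel_bounded:
  fixes f :: "'a::euclidean_space \<Rightarrow> real"
  assumes "A \<in> sets borel" "emeasure lborel A < \<infinity>" "f \<in> borel_measurable borel"
    "\<And>x. x \<in> A \<Longrightarrow> \<bar>f x\<bar> \<le> C"
  shows "set_integrable lborel A f"
  unfolding set_integrable_def
  by (rule integrableI_bounded_set_indicator[where B=C]) (use assms in auto)

text \<open>For large \<open>K\<close> the function \<open>1 + h / K\<close> is nonnegative and is
  the density of a measure with the Lebesgue value on every box. Boxes determine the measure, and
  densities are unique up to null sets.\<close>

lemma AE_zero_if_box_integrals_zero:
  fixes h :: "'a::euclidean_space \<Rightarrow> real"
  assumes hm[measurable]: "h \<in> borel_measurable borel" and hC: "\<And>x. \<bar>h x\<bar> \<le> C"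
    and zero: "\<And>a b. (LINT x:box a b|lborel. h x) = 0"
  shows "AE x in lborel. h x = 0"
proof -
  define K where "K = \<bar>C\<bar> + 1"
  have K: "K > 0" unfolding K_def by simp
  have hK: "\<bar>h x\<bar> \<le> K" for x using hC[of x] unfolding K_def by linarith
  define M where "M = density lborel (\<lambda>x. ennreal (1 + h x / K))"
  have nn: "0 \<le> 1 + h x / K" for x
  proof -
    have "-1 \<le> h x / K" using K hK[of x] by (simp add: le_divide_eq abs_le_iff)
    then show ?thesis by simp
  qed
  have "lborel = M"
  proof (rule lborel_eqI)
    show "sets M = sets borel" by (simp add: M_def)
    fix l u :: 'a assume lu: "\<And>b. b \<in> Basis \<Longrightarrow> l \<bullet> b \<le> u \<bullet> b"
    have bf: "emeasure lborel (box l u) < \<infinity>" by (simp add: emeasure_lborel_box_eq)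
    have i1: "set_integrable lborel (box l u) h"
      by (rule set_integrable_lborel_bounded[where C=K]) (use hK bf in auto)
    have i2: "set_integrable lborel (box l u) (\<lambda>x. 1::real)"
      by (rule set_integrable_lborel_bounded[where C=1]) (use bf in auto)
    have i3: "set_integrable lborel (box l u) (\<lambda>x. 1 + h x / K)"
      by (intro set_integral_add set_integrable_divide i1 i2)
    have "emeasure M (box l u) = (\<integral>\<^sup>+x. ennreal (1 + h x / K) * indicator (box l u) x \<partial>lborel)"
      unfolding M_def by (subst emeasure_density) auto
    also have "\<dots> = (\<integral>\<^sup>+x. ennreal (indicator (box l u) x *\<^sub>R (1 + h x / K)) \<partial>lborel)"
      by (intro nn_integral_cong) (auto simp: indicator_def)
    also have "\<dots> = ennreal (LINT x:box l u|lborel. 1 + h x / K)"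
      unfolding set_lebesgue_integral_def
      by (rule nn_integral_eq_integral) (use i3 nn in \<open>auto simp: set_integrable_def indicator_def\<close>)
    also have "(LINT x:box l u|lborel. 1 + h x / K) = (LINT x:box l u|lborel. (1::real))"
      using i1 i2 zero[of l u] by (subst set_integral_add) (auto intro!: set_integrable_divide)
    also have "\<dots> = measure lborel (box l u)"
      by (simp add: set_lebesgue_integral_def)
    finally have "emeasure M (box l u) = ennreal (measure lborel (box l u))" .
    also have "\<dots> = emeasure lborel (box l u)" using bf by (simp add: emeasure_eq_ennreal_measure)
    also have "\<dots> = (\<Prod>b\<in>Basis. (u - l) \<bullet> b)" using lu by simp
    finally show "emeasure M (box l u) = (\<Prod>b\<in>Basis. (u - l) \<bullet> b)" .
  qed
  then have "density lborel (\<lambda>x. 1) = density lborel (\<lambda>x. ennreal (1 + h x / K))"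
    by (simp add: density_1 M_def)
  then have "AE x in lborel. 1 = ennreal (1 + h x / K)"
    by (subst (asm) sigma_finite_measure.density_unique_iff[OF sigma_finite_lborel]) auto
  then show ?thesis
  proof (rule AE_mp, intro AE_I2 impI)
    fix x assume "1 = ennreal (1 + h x / K)"
    then have "1 = 1 + h x / K" using nn[of x] by (metis ennreal_1 ennreal_inj zero_le_one)
    then show "h x = 0" using K by simp
  qed
qed

text \<open>A Vitali-Caratheodory majorant: \<open>d\<close> is cut into level slices
  \<open>A k\<close> of height \<open>e\<close>, each slice is put into an open set of nearly the
  same measure, and \<open>g\<close> adds up constant weights on these open sets. Openness makes the
  pointwise bound valid on a whole neighbourhood.\<close>

lemma lower_semicontinuous_majorant:
  fixes d :: "real \<Rightarrow> real"
  assumes dm[measurable]: "d \<in> borel_measurable borel" and d0: "\<And>x. 0 \<le> d x" and dC: "\<And>x. d x \<le> C"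
    and e: "e > 0"
  obtains g K where "g \<in> borel_measurable borel" "\<And>x. \<bar>g x\<bar> \<le> K"
    "\<And>x. x \<in> {a..b} \<Longrightarrow> \<exists>\<delta>>0. \<forall>y. \<bar>y - x\<bar> < \<delta> \<longrightarrow> d x + e \<le> g y"
    "(LINT x:{a..b}|lborel. g x) \<le> (LINT x:{a..b}|lborel. d x + 2 * e) + e"
proof -
  obtain N :: nat where N: "C < real N * e" using reals_Archimedean3[OF e] by blast
  define A where "A k = {x \<in> {a..b}. real k * e \<le> d x \<and> d x < (real k + 1) * e}" for k :: nat
  have Am[measurable]: "A k \<in> sets borel" for k unfolding A_def by measurable
  \<comment> \<open>The sum of all weights bounds \<open>g\<close> and also prices the excess of the
    open sets over the slices, so an excess below \<open>e / S\<close> for each costs at most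
    \<open>e\<close> altogether. The summand 1 gives positivity at once.\<close>
  define S where "S = (\<Sum>k<N. (real k + 2) * e) + 1"
  have S: "S > 0" unfolding S_def using e by (intro add_nonneg_pos sum_nonneg) auto
  define \<eta> where "\<eta> = e / S"
  have eta: "\<eta> > 0" using S e unfolding \<eta>_def by simp
  have "\<exists>T. open T \<and> A k \<subseteq> T \<and> emeasure lebesgue (T - A k) < ennreal \<eta>" for k
    using sets_lebesgue_outer_open[of "A k" \<eta>] eta Am[of k] by (metis sets_completionI_sets sets_lborel)
  then obtain T where T: "\<And>k. open (T k)" "\<And>k. A k \<subseteq> T k" "\<And>k. emeasure lebesgue (T k - A k) < ennreal \<eta>"
    by metis
  have Tm[measurable]: "T k \<in> sets borel" for k using T(1) by auto
  have Te: "emeasure lborel (T k - A k) < ennreal \<eta>" for k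
    using T(3)[of k] by (simp add: emeasure_completion)
  \<comment> \<open>On \<open>A k\<close> the value of \<open>d\<close> lies between
    \<open>k * e\<close> and \<open>(k + 1) * e\<close>; the weight \<open>k + 2\<close> leaves the
    required gap \<open>e\<close> and overshoots by at most \<open>2 * e\<close>.\<close>
  define g where "g x = (\<Sum>k<N. (real k + 2) * e * indicator (T k) x)" for x
  have gm[measurable]: "g \<in> borel_measurable borel" unfolding g_def by measurable
  have g0: "0 \<le> g x" for x unfolding g_def using e by (intro sum_nonneg) auto
  have gS: "\<bar>g x\<bar> \<le> S" for x
  proof -
    have "g x \<le> (\<Sum>k<N. (real k + 2) * e)" unfolding g_def using e
      by (intro sum_mono) (auto simp: indicator_def)
    then show ?thesis using g0[of x] unfolding S_def by simp
  qed
  have ex: "\<exists>k<N. x \<in> A k" if x: "x \<in> {a..b}" for x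
  proof -
    let ?k = "nat \<lfloor>d x / e\<rfloor>"
    have nn: "0 \<le> d x / e" using d0[of x] e by simp
    have r: "real ?k = real_of_int \<lfloor>d x / e\<rfloor>" using nn by simp
    have "real ?k \<le> d x / e" "d x / e < real ?k + 1" unfolding r by linarith+
    then have h: "real ?k * e \<le> d x" "d x < (real ?k + 1) * e" using e by (auto simp: field_simps)
    then have "real ?k * e < real N * e" using N dC[of x] by linarith
    then have "?k < N" using e by simp
    then show ?thesis using h x unfolding A_def by blast
  qed
  have p3: "\<exists>\<delta>>0. \<forall>y. \<bar>y - x\<bar> < \<delta> \<longrightarrow> d x + e \<le> g y" if x: "x \<in> {a..b}" for x
  proof -
    obtain k where k: "k < N" "x \<in> A k" using ex[OF x] by blast
    then have "x \<in> T k" using T by blast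
    then obtain \<delta> where dl: "\<delta> > 0" "ball x \<delta> \<subseteq> T k" using T(1) open_contains_ball by blast
    have "d x + e \<le> g y" if "\<bar>y - x\<bar> < \<delta>" for y
    proof -
      have "y \<in> T k" using that dl by (auto simp: dist_real_def subset_iff)
      then have "(real k + 2) * e \<le> g y" unfolding g_def using k e
        by (intro order_trans[OF _ member_le_sum[of k]]) auto
      moreover have "d x < (real k + 1) * e" using k unfolding A_def by auto
      ultimately show ?thesis by (simp add: algebra_simps)
    qed
    then show ?thesis using dl by blast
  qed
  have fab: "emeasure lborel {a..b} < \<infinity>" by (simp add: emeasure_lborel_Icc_eq)
  define w where "w x = (\<Sum>k<N. (real k + 2) * e * indicator (T k - A k) x)" for x
  have wint: "integrable lborel w" unfolding w_def
  proof (intro Bochner_Integration.integrable_sum integrable_mult_right)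
    fix k show "integrable lborel (indicat_real (T k - A k))"
      using Te[of k] by (intro integrable_real_indicator) (auto simp: less_top[symmetric] top.extremum_strict intro: order_less_trans[OF _ ennreal_less_top])
  qed
  have wval: "(LINT x|lborel. w x) \<le> e"
  proof -
    have "(LINT x|lborel. w x) = (\<Sum>k<N. (real k + 2) * e * measure lborel (T k - A k))"
      unfolding w_def
    proof (subst Bochner_Integration.integral_sum)
      show "integrable lborel (\<lambda>x. (real k + 2) * e * indicat_real (T k - A k) x)" for k
        using Te[of k] by (intro integrable_mult_right integrable_real_indicator) (auto intro: order_less_trans[OF _ ennreal_less_top])
    qed simp
    also have "\<dots> \<le> (\<Sum>k<N. (real k + 2) * e * \<eta>)"
    proof (intro sum_mono mult_left_mono)
      fix k
      have fin: "emeasure lborel (T k - A k) < \<infinity>" using Te[of k] by (auto intro: order_less_trans[OF _ ennreal_less_top])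
      then have "ennreal (measure lborel (T k - A k)) < ennreal \<eta>" using Te[of k]
        by (simp add: emeasure_eq_ennreal_measure)
      then show "measure lborel (T k - A k) \<le> \<eta>" using eta by (simp add: ennreal_less_iff)
    qed (use e in auto)
    also have "\<dots> = (S - 1) * \<eta>" unfolding S_def by (simp add: sum_distrib_right)
    also have "\<dots> \<le> S * \<eta>" using eta by (intro mult_right_mono) auto
    also have "\<dots> = e" using S unfolding \<eta>_def by simp
    finally show ?thesis .
  qed
  have gle: "indicator {a..b} x * g x \<le> indicator {a..b} x * (d x + 2 * e) + w x" for x
  proof (cases "x \<in> {a..b}")
    case True
    have "g x \<le> (\<Sum>k<N. (real k + 2) * e * (indicator (A k) x + indicator (T k - A k) x))"
      unfolding g_def using e T(2) by (intro sum_mono mult_left_mono) (auto simp: indicator_def)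
    also have "\<dots> = (\<Sum>k<N. (real k + 2) * e * indicator (A k) x) + w x"
      unfolding w_def by (simp add: algebra_simps sum.distrib)
    also have "(\<Sum>k<N. (real k + 2) * e * indicator (A k) x) \<le> d x + 2 * e"
    proof -
      obtain k where k: "k < N" "x \<in> A k" using ex[OF True] by blast
      have un: "j = k" if "x \<in> A j" for j
      proof -
        have "real j * e < (real k + 1) * e" "real k * e < (real j + 1) * e"
          using that k unfolding A_def by auto
        then show ?thesis using e by simp
      qed
      have "(\<Sum>j<N. (real j + 2) * e * indicator (A j) x) = (\<Sum>j<N. if j = k then (real k + 2) * e else 0)"
      proof (rule sum.cong)
        fix j assume "j \<in> {..<N}"
        show "(real j + 2) * e * indicator (A j) x = (if j = k then (real k + 2) * e else 0)"
        proof (cases "j = k")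
          case False
          then have "x \<notin> A j" using un by blast
          then show ?thesis using False by simp
        qed (use k in simp)
      qed simp
      also have "\<dots> = (real k + 2) * e" using k by simp
      also have "\<dots> \<le> d x + 2 * e" using k unfolding A_def by (simp add: algebra_simps)
      finally show ?thesis .
    qed
    finally show ?thesis using True by simp
  next
    case False
    then show ?thesis unfolding w_def using e by (auto intro!: sum_nonneg)
  qed
  have "set_integrable lborel {a..b} (\<lambda>x. d x + 2 * e)"
    by (rule set_integrable_lborel_bounded[where C="C + 2*e"]) (use fab d0 dC e in \<open>auto intro: add_mono\<close>)
  then have i1: "integrable lborel (\<lambda>x. indicator {a..b} x * (d x + 2 * e))"
    by (simp add: set_integrable_def)
  have "set_integrable lborel {a..b} g"
    by (rule set_integrable_lborel_bounded[where C=S]) (use fab gS in auto)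
  then have i2: "integrable lborel (\<lambda>x. indicator {a..b} x * g x)"
    by (simp add: set_integrable_def)
  have "(LINT x:{a..b}|lborel. g x) \<le> (LINT x|lborel. indicator {a..b} x * (d x + 2 * e) + w x)"
    unfolding set_lebesgue_integral_def real_scaleR_def
    by (rule integral_mono[OF i2 Bochner_Integration.integrable_add[OF i1 wint] gle])
  also have "\<dots> = (LINT x:{a..b}|lborel. d x + 2 * e) + (LINT x|lborel. w x)"
    unfolding set_lebesgue_integral_def using i1 wint by simp
  also have "\<dots> \<le> (LINT x:{a..b}|lborel. d x + 2 * e) + e" using wval by simp
  finally have "(LINT x:{a..b}|lborel. g x) \<le> (LINT x:{a..b}|lborel. d x + 2 * e) + e" .
  then show ?thesis using that[OF gm gS p3] by blast
qed

lemma set_lborel_integral_combine: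
  fixes g :: "real \<Rightarrow> real"
  assumes gm[measurable]: "g \<in> borel_measurable borel" and gK: "\<And>x. \<bar>g x\<bar> \<le> K" and "a \<le> x" "x \<le> y"
  shows "(LINT t:{a..y}|lborel. g t) = (LINT t:{a..x}|lborel. g t) + (LINT t:{x..y}|lborel. g t)"
proof -
  have i: "set_integrable lborel A g" if "A \<in> sets borel" "A \<subseteq> {p..q}" for A p q
    by (rule set_integrable_lborel_bounded[where C=K])
       (use that gK in \<open>auto intro: order_le_less_trans[OF emeasure_mono[OF that(2), of lborel]] simp: emeasure_lborel_Icc_eq\<close>)
  have "{a..y} = {a..x} \<union> {x<..y}" using assms by auto
  moreover have "{a..x} \<inter> {x<..y} = {}" "{x<..y} \<subseteq> {x..y}" by auto
  ultimately have "(LINT t:{a..y}|lborel. g t) = (LINT t:{a..x}|lborel. g t) + (LINT t:{x<..y}|lborel. g t)"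
    using set_integral_Un[of "{a..x}" "{x<..y}" lborel g] i[of "{a..x}" a x] i[of "{x<..y}" x y] by simp
  also have "(LINT t:{x<..y}|lborel. g t) = (LINT t:{x..y}|lborel. g t)"
    unfolding set_lebesgue_integral_def
  proof (rule integral_cong_AE)
    show "AE t in lborel. indicat_real {x<..y} t *\<^sub>R g t = indicat_real {x..y} t *\<^sub>R g t"
      by (rule AE_mp[OF AE_lborel_singleton[of x]]) (auto simp: indicator_def)
  qed measurable
  finally show ?thesis .
qed

text \<open>Continuous induction. With \<open>G\<close> the integral of the majorant
  \<open>g\<close>, the points where \<open>f - G\<close> has not risen above \<open>f a\<close>
  form a closed set. At its supremum \<open>m\<close> one step supplied by \<open>step\<close> stays
  inside the neighbourhood where \<open>g\<close> dominates \<open>d m + e\<close>, so it leads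
  beyond \<open>m\<close> unless \<open>m = b\<close>. A single small step at each point is
  enough.\<close>

lemma increment_le_integral_of_dini_bound:
  fixes f d :: "real \<Rightarrow> real"
  assumes cf: "continuous_on UNIV f" and dm[measurable]: "d \<in> borel_measurable borel"
    and d0: "\<And>x. 0 \<le> d x" and dC: "\<And>x. d x \<le> C"
    and step: "\<And>x e \<delta>. e > 0 \<Longrightarrow> \<delta> > 0 \<Longrightarrow> \<exists>h. 0 < h \<and> h < \<delta> \<and> f (x + h) - f x \<le> h * (d x + e)"
    and ab: "a \<le> b"
  shows "f b - f a \<le> (LINT x:{a..b}|lborel. d x)"
proof -
  have key: "f b - f a \<le> (LINT x:{a..b}|lborel. d x + 2 * e) + e" if e: "e > 0" for e
  proof -
    obtain g K where g[measurable]: "g \<in> borel_measurable borel" and gK: "\<And>x. \<bar>g x\<bar> \<le> K"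
      and gl: "\<And>x. x \<in> {a..b} \<Longrightarrow> \<exists>\<delta>>0. \<forall>y. \<bar>y - x\<bar> < \<delta> \<longrightarrow> d x + e \<le> g y"
      and gi: "(LINT x:{a..b}|lborel. g x) \<le> (LINT x:{a..b}|lborel. d x + 2 * e) + e"
      using lower_semicontinuous_majorant[OF dm d0 dC e, of a b] by blast
    define G where "G x = (LINT t:{a..x}|lborel. g t)" for x
    have gint: "set_integrable lborel {x..y} g" for x y
      by (rule set_integrable_lborel_bounded[where C=K]) (use gK in \<open>auto simp: emeasure_lborel_Icc_eq\<close>)
    have Gc: "continuous_on {a..b} G"
    proof -
      have "g absolutely_integrable_on {a..b}"
        using gint[of a b] unfolding set_integrable_def by (simp add: integrable_completion)
      then have "continuous_on {a..b} (\<lambda>x. integral {a..x} g)"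
        by (intro indefinite_integral_continuous_1) (auto simp: absolutely_integrable_on_def)
      moreover have "G x = integral {a..x} g" for x
        unfolding G_def using set_borel_integral_eq_integral(2)[OF gint] by simp
      ultimately show ?thesis by simp
    qed
    define S where "S = {x \<in> {a..b}. f x - G x \<le> f a}"
    have Scl: "closed S" unfolding S_def
      by (intro continuous_on_closed_Collect_le continuous_on_diff Gc continuous_on_subset[OF cf]) auto
    have "G a = 0" unfolding G_def using set_borel_integral_eq_integral(2)[OF gint[of a a]] by simp
    then have aS: "a \<in> S" unfolding S_def using ab by simp
    have Sb: "bdd_above S" unfolding S_def by (intro bdd_aboveI[of _ b]) auto
    define m where "m = Sup S"
    have mS: "m \<in> S" unfolding m_def by (rule closed_contains_Sup) (use aS Sb Scl in auto)
    then have mab: "a \<le> m" "m \<le> b" unfolding S_def by auto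
    have "m = b"
    proof (rule ccontr)
      assume "m \<noteq> b"
      then have mb: "m < b" using mab by simp
      obtain \<delta> where dl: "\<delta> > 0" "\<And>y. \<bar>y - m\<bar> < \<delta> \<Longrightarrow> d m + e \<le> g y" using gl[of m] mab by auto
      obtain h where h: "0 < h" "h < min \<delta> (b - m)" "f (m + h) - f m \<le> h * (d m + e)"
        using step[of e "min \<delta> (b - m)" m] e dl mb by auto
      have "h * (d m + e) = (LINT t:{m..m+h}|lborel. d m + e)"
        using h by (simp add: set_lebesgue_integral_def)
      also have "\<dots> \<le> (LINT t:{m..m+h}|lborel. g t)"
        by (rule set_integral_mono) (use gint h dl in \<open>auto simp: set_integrable_def\<close>)
      finally have "f (m + h) - f m \<le> (LINT t:{m..m+h}|lborel. g t)" using h by linarith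
      moreover have "G (m + h) = G m + (LINT t:{m..m+h}|lborel. g t)"
        unfolding G_def by (rule set_lborel_integral_combine[OF g gK]) (use mab h in auto)
      moreover have "f m - G m \<le> f a" using mS unfolding S_def by simp
      ultimately have "m + h \<in> S" unfolding S_def using mab h by auto
      then have "m + h \<le> m" unfolding m_def using Sb by (rule cSup_upper)
      then show False using h by simp
    qed
    then have "f b - f a \<le> G b" using mS unfolding S_def by simp
    then show ?thesis using gi unfolding G_def by linarith
  qed
  have di: "set_integrable lborel {a..b} d"
    by (rule set_integrable_lborel_bounded[where C=C]) (use d0 dC in \<open>auto simp: emeasure_lborel_Icc_eq\<close>)
  have "f b - f a \<le> (LINT x:{a..b}|lborel. d x) + e" if "e > 0" for e
  proof -
    \<comment> \<open>The total error at level \<open>e'\<close> is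
      \<open>2 * e' * (b - a) + e'\<close>, which this choice makes equal to
      \<open>e\<close>.\<close>
    define e' where "e' = e / (2 * (b - a) + 1)"
    have e': "e' > 0" using that ab unfolding e'_def by simp
    have "(LINT x:{a..b}|lborel. d x + 2 * e') = (LINT x:{a..b}|lborel. d x) + 2 * e' * (b - a)"
      using di ab by (subst set_integral_add) (auto simp: set_lebesgue_integral_def set_integrable_def)
    moreover have "2 * e' * (b - a) + e' = e" 
    proof -
      have "2 * e' * (b - a) + e' = e' * (2 * (b - a) + 1)" by (simp add: algebra_simps)
      also have "\<dots> = e" unfolding e'_def using ab by simp
      finally show ?thesis .
    qed
    ultimately show ?thesis using key[OF e'] by linarith
  qed
  then show ?thesis by (meson field_le_epsilon)
qed

text \<open>\<open>d\<close> is the lower right Dini derivative. Only rational increments enter the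
  supremum of infima, which keeps it measurable; the upper estimate asks for just one increment, and
  continuity of \<open>f\<close> extends the lower estimate to all real ones.\<close>

lemma lipschitz_lower_dini_derivative:
  fixes f :: "real \<Rightarrow> real"
  assumes lip: "C-lipschitz_on UNIV f"
  obtains d where "d \<in> borel_measurable borel" "\<And>x. \<bar>d x\<bar> \<le> C"
    "\<And>x e \<delta>. e > 0 \<Longrightarrow> \<delta> > 0 \<Longrightarrow> \<exists>h. 0 < h \<and> h < \<delta> \<and> f (x + h) - f x \<le> h * (d x + e)"
    "\<And>x e. e > 0 \<Longrightarrow> \<exists>\<delta>>0. \<forall>h. 0 < h \<longrightarrow> h < \<delta> \<longrightarrow> h * (d x - e) \<le> f (x + h) - f x"
proof -
  define q where "q x h = (f (x + h) - f x) / h" for x h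
  define Q where "Q n = {r. r \<in> \<rat> \<and> 0 < r \<and> r < inverse (real (Suc n))}" for n
  define d where "d x = (SUP n. INF r\<in>Q n. q x r)" for x
  have cf: "continuous_on UNIV f" using lip by (rule lipschitz_on_continuous_on)
  have fm[measurable]: "f \<in> borel_measurable borel" using cf by (rule borel_measurable_continuous_onI)
  have qC: "\<bar>q x r\<bar> \<le> C" if "r > 0" for x r
  proof -
    have "\<bar>f (x + r) - f x\<bar> \<le> C * \<bar>r\<bar>"
      using lipschitz_onD[OF lip, of "x + r" x] by (simp add: dist_real_def)
    then show ?thesis using that unfolding q_def by (simp add: field_simps)
  qed
  have Qpos: "r > 0" if "r \<in> Q n" for r n using that unfolding Q_def by auto
  have qb: "- C \<le> q x r" "q x r \<le> C" if "r \<in> Q n" for x r n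
    using qC[OF Qpos[OF that], of x] by (auto simp: abs_le_iff)
  have Qc: "countable (Q n)" for n
    by (rule countable_subset[OF _ countable_rat]) (auto simp: Q_def)
  have Qne: "Q n \<noteq> {}" for n
  proof -
    have "0 < inverse (real (Suc n))" by simp
    from Rats_dense_in_real[OF this] show ?thesis unfolding Q_def by blast
  qed
  have bb: "bdd_below (q x ` Q n)" for x n
    by (rule bdd_belowI2[of _ "-C"]) (rule qb)
  have I1: "- C \<le> (INF r\<in>Q n. q x r)" for x n
    by (rule cINF_greatest[OF Qne]) (rule qb)
  have I2: "(INF r\<in>Q n. q x r) \<le> C" for x n
  proof -
    obtain r where r: "r \<in> Q n" using Qne by blast
    have "(INF r\<in>Q n. q x r) \<le> q x r" by (rule cINF_lower[OF bb r])
    also have "\<dots> \<le> C" using qC[OF Qpos[OF r], of x] by (simp add: abs_le_iff)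
    finally show ?thesis .
  qed
  have ba: "bdd_above (range (\<lambda>n. INF r\<in>Q n. q x r))" for x
    by (rule bdd_aboveI2[of _ _ C]) (rule I2)
  have qm[measurable]: "(\<lambda>x. q x r) \<in> borel_measurable borel" for r
    unfolding q_def by measurable
  have Im[measurable]: "(\<lambda>x. INF r\<in>Q n. q x r) \<in> borel_measurable borel" for n
    by (rule borel_measurable_cINF[OF Qc]) (use bb in auto)
  have dm: "d \<in> borel_measurable borel" unfolding d_def
    by (rule borel_measurable_cSUP) (use ba in auto)
  have dC: "\<bar>d x\<bar> \<le> C" for x
  proof -
    have "- C \<le> d x" unfolding d_def by (rule order_trans[OF I1[of x 0] cSUP_upper[OF _ ba]]) simp
    moreover have "d x \<le> C" unfolding d_def by (rule cSUP_least) (use I2 in auto)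
    ultimately show ?thesis by simp
  qed
  have st: "\<exists>h. 0 < h \<and> h < \<delta> \<and> f (x + h) - f x \<le> h * (d x + e)" if "e > 0" and dp: "\<delta> > 0" for x e \<delta> :: real
  proof -
    obtain n where n: "inverse (real (Suc n)) < \<delta>" using reals_Archimedean[of \<delta>] dp by auto
    have "(INF r\<in>Q n. q x r) \<le> d x" unfolding d_def by (rule cSUP_upper[OF _ ba]) simp
    then have "(INF r\<in>Q n. q x r) < d x + e" using \<open>e > 0\<close> by simp
    then obtain r where r: "r \<in> Q n" "q x r < d x + e"
      using cInf_lessD[of "q x ` Q n" "d x + e"] Qne by auto
    then have "0 < r" "r < \<delta>" using n unfolding Q_def by auto
    moreover have "f (x + r) - f x \<le> r * (d x + e)"
      using r \<open>0 < r\<close> unfolding q_def by (simp add: field_simps)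
    ultimately show ?thesis by blast
  qed
  have lo: "\<exists>\<delta>>0. \<forall>h. 0 < h \<longrightarrow> h < \<delta> \<longrightarrow> h * (d x - e) \<le> f (x + h) - f x" if "e > 0" for x e
  proof -
    have "d x - e < d x" using that by simp
    then obtain n where n: "d x - e < (INF r\<in>Q n. q x r)"
      unfolding d_def by (subst (asm) less_cSUP_iff) (use ba in auto)
    define \<delta> where "\<delta> = inverse (real (Suc n))"
    have rat: "r * (d x - e) \<le> f (x + r) - f x" if "r \<in> \<rat>" "0 < r" "r < \<delta>" for r
    proof -
      have "r \<in> Q n" using that unfolding Q_def \<delta>_def by simp
      then have "(INF r\<in>Q n. q x r) \<le> q x r" by (rule cINF_lower[OF bb])
      then have "d x - e \<le> q x r" using n by simp
      then show ?thesis using that unfolding q_def by (simp add: field_simps)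
    qed
    have "h * (d x - e) \<le> f (x + h) - f x" if h: "0 < h" "h < \<delta>" for h
    proof (rule ccontr)
      assume neg: "\<not> ?thesis"
      \<comment> \<open>A real increment violating the estimate lies in an open set of violations,
        and that set would contain a rational one.\<close>
      define S where "S = {h. f (x + h) - f x < h * (d x - e)} \<inter> {0<..<\<delta>}"
      have "open S" unfolding S_def
        by (intro open_Int open_Collect_less continuous_intros continuous_on_compose2[OF cf]) auto
      moreover have "h \<in> S" using neg h unfolding S_def by auto
      ultimately obtain \<epsilon> where ep: "\<epsilon> > 0" "ball h \<epsilon> \<subseteq> S" using open_contains_ball by blast
      obtain r where r: "r \<in> \<rat>" "h < r" "r < h + \<epsilon>" using Rats_dense_in_real[of h "h + \<epsilon>"] ep by auto
      then have "r \<in> S" using ep by (auto simp: dist_real_def subset_iff)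
      then show False using rat[OF r(1)] unfolding S_def by auto
    qed
    moreover have "\<delta> > 0" unfolding \<delta>_def by simp
    ultimately show ?thesis by blast
  qed
  show ?thesis using that[OF dm dC st lo] by blast
qed

text \<open>Adding \<open>C * x\<close> to \<open>f\<close> makes the derivate nonnegative, as
  \<open>increment_le_integral_of_dini_bound\<close> requires.\<close>

lemma lipschitz_increment_le:
  fixes f d :: "real \<Rightarrow> real"
  assumes lip: "C-lipschitz_on UNIV f" and dm[measurable]: "d \<in> borel_measurable borel"
    and dC: "\<And>x. \<bar>d x\<bar> \<le> C"
    and step: "\<And>x e \<delta>. e > 0 \<Longrightarrow> \<delta> > 0 \<Longrightarrow> \<exists>h. 0 < h \<and> h < \<delta> \<and> f (x + h) - f x \<le> h * (d x + e)"
    and ab: "a \<le> b"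
  shows "f b - f a \<le> (LINT x:{a..b}|lborel. d x)"
proof -
  have cf: "continuous_on UNIV f" using lip by (rule lipschitz_on_continuous_on)
  have di: "set_integrable lborel {a..b} d"
    by (rule set_integrable_lborel_bounded[where C=C]) (use dC in \<open>auto simp: emeasure_lborel_Icc_eq\<close>)
  have "(f b + C * b) - (f a + C * a) \<le> (LINT x:{a..b}|lborel. d x + C)"
  proof (rule increment_le_integral_of_dini_bound[where C="2 * C"])
    show "continuous_on UNIV (\<lambda>x. f x + C * x)" using cf by (intro continuous_intros)
    show "0 \<le> d x + C" "d x + C \<le> 2 * C" for x using dC[of x] by (auto simp: abs_le_iff)
    fix x e \<delta> :: real assume "e > 0" "\<delta> > 0"
    from step[OF this, of x] obtain h where h: "0 < h" "h < \<delta>" "f (x + h) - f x \<le> h * (d x + e)" by blast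
    then show "\<exists>h. 0 < h \<and> h < \<delta> \<and> f (x + h) + C * (x + h) - (f x + C * x) \<le> h * (d x + C + e)"
      by (intro exI[of _ h]) (auto simp: algebra_simps)
  qed (use ab in auto)
  also have "\<dots> = (LINT x:{a..b}|lborel. d x) + C * (b - a)"
    using di ab by (subst set_integral_add) (auto simp: set_lebesgue_integral_def set_integrable_def)
  finally show ?thesis by (simp add: algebra_simps)
qed

text \<open>The lower derivates \<open>d\<close> of \<open>f\<close> and \<open>c\<close> of
  \<open>- f\<close> satisfy \<open>d + c \<le> 0\<close> everywhere, whereas the two increment
  bounds add up to a nonnegative integral of \<open>d + c\<close> over every interval. So
  \<open>d = - c\<close> almost everywhere: lower and upper right derivates agree, and the increment
  bounds are equalities.\<close>

lemma lipschitz_right_derivative: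
  fixes f :: "real \<Rightarrow> real"
  assumes lip: "C-lipschitz_on UNIV f"
  obtains d where "d \<in> borel_measurable borel" "\<And>x. \<bar>d x\<bar> \<le> C"
    "\<And>a b. a \<le> b \<Longrightarrow> f b - f a = (LINT x:{a..b}|lborel. d x)"
    "AE x in lborel. \<forall>e>0. \<exists>\<delta>>0. \<forall>h. 0 < h \<longrightarrow> h < \<delta> \<longrightarrow> \<bar>f (x + h) - f x - h * d x\<bar> \<le> e * h"
proof -
  have lip': "C-lipschitz_on UNIV (\<lambda>x. - f x)"
    using lip unfolding lipschitz_on_def by (simp add: dist_minus)
  obtain d where d[measurable]: "d \<in> borel_measurable borel" and dC: "\<And>x. \<bar>d x\<bar> \<le> C"
    and d1: "\<And>x e \<delta>. e > 0 \<Longrightarrow> \<delta> > 0 \<Longrightarrow> \<exists>h. 0 < h \<and> h < \<delta> \<and> f (x + h) - f x \<le> h * (d x + e)"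
    and d2: "\<And>x e. e > 0 \<Longrightarrow> \<exists>\<delta>>0. \<forall>h. 0 < h \<longrightarrow> h < \<delta> \<longrightarrow> h * (d x - e) \<le> f (x + h) - f x"
    by (rule lipschitz_lower_dini_derivative[OF lip]) (rule that, assumption, blast, blast, blast)
  obtain c where c[measurable]: "c \<in> borel_measurable borel" and cC: "\<And>x. \<bar>c x\<bar> \<le> C"
    and c1: "\<And>x e \<delta>. e > 0 \<Longrightarrow> \<delta> > 0 \<Longrightarrow> \<exists>h. 0 < h \<and> h < \<delta> \<and> - f (x + h) - - f x \<le> h * (c x + e)"
    and c2: "\<And>x e. e > 0 \<Longrightarrow> \<exists>\<delta>>0. \<forall>h. 0 < h \<longrightarrow> h < \<delta> \<longrightarrow> h * (c x - e) \<le> - f (x + h) - - f x"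
    by (rule lipschitz_lower_dini_derivative[OF lip']) (rule that, assumption, blast, blast, blast)
  have le: "d x \<le> - c x" for x
  proof (rule field_le_epsilon)
    fix e :: real assume "e > 0"
    then have e: "e / 2 > 0" by simp
    obtain s where s: "s > 0" "\<And>h. 0 < h \<Longrightarrow> h < s \<Longrightarrow> h * (d x - e / 2) \<le> f (x + h) - f x" using d2[OF e] by blast
    obtain t where t: "t > 0" "\<And>h. 0 < h \<Longrightarrow> h < t \<Longrightarrow> h * (c x - e / 2) \<le> - f (x + h) - - f x" using c2[OF e] by blast
    define h where "h = min s t / 2"
    have h: "0 < h" "h < s" "h < t" using s(1) t(1) unfolding h_def by (auto simp: min_def)
    have "h * (d x - e/2) + h * (c x - e/2) \<le> 0" using s(2)[OF h(1,2)] t(2)[OF h(1,3)] by linarith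
    then have "h * (d x + c x - e) \<le> 0" by (simp add: algebra_simps)
    then show "d x \<le> - c x + e" using h by (simp add: mult_le_0_iff)
  qed
  have int: "set_integrable lborel {a..b} d" "set_integrable lborel {a..b} c" for a b
    by (rule set_integrable_lborel_bounded[where C=C]; use dC cC in \<open>auto simp: emeasure_lborel_Icc_eq\<close>)+
  have up: "f b - f a \<le> (LINT x:{a..b}|lborel. d x)" if "a \<le> b" for a b
    by (rule lipschitz_increment_le[OF lip d dC d1 that])
  have dn: "- f b - - f a \<le> (LINT x:{a..b}|lborel. c x)" if "a \<le> b" for a b
    by (rule lipschitz_increment_le[OF lip' c cC c1 that])
  have sum0: "(LINT x:{a..b}|lborel. d x + c x) = (LINT x:{a..b}|lborel. d x) + (LINT x:{a..b}|lborel. c x)" for a b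
    using int by (rule set_integral_add(2))
  have npos: "(LINT x:{a..b}|lborel. d x + c x) \<le> 0" for a b
  proof -
    have "0 \<le> (\<integral>x. - (indicat_real {a..b} x * (d x + c x)) \<partial>lborel)"
    proof (rule Bochner_Integration.integral_nonneg)
      fix x show "0 \<le> - (indicat_real {a..b} x * (d x + c x))"
        using le[of x] by (auto simp: indicator_def)
    qed
    then show ?thesis by (simp add: set_lebesgue_integral_def)
  qed
  have eq: "f b - f a = (LINT x:{a..b}|lborel. d x)" if "a \<le> b" for a b
    using up[OF that] dn[OF that] npos[of a b] sum0[of a b] by linarith
  have z: "AE x in lborel. d x + c x = 0"
  proof (rule AE_zero_if_box_integrals_zero[where C="2 * C"])
    show "\<bar>d x + c x\<bar> \<le> 2 * C" for x using dC[of x] cC[of x] by linarith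
    fix a b :: real
    show "(LINT x:box a b|lborel. d x + c x) = 0"
    proof (cases "a \<le> b")
      case True
      have "(LINT x:{a..b}|lborel. d x + c x) = 0"
        using up[OF True] dn[OF True] npos[of a b] sum0[of a b] by linarith
      moreover have "(LINT x:box a b|lborel. d x + c x) = (LINT x:{a..b}|lborel. d x + c x)"
        unfolding set_lebesgue_integral_def
      proof (rule integral_cong_AE)
        show "AE x in lborel. indicat_real (box a b) x *\<^sub>R (d x + c x) = indicat_real {a..b} x *\<^sub>R (d x + c x)"
          by (rule AE_mp[OF AE_lborel_singleton[of a]], rule AE_mp[OF AE_lborel_singleton[of b]])
             (auto simp: indicator_def)
      qed measurable
      ultimately show ?thesis by simp
    next
      case False
      then show ?thesis by (simp add: set_lebesgue_integral_def)
    qed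
  qed measurable
  have "AE x in lborel. \<forall>e>0. \<exists>\<delta>>0. \<forall>h. 0 < h \<longrightarrow> h < \<delta> \<longrightarrow> \<bar>f (x + h) - f x - h * d x\<bar> \<le> e * h"
    using z
  proof (rule AE_mp, intro AE_I2 impI allI)
    fix x e :: real assume "d x + c x = 0" and e: "e > 0"
    then have cd: "c x = - d x" by simp
    obtain s where s: "s > 0" "\<And>h. 0 < h \<Longrightarrow> h < s \<Longrightarrow> h * (d x - e) \<le> f (x + h) - f x" using d2[OF e] by blast
    obtain t where t: "t > 0" "\<And>h. 0 < h \<Longrightarrow> h < t \<Longrightarrow> h * (c x - e) \<le> - f (x + h) - - f x" using c2[OF e] by blast
    have "\<bar>f (x + h) - f x - h * d x\<bar> \<le> e * h" if "0 < h" "h < min s t" for h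
      using s(2)[of h] t(2)[of h] that unfolding cd by (simp add: abs_le_iff algebra_simps)
    then show "\<exists>\<delta>>0. \<forall>h. 0 < h \<longrightarrow> h < \<delta> \<longrightarrow> \<bar>f (x + h) - f x - h * d x\<bar> \<le> e * h"
      using s(1) t(1) by (intro exI[of _ "min s t"]) auto
  qed
  then show ?thesis using that[OF d dC eq] by blast
qed

text \<open>The right derivative of the reflected function \<open>- f (- z)\<close> at
  \<open>- x\<close> is the left derivative of \<open>f\<close> at \<open>x\<close>. Both one-sided
  derivatives integrate to the increments of \<open>f\<close>, hence they coincide almost
  everywhere.\<close>

lemma lipschitz_AE_has_derivative:
  fixes f :: "real \<Rightarrow> real"
  assumes lip: "C-lipschitz_on UNIV f"
  obtains d where "d \<in> borel_measurable borel" "\<And>x. \<bar>d x\<bar> \<le> C"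
    "\<And>a b. a \<le> b \<Longrightarrow> f b - f a = (LINT x:{a..b}|lborel. d x)"
    "AE x in lborel. (f has_real_derivative d x) (at x)"
proof -
  obtain d where d[measurable]: "d \<in> borel_measurable borel" and dC: "\<And>x. \<bar>d x\<bar> \<le> C"
    and di: "\<And>a b. a \<le> b \<Longrightarrow> f b - f a = (LINT x:{a..b}|lborel. d x)"
    and dA: "AE x in lborel. \<forall>e>0. \<exists>\<delta>>0. \<forall>h. 0 < h \<longrightarrow> h < \<delta> \<longrightarrow> \<bar>f (x + h) - f x - h * d x\<bar> \<le> e * h"
    by (rule lipschitz_right_derivative[OF lip]) (rule that, assumption, blast, blast, blast)
  have lip': "C-lipschitz_on UNIV (\<lambda>z. - f (- z))"
  proof (rule lipschitz_onI)
    fix x y :: real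
    show "dist (- f (- x)) (- f (- y)) \<le> C * dist x y"
      using lipschitz_onD[OF lip, of "- x" "- y"] by (simp add: dist_minus)
  qed (use lip lipschitz_on_nonneg in blast)
  obtain c where c[measurable]: "c \<in> borel_measurable borel" and cC: "\<And>x. \<bar>c x\<bar> \<le> C"
    and ci: "\<And>a b. a \<le> b \<Longrightarrow> - f (- b) - - f (- a) = (LINT x:{a..b}|lborel. c x)"
    and cA: "AE x in lborel. \<forall>e>0. \<exists>\<delta>>0. \<forall>h. 0 < h \<longrightarrow> h < \<delta> \<longrightarrow> \<bar>- f (- (x + h)) - - f (- x) - h * c x\<bar> \<le> e * h"
    by (rule lipschitz_right_derivative[OF lip']) (rule that, assumption, blast, blast, blast)
  \<comment> \<open>The exceptional set is enclosed in a Borel null set, because the substitution of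
    \<open>- x\<close> for \<open>x\<close> is made in a measurable statement.\<close>
  obtain N where N: "N \<in> null_sets lborel"
    "{x. \<not> (\<forall>e>0. \<exists>\<delta>>0. \<forall>h. 0 < h \<longrightarrow> h < \<delta> \<longrightarrow> \<bar>- f (- (x + h)) - - f (- x) - h * c x\<bar> \<le> e * h)} \<subseteq> N"
    using cA unfolding eventually_ae_filter by auto
  have Nm[measurable]: "N \<in> sets borel" using N by auto
  have "AE x in lborel. x \<notin> N" using N(1) by (rule AE_not_in)
  then have AN: "AE x in lborel. 0 + (-1) * x \<notin> N"
    by (intro AE_borel_affine) auto
  have z: "AE x in lborel. d x - c (- x) = 0"
  proof (rule AE_zero_if_box_integrals_zero[where C="2 * C"])
    show "\<bar>d x - c (- x)\<bar> \<le> 2 * C" for x using dC[of x] cC[of "- x"] by linarith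
    fix a b :: real
    show "(LINT x:box a b|lborel. d x - c (- x)) = 0"
    proof (cases "a \<le> b")
      case True
      have i1: "set_integrable lborel {a..b} d" "set_integrable lborel {a..b} (\<lambda>x. c (- x))"
        by (rule set_integrable_lborel_bounded[where C=C]; use dC cC in \<open>auto simp: emeasure_lborel_Icc_eq\<close>)+
      have "(LINT x:{-b..-a}|lborel. c x) = (\<integral>x. indicat_real {-b..-a} (0 + (-1) * x) *\<^sub>R c (0 + (-1) * x) \<partial>lborel)"
        unfolding set_lebesgue_integral_def
        by (subst lborel_integral_real_affine[of "-1" _ 0]) auto
      also have "\<dots> = (LINT x:{a..b}|lborel. c (- x))"
        unfolding set_lebesgue_integral_def
        by (intro Bochner_Integration.integral_cong) (auto simp: indicator_def)
      finally have "(LINT x:{a..b}|lborel. c (- x)) = f b - f a"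
        using ci[of "-b" "-a"] True by simp
      then have "(LINT x:{a..b}|lborel. d x - c (- x)) = 0"
        using di[OF True] i1 by (simp add: set_integral_diff)
      moreover have "(LINT x:box a b|lborel. d x - c (- x)) = (LINT x:{a..b}|lborel. d x - c (- x))"
        unfolding set_lebesgue_integral_def
      proof (rule integral_cong_AE)
        show "AE x in lborel. indicat_real (box a b) x *\<^sub>R (d x - c (- x)) = indicat_real {a..b} x *\<^sub>R (d x - c (- x))"
          by (rule AE_mp[OF AE_lborel_singleton[of a]], rule AE_mp[OF AE_lborel_singleton[of b]])
             (auto simp: indicator_def)
      qed measurable
      ultimately show ?thesis by simp
    next
      case False
      then show ?thesis by (simp add: set_lebesgue_integral_def)
    qed
  qed measurable
  have "AE x in lborel. (f has_real_derivative d x) (at x)"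
    using z dA AN
  proof eventually_elim
    case (elim x)
    have "- x \<notin> N" using elim(3) by simp
    then have L: "\<forall>e>0. \<exists>\<delta>>0. \<forall>h. 0 < h \<longrightarrow> h < \<delta> \<longrightarrow> \<bar>- f (- (- x + h)) - - f (- (- x)) - h * c (- x)\<bar> \<le> e * h"
      using N(2) by blast
    have cd: "c (- x) = d x" using elim(1) by simp
    show ?case unfolding DERIV_def
    proof (rule LIM_I)
      fix r :: real assume "0 < r"
      then have e: "r / 2 > 0" by simp
      obtain s where s: "s > 0" "\<And>h. 0 < h \<Longrightarrow> h < s \<Longrightarrow> \<bar>f (x + h) - f x - h * d x\<bar> \<le> r / 2 * h"
        using elim(2) e by blast
      obtain t where t: "t > 0" "\<And>h. 0 < h \<Longrightarrow> h < t \<Longrightarrow> \<bar>- f (- (- x + h)) - - f (- (- x)) - h * d x\<bar> \<le> r / 2 * h"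
        using L e unfolding cd by blast
      have "norm ((f (x + h) - f x) / h - d x) < r" if h: "h \<noteq> 0" "norm (h - 0) < min s t" for h
      proof -
        have "\<bar>f (x + h) - f x - h * d x\<bar> \<le> r / 2 * \<bar>h\<bar>"
        proof (cases "h > 0")
          case True then show ?thesis using s(2)[of h] h by simp
        next
          case False
          then have "0 < - h" "- h < t" using h by auto
          from t(2)[OF this] show ?thesis using False by (simp add: abs_minus_commute add.commute abs_le_iff algebra_simps)
        qed
        moreover have "(f (x + h) - f x) / h - d x = (f (x + h) - f x - h * d x) / h" using h by (simp add: field_simps)
        ultimately have "\<bar>(f (x + h) - f x) / h - d x\<bar> \<le> r / 2" using h by (simp add: abs_divide pos_divide_le_eq)
        then show ?thesis using \<open>0 < r\<close> by simp
      qed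
      then show "\<exists>s>0. \<forall>h. h \<noteq> 0 \<and> norm (h - 0) < s \<longrightarrow> norm ((f (x + h) - f x) / h - d x) < r"
        using s(1) t(1) by (intro exI[of _ "min s t"]) auto
    qed
  qed
  then show ?thesis using that[OF d dC di] by blast
qed

section \<open>Directional derivatives in the plane and the transport equation\<close>

text \<open>A limit along one fixed sequence is total and, for continuous \<open>f\<close>, Borel
  measurable; it is the directional derivative wherever that exists.\<close>

definition dirder :: "real \<times> real \<Rightarrow> (real \<times> real \<Rightarrow> real) \<Rightarrow> real \<times> real \<Rightarrow> real" where
  "dirder e f q = lim (\<lambda>n. (f (q + inverse (real (Suc n)) *\<^sub>R e) - f q) * real (Suc n))"

lemma borel_measurable_dirder:
  assumes cf: "continuous_on UNIV f"
  shows "dirder e f \<in> borel_measurable borel"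
proof -
  have "(\<lambda>q. (f (q + inverse (real (Suc n)) *\<^sub>R e) - f q) * real (Suc n)) \<in> borel_measurable borel" for n
    by (intro borel_measurable_continuous_onI continuous_intros continuous_on_compose2[OF cf]) auto
  then have "(\<lambda>q. lim (\<lambda>n. (f (q + inverse (real (Suc n)) *\<^sub>R e) - f q) * real (Suc n))) \<in> borel_measurable borel"
    by (rule borel_measurable_lim_metric)
  then show ?thesis unfolding dirder_def .
qed

lemma dirder_tendsto:
  fixes f :: "real \<times> real \<Rightarrow> real"
  assumes "((\<lambda>h. f (q + h *\<^sub>R e)) has_real_derivative D) (at 0)"
    and h: "h \<longlonglongrightarrow> 0" "\<And>n. h n \<noteq> 0"
  shows "(\<lambda>n. (f (q + h n *\<^sub>R e) - f q) / h n) \<longlonglongrightarrow> D"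
proof -
  have "((\<lambda>z. (f (q + (0 + z) *\<^sub>R e) - f (q + 0 *\<^sub>R e)) / z) \<longlongrightarrow> D) (at 0)"
    using assms(1) unfolding DERIV_def .
  then have l: "((\<lambda>z. (f (q + z *\<^sub>R e) - f q) / z) \<longlongrightarrow> D) (at 0)" by simp
  have "filterlim h (at 0) sequentially"
    using h by (auto simp: filterlim_at)
  from filterlim_compose[OF l this] show ?thesis .
qed

lemma dirder_eq:
  assumes "((\<lambda>h. f (q + h *\<^sub>R e)) has_real_derivative D) (at 0)"
  shows "dirder e f q = D"
proof -
  have "(\<lambda>n. (f (q + inverse (real (Suc n)) *\<^sub>R e) - f q) / inverse (real (Suc n))) \<longlonglongrightarrow> D"
    by (rule dirder_tendsto[OF assms LIMSEQ_inverse_real_of_nat]) simp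
  then show ?thesis unfolding dirder_def by (intro limI) (simp add: divide_inverse)
qed

text \<open>For continuous \<open>f\<close> these are the points of differentiability in direction
  \<open>e\<close>, written with countable quantifiers and rational increments so that the set is
  visibly Borel.\<close>

definition rat_diff_set :: "real \<times> real \<Rightarrow> (real \<times> real \<Rightarrow> real) \<Rightarrow> (real \<times> real) set" where
  "rat_diff_set e f = {q. \<forall>k::nat. \<exists>m::nat. \<forall>r::rat. r \<noteq> 0 \<and> \<bar>of_rat r\<bar> < inverse (real (Suc m)) \<longrightarrow>
     \<bar>f (q + of_rat r *\<^sub>R e) - f q - of_rat r * dirder e f q\<bar> \<le> \<bar>of_rat r\<bar> * inverse (real (Suc k))}"

lemma rat_diff_set_borel:
  assumes cf: "continuous_on UNIV f"
  shows "rat_diff_set e f \<in> sets borel"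
proof -
  have [measurable]: "f \<in> borel_measurable borel" "dirder e f \<in> borel_measurable borel"
    using cf by (auto intro: borel_measurable_continuous_onI borel_measurable_dirder)
  have [measurable]: "(\<lambda>q. f (q + x *\<^sub>R e)) \<in> borel_measurable borel" for x
    by (intro borel_measurable_continuous_onI continuous_intros continuous_on_compose2[OF cf]) auto
  have "Measurable.pred borel (\<lambda>q. \<forall>k::nat. \<exists>m::nat. \<forall>r::rat. r \<noteq> 0 \<and> \<bar>of_rat r\<bar> < inverse (real (Suc m)) \<longrightarrow>
     \<bar>f (q + of_rat r *\<^sub>R e) - f q - of_rat r * dirder e f q\<bar> \<le> \<bar>of_rat r\<bar> * inverse (real (Suc k)))"
    by measurable
  then show ?thesis unfolding rat_diff_set_def pred_def by simp
qed

lemma rat_diff_setD: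
  assumes cf: "continuous_on UNIV f" and q: "q \<in> rat_diff_set e f"
  shows "((\<lambda>h. f (q + h *\<^sub>R e)) has_real_derivative dirder e f q) (at 0)"
  unfolding DERIV_def
proof (rule LIM_I)
  let ?D = "dirder e f q"
  fix r :: real assume r: "0 < r"
  obtain k where k: "inverse (real (Suc k)) < r" using reals_Archimedean[OF r] by auto
  obtain m where m: "\<And>s::rat. s \<noteq> 0 \<Longrightarrow> \<bar>of_rat s\<bar> < inverse (real (Suc m)) \<Longrightarrow>
     \<bar>f (q + of_rat s *\<^sub>R e) - f q - of_rat s * ?D\<bar> \<le> \<bar>of_rat s\<bar> * inverse (real (Suc k))"
    using q unfolding rat_diff_set_def by blast
  have bd: "\<bar>f (q + h *\<^sub>R e) - f q - h * ?D\<bar> \<le> \<bar>h\<bar> * inverse (real (Suc k))"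
    if h: "h \<noteq> 0" "\<bar>h\<bar> < inverse (real (Suc m))" for h
  proof (rule ccontr)
    assume neg: "\<not> ?thesis"
    define S where "S = {h. \<bar>h\<bar> * inverse (real (Suc k)) < \<bar>f (q + h *\<^sub>R e) - f q - h * ?D\<bar>}
       \<inter> ({h. 0 < \<bar>h\<bar>} \<inter> {h. \<bar>h\<bar> < inverse (real (Suc m))})"
    have "open S" unfolding S_def
      by (intro open_Int open_Collect_less continuous_intros continuous_on_compose2[OF cf]) auto
    moreover have "h \<in> S" using neg h unfolding S_def by auto
    ultimately obtain \<epsilon> where ep: "\<epsilon> > 0" "ball h \<epsilon> \<subseteq> S" using open_contains_ball by blast
    obtain x where x: "x \<in> \<rat>" "h < x" "x < h + \<epsilon>" using Rats_dense_in_real[of h "h + \<epsilon>"] ep by auto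
    then have xS: "x \<in> S" using ep by (auto simp: dist_real_def subset_iff)
    obtain s where s: "x = of_rat s" using x(1) by (auto elim: Rats_cases)
    then show False using m[of s] xS unfolding S_def by auto
  qed
  have "norm ((f (q + (0 + h) *\<^sub>R e) - f (q + 0 *\<^sub>R e)) / h - ?D) < r"
    if h: "h \<noteq> 0" "norm (h - 0) < inverse (real (Suc m))" for h
  proof -
    have "\<bar>f (q + h *\<^sub>R e) - f q - h * ?D\<bar> \<le> \<bar>h\<bar> * inverse (real (Suc k))" using bd h by simp
    moreover have "(f (q + h *\<^sub>R e) - f q) / h - ?D = (f (q + h *\<^sub>R e) - f q - h * ?D) / h"
      using h by (simp add: field_simps)
    ultimately have "\<bar>(f (q + h *\<^sub>R e) - f q) / h - ?D\<bar> \<le> inverse (real (Suc k))"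
      using h by (simp add: abs_divide pos_divide_le_eq mult.commute)
    then show ?thesis using k by simp
  qed
  then show "\<exists>s>0. \<forall>h. h \<noteq> 0 \<and> norm (h - 0) < s \<longrightarrow>
       norm ((f (q + (0 + h) *\<^sub>R e) - f (q + 0 *\<^sub>R e)) / h - ?D) < r"
    by (intro exI[of _ "inverse (real (Suc m))"]) auto
qed

lemma rat_diff_setI:
  fixes f :: "real \<times> real \<Rightarrow> real"
  assumes d: "((\<lambda>h. f (q + h *\<^sub>R e)) has_real_derivative D) (at 0)"
  shows "q \<in> rat_diff_set e f"
proof -
  have D: "dirder e f q = D" by (rule dirder_eq[OF d])
  have "\<exists>m::nat. \<forall>r::rat. r \<noteq> 0 \<and> \<bar>of_rat r\<bar> < inverse (real (Suc m)) \<longrightarrow>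
     \<bar>f (q + of_rat r *\<^sub>R e) - f q - of_rat r * D\<bar> \<le> \<bar>of_rat r\<bar> * inverse (real (Suc k))" for k :: nat
  proof -
    have "((\<lambda>h. (f (q + (0 + h) *\<^sub>R e) - f (q + 0 *\<^sub>R e)) / h) \<longlongrightarrow> D) (at 0)"
      using d unfolding DERIV_def .
    then obtain s where s: "s > 0" "\<And>h. h \<noteq> 0 \<Longrightarrow> \<bar>h\<bar> < s \<Longrightarrow> \<bar>(f (q + h *\<^sub>R e) - f q) / h - D\<bar> < inverse (real (Suc k))"
      using LIM_D[of "\<lambda>h. (f (q + (0 + h) *\<^sub>R e) - f (q + 0 *\<^sub>R e)) / h" D 0 "inverse (real (Suc k))"]
      by auto
    obtain m where m: "inverse (real (Suc m)) < s" using reals_Archimedean[OF s(1)] by auto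
    show ?thesis
    proof (intro exI[of _ m] allI impI)
      fix r :: rat assume r: "r \<noteq> 0 \<and> \<bar>of_rat r\<bar> < inverse (real (Suc m))"
      let ?h = "of_rat r :: real"
      have h: "?h \<noteq> 0" "\<bar>?h\<bar> < s" using r m by auto
      have "f (q + ?h *\<^sub>R e) - f q - ?h * D = ?h * ((f (q + ?h *\<^sub>R e) - f q) / ?h - D)"
        using h(1) by (simp add: field_simps)
      then have "\<bar>f (q + ?h *\<^sub>R e) - f q - ?h * D\<bar> = \<bar>?h\<bar> * \<bar>(f (q + ?h *\<^sub>R e) - f q) / ?h - D\<bar>"
        by (simp add: abs_mult)
      also have "\<dots> \<le> \<bar>?h\<bar> * inverse (real (Suc k))"
        using s(2)[OF h] by (intro mult_left_mono) auto
      finally show "\<bar>f (q + ?h *\<^sub>R e) - f q - ?h * D\<bar> \<le> \<bar>?h\<bar> * inverse (real (Suc k))" .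
    qed
  qed
  then show ?thesis unfolding rat_diff_set_def mem_Collect_eq D by blast
qed

lemma lipschitz_section_fst:
  assumes "C-lipschitz_on UNIV (f :: real \<times> real \<Rightarrow> real)"
  shows "C-lipschitz_on UNIV (\<lambda>y. f (y, t))"
proof (rule lipschitz_onI)
  fix x y show "dist (f (x, t)) (f (y, t)) \<le> C * dist x y"
    using lipschitz_onD[OF assms, of "(x, t)" "(y, t)"] by (simp add: dist_Pair_Pair)
qed (use assms lipschitz_on_nonneg in blast)

lemma lipschitz_section_snd:
  assumes "C-lipschitz_on UNIV (f :: real \<times> real \<Rightarrow> real)"
  shows "C-lipschitz_on UNIV (\<lambda>t. f (y, t))"
proof (rule lipschitz_onI)
  fix s t show "dist (f (y, s)) (f (y, t)) \<le> C * dist s t"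
    using lipschitz_onD[OF assms, of "(y, s)" "(y, t)"] by (simp add: dist_Pair_Pair)
qed (use assms lipschitz_on_nonneg in blast)

lemma section_fst_derivative_iff:
  fixes f :: "real \<times> real \<Rightarrow> real"
  shows
  "((\<lambda>y. f (y, t)) has_real_derivative D) (at y) \<longleftrightarrow>
   ((\<lambda>h. f ((y, t) + h *\<^sub>R (1, 0))) has_real_derivative D) (at 0)"
  using DERIV_shift[of "\<lambda>y. f (y, t)" D 0 y] by (simp add: add.commute)

lemma section_snd_derivative_iff:
  fixes f :: "real \<times> real \<Rightarrow> real"
  shows
  "((\<lambda>t. f (y, t)) has_real_derivative D) (at t) \<longleftrightarrow>
   ((\<lambda>h. f ((y, t) + h *\<^sub>R (0, 1))) has_real_derivative D) (at 0)"
  using DERIV_shift[of "\<lambda>t. f (y, t)" D 0 t] by (simp add: add.commute)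

lemma lipschitz_section_fst_derivative:
  assumes lip: "C-lipschitz_on UNIV f"
  shows "AE y in lborel. ((\<lambda>h. f ((y, t) + h *\<^sub>R (1, 0))) has_real_derivative dirder (1, 0) f (y, t)) (at 0)
      \<and> \<bar>dirder (1, 0) f (y, t)\<bar> \<le> C"
    and "a \<le> b \<Longrightarrow> f (b, t) - f (a, t) = (LINT y:{a..b}|lborel. dirder (1, 0) f (y, t))"
proof -
  obtain d where d: "d \<in> borel_measurable borel" "\<And>x. \<bar>d x\<bar> \<le> C"
    "\<And>a b. a \<le> b \<Longrightarrow> f (b, t) - f (a, t) = (LINT x:{a..b}|lborel. d x)"
    "AE x in lborel. ((\<lambda>y. f (y, t)) has_real_derivative d x) (at x)"
    by (rule lipschitz_AE_has_derivative[OF lipschitz_section_fst[OF lip]]) (rule that, assumption, blast, blast, blast)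
  note [measurable] = d(1)
  have eq: "AE y in lborel. dirder (1, 0) f (y, t) = d y"
    using d(4) unfolding section_fst_derivative_iff by eventually_elim (rule dirder_eq)
  show "AE y in lborel. ((\<lambda>h. f ((y, t) + h *\<^sub>R (1, 0))) has_real_derivative dirder (1, 0) f (y, t)) (at 0)
      \<and> \<bar>dirder (1, 0) f (y, t)\<bar> \<le> C"
    using d(4) eq unfolding section_fst_derivative_iff by eventually_elim (use d(2) in auto)
  have dm: "dirder (1, 0) f \<in> borel_measurable borel"
    by (rule borel_measurable_dirder[OF lipschitz_on_continuous_on[OF lip]])
  have [measurable]: "(\<lambda>y. dirder (1, 0) f (y, t)) \<in> borel_measurable borel"
    by (rule measurable_compose[OF _ dm]) (intro borel_measurable_continuous_onI continuous_intros)
  assume ab: "a \<le> b"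
  show "f (b, t) - f (a, t) = (LINT y:{a..b}|lborel. dirder (1, 0) f (y, t))"
    unfolding d(3)[OF ab] set_lebesgue_integral_def
    by (rule integral_cong_AE) (use eq in \<open>measurable, eventually_elim, auto\<close>)
qed

lemma lipschitz_section_snd_derivative:
  assumes lip: "C-lipschitz_on UNIV f"
  shows "AE t in lborel. ((\<lambda>h. f ((y, t) + h *\<^sub>R (0, 1))) has_real_derivative dirder (0, 1) f (y, t)) (at 0)
      \<and> \<bar>dirder (0, 1) f (y, t)\<bar> \<le> C"
    and "a \<le> b \<Longrightarrow> f (y, b) - f (y, a) = (LINT t:{a..b}|lborel. dirder (0, 1) f (y, t))"
proof -
  obtain d where d: "d \<in> borel_measurable borel" "\<And>x. \<bar>d x\<bar> \<le> C"
    "\<And>a b. a \<le> b \<Longrightarrow> f (y, b) - f (y, a) = (LINT x:{a..b}|lborel. d x)"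
    "AE x in lborel. ((\<lambda>t. f (y, t)) has_real_derivative d x) (at x)"
    by (rule lipschitz_AE_has_derivative[OF lipschitz_section_snd[OF lip]]) (rule that, assumption, blast, blast, blast)
  note [measurable] = d(1)
  have eq: "AE t in lborel. dirder (0, 1) f (y, t) = d t"
    using d(4) unfolding section_snd_derivative_iff by eventually_elim (rule dirder_eq)
  show "AE t in lborel. ((\<lambda>h. f ((y, t) + h *\<^sub>R (0, 1))) has_real_derivative dirder (0, 1) f (y, t)) (at 0)
      \<and> \<bar>dirder (0, 1) f (y, t)\<bar> \<le> C"
    using d(4) eq unfolding section_snd_derivative_iff by eventually_elim (use d(2) in auto)
  have dm: "dirder (0, 1) f \<in> borel_measurable borel"
    by (rule borel_measurable_dirder[OF lipschitz_on_continuous_on[OF lip]])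
  have [measurable]: "(\<lambda>t. dirder (0, 1) f (y, t)) \<in> borel_measurable borel"
    by (rule measurable_compose[OF _ dm]) (intro borel_measurable_continuous_onI continuous_intros)
  assume ab: "a \<le> b"
  show "f (y, b) - f (y, a) = (LINT t:{a..b}|lborel. dirder (0, 1) f (y, t))"
    unfolding d(3)[OF ab] set_lebesgue_integral_def
    by (rule integral_cong_AE) (use eq in \<open>measurable, eventually_elim, auto\<close>)
qed

text \<open>Fubini: on every section \<open>f\<close> is a Lipschitz function of one variable, so
  the section misses the good set only in a null set. The Borel set \<open>rat_diff_set\<close>
  makes this applicable; for direction \<open>(1, 0)\<close> the order of the two variables is
  exchanged.\<close>

lemma AE_dirder:
  assumes lip: "C-lipschitz_on UNIV f" and e: "e = (1, 0) \<or> e = (0, 1)"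
  shows "AE q in lborel. ((\<lambda>h. f (q + h *\<^sub>R e)) has_real_derivative dirder e f q) (at 0)
      \<and> \<bar>dirder e f q\<bar> \<le> C"
proof -
  have cf: "continuous_on UNIV f" using lip by (rule lipschitz_on_continuous_on)
  have [measurable]: "dirder e f \<in> borel_measurable borel" by (rule borel_measurable_dirder[OF cf])
  define S where "S = {q. q \<in> rat_diff_set e f \<and> \<bar>dirder e f q\<bar> \<le> C}"
  have [measurable]: "rat_diff_set e f \<in> sets borel" by (rule rat_diff_set_borel[OF cf])
  have "{q \<in> space borel. q \<in> rat_diff_set e f \<and> \<bar>dirder e f q\<bar> \<le> C} \<in> sets borel" by measurable
  then have S: "S \<in> sets borel" unfolding S_def by simp
  have SP: "{x \<in> space (lborel \<Otimes>\<^sub>M lborel). x \<in> S} \<in> sets (lborel \<Otimes>\<^sub>M lborel :: (real \<times> real) measure)"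
    using S by (metis (no_types, lifting) Collect_mem_eq lborel_prod sets_lborel space_borel space_lborel UNIV_I Collect_cong)
  have "AE x in lborel \<Otimes>\<^sub>M lborel. x \<in> S"
  proof (rule lborel_pair.AE_pair_measure[OF SP])
    show "AE x in lborel. AE y in lborel. (x, y) \<in> S"
    proof (cases "e = (1, 0)")
      case True
      have "AE y in lborel. AE x in lborel. (x, y) \<in> S"
      proof (rule AE_I2)
        fix t show "AE y in lborel. (y, t) \<in> S"
          using lipschitz_section_fst_derivative(1)[OF lip, of t]
          by eventually_elim (use True in \<open>auto simp: S_def intro: rat_diff_setI\<close>)
      qed
      then show ?thesis
        by (subst lborel_pair.AE_commute) (use SP in auto)
    next
      case False
      then have e: "e = (0, 1)" using e by simp
      show ?thesis
      proof (rule AE_I2)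
        fix y show "AE t in lborel. (y, t) \<in> S"
          using lipschitz_section_snd_derivative(1)[OF lip, of y]
          by eventually_elim (use e in \<open>auto simp: S_def intro: rat_diff_setI\<close>)
      qed
    qed
  qed
  then have "AE q in lborel. q \<in> S" unfolding lborel_prod .
  then show ?thesis
    by eventually_elim (use rat_diff_setD[OF cf] in \<open>auto simp: S_def\<close>)
qed

text \<open>The bound on \<open>F\<close> holds only almost everywhere, so \<open>F\<close> is
  truncated at \<open>K\<close> and cut off outside the box. An intersection of two boxes is a box,
  and on it the truncation has the same integral as \<open>F\<close>.\<close>

lemma AE_zero_on_box:
  fixes F :: "'a::euclidean_space \<Rightarrow> real"
  assumes F[measurable]: "F \<in> borel_measurable borel" and K: "AE q in lborel. q \<in> box l u \<longrightarrow> \<bar>F q\<bar> \<le> K"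
    and zero: "\<And>a c. box a c \<subseteq> box l u \<Longrightarrow> (LINT q:box a c|lborel. F q) = 0"
  shows "AE q in lborel. q \<in> box l u \<longrightarrow> F q = 0"
proof -
  define h where "h q = indicator (box l u) q * max (- \<bar>K\<bar>) (min \<bar>K\<bar> (F q))" for q
  have "AE q in lborel. h q = 0"
  proof (rule AE_zero_if_box_integrals_zero[where C="\<bar>K\<bar>"])
    show "h \<in> borel_measurable borel" unfolding h_def by measurable
    show "\<bar>h x\<bar> \<le> \<bar>K\<bar>" for x unfolding h_def by (auto simp: indicator_def)
    fix a c :: 'a
    obtain a' c' where ac: "box a c \<inter> box l u = box a' c'" using box_Int_box[of a c l u] by blast
    have "(LINT q:box a c|lborel. h q) = (LINT q:box a' c'|lborel. F q)"
      unfolding set_lebesgue_integral_def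
    proof (rule integral_cong_AE)
      show "AE q in lborel. indicat_real (box a c) q *\<^sub>R h q = indicat_real (box a' c') q *\<^sub>R F q"
        using K by eventually_elim (auto simp: h_def indicator_def ac[symmetric])
    qed (unfold h_def, measurable)
    also have "\<dots> = 0" using zero[of a' c'] ac by blast
    finally show "(LINT q:box a c|lborel. h q) = 0" .
  qed
  then show ?thesis
    using K by eventually_elim (auto simp: h_def indicator_def)
qed

section \<open>Transport equations almost everywhere\<close>

lemma lborel_integral_translation:
  fixes \<phi> :: "'a::euclidean_space \<Rightarrow> real"
  assumes "\<phi> \<in> borel_measurable borel"
  shows "(\<integral>q. \<phi> (c + q) \<partial>lborel) = (\<integral>q. \<phi> q \<partial>lborel)"
proof -
  have "(\<integral>q. \<phi> q \<partial>lborel) = (\<integral>q. \<phi> q \<partial>(distr lborel borel ((+) c)))"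
    by (simp add: lborel_distr_plus)
  also have "\<dots> = (\<integral>q. \<phi> (c + q) \<partial>lborel)"
    by (rule integral_distr) (use assms in auto)
  finally show ?thesis by simp
qed

lemma AE_not_in_frontier_convex:
  fixes S :: "'a::euclidean_space set"
  assumes "convex S"
  shows "AE q in lborel. q \<notin> frontier S"
proof (rule AE_not_in)
  have "negligible (frontier S)" using assms by (rule negligible_convex_frontier)
  then have "frontier S \<in> null_sets (completion lborel)"
    by (simp add: negligible_iff_null_sets)
  then show "frontier S \<in> null_sets lborel"
    by (simp add: null_sets_completion_iff frontier_closed borel_closed)
qed

lemma mem_box_pair:
  "(y, t) \<in> box (a, b) (c, d) \<longleftrightarrow> a < y \<and> y < c \<and> b < t \<and> t < (d :: real)" for a c y :: real
  by (auto simp: box_def Basis_prod_def)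

text \<open>Existence of both partial derivatives gives no chain rule in the slanted direction
  \<open>(1, g)\<close>. The slanted quotient \<open>S\<close> is split into a horizontal part
  \<open>T1\<close> and a vertical part \<open>T2\<close> based at the shifted point
  \<open>q + (h, 0)\<close>. Under the integral over a box, \<open>T2\<close> can be translated back
  so that its increment starts at \<open>q\<close>, where the vertical derivative is available. The
  limits yield the equation in integrated form on every subbox.\<close>

lemma transport_AE:
  fixes f g b :: "real \<times> real \<Rightarrow> real"
  assumes lip: "C-lipschitz_on UNIV f" and cg: "continuous_on UNIV g" and cb: "continuous_on UNIV b"
    and gG: "\<And>q. q \<in> box l u \<Longrightarrow> \<bar>g q\<bar> \<le> G" and bB: "\<And>q. q \<in> box l u \<Longrightarrow> \<bar>b q\<bar> \<le> B"
    and hm: "hm > 0"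
    and exp: "\<And>q h. q \<in> box l u \<Longrightarrow> 0 < h \<Longrightarrow> h < hm \<Longrightarrow> \<bar>f (q + (h, h * g q)) - f q - h * b q\<bar> \<le> M * h\<^sup>2"
  shows "AE q in lborel. q \<in> box l u \<longrightarrow> dirder (1, 0) f q + g q * dirder (0, 1) f q = b q"
proof -
  have cf: "continuous_on UNIV f" using lip by (rule lipschitz_on_continuous_on)
  have C0: "C \<ge> 0" using lip by (rule lipschitz_on_nonneg)
  have m[measurable]: "dirder (1, 0) f \<in> borel_measurable borel" "dirder (0, 1) f \<in> borel_measurable borel"
    "f \<in> borel_measurable borel" "g \<in> borel_measurable borel" "b \<in> borel_measurable borel"
    using cf cg cb by (auto intro: borel_measurable_continuous_onI borel_measurable_dirder)
  note d1 = AE_dirder[OF lip disjI1[OF refl]] and d2 = AE_dirder[OF lip disjI2[OF refl]]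
  have fL: "\<bar>f p - f q\<bar> \<le> C * norm (p - q)" for p q
    using lipschitz_onD[OF lip, of p q] by (simp add: dist_norm)
  define F where "F q = dirder (1, 0) f q + g q * dirder (0, 1) f q - b q" for q
  have "AE q in lborel. q \<in> box l u \<longrightarrow> F q = 0"
  proof (rule AE_zero_on_box)
    show "F \<in> borel_measurable borel" unfolding F_def by measurable
    show "AE q in lborel. q \<in> box l u \<longrightarrow> \<bar>F q\<bar> \<le> C + G * C + B"
      using d1 d2
    proof eventually_elim
      case (elim q)
      show ?case
      proof
        assume q: "q \<in> box l u"
        have "\<bar>g q * dirder (0, 1) f q\<bar> \<le> G * C" unfolding abs_mult
          using gG[OF q] elim(2) by (intro mult_mono) auto
        then show "\<bar>F q\<bar> \<le> C + G * C + B" using bB[OF q] elim(1) unfolding F_def by linarith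
      qed
    qed
    fix a c :: "real \<times> real" assume sub: "box a c \<subseteq> box l u"
    let ?A = "box a c"
    \<comment> \<open>The factor 1/(n+2), rather than 1/(n+1), keeps every step strictly below
      \<open>hm\<close>.\<close>
    define h where "h n = hm * inverse (real (Suc (Suc n)))" for n
    have hp: "h n > 0" "h n < hm" for n
    proof -
      have i: "0 < inverse (real (Suc (Suc n)))" "inverse (real (Suc (Suc n))) < 1" by (auto simp: inverse_less_1_iff)
      show "h n > 0" unfolding h_def using hm i(1) by (rule mult_pos_pos)
      show "h n < hm" unfolding h_def using mult_strict_left_mono[OF i(2) hm] by simp
    qed
    have h0l: "h \<longlonglongrightarrow> 0"
    proof -
      have "(\<lambda>n. hm * inverse (real (Suc (Suc n)))) \<longlonglongrightarrow> hm * 0"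
        by (intro tendsto_mult tendsto_const LIMSEQ_Suc[OF LIMSEQ_inverse_real_of_nat])
      then show ?thesis unfolding h_def by simp
    qed
    define S where "S n q = (f (q + (h n, h n * g q)) - f q) / h n" for n q
    define T1 where "T1 n q = (f (q + (h n, 0)) - f q) / h n" for n q
    define T2 where "T2 n q = (f (q + (h n, h n * g q)) - f (q + (h n, 0))) / h n" for n q
    have mm[measurable]: "S n \<in> borel_measurable borel" "T1 n \<in> borel_measurable borel" "T2 n \<in> borel_measurable borel" for n
      unfolding S_def T1_def T2_def
      by (intro borel_measurable_continuous_onI continuous_intros continuous_on_compose2[OF cf] continuous_on_compose2[OF cg]; use hp[of n] in force)+
    \<comment> \<open>The box is enlarged by \<open>hm\<close> in the first direction so that one
      integrable bound also covers its translates.\<close>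
    have cbx: "q \<in> cbox a (c + (hm, 0))" if "q \<in> ?A" for q
      using that hm by (cases q; cases a; cases c) (auto simp: mem_box_pair cbox_Pair_eq)
    have fin: "emeasure lborel (cbox a (c + (hm, 0))) < \<infinity>" by (simp add: emeasure_lborel_cbox_eq)
    have wint: "integrable lborel (\<lambda>q. K * indicat_real (cbox a (c + (hm, 0))) q)" for K
      using fin by (intro integrable_mult_right integrable_real_indicator) auto
    have nh: "norm (h n, (0::real)) = h n" for n using hp[of n] by (simp add: norm_Pair)
    have nv: "norm ((0::real), x) = \<bar>x\<bar>" for x :: real by (simp add: norm_Pair)
    have T1b: "\<bar>T1 n q\<bar> \<le> C" for n q
      using fL[of "q + (h n, 0)" q] hp[of n] nh[of n] unfolding T1_def by (simp add: field_simps)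
    have T2b: "\<bar>T2 n q\<bar> \<le> C * \<bar>G\<bar>" if "q \<in> ?A" for n q
    proof -
      have "\<bar>f (q + (h n, h n * g q)) - f (q + (h n, 0))\<bar> \<le> C * norm ((0::real), h n * g q)"
        using fL[of "q + (h n, h n * g q)" "q + (h n, 0)"] by simp
      also have "\<dots> = C * (h n * \<bar>g q\<bar>)" using hp[of n] by (simp add: nv abs_mult)
      also have "\<dots> \<le> C * (h n * \<bar>G\<bar>)"
      proof -
        have "\<bar>g q\<bar> \<le> \<bar>G\<bar>" using gG[of q] that sub abs_ge_self order_trans by blast
        then show ?thesis using hp(1)[of n] C0 by (simp add: mult_left_mono)
      qed
      finally show ?thesis using hp[of n] unfolding T2_def by (simp add: field_simps)
    qed
    have ST: "S n q = T1 n q + T2 n q" for n q unfolding S_def T1_def T2_def by (simp add: diff_divide_distrib)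
    have LS: "(\<lambda>n. \<integral>q. indicat_real ?A q * S n q \<partial>lborel) \<longlonglongrightarrow> (\<integral>q. indicat_real ?A q * b q \<partial>lborel)"
    proof (rule integral_dominated_convergence[OF _ _ wint[of "C + C * \<bar>G\<bar>"]])
      show "AE q in lborel. (\<lambda>n. indicat_real ?A q * S n q) \<longlonglongrightarrow> indicat_real ?A q * b q"
      proof (rule AE_I2)
        fix q
        show "(\<lambda>n. indicat_real ?A q * S n q) \<longlonglongrightarrow> indicat_real ?A q * b q"
        proof (cases "q \<in> ?A")
          case True
          then have q: "q \<in> box l u" using sub by auto
          have "\<bar>S n q - b q\<bar> \<le> M * h n" for n
          proof -
            have "S n q - b q = (f (q + (h n, h n * g q)) - f q - h n * b q) / h n"
              using hp[of n] unfolding S_def by (simp add: field_simps)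
            then have "\<bar>S n q - b q\<bar> = \<bar>f (q + (h n, h n * g q)) - f q - h n * b q\<bar> / h n"
              using hp[of n] by (simp add: abs_divide)
            also have "\<dots> \<le> M * (h n)\<^sup>2 / h n" using exp[OF q hp(1)[of n] hp(2)[of n]] hp[of n] by (intro divide_right_mono) auto
            finally show ?thesis using hp[of n] by (simp add: power2_eq_square)
          qed
          moreover have "(\<lambda>n. M * h n) \<longlonglongrightarrow> 0" using tendsto_mult[OF tendsto_const[of M] h0l] by simp
          ultimately have "(\<lambda>n. S n q - b q) \<longlonglongrightarrow> 0"
            using Lim_null_comparison[of "\<lambda>n. S n q - b q" "\<lambda>n. M * h n" sequentially] by simp
          then show ?thesis using True by (simp add: LIM_zero_iff)
        qed simp
      qed
      show "AE q in lborel. norm (indicat_real ?A q * S n q) \<le> (C + C * \<bar>G\<bar>) * indicat_real (cbox a (c + (hm, 0))) q" for n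
      proof (rule AE_I2)
        fix q
        show "norm (indicat_real ?A q * S n q) \<le> (C + C * \<bar>G\<bar>) * indicat_real (cbox a (c + (hm, 0))) q"
        proof (cases "q \<in> ?A")
          case True
          then show ?thesis using T1b[of n q] T2b[OF True, of n] cbx[OF True] unfolding ST by simp
        next
          case False
          then show ?thesis using C0 by simp
        qed
      qed
    qed measurable
    have L1: "(\<lambda>n. \<integral>q. indicat_real ?A q * T1 n q \<partial>lborel) \<longlonglongrightarrow> (\<integral>q. indicat_real ?A q * dirder (1, 0) f q \<partial>lborel)"
    proof (rule integral_dominated_convergence[OF _ _ wint[of "C"]])
      show "AE q in lborel. (\<lambda>n. indicat_real ?A q * T1 n q) \<longlonglongrightarrow> indicat_real ?A q * dirder (1, 0) f q"
        using d1
      proof eventually_elim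
        case (elim q)
        have "(\<lambda>n. (f (q + h n *\<^sub>R (1, 0)) - f q) / h n) \<longlonglongrightarrow> dirder (1, 0) f q"
          by (rule dirder_tendsto[OF _ h0l]) (use elim hp in \<open>auto simp: less_imp_neq[symmetric]\<close>)
        then show ?case unfolding T1_def by (intro tendsto_mult tendsto_const) simp
      qed
      show "AE q in lborel. norm (indicat_real ?A q * T1 n q) \<le> C * indicat_real (cbox a (c + (hm, 0))) q" for n
        using T1b[of n] C0 cbx by (intro AE_I2) (auto simp: indicator_def)
    qed measurable
    have sub_eq: "- (h n, 0) + q = q - (h n, 0)" for n and q :: "real \<times> real" by (cases q) simp
    \<comment> \<open>Translation by \<open>(h n, 0)\<close> puts the start of the vertical
      increment at \<open>q\<close> itself.\<close>
    have sh: "(\<integral>q. indicat_real ?A q * T2 n q \<partial>lborel)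
        = (\<integral>q. indicat_real ?A (q - (h n, 0)) * T2 n (q - (h n, 0)) \<partial>lborel)" for n
      using lborel_integral_translation[of "\<lambda>q. indicat_real ?A q * T2 n q" "- (h n, 0)", unfolded sub_eq]
      by simp
    have "(\<lambda>n. \<integral>q. indicat_real ?A (q - (h n, 0)) * T2 n (q - (h n, 0)) \<partial>lborel)
       \<longlonglongrightarrow> (\<integral>q. indicat_real ?A q * (g q * dirder (0, 1) f q) \<partial>lborel)"
    proof (rule integral_dominated_convergence[OF _ _ wint[of "C * \<bar>G\<bar>"]])
      have [measurable]: "(\<lambda>q. q - (h n, 0)) \<in> borel_measurable (borel :: (real \<times> real) measure)" for n
        by (intro borel_measurable_continuous_onI continuous_intros)
      show "(\<lambda>q. indicat_real ?A (q - (h n, 0)) * T2 n (q - (h n, 0))) \<in> borel_measurable lborel" for n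
        by measurable
      show "AE q in lborel. (\<lambda>n. indicat_real ?A (q - (h n, 0)) * T2 n (q - (h n, 0)))
          \<longlonglongrightarrow> indicat_real ?A q * (g q * dirder (0, 1) f q)"
        using d2 AE_not_in_frontier_convex[OF convex_box(2)[of a c]]
      proof eventually_elim
        case (elim q)
        have l0: "(\<lambda>n. q - (h n, 0)) \<longlonglongrightarrow> q"
        proof -
          have "(\<lambda>n. q - (h n, 0)) \<longlonglongrightarrow> q - (0, 0)" by (intro tendsto_diff tendsto_const tendsto_Pair h0l)
          then show ?thesis by (simp add: zero_prod_def[symmetric])
        qed
        \<comment> \<open>Off the frontier, a null set, the indicators of the translated boxes are
          eventually constant.\<close>
        have ind: "(\<lambda>n. indicat_real ?A (q - (h n, 0))) \<longlonglongrightarrow> indicat_real ?A q"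
        proof (cases "q \<in> ?A")
          case True
          have "eventually (\<lambda>n. q - (h n, 0) \<in> ?A) sequentially" using topological_tendstoD[OF l0 open_box True] .
          then show ?thesis using True by (intro tendsto_eventually) (auto elim: eventually_mono)
        next
          case False
          then have "q \<in> - closure ?A" using elim(2) by (auto simp: frontier_def interior_open[OF open_box])
          then have "eventually (\<lambda>n. q - (h n, 0) \<in> - closure ?A) sequentially"
            by (intro topological_tendstoD[OF l0 open_Compl[OF closed_closure]])
          then have "eventually (\<lambda>n. indicat_real ?A (q - (h n, 0)) = 0) sequentially"
          proof (rule eventually_mono)
            fix n assume "q - (h n, 0) \<in> - closure ?A"
            then have "q - (h n, 0) \<notin> ?A" using closure_subset by blast
            then show "indicat_real ?A (q - (h n, 0)) = 0" by simp
          qed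
          then show ?thesis using False by (intro tendsto_eventually) simp
        qed
        have gl: "(\<lambda>n. g (q - (h n, 0))) \<longlonglongrightarrow> g q"
          using cg l0 by (intro continuous_on_tendsto_compose[OF cg]) auto
        \<comment> \<open>Caratheodory's form of the derivative avoids dividing by the increment
          \<open>h n * g\<close>, which may be zero.\<close>
        obtain \<psi> where psi: "\<And>z. f (q + z *\<^sub>R (0, 1)) - f (q + 0 *\<^sub>R (0, 1)) = \<psi> z * (z - 0)" "isCont \<psi> 0" "\<psi> 0 = dirder (0, 1) f q"
          using elim(1) unfolding CARAT_DERIV by blast
        have "T2 n (q - (h n, 0)) = \<psi> (h n * g (q - (h n, 0))) * g (q - (h n, 0))" for n
        proof -
          have e1: "q - (h n, 0) + (h n, h n * g (q - (h n, 0))) = q + (h n * g (q - (h n, 0))) *\<^sub>R (0, 1)"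
            by (cases q) simp
          have e2: "q - (h n, 0) + (h n, 0) = q + 0 *\<^sub>R (0, 1)" by (cases q) simp
          show ?thesis unfolding T2_def e1 e2 psi(1) using hp[of n] by simp
        qed
        moreover have "(\<lambda>n. \<psi> (h n * g (q - (h n, 0)))) \<longlonglongrightarrow> \<psi> 0"
          using tendsto_mult[OF h0l gl] by (intro isCont_tendsto_compose[OF psi(2)]) simp
        ultimately have "(\<lambda>n. T2 n (q - (h n, 0))) \<longlonglongrightarrow> dirder (0, 1) f q * g q"
          using gl psi(3) by (simp add: tendsto_mult)
        from tendsto_mult[OF ind this] show ?case by (simp only: mult.commute)
      qed
      show "AE q in lborel. norm (indicat_real ?A (q - (h n, 0)) * T2 n (q - (h n, 0))) \<le> C * \<bar>G\<bar> * indicat_real (cbox a (c + (hm, 0))) q" for n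
      proof (rule AE_I2)
        fix q
        show "norm (indicat_real ?A (q - (h n, 0)) * T2 n (q - (h n, 0))) \<le> C * \<bar>G\<bar> * indicat_real (cbox a (c + (hm, 0))) q"
        proof (cases "q - (h n, 0) \<in> ?A")
          case True
          then have "q \<in> cbox a (c + (hm, 0))" using hp[of n]
            by (cases q; cases a; cases c) (auto simp: mem_box_pair cbox_Pair_eq)
          then show ?thesis using T2b[OF True, of n] True by simp
        next
          case False
          then show ?thesis using C0 by simp
        qed
      qed
    qed measurable
    then have L2: "(\<lambda>n. \<integral>q. indicat_real ?A q * T2 n q \<partial>lborel) \<longlonglongrightarrow> (\<integral>q. indicat_real ?A q * (g q * dirder (0, 1) f q) \<partial>lborel)"
      unfolding sh .
    have finA: "emeasure lborel ?A < \<infinity>" by (simp add: emeasure_lborel_box_eq)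
    have bi: "integrable lborel (\<lambda>q. indicat_real ?A q * w q)"
      if [measurable]: "w \<in> borel_measurable borel" and "AE q in lborel. q \<in> ?A \<longrightarrow> \<bar>w q\<bar> \<le> K" for w K
      using integrableI_bounded_set_indicator[of ?A lborel w K] that finA by simp
    have i1: "integrable lborel (\<lambda>q. indicat_real ?A q * T1 n q)" for n
      by (rule bi[where K=C]) (use T1b in auto)
    have i2: "integrable lborel (\<lambda>q. indicat_real ?A q * T2 n q)" for n
      by (rule bi[where K="C * \<bar>G\<bar>"]) (use T2b in auto)
    have "(\<integral>q. indicat_real ?A q * S n q \<partial>lborel) = (\<integral>q. indicat_real ?A q * T1 n q \<partial>lborel) + (\<integral>q. indicat_real ?A q * T2 n q \<partial>lborel)" for n
      unfolding ST distrib_left by (rule Bochner_Integration.integral_add[OF i1 i2])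
    then have "(\<integral>q. indicat_real ?A q * b q \<partial>lborel) = (\<integral>q. indicat_real ?A q * dirder (1, 0) f q \<partial>lborel) + (\<integral>q. indicat_real ?A q * (g q * dirder (0, 1) f q) \<partial>lborel)"
      using LIMSEQ_unique[OF LS] tendsto_add[OF L1 L2] by simp
    moreover have j1: "integrable lborel (\<lambda>q. indicat_real ?A q * dirder (1, 0) f q)"
      by (rule bi[where K=C]) (use d1 in auto)
    moreover have j2: "integrable lborel (\<lambda>q. indicat_real ?A q * (g q * dirder (0, 1) f q))"
    proof (rule bi[where K="G * C"])
      show "AE q in lborel. q \<in> ?A \<longrightarrow> \<bar>g q * dirder (0, 1) f q\<bar> \<le> G * C"
        using d2
      proof eventually_elim
        case (elim q)
        show ?case
        proof
          assume "q \<in> ?A"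
          then have "\<bar>g q\<bar> \<le> G" using gG[of q] sub by blast
          then show "\<bar>g q * dirder (0, 1) f q\<bar> \<le> G * C"
            unfolding abs_mult using elim by (intro mult_mono) auto
        qed
      qed
    qed measurable
    moreover have j3: "integrable lborel (\<lambda>q. indicat_real ?A q * b q)"
      by (rule bi[where K=B], rule m(5), intro AE_I2 impI) (use bB sub in blast)
    ultimately show "(LINT q:?A|lborel. F q) = 0"
      unfolding set_lebesgue_integral_def F_def
      by (simp add: algebra_simps Bochner_Integration.integral_diff Bochner_Integration.integral_add)
  qed
  then show ?thesis unfolding F_def by eventually_elim auto
qed

text \<open>The divergence theorem on a rectangle: the fundamental theorem on sections in one
  variable, Fubini in the other. The weight \<open>4 * y\<close> is constant along the sections in
  \<open>t\<close>.\<close>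

lemma box_flux:
  fixes n1 n2 :: "real \<times> real \<Rightarrow> real"
  assumes l1: "C-lipschitz_on UNIV n1" and l2: "C-lipschitz_on UNIV n2"
    and yy: "y0 \<le> y1" and tt: "t0 \<le> t1"
    and div: "AE q in lborel. q \<in> box (y0, t0) (y1, t1) \<longrightarrow> dirder (1, 0) n2 q + 4 * fst q * dirder (0, 1) n1 q = 0"
  shows "(LINT t:{t0..t1}|lborel. n2 (y1, t) - n2 (y0, t)) + (LINT y:{y0..y1}|lborel. 4 * y * (n1 (y, t1) - n1 (y, t0))) = 0"
proof -
  let ?A = "cbox (y0, t0) (y1, t1)"
  have [measurable]: "dirder e n1 \<in> borel_measurable borel" "dirder e n2 \<in> borel_measurable borel" for e
    using l1 l2 by (auto intro!: borel_measurable_dirder lipschitz_on_continuous_on)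
  note d1 = AE_dirder[OF l1 disjI2[OF refl]] and d2 = AE_dirder[OF l2 disjI1[OF refl]]
  have [measurable]: "(fst :: real \<times> real \<Rightarrow> real) \<in> borel_measurable borel"
    by (intro borel_measurable_continuous_onI continuous_intros)
  have ind: "indicat_real ?A (y, t) = indicat_real {y0..y1} y * indicat_real {t0..t1} t" for y t
    by (auto simp: indicator_def cbox_Pair_eq)
  have fin: "emeasure lborel ?A < \<infinity>" by (simp add: emeasure_lborel_cbox_eq)
  have i2: "integrable (lborel \<Otimes>\<^sub>M lborel) (\<lambda>(y, t). indicat_real ?A (y, t) * dirder (1, 0) n2 (y, t))"
  proof -
    have "integrable lborel (\<lambda>q. indicat_real ?A q *\<^sub>R dirder (1, 0) n2 q)"
    proof (rule integrableI_bounded_set_indicator[of ?A lborel _ C])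
      show "AE q in lborel. q \<in> ?A \<longrightarrow> norm (dirder (1, 0) n2 q) \<le> C"
        using d2 by eventually_elim simp
    qed (use fin in auto)
    then show ?thesis unfolding lborel_prod by (simp add: split_beta')
  qed
  have i1: "integrable (lborel \<Otimes>\<^sub>M lborel) (\<lambda>(y, t). indicat_real ?A (y, t) * (4 * y * dirder (0, 1) n1 (y, t)))"
  proof -
    have "integrable lborel (\<lambda>q. indicat_real ?A q *\<^sub>R (4 * fst q * dirder (0, 1) n1 q))"
    proof (rule integrableI_bounded_set_indicator[of ?A lborel _ "4 * max \<bar>y0\<bar> \<bar>y1\<bar> * C"])
      show "AE q in lborel. q \<in> ?A \<longrightarrow> norm (4 * fst q * dirder (0, 1) n1 q) \<le> 4 * max \<bar>y0\<bar> \<bar>y1\<bar> * C"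
        using d1
      proof eventually_elim
        case (elim q)
        show ?case
        proof
          assume "q \<in> ?A"
          then have "\<bar>fst q\<bar> \<le> max \<bar>y0\<bar> \<bar>y1\<bar>" by (cases q) (auto simp: cbox_Pair_eq)
          then have "4 * \<bar>fst q\<bar> * \<bar>dirder (0, 1) n1 q\<bar> \<le> 4 * max \<bar>y0\<bar> \<bar>y1\<bar> * C"
            using elim by (intro mult_mono) auto
          then show "norm (4 * fst q * dirder (0, 1) n1 q) \<le> 4 * max \<bar>y0\<bar> \<bar>y1\<bar> * C" by (simp add: abs_mult)
        qed
      qed
    qed (use fin in auto)
    then show ?thesis unfolding lborel_prod by (simp add: split_beta')
  qed
  have "(LINT t:{t0..t1}|lborel. n2 (y1, t) - n2 (y0, t)) = (\<integral>t. (\<integral>y. indicat_real ?A (y, t) * dirder (1, 0) n2 (y, t) \<partial>lborel) \<partial>lborel)"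
    unfolding set_lebesgue_integral_def
  proof (rule Bochner_Integration.integral_cong[OF refl])
    fix t
    show "indicat_real {t0..t1} t *\<^sub>R (n2 (y1, t) - n2 (y0, t)) = (\<integral>y. indicat_real ?A (y, t) * dirder (1, 0) n2 (y, t) \<partial>lborel)"
      unfolding ind lipschitz_section_fst_derivative(2)[OF l2 yy] set_lebesgue_integral_def
      by (simp add: mult.assoc mult.left_commute flip: integral_mult_right_zero)
  qed
  also have "\<dots> = (\<integral>q. (case q of (y, t) \<Rightarrow> indicat_real ?A (y, t) * dirder (1, 0) n2 (y, t)) \<partial>(lborel \<Otimes>\<^sub>M lborel))"
    by (rule lborel_pair.integral_snd[OF i2])
  finally have e2: "(LINT t:{t0..t1}|lborel. n2 (y1, t) - n2 (y0, t)) = (\<integral>q. indicat_real ?A q * dirder (1, 0) n2 q \<partial>lborel)"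
    unfolding lborel_prod by (simp add: split_beta')
  have "(LINT y:{y0..y1}|lborel. 4 * y * (n1 (y, t1) - n1 (y, t0))) = (\<integral>y. (\<integral>t. indicat_real ?A (y, t) * (4 * y * dirder (0, 1) n1 (y, t)) \<partial>lborel) \<partial>lborel)"
    unfolding set_lebesgue_integral_def
  proof (rule Bochner_Integration.integral_cong[OF refl])
    fix y
    show "indicat_real {y0..y1} y *\<^sub>R (4 * y * (n1 (y, t1) - n1 (y, t0))) = (\<integral>t. indicat_real ?A (y, t) * (4 * y * dirder (0, 1) n1 (y, t)) \<partial>lborel)"
      unfolding ind lipschitz_section_snd_derivative(2)[OF l1 tt] set_lebesgue_integral_def
      by (simp add: mult.assoc mult.left_commute flip: integral_mult_right_zero)
  qed
  also have "\<dots> = (\<integral>q. (case q of (y, t) \<Rightarrow> indicat_real ?A (y, t) * (4 * y * dirder (0, 1) n1 (y, t))) \<partial>(lborel \<Otimes>\<^sub>M lborel))"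
    by (rule lborel_pair.integral_fst[OF i1])
  finally have e1: "(LINT y:{y0..y1}|lborel. 4 * y * (n1 (y, t1) - n1 (y, t0))) = (\<integral>q. indicat_real ?A q * (4 * fst q * dirder (0, 1) n1 q) \<partial>lborel)"
    unfolding lborel_prod by (simp add: split_beta')
  have "(\<integral>q. indicat_real ?A q * dirder (1, 0) n2 q \<partial>lborel) + (\<integral>q. indicat_real ?A q * (4 * fst q * dirder (0, 1) n1 q) \<partial>lborel)
     = (\<integral>q. indicat_real ?A q * dirder (1, 0) n2 q + indicat_real ?A q * (4 * fst q * dirder (0, 1) n1 q) \<partial>lborel)"
    using i1 i2 unfolding lborel_prod by (subst Bochner_Integration.integral_add) (auto simp: split_beta')
  also have "\<dots> = 0"
  proof (rule integral_eq_zero_AE)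
    show "AE q in lborel. indicat_real ?A q * dirder (1, 0) n2 q + indicat_real ?A q * (4 * fst q * dirder (0, 1) n1 q) = 0"
      using div AE_not_in_frontier_convex[OF convex_box(1)[of "(y0, t0)" "(y1, t1)"]]
    proof eventually_elim
      case (elim q)
      show ?case
      proof (cases "q \<in> box (y0, t0) (y1, t1)")
        case True then show ?thesis using elim(1) by (simp add: distrib_left[symmetric])
      next
        case False
        then have "q \<notin> ?A" using elim(2) by (auto simp: frontier_def interior_cbox closure_closed)
        then show ?thesis by simp
      qed
    qed
  qed
  finally show ?thesis using e1 e2 by simp
qed

section \<open>The normal as a function of the slope\<close>

lemma dirder_compose:
  fixes f :: "real \<times> real \<Rightarrow> real"
  assumes "((\<lambda>h. f (q + h *\<^sub>R e)) has_real_derivative D) (at 0)" "(N has_real_derivative N') (at (f q))"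
  shows "dirder e (\<lambda>q. N (f q)) q = N' * D"
proof (rule dirder_eq)
  have "(N has_real_derivative N') (at (f (q + 0 *\<^sub>R e)))" using assms(2) by simp
  from DERIV_chain2[OF this assms(1)]
  show "((\<lambda>h. N (f (q + h *\<^sub>R e))) has_real_derivative N' * D) (at 0)" .
qed

lemma lipschitz_compose_real:
  fixes f :: "'a::metric_space \<Rightarrow> real"
  assumes f: "C-lipschitz_on UNIV f" and N: "\<And>x y :: real. \<bar>N x - N y\<bar> \<le> \<bar>x - y\<bar>"
  shows "C-lipschitz_on UNIV (\<lambda>q. N (f q) :: real)"
proof (rule lipschitz_onI)
  fix p q
  show "dist (N (f p)) (N (f q)) \<le> C * dist p q"
    using N[of "f p" "f q"] lipschitz_onD[OF f, of p q] by (simp add: dist_real_def)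
qed (use f lipschitz_on_nonneg in blast)

text \<open>The components of the normal $\nu$ as functions of the slope, oriented by $\nu_1>0$. Since
  $\nu_2'=K$ and $\nu_1'=bK$ with the same $K$, the transport equation for $\beta$ is the vanishing of
  $\partial_y\nu_2+4y\,\partial_\tau\nu_1$.\<close>

definition nu1 :: "real \<Rightarrow> real" where "nu1 b = 1 / sqrt (1 + b\<^sup>2)"
definition nu2 :: "real \<Rightarrow> real" where "nu2 b = - b / sqrt (1 + b\<^sup>2)"

lemma one_plus_sq_pos: "1 + (b::real)\<^sup>2 > 0" by (rule add_pos_nonneg) auto

lemma nu_sum_squares: "(nu1 b)\<^sup>2 + (nu2 b)\<^sup>2 = 1"
  using one_plus_sq_pos[of b] unfolding nu1_def nu2_def
  by (simp add: power_divide add_divide_distrib[symmetric])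

lemma nu1_DERIV: "(nu1 has_real_derivative (- b / ((1 + b\<^sup>2) * sqrt (1 + b\<^sup>2)))) (at b)"
proof -
  have p: "1 + b * b > 0" using one_plus_sq_pos[of b] by (simp add: power2_eq_square)
  show ?thesis unfolding nu1_def
    using one_plus_sq_pos[of b] p
    by (auto intro!: derivative_eq_intros simp: field_simps power2_eq_square)
qed

lemma nu2_DERIV: "(nu2 has_real_derivative (- 1 / ((1 + b\<^sup>2) * sqrt (1 + b\<^sup>2)))) (at b)"
proof -
  define r where "r = sqrt (1 + b\<^sup>2)"
  have r: "r > 0" "r * r = 1 + b\<^sup>2" using one_plus_sq_pos[of b] unfolding r_def by auto
  have "((\<lambda>b. sqrt (1 + b\<^sup>2)) has_real_derivative (b / r)) (at b)"
    unfolding r_def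
  proof -
    have "((\<lambda>b. 1 + b\<^sup>2) has_real_derivative 2 * b) (at b)"
      by (auto intro!: derivative_eq_intros)
    note D = DERIV_chain2[OF DERIV_real_sqrt[OF one_plus_sq_pos] this]
    have E: "inverse (sqrt (1 + b\<^sup>2)) / 2 * (2 * b) = b / sqrt (1 + b\<^sup>2)"
      by (simp add: field_simps)
    show "((\<lambda>b. sqrt (1 + b\<^sup>2)) has_real_derivative b / sqrt (1 + b\<^sup>2)) (at b)"
      using D unfolding E .
  qed
  from DERIV_divide[OF DERIV_minus[OF DERIV_ident] this]
  have "(nu2 has_real_derivative ((- 1 * r - (- b) * (b / r)) / (r * r))) (at b)"
    unfolding nu2_def[abs_def] using r(1) unfolding r_def by simp
  moreover have "(- 1 * r - (- b) * (b / r)) / (r * r) = (- (r * r) + b\<^sup>2) / (r * r * r)"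
    using r(1) by (simp add: field_simps power2_eq_square)
  moreover have "\<dots> = - 1 / ((1 + b\<^sup>2) * r)" unfolding r(2) by simp
  ultimately show ?thesis unfolding r_def by simp
qed

lemma abs_diff_le_of_DERIV_le_1:
  fixes N :: "real \<Rightarrow> real"
  assumes d: "\<And>b. (N has_real_derivative N' b) (at b)" and b: "\<And>b. \<bar>N' b\<bar> \<le> 1"
  shows "\<bar>N x - N y\<bar> \<le> \<bar>x - y\<bar>"
proof -
  have "norm (N x - N y) \<le> 1 * norm (x - y)"
    by (rule field_differentiable_bound[of UNIV N N']) (use d b in \<open>auto intro: DERIV_subset\<close>)
  then show ?thesis by simp
qed

lemma nu1_lipschitz: "\<bar>nu1 x - nu1 y\<bar> \<le> \<bar>x - y\<bar>"
proof (rule abs_diff_le_of_DERIV_le_1[OF nu1_DERIV])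
  fix b :: real
  have "\<bar>b\<bar> \<le> sqrt (1 + b\<^sup>2)" by (rule real_le_rsqrt) simp
  also have "\<dots> \<le> (1 + b\<^sup>2) * sqrt (1 + b\<^sup>2)" using mult_right_mono[of 1 "1 + b\<^sup>2" "sqrt (1 + b\<^sup>2)"] by simp
  finally show "\<bar>- b / ((1 + b\<^sup>2) * sqrt (1 + b\<^sup>2))\<bar> \<le> 1"
    using one_plus_sq_pos[of b] by (simp add: abs_mult)
qed

lemma nu2_lipschitz: "\<bar>nu2 x - nu2 y\<bar> \<le> \<bar>x - y\<bar>"
proof (rule abs_diff_le_of_DERIV_le_1[OF nu2_DERIV])
  fix b :: real
  have "1 \<le> sqrt (1 + b\<^sup>2)" by simp
  also have "\<dots> \<le> (1 + b\<^sup>2) * sqrt (1 + b\<^sup>2)" using mult_right_mono[of 1 "1 + b\<^sup>2" "sqrt (1 + b\<^sup>2)"] by simp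
  finally show "\<bar>- 1 / ((1 + b\<^sup>2) * sqrt (1 + b\<^sup>2))\<bar> \<le> 1"
    using one_plus_sq_pos[of b] by (simp add: abs_mult)
qed

text \<open>The error \<open>M * h\<^sup>2\<close> is allowed because the step follows the tangent
  of the characteristic instead of the characteristic itself. The transport equation with right-hand
  side zero, multiplied by the common factor \<open>K\<close> of both derivatives of the normal, is
  the divergence condition of \<open>box_flux\<close>.\<close>

lemma conservation_law_box_flux:
  fixes \<beta> :: "real \<times> real \<Rightarrow> real"
  assumes lip: "C-lipschitz_on UNIV \<beta>" and bB: "\<And>q. \<bar>\<beta> q\<bar> \<le> B" and hm: "hm > 0"
    and exp: "\<And>q h. q \<in> box (y0, t0) (y1, t1) \<Longrightarrow> 0 < h \<Longrightarrow> h < hm \<Longrightarrow> \<bar>\<beta> (q + (h, h * (4 * fst q * \<beta> q))) - \<beta> q\<bar> \<le> M * h\<^sup>2"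
    and yy: "y0 \<le> y1" and tt: "t0 \<le> t1"
  shows "(LINT t:{t0..t1}|lborel. nu2 (\<beta> (y1, t)) - nu2 (\<beta> (y0, t)))
     + (LINT y:{y0..y1}|lborel. 4 * y * (nu1 (\<beta> (y, t1)) - nu1 (\<beta> (y, t0)))) = 0"
proof (rule box_flux[where C=C])
  show "C-lipschitz_on UNIV (\<lambda>q. nu1 (\<beta> q))" by (rule lipschitz_compose_real[OF lip nu1_lipschitz])
  show "C-lipschitz_on UNIV (\<lambda>q. nu2 (\<beta> q))" by (rule lipschitz_compose_real[OF lip nu2_lipschitz])
  have cb: "continuous_on UNIV \<beta>" using lip by (rule lipschitz_on_continuous_on)
  have "AE q in lborel. q \<in> box (y0, t0) (y1, t1) \<longrightarrow> dirder (1, 0) \<beta> q + (4 * fst q * \<beta> q) * dirder (0, 1) \<beta> q = 0"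
  proof (rule transport_AE[OF lip, where G="4 * max \<bar>y0\<bar> \<bar>y1\<bar> * B" and B=0 and hm=hm and M=M])
    show "continuous_on UNIV (\<lambda>q. 4 * fst q * \<beta> q)" by (intro continuous_intros cb)
    fix q assume q: "q \<in> box (y0, t0) (y1, t1)"
    then have "\<bar>fst q\<bar> \<le> max \<bar>y0\<bar> \<bar>y1\<bar>" by (cases q) (auto simp: mem_box_pair)
    then have "4 * \<bar>fst q\<bar> * \<bar>\<beta> q\<bar> \<le> 4 * max \<bar>y0\<bar> \<bar>y1\<bar> * B" using bB[of q] by (intro mult_mono) auto
    then show "\<bar>4 * fst q * \<beta> q\<bar> \<le> 4 * max \<bar>y0\<bar> \<bar>y1\<bar> * B" by (simp add: abs_mult)
  qed (use hm exp in auto)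
  then show "AE q in lborel. q \<in> box (y0, t0) (y1, t1) \<longrightarrow>
      dirder (1, 0) (\<lambda>q. nu2 (\<beta> q)) q + 4 * fst q * dirder (0, 1) (\<lambda>q. nu1 (\<beta> q)) q = 0"
    using AE_dirder[OF lip disjI1[OF refl]] AE_dirder[OF lip disjI2[OF refl]]
  proof eventually_elim
    case (elim q)
    show ?case
    proof
      assume q: "q \<in> box (y0, t0) (y1, t1)"
      define K where "K = - 1 / ((1 + (\<beta> q)\<^sup>2) * sqrt (1 + (\<beta> q)\<^sup>2))"
      have a: "dirder (1, 0) (\<lambda>q. nu2 (\<beta> q)) q = K * dirder (1, 0) \<beta> q"
        unfolding K_def by (rule dirder_compose[OF _ nu2_DERIV]) (use elim in auto)
      have "dirder (0, 1) (\<lambda>q. nu1 (\<beta> q)) q = (- \<beta> q / ((1 + (\<beta> q)\<^sup>2) * sqrt (1 + (\<beta> q)\<^sup>2))) * dirder (0, 1) \<beta> q"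
        by (rule dirder_compose[OF _ nu1_DERIV]) (use elim in auto)
      then have b: "dirder (0, 1) (\<lambda>q. nu1 (\<beta> q)) q = K * \<beta> q * dirder (0, 1) \<beta> q"
        unfolding K_def by simp
      have "dirder (1, 0) (\<lambda>q. nu2 (\<beta> q)) q + 4 * fst q * dirder (0, 1) (\<lambda>q. nu1 (\<beta> q)) q
          = K * (dirder (1, 0) \<beta> q + (4 * fst q * \<beta> q) * dirder (0, 1) \<beta> q)"
        unfolding a b by (simp add: algebra_simps)
      then show "dirder (1, 0) (\<lambda>q. nu2 (\<beta> q)) q + 4 * fst q * dirder (0, 1) (\<lambda>q. nu1 (\<beta> q)) q = 0"
        using elim(1) q by simp
    qed
  qed
qed (use yy tt in auto)

section \<open>Parabolic arcs and the slope of a ruled graph\<close>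

text \<open>The horizontal segment $(u,y,t+2yu)+h\,(b,1,2yb-2u)$ projects to the point below.\<close>

definition arc_pt :: "(real \<times> real \<Rightarrow> real) \<Rightarrow> real \<Rightarrow> real \<times> real \<Rightarrow> real \<Rightarrow> real \<times> real" where
  "arc_pt u b q h = (fst q + h, snd q - 4 * u q * h - 2 * b * h\<^sup>2)"

text \<open>The arc must leave \<open>D\<close> at both ends. Hence a point well inside
  \<open>D\<close> keeps its arc for a time bounded below by its distance to the complement, which
  an arbitrarily short arc would not guarantee.\<close>

definition has_arc :: "(real \<times> real) set \<Rightarrow> (real \<times> real \<Rightarrow> real) \<Rightarrow> real \<times> real \<Rightarrow> real \<Rightarrow> bool" where
  "has_arc D u q b \<longleftrightarrow> (\<exists>y0 y1. y0 < 0 \<and> 0 < y1 \<and>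
     (\<forall>h. y0 < h \<longrightarrow> h < y1 \<longrightarrow> arc_pt u b q h \<in> D \<and> u (arc_pt u b q h) = u q + b * h) \<and>
     arc_pt u b q y0 \<notin> D \<and> arc_pt u b q y1 \<notin> D)"

text \<open>One \<open>\<eta>\<close> serves all points of a ball, because difference quotients with
  a common step are later taken at all points of a box simultaneously.\<close>

definition local_arcs :: "(real \<times> real) set \<Rightarrow> (real \<times> real \<Rightarrow> real) \<Rightarrow> (real \<times> real \<Rightarrow> real) \<Rightarrow> bool" where
  "local_arcs D u \<beta> \<longleftrightarrow> (\<forall>q0\<in>D. \<exists>\<eta>>0. \<exists>L. ball q0 \<eta> \<subseteq> D \<and> L-lipschitz_on (ball q0 \<eta>) \<beta> \<and>
     (\<forall>p\<in>ball q0 \<eta>. \<forall>h. \<bar>h\<bar> < \<eta> \<longrightarrow> arc_pt u (\<beta> p) p h \<in> D \<and>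
        u (arc_pt u (\<beta> p) p h) = u p + \<beta> p * h \<and> \<beta> (arc_pt u (\<beta> p) p h) = \<beta> p))"

lemma norm_pair_le: "norm (x, y) \<le> \<bar>x\<bar> + \<bar>y\<bar>" for x y :: real
  using norm_Pair_le[of x y] by simp

text \<open>Both arcs are followed for the same time \<open>h\<close>. The values of
  \<open>u\<close> drift apart by \<open>h * \<bar>b - b'\<bar>\<close> up to a multiple of the
  initial distance, whereas the slopes separate the points only by
  \<open>2 * h\<^sup>2 * \<bar>b - b'\<bar>\<close>. For \<open>4 * C * h \<le> 1\<close> half of
  the left side absorbs the Lipschitz bound of the quadratic term.\<close>

lemma slope_compare:
  assumes lip: "C-lipschitz_on D u" and h: "0 < h" "4 * C * h \<le> 1"
    and a: "arc_pt u b q h \<in> D" "u (arc_pt u b q h) = u q + b * h"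
    and a': "arc_pt u b' q' h \<in> D" "u (arc_pt u b' q' h) = u q' + b' * h"
    and q: "q \<in> D" "q' \<in> D"
  shows "h * \<bar>b - b'\<bar> \<le> 8 * C * dist q q'"
proof -
  define e where "e = dist q q'"
  have C0: "C \<ge> 0" using lip by (rule lipschitz_on_nonneg)
  have e0: "e \<ge> 0" unfolding e_def by simp
  have ey: "\<bar>fst q - fst q'\<bar> \<le> e" "\<bar>snd q - snd q'\<bar> \<le> e"
    using dist_fst_le[of q q'] dist_snd_le[of q q'] unfolding e_def dist_real_def by auto
  have d0: "\<bar>u q - u q'\<bar> \<le> C * e" using lipschitz_onD[OF lip q] unfolding e_def dist_real_def .
  have "\<bar>(u q + b * h) - (u q' + b' * h)\<bar> \<le> C * dist (arc_pt u b q h) (arc_pt u b' q' h)"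
    using lipschitz_onD[OF lip a(1) a'(1)] unfolding a(2) a'(2) dist_real_def .
  also have "\<dots> \<le> C * (2 * e + 4 * h * (C * e) + 2 * h\<^sup>2 * \<bar>b - b'\<bar>)"
  proof (rule mult_left_mono[OF _ C0])
    have "dist (arc_pt u b q h) (arc_pt u b' q' h) \<le> \<bar>fst q - fst q'\<bar> + \<bar>(snd q - snd q') - 4 * h * (u q - u q') - 2 * h\<^sup>2 * (b - b')\<bar>"
      unfolding dist_norm arc_pt_def using norm_pair_le by (simp add: algebra_simps)
    also have "\<dots> \<le> e + (e + 4 * h * (C * e) + 2 * h\<^sup>2 * \<bar>b - b'\<bar>)"
    proof -
      have "\<bar>4 * h * (u q - u q')\<bar> \<le> 4 * h * (C * e)" using h d0 by (simp add: abs_mult)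
      moreover have "\<bar>2 * h\<^sup>2 * (b - b')\<bar> = 2 * h\<^sup>2 * \<bar>b - b'\<bar>" by (simp add: abs_mult)
      ultimately show ?thesis using ey by linarith
    qed
    finally show "dist (arc_pt u b q h) (arc_pt u b' q' h) \<le> 2 * e + 4 * h * (C * e) + 2 * h\<^sup>2 * \<bar>b - b'\<bar>" by simp
  qed
  finally have m: "\<bar>(u q - u q') + h * (b - b')\<bar> \<le> 2 * (C * e) + (4 * C * h) * (C * e) + (2 * C * h) * (h * \<bar>b - b'\<bar>)"
    by (simp add: algebra_simps power2_eq_square)
  have x: "(4 * C * h) * (C * e) \<le> C * e" using mult_right_mono[OF h(2), of "C * e"] C0 e0 by simp
  have y: "(2 * C * h) * (h * \<bar>b - b'\<bar>) \<le> (1/2) * (h * \<bar>b - b'\<bar>)" using h by (intro mult_right_mono) auto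
  have "h * \<bar>b - b'\<bar> = \<bar>h * (b - b')\<bar>" using h by (simp add: abs_mult)
  then have "h * \<bar>b - b'\<bar> \<le> \<bar>(u q - u q') + h * (b - b')\<bar> + \<bar>u q - u q'\<bar>" by linarith
  then show ?thesis using m x y d0 unfolding e_def[symmetric] by linarith
qed

text \<open>The same absorption, with the starting point of the arc in place of a second
  arc.\<close>

lemma slope_bound:
  assumes lip: "C-lipschitz_on D u" and M: "\<bar>u q\<bar> \<le> M" and h: "0 < h" "4 * C * h \<le> 1"
    and a: "arc_pt u b q h \<in> D" "u (arc_pt u b q h) = u q + b * h" and q: "q \<in> D"
  shows "\<bar>b\<bar> \<le> 2 * C * (1 + 4 * M)"
proof -
  have C0: "C \<ge> 0" using lip by (rule lipschitz_on_nonneg)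
  have "\<bar>b * h\<bar> \<le> C * dist (arc_pt u b q h) q"
    using lipschitz_onD[OF lip a(1) q] unfolding a(2) dist_real_def by simp
  also have "\<dots> \<le> C * (h + 4 * M * h + 2 * h\<^sup>2 * \<bar>b\<bar>)"
  proof (rule mult_left_mono[OF _ C0])
    have "dist (arc_pt u b q h) q \<le> \<bar>h\<bar> + \<bar>- 4 * u q * h - 2 * b * h\<^sup>2\<bar>"
      unfolding dist_norm arc_pt_def using norm_pair_le[of h "- 4 * u q * h - 2 * b * h\<^sup>2"]
      by (cases q) simp
    also have "\<dots> \<le> h + (4 * M * h + 2 * h\<^sup>2 * \<bar>b\<bar>)"
    proof -
      have "\<bar>4 * u q * h\<bar> \<le> 4 * M * h" using h M by (simp add: abs_mult)
      moreover have "\<bar>2 * b * h\<^sup>2\<bar> = 2 * h\<^sup>2 * \<bar>b\<bar>" by (simp add: abs_mult)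
      ultimately show ?thesis using h by linarith
    qed
    finally show "dist (arc_pt u b q h) q \<le> h + 4 * M * h + 2 * h\<^sup>2 * \<bar>b\<bar>" by simp
  qed
  finally have "h * \<bar>b\<bar> \<le> h * (C * (1 + 4 * M) + (2 * C * h) * \<bar>b\<bar>)"
    using h by (simp add: abs_mult algebra_simps power2_eq_square)
  then have "\<bar>b\<bar> \<le> C * (1 + 4 * M) + (2 * C * h) * \<bar>b\<bar>" using h(1) by simp
  moreover have "(2 * C * h) * \<bar>b\<bar> \<le> (1/2) * \<bar>b\<bar>" using h by (intro mult_right_mono) auto
  ultimately show ?thesis by linarith
qed

lemma exists_small: "\<exists>h. 0 < h \<and> h < \<delta> \<and> 4 * C * h \<le> 1" if "\<delta> > 0" for C \<delta> :: real
proof -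
  define h where "h = min (\<delta> / 2) (1 / (4 * \<bar>C\<bar> + 1))"
  have "h > 0" "h < \<delta>" using that unfolding h_def by (auto simp: min_def)
  moreover have "4 * C * h \<le> 1"
  proof -
    have "4 * C * h \<le> (4 * \<bar>C\<bar> + 1) * h" using \<open>h > 0\<close> by (intro mult_right_mono) auto
    also have "\<dots> \<le> (4 * \<bar>C\<bar> + 1) * (1 / (4 * \<bar>C\<bar> + 1))" unfolding h_def by (intro mult_left_mono) auto
    also have "\<dots> = 1" by (simp add: add_nonneg_eq_0_iff)
    finally show ?thesis .
  qed
  ultimately show ?thesis by blast
qed

lemma slope_unique:
  assumes lip: "C-lipschitz_on D u" and q: "q \<in> D" and d: "\<delta> > 0"
    and a: "\<And>h. 0 < h \<Longrightarrow> h < \<delta> \<Longrightarrow> arc_pt u b q h \<in> D \<and> u (arc_pt u b q h) = u q + b * h"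
    and a': "\<And>h. 0 < h \<Longrightarrow> h < \<delta> \<Longrightarrow> arc_pt u b' q h \<in> D \<and> u (arc_pt u b' q h) = u q + b' * h"
  shows "b = b'"
proof -
  obtain h where h: "0 < h" "h < \<delta>" "4 * C * h \<le> 1" using exists_small[OF d] by blast
  then have "h * \<bar>b - b'\<bar> \<le> 8 * C * dist q q"
    using slope_compare[OF lip h(1,3) _ _ _ _ q q] a[OF h(1,2)] a'[OF h(1,2)] by blast
  then show ?thesis using h(1) by (simp add: mult_le_0_iff)
qed

text \<open>Since \<open>u\<close> has grown by exactly \<open>b * h\<close>, the restarted parabola
  has the tangent of the old one at time \<open>h\<close>, and restarting is a shift of the
  parameter.\<close>

lemma arc_pt_add:
  assumes "u (arc_pt u b p h) = u p + b * h"
  shows "arc_pt u b (arc_pt u b p h) k = arc_pt u b p (h + k)"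
  using assms unfolding arc_pt_def by (simp add: algebra_simps power2_eq_square)

lemma dist_arc_pt_le:
  assumes "\<bar>u q\<bar> \<le> M" "\<bar>b\<bar> \<le> B" "\<bar>h\<bar> \<le> 1"
  shows "dist q (arc_pt u b q h) \<le> \<bar>h\<bar> * (1 + 4 * M + 2 * B)"
proof -
  have "dist q (arc_pt u b q h) \<le> \<bar>h\<bar> + \<bar>4 * u q * h + 2 * b * h\<^sup>2\<bar>"
    unfolding dist_norm arc_pt_def using norm_pair_le[of "- h" "4 * u q * h + 2 * b * h\<^sup>2"]
    by (cases q) simp
  also have "\<dots> \<le> \<bar>h\<bar> + (4 * M * \<bar>h\<bar> + 2 * B * \<bar>h\<bar>)"
  proof -
    have "\<bar>4 * u q * h\<bar> \<le> 4 * M * \<bar>h\<bar>" using assms by (auto simp: abs_mult intro: mult_right_mono)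
    moreover have "\<bar>2 * b * h\<^sup>2\<bar> \<le> 2 * B * \<bar>h\<bar>"
    proof -
      have "h\<^sup>2 \<le> \<bar>h\<bar>" using assms(3) mult_right_mono[of "\<bar>h\<bar>" 1 "\<bar>h\<bar>"] by (simp add: power2_eq_square abs_mult_self_eq flip: abs_mult)
      then have "\<bar>b\<bar> * h\<^sup>2 \<le> B * \<bar>h\<bar>" using assms(2) by (intro mult_mono) auto
      then show ?thesis by (simp add: abs_mult)
    qed
    ultimately show ?thesis by linarith
  qed
  finally show ?thesis by (simp add: algebra_simps)
qed

lemma has_arc_slope_bound:
  assumes lip: "C-lipschitz_on D u" and q: "q \<in> D" and M: "\<bar>u q\<bar> \<le> M" and a: "has_arc D u q b"
  shows "\<bar>b\<bar> \<le> 2 * C * (1 + 4 * M)"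
proof -
  obtain y0 y1 where y: "y0 < 0" "0 < y1" 
    "\<And>h. y0 < h \<Longrightarrow> h < y1 \<Longrightarrow> arc_pt u b q h \<in> D \<and> u (arc_pt u b q h) = u q + b * h"
    using a unfolding has_arc_def by blast
  obtain h where h: "0 < h" "h < y1" "4 * C * h \<le> 1" using exists_small[OF y(2)] by blast
  then show ?thesis using slope_bound[OF lip M h(1,3) _ _ q] y(3)[of h] y(1) by simp
qed

text \<open>The ends of the arc lie outside \<open>D\<close>. While the speed bound keeps the arc in
  a ball contained in \<open>D\<close>, neither end can have been reached.\<close>

lemma has_arc_extends:
  assumes a: "has_arc D u q b" and M: "\<bar>u q\<bar> \<le> M" "0 \<le> M" and B: "\<bar>b\<bar> \<le> B"
    and bl: "ball q \<delta> \<subseteq> D" and h: "\<bar>h\<bar> \<le> 1" "\<bar>h\<bar> * (1 + 4 * M + 2 * B) < \<delta>"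
  shows "arc_pt u b q h \<in> D \<and> u (arc_pt u b q h) = u q + b * h"
proof -
  obtain y0 y1 where y: "y0 < 0" "0 < y1" 
    "\<And>h. y0 < h \<Longrightarrow> h < y1 \<Longrightarrow> arc_pt u b q h \<in> D \<and> u (arc_pt u b q h) = u q + b * h"
    "arc_pt u b q y0 \<notin> D" "arc_pt u b q y1 \<notin> D"
    using a unfolding has_arc_def by blast
  have K: "0 \<le> 1 + 4 * M + 2 * B" using M B by linarith
  have far: "\<bar>h\<bar> < \<bar>z\<bar>" if "arc_pt u b q z \<notin> D" for z
  proof (rule ccontr)
    assume "\<not> ?thesis"
    then have z: "\<bar>z\<bar> \<le> \<bar>h\<bar>" by simp
    then have "dist q (arc_pt u b q z) \<le> \<bar>z\<bar> * (1 + 4 * M + 2 * B)"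
      using dist_arc_pt_le[of u q M b B z] M B h by simp
    also have "\<dots> \<le> \<bar>h\<bar> * (1 + 4 * M + 2 * B)" using z K by (rule mult_right_mono)
    finally have "arc_pt u b q z \<in> ball q \<delta>" using h by simp
    then show False using that bl by blast
  qed
  show ?thesis using far[OF y(4)] far[OF y(5)] y(1,2) by (intro y(3)) auto
qed

text \<open>Near \<open>q0\<close> the distance to the complement gives all arcs a common lifetime.
  Comparing two arcs at one fixed time \<open>k\<close> yields the Lipschitz constant
  \<open>8 * C / k\<close>. Constancy along an arc is uniqueness of the slope: from a point of the
  arc, both its remainder and that point's own arc continue.\<close>

lemma local_arcsI:
  assumes op: "open D" and lip: "C-lipschitz_on D u" and M: "\<And>q. q \<in> D \<Longrightarrow> \<bar>u q\<bar> \<le> M"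
    and arcs: "\<And>q. q \<in> D \<Longrightarrow> has_arc D u q (\<beta> q)"
  shows "local_arcs D u \<beta>"
  unfolding local_arcs_def
proof
  fix q0 assume q0: "q0 \<in> D"
  then have M0: "0 \<le> M" using M[of q0] by linarith
  define B where "B = 2 * C * (1 + 4 * M)"
  have B: "\<bar>\<beta> q\<bar> \<le> B" if "q \<in> D" for q
    unfolding B_def by (rule has_arc_slope_bound[OF lip that M[OF that] arcs[OF that]])
  have B0: "0 \<le> B" using B[OF q0] by linarith
  define K where "K = 1 + 4 * M + 2 * B"
  have K: "K \<ge> 1" using M0 B0 unfolding K_def by simp
  obtain d where d: "d > 0" "ball q0 (2 * d) \<subseteq> D"
  proof -
    obtain e where "e > 0" "ball q0 e \<subseteq> D" using op q0 open_contains_ball by blast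
    then show ?thesis using that[of "e / 2"] by simp
  qed
  have bl: "ball p d \<subseteq> D" if "p \<in> ball q0 d" for p
  proof
    fix x assume "x \<in> ball p d"
    then have "dist q0 x < 2 * d" using that dist_triangle[of q0 x p] by simp
    then show "x \<in> D" using d(2) by auto
  qed
  \<comment> \<open>\<open>K\<close> bounds the speed of an arc for times at most 1, so within time
    \<open>d / K\<close> no arc leaves the ball of radius \<open>d\<close> about its start.\<close>
  define \<eta> where "\<eta> = min (1 / 2) (d / K) "
  have eta: "\<eta> > 0" "\<eta> \<le> 1 / 2" "\<eta> * K \<le> d" using d K unfolding \<eta>_def
    by (auto simp: min_def field_simps)
  have "\<eta> * 1 \<le> \<eta> * K" using K eta(1) by (intro mult_left_mono) auto
  then have ed: "\<eta> \<le> d" using eta(3) by linarith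
  have ext: "arc_pt u (\<beta> p) p h \<in> D \<and> u (arc_pt u (\<beta> p) p h) = u p + \<beta> p * h"
    if p: "p \<in> ball q0 d" and h: "\<bar>h\<bar> < \<eta>" for p h
  proof -
    have pD: "p \<in> D" using bl[OF p] d(1) by auto
    show ?thesis
    proof (rule has_arc_extends[OF arcs[OF pD] M[OF pD] M0 B[OF pD] bl[OF p]])
      have "\<bar>h\<bar> * K < \<eta> * K" using h K by (intro mult_strict_right_mono) auto
      then show "\<bar>h\<bar> * (1 + 4 * M + 2 * B) < d" using eta(3) unfolding K_def by linarith
      show "\<bar>h\<bar> \<le> 1" using h eta by simp
    qed
  qed
  obtain k where k: "0 < k" "k < \<eta>" "4 * C * k \<le> 1" using exists_small[OF eta(1)] by blast
  have C0: "C \<ge> 0" using lip by (rule lipschitz_on_nonneg)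
  have L: "(8 * C / k)-lipschitz_on (ball q0 d) \<beta>"
  proof (rule lipschitz_onI)
    fix p p' assume p: "p \<in> ball q0 d" "p' \<in> ball q0 d"
    have "p \<in> D" "p' \<in> D" using bl[OF p(1)] bl[OF p(2)] d(1) by auto
    then have "k * \<bar>\<beta> p - \<beta> p'\<bar> \<le> 8 * C * dist p p'"
      using slope_compare[OF lip k(1,3)] ext[OF p(1), of k] ext[OF p(2), of k] k by simp
    then show "dist (\<beta> p) (\<beta> p') \<le> 8 * C / k * dist p p'"
      using k(1) by (simp add: dist_real_def field_simps)
  qed (use C0 k in simp)
  have const: "\<beta> (arc_pt u (\<beta> p) p h) = \<beta> p" if p: "p \<in> ball q0 d" and h: "\<bar>h\<bar> < \<eta>" for p h
  proof -
    let ?p = "arc_pt u (\<beta> p) p h"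
    have e: "?p \<in> D" "u ?p = u p + \<beta> p * h" using ext[OF p h] by auto
    obtain y0 y1 where y: "y0 < 0" "0 < y1" 
      "\<And>h. y0 < h \<Longrightarrow> h < y1 \<Longrightarrow> arc_pt u (\<beta> ?p) ?p h \<in> D \<and> u (arc_pt u (\<beta> ?p) ?p h) = u ?p + \<beta> ?p * h"
      using arcs[OF e(1)] unfolding has_arc_def by blast
    show ?thesis
    proof (rule slope_unique[OF lip e(1), of "min y1 (\<eta> - h)"])
      show "min y1 (\<eta> - h) > 0" using y h by auto
      fix k assume k: "0 < k" "k < min y1 (\<eta> - h)"
      show "arc_pt u (\<beta> ?p) ?p k \<in> D \<and> u (arc_pt u (\<beta> ?p) ?p k) = u ?p + \<beta> ?p * k"
        using k y(1) by (intro y(3)) auto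
      have "\<bar>h + k\<bar> < \<eta>" using k h by auto
      from ext[OF p this] show "arc_pt u (\<beta> p) ?p k \<in> D \<and> u (arc_pt u (\<beta> p) ?p k) = u ?p + \<beta> p * k"
        unfolding arc_pt_add[OF e(2)] e(2) by (simp add: algebra_simps)
    qed
  qed
  have sub: "ball q0 \<eta> \<subseteq> ball q0 d" using ed by auto
  show "\<exists>\<eta>>0. \<exists>L. ball q0 \<eta> \<subseteq> D \<and> L-lipschitz_on (ball q0 \<eta>) \<beta> \<and>
     (\<forall>p\<in>ball q0 \<eta>. \<forall>h. \<bar>h\<bar> < \<eta> \<longrightarrow> arc_pt u (\<beta> p) p h \<in> D \<and>
        u (arc_pt u (\<beta> p) p h) = u p + \<beta> p * h \<and> \<beta> (arc_pt u (\<beta> p) p h) = \<beta> p)"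
  proof (rule exI[of _ \<eta>], rule conjI[OF eta(1)], rule exI[of _ "8 * C / k"], intro conjI ballI allI impI)
    have "ball q0 \<eta> \<subseteq> ball q0 (2 * d)" using ed d(1) by (intro subset_ball) linarith
    then show "ball q0 \<eta> \<subseteq> D" using d(2) by (rule order_trans)
    show "(8 * C / k)-lipschitz_on (ball q0 \<eta>) \<beta>" using L sub by (rule lipschitz_on_subset)
    fix p h assume "p \<in> ball q0 \<eta>" "\<bar>h\<bar> < \<eta>"
    then have p: "p \<in> ball q0 d" "\<bar>h\<bar> < \<eta>" using sub by auto
    show "arc_pt u (\<beta> p) p h \<in> D" "u (arc_pt u (\<beta> p) p h) = u p + \<beta> p * h" "\<beta> (arc_pt u (\<beta> p) p h) = \<beta> p"
      using ext[OF p] const[OF p] by auto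
  qed
qed

lemma local_arcs_continuous:
  assumes "local_arcs D u \<beta>" "open D"
  shows "continuous_on D \<beta>"
proof (subst continuous_on_eq_continuous_at[OF assms(2)], rule)
  fix q0 assume "q0 \<in> D"
  then obtain \<eta> L where "\<eta> > 0" "L-lipschitz_on (ball q0 \<eta>) \<beta>"
    using assms(1) unfolding local_arcs_def by blast
  then have "continuous_on (ball q0 \<eta>) \<beta>" by (intro lipschitz_on_continuous_on)
  then show "isCont \<beta> q0" using \<open>\<eta> > 0\<close> by (auto simp: continuous_on_eq_continuous_at)
qed

text \<open>Lindelof: countably many of the neighbourhoods cover \<open>D\<close>, and their
  exceptional sets unite to a null set.\<close>

lemma AE_locally:
  fixes D :: "'a::euclidean_space set"
  assumes "\<And>q. q \<in> D \<Longrightarrow> \<exists>U. open U \<and> q \<in> U \<and> (AE x in lborel. x \<in> U \<longrightarrow> P x)"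
  shows "AE x in lborel. x \<in> D \<longrightarrow> P x"
proof -
  define F where "F = {U. open U \<and> (AE x in lborel. x \<in> U \<longrightarrow> P x)}"
  obtain F' where F': "F' \<subseteq> F" "countable F'" "\<Union>F' = \<Union>F"
    using Lindelof[of F] unfolding F_def by blast
  have "AE x in lborel. \<forall>U\<in>F'. x \<in> U \<longrightarrow> P x"
    using F' unfolding AE_ball_countable[OF F'(2)] F_def by blast
  moreover have "D \<subseteq> \<Union>F'" unfolding F'(3) F_def using assms by blast
  ultimately show ?thesis by (auto elim!: eventually_mono)
qed

text \<open>Composition with the nearest-point projection, which is 1-Lipschitz onto a closed convex
  set. Besides the constant this preserves the range, hence every bound on \<open>f\<close>.\<close>

lemma lipschitz_extension_convex:
  fixes f :: "'a::euclidean_space \<Rightarrow> real"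
  assumes cv: "convex S" and ne: "S \<noteq> {}" and lip: "C-lipschitz_on S f" and cl: "closed S"
  shows "\<exists>g. C-lipschitz_on UNIV g \<and> (\<forall>x\<in>S. g x = f x) \<and> range g \<subseteq> f ` S"
proof (intro exI[of _ "\<lambda>x. f (closest_point S x)"] conjI)
  show "C-lipschitz_on UNIV (\<lambda>x. f (closest_point S x))"
  proof (rule lipschitz_onI)
    fix x y
    have "dist (f (closest_point S x)) (f (closest_point S y)) \<le> C * dist (closest_point S x) (closest_point S y)"
      using closest_point_in_set[OF cl ne] by (intro lipschitz_onD[OF lip])
    also have "\<dots> \<le> C * dist x y"
      using closest_point_lipschitz[OF cv cl ne] lipschitz_on_nonneg[OF lip] by (intro mult_left_mono)
    finally show "dist (f (closest_point S x)) (f (closest_point S y)) \<le> C * dist x y" .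
  qed (use lip lipschitz_on_nonneg in blast)
  show "\<forall>x\<in>S. f (closest_point S x) = f x" by (simp add: closest_point_self)
  show "range (\<lambda>x. f (closest_point S x)) \<subseteq> f ` S" using closest_point_in_set[OF cl ne] by auto
qed

section \<open>The ruling between the two boundary curves\<close>

lemma lip_const_lipschitz_on:
  assumes "\<exists>C. C-lipschitz_on S f"
  shows "(lip_const S f)-lipschitz_on S f"
proof (rule lipschitz_onI)
  have ne: "{C. C-lipschitz_on S f} \<noteq> {}" using assms by blast
  show "0 \<le> lip_const S f" unfolding lip_const_def
    by (rule cInf_greatest[OF ne]) (auto intro: lipschitz_on_nonneg)
  fix x y assume xy: "x \<in> S" "y \<in> S"
  show "dist (f x) (f y) \<le> lip_const S f * dist x y"
  proof (cases "x = y")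
    case False
    then have d: "dist x y > 0" by simp
    have "dist (f x) (f y) / dist x y \<le> lip_const S f" unfolding lip_const_def
    proof (rule cInf_greatest[OF ne])
      fix C assume "C \<in> {C. C-lipschitz_on S f}"
      then have "dist (f x) (f y) \<le> C * dist x y" using xy by (auto intro: lipschitz_onD)
      then show "dist (f x) (f y) / dist x y \<le> C" using d by (simp add: pos_divide_le_eq)
    qed
    then show ?thesis using d by (simp add: pos_divide_le_eq)
  qed simp
qed

lemma abs_le_sup_norm:
  assumes "C-lipschitz_on {a<..<b} f" "s \<in> {a<..<b}"
  shows "\<bar>f s\<bar> \<le> sup_norm {a<..<b} f"
  unfolding sup_norm_def
proof (rule cSup_upper)
  have "\<bar>f x\<bar> \<le> \<bar>f s\<bar> + C * (b - a)" if "x \<in> {a<..<b}" for x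
  proof -
    have "\<bar>f x - f s\<bar> \<le> C * \<bar>x - s\<bar>" using lipschitz_onD[OF assms(1) that assms(2)] by (simp add: dist_real_def)
    also have "\<dots> \<le> C * (b - a)" using that assms lipschitz_on_nonneg[OF assms(1)] by (intro mult_left_mono) auto
    finally show ?thesis by linarith
  qed
  then show "bdd_above ((\<lambda>s. \<bar>f s\<bar>) ` {a<..<b})" by (rule bdd_aboveI2)
qed (use assms in auto)

lemma lipschitz_on_closed_interval:
  fixes f :: "real \<Rightarrow> real"
  assumes "C-lipschitz_on {a<..<b} f" "continuous_on {a..b} f" "a < b"
  shows "C-lipschitz_on {a..b} f"
  using lipschitz_on_closure[OF assms(1)] assms by simp

lemma abs_le_closed_interval:
  fixes f :: "real \<Rightarrow> real"
  assumes "continuous_on {a..b} f" "a < b" "\<And>s. s \<in> {a<..<b} \<Longrightarrow> \<bar>f s\<bar> \<le> M" "s \<in> {a..b}"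
  shows "\<bar>f s\<bar> \<le> M"
proof -
  have "continuous_on (closure {a<..<b}) (\<lambda>s. \<bar>f s\<bar>)" using assms(1,2) by (auto intro!: continuous_intros)
  from continuous_le_on_closure[OF this _ assms(3)] show ?thesis using assms(2,4) by simp
qed

lemma Hplane_iff:
  "(a, b, c) \<in> Hplane (x, y, t) \<longleftrightarrow> c = 2 * y * a - 2 * x * b"
  unfolding Hplane_def span_insert span_singleton by (auto simp: algebra_simps image_iff)

text \<open>Inserting the curves turns horizontality into one scalar equation in \<open>l\<close>,
  to which the intermediate value theorem and a contraction estimate apply.\<close>

lemma pcurve_diff_Hplane:
  "pcurve \<phi> \<gamma>2 l - pcurve \<phi> \<gamma>1 s \<in> Hplane (pcurve \<phi> \<gamma>1 s) \<longleftrightarrow>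
     l - s + 2 * (\<gamma>2 l - \<gamma>1 s) * (bdry_fun \<phi> \<gamma>1 s + bdry_fun \<phi> \<gamma>2 l) = 0"
  unfolding pcurve_def diff_Pair Hplane_iff by (auto simp: algebra_simps)

text \<open>At \<open>l = 0\<close> and \<open>l = tbar\<close> the function
  \<open>\<gamma>2\<close> vanishes and \<open>\<bar>\<gamma>1 s\<bar>\<close> is at most
  \<open>Lg\<close> times the distance from \<open>s\<close> to that end, so smallness forces
  opposite strict signs and there is an interior root. For two distinct roots the same smallness
  would make their distance strictly smaller than itself.\<close>

lemma lam_solution:
  fixes \<gamma>1 \<gamma>2 :: "real \<Rightarrow> real" and \<phi> :: "real \<times> real \<Rightarrow> real" and tbar s :: real
  defines "f1 \<equiv> bdry_fun \<phi> \<gamma>1" and "f2 \<equiv> bdry_fun \<phi> \<gamma>2"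
  assumes s: "s \<in> {0<..<tbar}"
    and ends: "\<gamma>1 0 = 0" "\<gamma>1 tbar = 0" "\<gamma>2 0 = 0" "\<gamma>2 tbar = 0"
    and lg1: "Lg-lipschitz_on {0..tbar} \<gamma>1" and lg2: "Lg-lipschitz_on {0..tbar} \<gamma>2" and lf2: "Lf-lipschitz_on {0..tbar} f2"
    and bg1: "\<bar>\<gamma>1 s\<bar> \<le> G" and bg2: "\<And>l. l \<in> {0..tbar} \<Longrightarrow> \<bar>\<gamma>2 l\<bar> \<le> G"
    and bf1: "\<bar>f1 s\<bar> \<le> P" and bf2: "\<And>l. l \<in> {0..tbar} \<Longrightarrow> \<bar>f2 l\<bar> \<le> P"
    and small: "4 * (G + Lg) * (P + Lf) < 1"
  shows "lam tbar \<gamma>1 \<gamma>2 \<phi> s \<in> {0<..<tbar} \<and>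
    lam tbar \<gamma>1 \<gamma>2 \<phi> s - s + 2 * (\<gamma>2 (lam tbar \<gamma>1 \<gamma>2 \<phi> s) - \<gamma>1 s) * (f1 s + f2 (lam tbar \<gamma>1 \<gamma>2 \<phi> s)) = 0"
proof -
  have tb: "0 < tbar" using s by simp
  have nn: "0 \<le> G" "0 \<le> P" "0 \<le> Lg" "0 \<le> Lf"
    using bg1 bf1 lipschitz_on_nonneg[OF lg1] lipschitz_on_nonneg[OF lf2] by linarith+
  \<comment> \<open>Both numbers come from expanding the product: existence of the root uses
    \<open>4 * Lg * P\<close>, uniqueness uses also \<open>4 * G * Lf\<close>.\<close>
  have sm: "4 * Lg * P + 4 * G * Lf < 1"
  proof -
    have "4 * (G + Lg) * (P + Lf) = 4 * Lg * P + 4 * G * Lf + 4 * (G * P) + 4 * (Lg * Lf)" by (simp add: algebra_simps)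
    moreover have "0 \<le> G * P" "0 \<le> Lg * Lf" using nn by auto
    ultimately show ?thesis using small by linarith
  qed
  have sm1: "4 * Lg * P < 1" using sm nn by (smt (verit) mult_nonneg_nonneg)
  define g where "g l = l - s + 2 * (\<gamma>2 l - \<gamma>1 s) * (f1 s + f2 l)" for l
  have cg: "continuous_on {0..tbar} g" unfolding g_def
    using lipschitz_on_continuous_on[OF lg2] lipschitz_on_continuous_on[OF lf2] by (intro continuous_intros)
  have prod: "\<bar>2 * (- \<gamma>1 s) * (f1 s + f2 l)\<bar> \<le> 4 * Lg * P * d" if l: "l \<in> {0..tbar}" and d: "\<bar>\<gamma>1 s\<bar> \<le> Lg * d" "0 \<le> d" for l d
  proof -
    have "\<bar>f1 s + f2 l\<bar> \<le> 2 * P" using bf1 bf2[OF l] by linarith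
    then have "\<bar>\<gamma>1 s\<bar> * \<bar>f1 s + f2 l\<bar> \<le> (Lg * d) * (2 * P)" using d nn by (intro mult_mono) auto
    then have "2 * (\<bar>\<gamma>1 s\<bar> * \<bar>f1 s + f2 l\<bar>) \<le> 2 * ((Lg * d) * (2 * P))" by linarith
    also have "\<dots> = 4 * Lg * P * d" by simp
    finally have "2 * (\<bar>\<gamma>1 s\<bar> * \<bar>f1 s + f2 l\<bar>) \<le> 4 * Lg * P * d" .
    moreover have "\<bar>2 * (- \<gamma>1 s) * (f1 s + f2 l)\<bar> = 2 * (\<bar>\<gamma>1 s\<bar> * \<bar>f1 s + f2 l\<bar>)"
      unfolding abs_mult by simp
    ultimately show ?thesis by linarith
  qed
  have g0: "g 0 < 0"
  proof -
    have "\<bar>\<gamma>1 s\<bar> \<le> Lg * s" using lipschitz_onD[OF lg1, of s 0] s ends by (simp add: dist_real_def)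
    then have "\<bar>2 * (- \<gamma>1 s) * (f1 s + f2 0)\<bar> \<le> 4 * Lg * P * s" using prod[of 0 s] s by simp
    moreover have "4 * Lg * P * s < 1 * s" using sm1 s by (intro mult_strict_right_mono) auto
    ultimately have "\<bar>2 * (- \<gamma>1 s) * (f1 s + f2 0)\<bar> < s" by linarith
    then have "2 * (- \<gamma>1 s) * (f1 s + f2 0) < s" by (rule order_le_less_trans[OF abs_ge_self])
    then show ?thesis unfolding g_def ends diff_0 by linarith
  qed
  have g1: "g tbar > 0"
  proof -
    have "\<bar>\<gamma>1 s\<bar> \<le> Lg * (tbar - s)" using lipschitz_onD[OF lg1, of s tbar] s ends by (simp add: dist_real_def)
    then have "\<bar>2 * (- \<gamma>1 s) * (f1 s + f2 tbar)\<bar> \<le> 4 * Lg * P * (tbar - s)" using prod[of tbar "tbar - s"] s by simp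
    moreover have "4 * Lg * P * (tbar - s) < 1 * (tbar - s)" using sm1 s by (intro mult_strict_right_mono) auto
    ultimately have "\<bar>2 * (- \<gamma>1 s) * (f1 s + f2 tbar)\<bar> < 1 * (tbar - s)" by (rule order_le_less_trans)
    then have "\<bar>2 * (- \<gamma>1 s) * (f1 s + f2 tbar)\<bar> < tbar - s" unfolding mult_1 .
    then have "- (2 * (- \<gamma>1 s) * (f1 s + f2 tbar)) < tbar - s" by (rule order_le_less_trans[OF abs_ge_minus_self])
    then have "0 < tbar - s + X" if "X = 2 * (- \<gamma>1 s) * (f1 s + f2 tbar)" for X unfolding that[symmetric] by linarith
    then have "0 < tbar - s + 2 * (- \<gamma>1 s) * (f1 s + f2 tbar)" by blast
    then show ?thesis unfolding g_def ends diff_0 .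
  qed
  obtain l where l: "0 \<le> l" "l \<le> tbar" "g l = 0"
    using IVT'[of g 0 0 tbar] g0 g1 tb cg by force
  have un: "l' = l" if l': "l' \<in> {0..tbar}" "g l' = 0" for l'
  proof (rule ccontr)
    assume ne: "l' \<noteq> l"
    have li: "l \<in> {0..tbar}" using l by simp
    have a: "\<bar>\<gamma>2 l' - \<gamma>2 l\<bar> \<le> Lg * \<bar>l' - l\<bar>" using lipschitz_onD[OF lg2 l'(1) li] by (simp add: dist_real_def)
    have b: "\<bar>f2 l' - f2 l\<bar> \<le> Lf * \<bar>l' - l\<bar>" using lipschitz_onD[OF lf2 l'(1) li] by (simp add: dist_real_def)
    have c: "\<bar>f1 s + f2 l'\<bar> \<le> 2 * P" using bf1 bf2[OF l'(1)] by linarith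
    have d: "\<bar>\<gamma>2 l - \<gamma>1 s\<bar> \<le> 2 * G" using bg1 bg2[OF li] by linarith
    have "l' - l = - (2 * ((\<gamma>2 l' - \<gamma>2 l) * (f1 s + f2 l')) + 2 * ((\<gamma>2 l - \<gamma>1 s) * (f2 l' - f2 l)))"
      using l'(2) l(3) unfolding g_def by (simp add: algebra_simps)
    then have "\<bar>l' - l\<bar> \<le> 2 * \<bar>(\<gamma>2 l' - \<gamma>2 l) * (f1 s + f2 l')\<bar> + 2 * \<bar>(\<gamma>2 l - \<gamma>1 s) * (f2 l' - f2 l)\<bar>" by linarith
    moreover have "\<bar>(\<gamma>2 l' - \<gamma>2 l) * (f1 s + f2 l')\<bar> \<le> (Lg * \<bar>l' - l\<bar>) * (2 * P)"
      unfolding abs_mult using a c nn by (intro mult_mono) auto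
    moreover have "\<bar>(\<gamma>2 l - \<gamma>1 s) * (f2 l' - f2 l)\<bar> \<le> (2 * G) * (Lf * \<bar>l' - l\<bar>)"
      unfolding abs_mult using b d nn by (intro mult_mono) auto
    ultimately have "\<bar>l' - l\<bar> \<le> (4 * Lg * P + 4 * G * Lf) * \<bar>l' - l\<bar>" by (simp add: algebra_simps)
    moreover have "(4 * Lg * P + 4 * G * Lf) * \<bar>l' - l\<bar> < 1 * \<bar>l' - l\<bar>" using sm ne by (intro mult_strict_right_mono) auto
    ultimately show False by simp
  qed
  have "lam tbar \<gamma>1 \<gamma>2 \<phi> s = l" unfolding lam_def pcurve_diff_Hplane
  proof (rule the_equality)
    show "l \<in> {0..tbar} \<and> l - s + 2 * (\<gamma>2 l - \<gamma>1 s) * (bdry_fun \<phi> \<gamma>1 s + bdry_fun \<phi> \<gamma>2 l) = 0"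
      using l unfolding g_def f1_def f2_def by simp
  qed (use un in \<open>auto simp: g_def f1_def f2_def\<close>)
  moreover have "l \<noteq> 0" "l \<noteq> tbar" using g0 g1 l(3) by auto
  ultimately show ?thesis using l unfolding g_def by auto
qed

text \<open>Along a horizontal line the left coordinate \<open>t - 2 * y * x\<close> is a quadratic
  polynomial in the parameter with leading coefficient \<open>- 2 * dx * dy\<close>. Measuring time
  by the second coordinate, with \<open>dx = b * dy\<close>, turns it into the parabola
  \<open>arc_pt\<close>.\<close>

lemma arc_pt_on_segment:
  fixes x1 y1 t1 dx dy dt h b :: real
  assumes u: "u q = x1 + h * dx" and y: "fst q = y1 + h * dy" and t: "snd q + 2 * fst q * u q = t1 + h * dt"
    and dx: "dx = b * dy" and dt: "dt = 2 * y1 * dx - 2 * x1 * dy"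
  shows "arc_pt u b q ((k - h) * dy) = (y1 + k * dy, t1 + k * dt - 2 * (y1 + k * dy) * (x1 + k * dx))"
    and "u q + b * ((k - h) * dy) = x1 + k * dx"
proof -
  have sq: "snd q = t1 + h * dt - 2 * (y1 + h * dy) * (x1 + h * dx)" using t unfolding u y by linarith
  show "arc_pt u b q ((k - h) * dy) = (y1 + k * dy, t1 + k * dt - 2 * (y1 + k * dy) * (x1 + k * dx))"
    unfolding arc_pt_def sq u y dt dx by (simp add: algebra_simps power2_eq_square)
  show "u q + b * ((k - h) * dy) = x1 + k * dx" unfolding u dx by (simp add: algebra_simps)
qed

text \<open>The point over \<open>q\<close> lies on a segment of the ruling. The ends of the segment
  project to \<open>(\<gamma>1 s, s)\<close> and \<open>(\<gamma>2 l, l)\<close>, which are outside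
  \<open>D\<close>; its inner points lie again on the graph of \<open>u\<close>, so \<open>u\<close>
  is affine along the projection. The second coordinate rises from a negative to a positive value
  and serves as time.\<close>

lemma ruled_graph_has_arc:
  fixes tbar :: real and \<gamma>1 \<gamma>2 :: "real \<Rightarrow> real" and \<phi> u :: "real \<times> real \<Rightarrow> real"
  assumes g_sign: "\<forall>s\<in>{0<..<tbar}. \<gamma>1 s < 0 \<and> 0 < \<gamma>2 s"
    and D_def: "D = {(y, t). t \<in> {0<..<tbar} \<and> \<gamma>1 t < y \<and> y < \<gamma>2 t}"
    and u_graph: "Sgraph D u = R_phi tbar \<gamma>1 \<gamma>2 \<phi>"
    and lam: "\<And>s. s \<in> {0<..<tbar} \<Longrightarrow> lam tbar \<gamma>1 \<gamma>2 \<phi> s \<in> {0<..<tbar} \<and>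
        lam tbar \<gamma>1 \<gamma>2 \<phi> s - s + 2 * (\<gamma>2 (lam tbar \<gamma>1 \<gamma>2 \<phi> s) - \<gamma>1 s) * (bdry_fun \<phi> \<gamma>1 s + bdry_fun \<phi> \<gamma>2 (lam tbar \<gamma>1 \<gamma>2 \<phi> s)) = 0"
    and q: "q \<in> D"
  shows "\<exists>b. has_arc D u q b"
proof -
  have "(u q, fst q, snd q + 2 * fst q * u q) \<in> Sgraph D u" unfolding Sgraph_def using q
    by (intro CollectI exI[of _ "fst q"] exI[of _ "snd q"]) auto
  then obtain h s where hs: "0 < h" "h < 1" "s \<in> {0<..<tbar}" "(u q, fst q, snd q + 2 * fst q * u q) = rho tbar \<gamma>1 \<gamma>2 \<phi> h s"
    unfolding u_graph R_phi_def by auto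
  define l where "l = lam tbar \<gamma>1 \<gamma>2 \<phi> s"
  define x1 where "x1 = bdry_fun \<phi> \<gamma>1 s"
  define x2 where "x2 = bdry_fun \<phi> \<gamma>2 l"
  define y1 where "y1 = \<gamma>1 s"
  define y2 where "y2 = \<gamma>2 l"
  define t1 where "t1 = s + 2 * y1 * x1"
  define t2 where "t2 = l + 2 * y2 * x2"
  define dx where "dx = x2 - x1"
  define dy where "dy = y2 - y1"
  define dt where "dt = t2 - t1"
  define b where "b = dx / dy"
  have l: "l \<in> {0<..<tbar}" "l - s + 2 * (y2 - y1) * (x1 + x2) = 0"
    using lam[OF hs(3)] unfolding l_def x1_def x2_def y1_def y2_def by auto
  have dy: "dy > 0" using g_sign hs(3) l(1) unfolding dy_def y1_def y2_def by (smt (verit))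
  have dxb: "dx = b * dy" unfolding b_def using dy by simp
  have dts: "dt = 2 * y1 * dx - 2 * x1 * dy"
    using l(2) unfolding dt_def t1_def t2_def dx_def dy_def by (simp add: algebra_simps)
  have rho: "rho tbar \<gamma>1 \<gamma>2 \<phi> k s = (x1 + k * dx, y1 + k * dy, t1 + k * dt)" for k
    unfolding rho_def pcurve_def l_def[symmetric] x1_def[symmetric] x2_def[symmetric] y1_def[symmetric] y2_def[symmetric]
      dx_def dy_def dt_def t1_def t2_def by (simp add: algebra_simps)
  have uq: "u q = x1 + h * dx" "fst q = y1 + h * dy" "snd q + 2 * fst q * u q = t1 + h * dt"
    using hs(4) unfolding rho by auto
  note seg = arc_pt_on_segment[where u=u and q=q and ?x1.0=x1 and ?y1.0=y1 and ?t1.0=t1 and h=h and dx=dx and dy=dy and dt=dt and b=b, OF uq dxb dts]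
  have inner: "arc_pt u b q z \<in> D \<and> u (arc_pt u b q z) = u q + b * z" if z: "- h * dy < z" "z < (1 - h) * dy" for z
  proof -
    define k where "k = h + z / dy"
    have zk: "z = (k - h) * dy" unfolding k_def using dy by simp
    have "0 < k * dy" "k * dy < 1 * dy" using z unfolding zk by (auto simp: algebra_simps)
    then have k: "0 < k" "k < 1" using dy by (auto simp: zero_less_mult_iff)
    have "rho tbar \<gamma>1 \<gamma>2 \<phi> k s \<in> R_phi tbar \<gamma>1 \<gamma>2 \<phi>" unfolding R_phi_def using k hs(3) by auto
    then have "(x1 + k * dx, y1 + k * dy, t1 + k * dt) \<in> Sgraph D u" unfolding u_graph rho .
    then obtain y t where yt: "(y, t) \<in> D" "x1 + k * dx = u (y, t)" "y1 + k * dy = y" "t1 + k * dt = t + 2 * y * u (y, t)"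
      unfolding Sgraph_def by auto
    have "arc_pt u b q z = (y, t)" unfolding zk seg(1) using yt by (simp add: algebra_simps)
    then show ?thesis using yt(1,2) seg(2)[of k] unfolding zk by simp
  qed
  have e0: "arc_pt u b q (- h * dy) = (y1, s)" using seg(1)[of 0] unfolding t1_def by simp
  have e1: "arc_pt u b q ((1 - h) * dy) = (y2, l)" using seg(1)[of 1]
    unfolding dx_def dy_def dt_def t2_def t1_def by (simp add: algebra_simps)
  have "(y1, s) \<notin> D" "(y2, l) \<notin> D" unfolding D_def y1_def y2_def by auto
  then have "has_arc D u q b" unfolding has_arc_def
    using hs dy inner e0 e1 by (intro exI[of _ "- h * dy"] exI[of _ "(1 - h) * dy"]) auto
  then show ?thesis ..
qed

section \<open>The slope as the intrinsic derivative of u\<close>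

lemma Bop_eq_dirder:
  assumes op: "open U" "q \<in> U" and eq: "\<And>p. p \<in> U \<Longrightarrow> f p = u p"
    and d1: "((\<lambda>h. f (q + h *\<^sub>R (1, 0))) has_real_derivative a) (at 0)"
    and d2: "((\<lambda>h. f (q + h *\<^sub>R (0, 1))) has_real_derivative b) (at 0)"
  shows "Bop u q = a - 4 * u q * b"
proof -
  obtain y t where q: "q = (y, t)" by (cases q)
  obtain e where e: "e > 0" "ball q e \<subseteq> U" using op open_contains_ball by blast
  have d1': "((\<lambda>z. f (z, t)) has_real_derivative a) (at y)"
    using d1 unfolding q section_fst_derivative_iff .
  have d2': "((\<lambda>z. f (y, z)) has_real_derivative b) (at t)"
    using d2 unfolding q section_snd_derivative_iff .
  have n1: "eventually (\<lambda>z. f (z, t) = u (z, t)) (nhds y)"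
  proof -
    have "eventually (\<lambda>z. z \<in> ball y e) (nhds y)" using e by (intro eventually_nhds_in_open) auto
    then show ?thesis
    proof (rule eventually_mono)
      fix z assume "z \<in> ball y e"
      then have "(z, t) \<in> ball q e" unfolding q by (simp add: dist_Pair_Pair)
      then show "f (z, t) = u (z, t)" using e eq by blast
    qed
  qed
  have n2: "eventually (\<lambda>z. f (y, z) = u (y, z)) (nhds t)"
  proof -
    have "eventually (\<lambda>z. z \<in> ball t e) (nhds t)" using e by (intro eventually_nhds_in_open) auto
    then show ?thesis
    proof (rule eventually_mono)
      fix z assume "z \<in> ball t e"
      then have "(y, z) \<in> ball q e" unfolding q by (simp add: dist_Pair_Pair)
      then show "f (y, z) = u (y, z)" using e eq by blast
    qed
  qed
  have r1: "((\<lambda>z. u (z, t)) has_real_derivative a) (at y)"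
    using d1' DERIV_cong_ev[OF refl n1 refl] by blast
  have r2: "((\<lambda>z. u (y, z)) has_real_derivative b) (at t)"
    using d2' DERIV_cong_ev[OF refl n2 refl] by blast
  have r3: "((\<lambda>z. (u (y, z))\<^sup>2) has_real_derivative (2 * u (y, t) * b)) (at t)"
    using r2 by (auto intro!: derivative_eq_intros)
  show ?thesis unfolding Bop_def q fst_conv snd_conv DERIV_imp_deriv[OF r1] DERIV_imp_deriv[OF r3] by simp
qed

text \<open>The arc deviates from its tangent step in direction \<open>(1, - 4 * u)\<close> by
  exactly \<open>2 * \<bar>\<beta>\<bar> * h\<^sup>2\<close>, so the Lipschitz function
  \<open>u\<close> grows by \<open>h * \<beta>\<close> along the tangent step up to a quadratic
  error. The transport equation in this direction is \<open>Bop u = \<beta>\<close>, as the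
  derivative of \<open>2 * u\<^sup>2\<close> is \<open>4 * u\<close> times that of
  \<open>u\<close>.\<close>

lemma AE_Bop_eq:
  assumes op: "open D" and lip: "C-lipschitz_on D u" and M: "\<And>q. q \<in> D \<Longrightarrow> \<bar>u q\<bar> \<le> M"
    and B: "\<And>q. q \<in> D \<Longrightarrow> \<bar>\<beta> q\<bar> \<le> B" and arcs: "local_arcs D u \<beta>"
  shows "AE q in lborel. q \<in> D \<longrightarrow> Bop u q = \<beta> q"
proof (rule AE_locally)
  fix q0 assume q0: "q0 \<in> D"
  obtain \<eta> L where eta: "\<eta> > 0" "ball q0 \<eta> \<subseteq> D" "L-lipschitz_on (ball q0 \<eta>) \<beta>"
    and arc: "\<And>p h. p \<in> ball q0 \<eta> \<Longrightarrow> \<bar>h\<bar> < \<eta> \<Longrightarrow> arc_pt u (\<beta> p) p h \<in> D \<and> u (arc_pt u (\<beta> p) p h) = u p + \<beta> p * h"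
    using arcs q0 unfolding local_arcs_def by blast
  define r where "r = \<eta> / 2"
  have r: "r > 0" "cball q0 r \<subseteq> ball q0 \<eta>" using eta(1) unfolding r_def by auto
  have rD: "cball q0 r \<subseteq> D" using r eta by blast
  have ne: "cball q0 r \<noteq> {}" using r by simp
  \<comment> \<open>The transport lemma asks for functions on the whole plane, so \<open>u\<close>
    and \<open>\<beta>\<close> are extended from a closed ball.\<close>
  obtain f where f: "C-lipschitz_on UNIV f" "\<And>x. x \<in> cball q0 r \<Longrightarrow> f x = u x"
    using lipschitz_extension_convex[OF convex_cball ne lipschitz_on_subset[OF lip rD] closed_cball] by blast
  obtain b where b: "L-lipschitz_on UNIV b" "\<And>x. x \<in> cball q0 r \<Longrightarrow> b x = \<beta> x"
    using lipschitz_extension_convex[OF convex_cball ne lipschitz_on_subset[OF eta(3) r(2)] closed_cball] by blast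
  have C0: "C \<ge> 0" using lip by (rule lipschitz_on_nonneg)
  have M0: "M \<ge> 0" using M[OF q0] by linarith
  have B0: "B \<ge> 0" using B[OF q0] by linarith
  obtain l w where lw: "q0 \<in> box l w" "box l w \<subseteq> ball q0 (r / 2)"
    using rational_boxes[of "r / 2" q0] r by auto
  have bx: "q \<in> ball q0 r" "q \<in> cball q0 r" "q \<in> D" if "q \<in> box l w" for q
  proof -
    have "dist q0 q < r / 2" using that lw(2) by auto
    then show "q \<in> ball q0 r" using r by simp
    then show "q \<in> cball q0 r" by simp
    then show "q \<in> D" using rD by blast
  qed
  define K where "K = 1 + 4 * M + 2 * B"
  have K: "K \<ge> 1" using M0 B0 unfolding K_def by simp
  \<comment> \<open>Points of the box are within \<open>r / 2\<close> of \<open>q0\<close>, and an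
    arc covers at most \<open>hm * K \<le> r / 2\<close>; so it stays in the ball on which
    \<open>f\<close> agrees with \<open>u\<close>.\<close>
  define hm where "hm = min (min 1 \<eta>) (r / (2 * K))"
  have hm: "hm > 0" "hm \<le> 1" "hm \<le> \<eta>" "hm \<le> r / (2 * K)" using eta r K unfolding hm_def by auto
  have hmK: "hm * K \<le> r / 2" using mult_right_mono[OF hm(4), of K] K by simp
  have "AE q in lborel. q \<in> box l w \<longrightarrow> dirder (1, 0) f q + (- 4 * f q) * dirder (0, 1) f q = b q"
  proof (rule transport_AE[OF f(1), where G="4 * M" and B=B and hm=hm and M="2 * C * B"])
    show "continuous_on UNIV (\<lambda>q. - 4 * f q)" using lipschitz_on_continuous_on[OF f(1)] by (intro continuous_intros)
    show "continuous_on UNIV b" using lipschitz_on_continuous_on[OF b(1)] .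
    show "hm > 0" by (rule hm)
    fix q assume q: "q \<in> box l w"
    show "\<bar>- 4 * f q\<bar> \<le> 4 * M" using M[OF bx(3)[OF q]] f(2)[OF bx(2)[OF q]] by (simp add: abs_mult)
    show "\<bar>b q\<bar> \<le> B" using B[OF bx(3)[OF q]] b(2)[OF bx(2)[OF q]] by simp
    fix h assume h: "0 < h" "h < hm"
    define p where "p = arc_pt u (\<beta> q) q h"
    have qe: "q \<in> ball q0 \<eta>" using bx(2)[OF q] r(2) by blast
    have up: "u p = u q + \<beta> q * h" using arc[OF qe, of h] h hm unfolding p_def by simp
    have "dist q p \<le> \<bar>h\<bar> * K" unfolding p_def K_def
      by (rule dist_arc_pt_le) (use M B bx[OF q] h hm in auto)
    also have "\<dots> \<le> hm * K" using h K by (intro mult_right_mono) auto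
    finally have "dist q p \<le> r / 2" using hmK by simp
    moreover have "dist q0 q < r / 2" using q lw(2) by auto
    ultimately have "dist q0 p \<le> r" using dist_triangle[of q0 p q] by simp
    then have fp: "f p = u p" using f(2) by simp
    have "\<bar>f (q + (h, h * (- 4 * f q))) - f p\<bar> \<le> C * dist (q + (h, h * (- 4 * f q))) p"
      using lipschitz_onD[OF f(1), of "q + (h, h * (- 4 * f q))" p] by (simp add: dist_real_def)
    also have "dist (q + (h, h * (- 4 * f q))) p = 2 * \<bar>\<beta> q\<bar> * h\<^sup>2"
      unfolding p_def arc_pt_def f(2)[OF bx(2)[OF q]]
      by (cases q) (simp add: dist_Pair_Pair dist_real_def abs_mult)
    also have "C * (2 * \<bar>\<beta> q\<bar> * h\<^sup>2) \<le> C * (2 * B * h\<^sup>2)"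
      using C0 B[OF bx(3)[OF q]] by (intro mult_left_mono mult_right_mono) auto
    finally show "\<bar>f (q + (h, h * (- 4 * f q))) - f q - h * b q\<bar> \<le> 2 * C * B * h\<^sup>2"
      unfolding fp up b(2)[OF bx(2)[OF q]] f(2)[OF bx(2)[OF q]] by (simp add: algebra_simps)
  qed
  then have "AE q in lborel. q \<in> box l w \<longrightarrow> Bop u q = \<beta> q"
    using AE_dirder[OF f(1) disjI1[OF refl]] AE_dirder[OF f(1) disjI2[OF refl]]
  proof eventually_elim
    case (elim q)
    show ?case
    proof
      assume q: "q \<in> box l w"
      have "Bop u q = dirder (1, 0) f q - 4 * u q * dirder (0, 1) f q"
        by (rule Bop_eq_dirder[OF open_ball bx(1)[OF q] _ elim(2)[THEN conjunct1] elim(3)[THEN conjunct1]]) (use f(2) in auto)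
      then show "Bop u q = \<beta> q" using elim(1) q f(2)[OF bx(2)[OF q]] b(2)[OF bx(2)[OF q]] by simp
    qed
  qed
  then show "\<exists>U. open U \<and> q0 \<in> U \<and> (AE x in lborel. x \<in> U \<longrightarrow> Bop u x = \<beta> x)"
    using lw(1) open_box by blast
qed

section \<open>Left and right coordinates of the surface\<close>

text \<open>At a common point of the two graphs \<open>t + 2 * y * u = \<tau> - 2 * y * v\<close>
  with \<open>u = v\<close>; solving for \<open>t\<close> or for \<open>\<tau>\<close> gives the two
  maps.\<close>

definition right_to_left :: "(real \<times> real \<Rightarrow> real) \<Rightarrow> real \<times> real \<Rightarrow> real \<times> real" where
  "right_to_left v r = (fst r, snd r - 4 * fst r * v r)"

definition left_to_right :: "(real \<times> real \<Rightarrow> real) \<Rightarrow> real \<times> real \<Rightarrow> real \<times> real" where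
  "left_to_right u q = (fst q, snd q + 4 * fst q * u q)"

lemma right_to_left:
  assumes gr: "Sgraph D u = SgraphR Dr v" and r: "r \<in> Dr"
  shows "right_to_left v r \<in> D" "u (right_to_left v r) = v r" "left_to_right u (right_to_left v r) = r"
proof -
  have "(v r, fst r, snd r - 2 * fst r * v r) \<in> SgraphR Dr v" unfolding SgraphR_def using r
    by (intro CollectI exI[of _ "fst r"] exI[of _ "snd r"]) auto
  then obtain y t where "(y, t) \<in> D" "v r = u (y, t)" "fst r = y" "snd r - 2 * fst r * v r = t + 2 * y * u (y, t)"
    unfolding gr[symmetric] Sgraph_def by auto
  then have "right_to_left v r = (y, t)" "(y, t) \<in> D" "v r = u (y, t)" unfolding right_to_left_def by auto
  then show "right_to_left v r \<in> D" "u (right_to_left v r) = v r" by auto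
  then show "left_to_right u (right_to_left v r) = r"
    unfolding left_to_right_def by (cases r) (simp add: right_to_left_def)
qed

lemma left_to_right:
  assumes gr: "Sgraph D u = SgraphR Dr v" and q: "q \<in> D"
  shows "left_to_right u q \<in> Dr" "v (left_to_right u q) = u q" "right_to_left v (left_to_right u q) = q"
proof -
  have "(u q, fst q, snd q + 2 * fst q * u q) \<in> Sgraph D u" unfolding Sgraph_def using q
    by (intro CollectI exI[of _ "fst q"] exI[of _ "snd q"]) auto
  then obtain y t where "(y, t) \<in> Dr" "u q = v (y, t)" "fst q = y" "snd q + 2 * fst q * u q = t - 2 * y * v (y, t)"
    unfolding gr SgraphR_def by auto
  then have "left_to_right u q = (y, t)" "(y, t) \<in> Dr" "u q = v (y, t)" unfolding left_to_right_def by auto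
  then show "left_to_right u q \<in> Dr" "v (left_to_right u q) = u q" by auto
  then show "right_to_left v (left_to_right u q) = q"
    unfolding right_to_left_def by (cases q) (simp add: left_to_right_def)
qed

lemma right_to_left_lipschitz:
  assumes v: "C-lipschitz_on (ball r0 e) v" and e: "0 < e" "e \<le> 1"
  shows "\<exists>K. K-lipschitz_on (ball r0 e) (right_to_left v)"
proof (intro exI lipschitz_onI)
  let ?Y = "\<bar>fst r0\<bar> + 1" and ?V = "\<bar>v r0\<bar> + C"
  have C0: "C \<ge> 0" using v by (rule lipschitz_on_nonneg)
  show "0 \<le> 2 + 4 * (?Y * C + ?V)" using C0 by (simp add: add_nonneg_nonneg)
  fix r s assume r: "r \<in> ball r0 e" and s: "s \<in> ball r0 e"
  have a: "\<bar>fst r\<bar> \<le> ?Y" using r e dist_fst_le[of r0 r] by (simp add: dist_real_def)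
  have "\<bar>v s - v r0\<bar> \<le> C * dist s r0" using lipschitz_onD[OF v s, of r0] e by (simp add: dist_real_def)
  also have "\<dots> \<le> C * 1" using s e C0 by (intro mult_left_mono) (auto simp: dist_commute)
  finally have b: "\<bar>v s\<bar> \<le> ?V" by linarith
  have c: "\<bar>v r - v s\<bar> \<le> C * dist r s" using lipschitz_onD[OF v r s] by (simp add: dist_real_def)
  have d: "\<bar>fst r - fst s\<bar> \<le> dist r s" "\<bar>snd r - snd s\<bar> \<le> dist r s"
    using dist_fst_le[of r s] dist_snd_le[of r s] by (auto simp: dist_real_def)
  have "fst r * v r - fst s * v s = fst r * (v r - v s) + (fst r - fst s) * v s" by (simp add: algebra_simps)
  then have "\<bar>fst r * v r - fst s * v s\<bar> \<le> \<bar>fst r\<bar> * \<bar>v r - v s\<bar> + \<bar>fst r - fst s\<bar> * \<bar>v s\<bar>"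
    by (metis abs_mult abs_triangle_ineq)
  also have "\<dots> \<le> ?Y * (C * dist r s) + dist r s * ?V"
    using a b c d C0 by (intro add_mono mult_mono) auto
  finally have p: "\<bar>fst r * v r - fst s * v s\<bar> \<le> (?Y * C + ?V) * dist r s" by (simp add: algebra_simps)
  define Z where "Z = (?Y * C + ?V) * dist r s"
  have "dist (right_to_left v r) (right_to_left v s) \<le> \<bar>fst r - fst s\<bar> + \<bar>(snd r - snd s) - 4 * (fst r * v r - fst s * v s)\<bar>"
    unfolding right_to_left_def dist_norm using norm_pair_le by (simp add: algebra_simps)
  also have "\<dots> \<le> dist r s + (dist r s + 4 * Z)" 
  proof -
    define W where "W = fst r * v r - fst s * v s"
    have "\<bar>W\<bar> \<le> Z" using p unfolding W_def Z_def .
    then show ?thesis using d unfolding W_def[symmetric] by linarith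
  qed
  finally show "dist (right_to_left v r) (right_to_left v s) \<le> (2 + 4 * (?Y * C + ?V)) * dist r s"
    unfolding Z_def by (simp add: algebra_simps)
qed

text \<open>The flux, through the boundary of a rectangle, of the planar field with components
  \<open>nu2\<close> and \<open>4 * y * nu1\<close> of the slope. Its planar divergence is the
  horizontal divergence of the field extended constantly along right cosets. Written with face
  integrals, the condition makes sense for a merely continuous slope.\<close>

definition box_flux_zero :: "(real \<times> real \<Rightarrow> real) \<Rightarrow> real \<Rightarrow> real \<Rightarrow> real \<Rightarrow> real \<Rightarrow> bool" where
  "box_flux_zero b y0 y1 t0 t1 \<longleftrightarrow> (LINT t:{t0..t1}|lborel. nu2 (b (y1, t)) - nu2 (b (y0, t)))
     + (LINT y:{y0..y1}|lborel. 4 * y * (nu1 (b (y, t1)) - nu1 (b (y, t0)))) = 0"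

lemma box_flux_zero_cong:
  assumes "\<And>q. q \<in> cbox (y0, t0) (y1, t1) \<Longrightarrow> b q = b' q" "y0 \<le> y1" "t0 \<le> t1"
  shows "box_flux_zero b y0 y1 t0 t1 \<longleftrightarrow> box_flux_zero b' y0 y1 t0 t1"
proof -
  have 1: "(LINT t:{t0..t1}|lborel. nu2 (b (y1, t)) - nu2 (b (y0, t))) = (LINT t:{t0..t1}|lborel. nu2 (b' (y1, t)) - nu2 (b' (y0, t)))"
    by (rule set_lebesgue_integral_cong) (use assms in \<open>auto simp: cbox_Pair_eq\<close>)
  have 2: "(LINT y:{y0..y1}|lborel. 4 * y * (nu1 (b (y, t1)) - nu1 (b (y, t0)))) = (LINT y:{y0..y1}|lborel. 4 * y * (nu1 (b' (y, t1)) - nu1 (b' (y, t0))))"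
    by (rule set_lebesgue_integral_cong) (use assms in \<open>auto simp: cbox_Pair_eq\<close>)
  show ?thesis unfolding box_flux_zero_def 1 2 ..
qed

text \<open>Seen in right coordinates, an arc of slope \<open>s\<close> has tangent
  \<open>(1, 4 * y * s)\<close>: the terms in \<open>v\<close> cancel and only the slope remains. As
  the slope is constant along the arc, the arcs are exactly the characteristics of the conservation
  law for the slope.\<close>

lemma right_box_flux:
  assumes gr: "Sgraph D u = SgraphR Dr v" and opr: "open Dr" and r0: "r0 \<in> Dr"
    and vlip: "\<forall>q\<in>Dr. \<exists>e>0. \<exists>C. C-lipschitz_on (ball q e \<inter> Dr) v"
    and arcs: "local_arcs D u \<beta>" and B: "\<And>q. q \<in> D \<Longrightarrow> \<bar>\<beta> q\<bar> \<le> B"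
  shows "\<exists>\<eta>>0. \<forall>y0 y1 t0 t1. y0 \<le> y1 \<longrightarrow> t0 \<le> t1 \<longrightarrow> cbox (y0, t0) (y1, t1) \<subseteq> ball r0 \<eta> \<longrightarrow>
     box_flux_zero (\<lambda>r. \<beta> (right_to_left v r)) y0 y1 t0 t1"
proof -
  let ?J = "right_to_left v"
  define b where "b r = \<beta> (?J r)" for r
  obtain e0 C where e0: "e0 > 0" "C-lipschitz_on (ball r0 e0 \<inter> Dr) v" using vlip r0 by blast
  obtain e1 where e1: "e1 > 0" "ball r0 e1 \<subseteq> Dr" using opr r0 open_contains_ball by blast
  define e where "e = min (min e0 e1) 1"
  have e: "0 < e" "e \<le> 1" "ball r0 e \<subseteq> ball r0 e0 \<inter> Dr" using e0 e1 unfolding e_def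
    by (auto simp: subset_iff)
  have eDr: "ball r0 e \<subseteq> Dr" using e(3) by blast
  obtain K where K: "K-lipschitz_on (ball r0 e) ?J"
    using right_to_left_lipschitz[OF lipschitz_on_subset[OF e0(2) e(3)] e(1,2)] by blast
  have K0: "K \<ge> 0" using K by (rule lipschitz_on_nonneg)
  obtain \<eta> L where eta: "\<eta> > 0" "L-lipschitz_on (ball (?J r0) \<eta>) \<beta>"
    and arc: "\<And>p h. p \<in> ball (?J r0) \<eta> \<Longrightarrow> \<bar>h\<bar> < \<eta> \<Longrightarrow> arc_pt u (\<beta> p) p h \<in> D \<and> u (arc_pt u (\<beta> p) p h) = u p + \<beta> p * h
         \<and> \<beta> (arc_pt u (\<beta> p) p h) = \<beta> p"
    using arcs right_to_left(1)[OF gr r0] unfolding local_arcs_def by metis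
  define r where "r = min (e / 2) (\<eta> / (2 * (K + 1)))"
  have r: "r > 0" "cball r0 r \<subseteq> ball r0 e" using e(1) eta(1) K0 unfolding r_def by auto
  have Jb: "?J x \<in> ball (?J r0) \<eta>" if "x \<in> cball r0 r" for x
  proof -
    have "dist (?J r0) (?J x) \<le> K * dist r0 x" by (rule lipschitz_onD[OF K]) (use that r e in auto)
    also have "\<dots> \<le> (K + 1) * r" using that K0 r(1) by (intro mult_mono) auto
    also have "\<dots> \<le> (K + 1) * (\<eta> / (2 * (K + 1)))" using K0 unfolding r_def by (intro mult_left_mono) auto
    also have "\<dots> = \<eta> / 2" using K0 by (simp add: field_simps)
    finally show ?thesis using eta(1) by simp
  qed
  have ne: "cball r0 r \<noteq> {}" using r by simp
  have blip: "(L * K)-lipschitz_on (cball r0 r) b"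
    unfolding b_def[abs_def]
  proof (rule lipschitz_on_compose2[of K "cball r0 r" ?J L \<beta>])
    show "K-lipschitz_on (cball r0 r) ?J" using K r(2) by (rule lipschitz_on_subset)
    show "L-lipschitz_on (?J ` cball r0 r) \<beta>"
      by (rule lipschitz_on_subset[OF eta(2)]) (use Jb in blast)
  qed
  \<comment> \<open>The extension takes only values of \<open>b\<close>, so the bound
    \<open>B\<close> survives.\<close>
  obtain b' where b': "(L * K)-lipschitz_on UNIV b'" "\<And>x. x \<in> cball r0 r \<Longrightarrow> b' x = b x" "range b' \<subseteq> b ` cball r0 r"
    using lipschitz_extension_convex[OF convex_cball ne blip closed_cball] by blast
  have cD: "?J x \<in> D" if "x \<in> cball r0 r" for x using right_to_left(1)[OF gr, of x] that r(2) eDr by blast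
  have b'B: "\<bar>b' x\<bar> \<le> B" for x
  proof -
    obtain z where "z \<in> cball r0 r" "b' x = b z" using b'(3) by blast
    then show ?thesis using B[OF cD] unfolding b_def by simp
  qed
  have B0: "B \<ge> 0" using b'B[of r0] by linarith
  define Y where "Y = \<bar>fst r0\<bar> + r"
  have Y0: "Y \<ge> 0" using r unfolding Y_def by simp
  define Q where "Q = 1 + 4 * Y * B + 2 * B"
  have Q: "Q \<ge> 1" using Y0 B0 unfolding Q_def by simp
  define hm where "hm = min (min 1 \<eta>) (r / (2 * Q))"
  have hm: "hm > 0" "hm \<le> 1" "hm \<le> \<eta>" "hm \<le> r / (2 * Q)" using eta r Q unfolding hm_def by auto
  have hmQ: "hm * Q \<le> r / 2" using mult_right_mono[OF hm(4), of Q] Q by simp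
  have "box_flux_zero b y0 y1 t0 t1" if yt: "y0 \<le> y1" "t0 \<le> t1" and sub: "cbox (y0, t0) (y1, t1) \<subseteq> ball r0 (r / 2)" for y0 y1 t0 t1
  proof -
    have "box_flux_zero b' y0 y1 t0 t1" unfolding box_flux_zero_def
    proof (rule conservation_law_box_flux[OF b'(1) b'B hm(1) _ yt, where M="2 * (L * K) * B"])
      fix q :: "real \<times> real" and h :: real assume q: "q \<in> box (y0, t0) (y1, t1)" and h: "0 < h" "h < hm"
      have "q \<in> ball r0 (r / 2)" using q sub box_subset_cbox by blast
      then have dq: "dist r0 q < r / 2" by simp
      then have qc: "q \<in> cball r0 r" using r by simp
      define s where "s = b q"
      have bq: "b' q = s" unfolding s_def by (rule b'(2)[OF qc])
      have sB: "\<bar>s\<bar> \<le> B" using b'B[of q] bq by simp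
      have qDr: "q \<in> Dr" using qc r(2) eDr by blast
      define p where "p = arc_pt u s (?J q) h"
      have p: "p \<in> D" "u p = u (?J q) + s * h" "\<beta> p = s"
        using arc[OF Jb[OF qc], of h] h hm unfolding p_def s_def b_def by auto
      \<comment> \<open>The arc point \<open>p\<close> in right coordinates: its second entry is
        \<open>snd q\<close> plus the integral of \<open>4 * y * s\<close> from \<open>fst q\<close>
        to \<open>fst q + h\<close>.\<close>
      define x where "x = (fst q + h, snd q + 4 * fst q * s * h + 2 * s * h\<^sup>2)"
      have uJ: "u (?J q) = v q" by (rule right_to_left(2)[OF gr qDr])
      have up: "u p = v q + s * h" using p(2) unfolding uJ .
      have pe: "p = (fst q + h, snd q - 4 * fst q * v q - 4 * v q * h - 2 * s * h\<^sup>2)"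
        unfolding p_def arc_pt_def uJ by (simp add: right_to_left_def)
      have xp: "left_to_right u p = x"
        unfolding left_to_right_def up unfolding pe x_def by (simp add: algebra_simps power2_eq_square)
      have bx: "b x = s" unfolding b_def xp[symmetric] left_to_right(3)[OF gr p(1)] by (rule p(3))
      have fq: "\<bar>fst q\<bar> \<le> Y" using dist_fst_le[of r0 q] dq r(1) unfolding Y_def by (simp add: dist_real_def)
      have "dist q x \<le> \<bar>h\<bar> + \<bar>4 * fst q * s * h + 2 * s * h\<^sup>2\<bar>"
        unfolding x_def dist_norm using norm_pair_le[of "- h" "- (4 * fst q * s * h + 2 * s * h\<^sup>2)"] by (cases q) simp
      also have "\<dots> \<le> h + (4 * Y * B * h + 2 * B * h)"
      proof -
        have "\<bar>4 * fst q * s * h\<bar> \<le> 4 * Y * B * h" unfolding abs_mult using fq sB h Y0 B0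
          by (intro mult_mono) auto
        moreover have "\<bar>2 * s * h\<^sup>2\<bar> \<le> 2 * B * h"
        proof -
          have "h\<^sup>2 \<le> h" using h hm mult_right_mono[of h 1 h] by (simp add: power2_eq_square)
          then show ?thesis unfolding abs_mult using sB h B0 by (intro mult_mono) auto
        qed
        ultimately show ?thesis using h by linarith
      qed
      also have "\<dots> = h * Q" unfolding Q_def by (simp add: algebra_simps)
      also have "\<dots> \<le> hm * Q" using h Q by (intro mult_right_mono) auto
      finally have "dist r0 x \<le> r" using hmQ dq dist_triangle[of r0 x q] by simp
      then have b'x: "b' x = s" using b'(2)[of x] bx by simp
      have "\<bar>b' (q + (h, h * (4 * fst q * b' q))) - b' x\<bar> \<le> (L * K) * dist (q + (h, h * (4 * fst q * b' q))) x"
        using lipschitz_onD[OF b'(1), of "q + (h, h * (4 * fst q * b' q))" x] by (simp add: dist_real_def)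
      also have "dist (q + (h, h * (4 * fst q * b' q))) x = 2 * \<bar>s\<bar> * h\<^sup>2"
        unfolding x_def bq by (cases q) (simp add: dist_Pair_Pair dist_real_def abs_mult mult.commute mult.left_commute)
      also have "(L * K) * (2 * \<bar>s\<bar> * h\<^sup>2) \<le> (L * K) * (2 * B * h\<^sup>2)"
        using lipschitz_on_nonneg[OF b'(1)] sB by (intro mult_left_mono mult_right_mono) auto
      finally show "\<bar>b' (q + (h, h * (4 * fst q * b' q))) - b' q\<bar> \<le> 2 * (L * K) * B * h\<^sup>2"
        unfolding b'x bq by (simp add: algebra_simps)
    qed
    moreover have "b' q = b q" if "q \<in> cbox (y0, t0) (y1, t1)" for q
    proof (rule b'(2))
      have "q \<in> ball r0 (r / 2)" using that sub by blast
      then show "q \<in> cball r0 r" using r(1) by simp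
    qed
    ultimately show ?thesis using box_flux_zero_cong[of y0 t0 y1 t1 b' b] yt by blast
  qed
  note fl = this
  have beq: "(\<lambda>r. \<beta> (right_to_left v r)) = b" by (rule ext) (simp add: b_def)
  show ?thesis unfolding beq
  proof (intro exI conjI allI impI)
    show "r / 2 > 0" using r(1) by simp
    fix y0 y1 t0 t1 assume "y0 \<le> y1" "t0 \<le> t1" "cbox (y0, t0) (y1, t1) \<subseteq> ball r0 (r / 2)"
    then show "box_flux_zero b y0 y1 t0 t1" by (rule fl)
  qed
qed

section \<open>Test functions\<close>

definition C1 :: "('a::real_normed_vector \<Rightarrow> real) \<Rightarrow> bool" where
  "C1 f \<longleftrightarrow> (\<forall>p. f differentiable (at p)) \<and> (\<forall>h. continuous_on UNIV (\<lambda>p. frechet_derivative f (at p) h))"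

lemma C1c_iff: "C1c f \<Omega> \<longleftrightarrow> C1 f \<and> compact (closure {p. f p \<noteq> 0}) \<and> closure {p. f p \<noteq> 0} \<subseteq> \<Omega>"
  unfolding C1c_def C1_def by blast

lemma C1D: "C1 f \<Longrightarrow> (f has_derivative frechet_derivative f (at p)) (at p)"
  unfolding C1_def by (simp add: frechet_derivative_works)

lemma C1_continuous_deriv: "C1 f \<Longrightarrow> continuous_on UNIV (\<lambda>p. frechet_derivative f (at p) h)"
  unfolding C1_def by blast

lemma C1_continuous: "C1 f \<Longrightarrow> continuous_on UNIV f"
  unfolding C1_def by (auto simp: continuous_on_eq_continuous_at differentiable_imp_continuous_within)

lemma C1I:
  assumes "\<And>p. (f has_derivative f' p) (at p)" "\<And>h. continuous_on UNIV (\<lambda>p. f' p h)"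
  shows "C1 f"
proof -
  have "frechet_derivative f (at p) = f' p" for p using frechet_derivative_at[OF assms(1)] by simp
  then show ?thesis unfolding C1_def differentiable_def using assms by auto
qed

lemma C1_const: "C1 (\<lambda>p. c)"
  by (rule C1I[where f'="\<lambda>p h. 0"]) auto

lemma C1_add: assumes f: "C1 f" and g: "C1 g" shows "C1 (\<lambda>p. f p + g p)"
proof (rule C1I)
  show "((\<lambda>p. f p + g p) has_derivative (\<lambda>h. frechet_derivative f (at p) h + frechet_derivative g (at p) h)) (at p)" for p
    by (intro has_derivative_add C1D f g)
  show "continuous_on UNIV (\<lambda>p. frechet_derivative f (at p) h + frechet_derivative g (at p) h)" for h
    by (intro continuous_on_add C1_continuous_deriv f g)
qed

lemma has_derivative_mult_C1:
  assumes f: "C1 f" and g: "C1 g"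
  shows "((\<lambda>p. f p * g p) has_derivative (\<lambda>h. f p * frechet_derivative g (at p) h + frechet_derivative f (at p) h * g p)) (at p)"
  by (intro has_derivative_mult C1D f g)

lemma C1_mult: assumes f: "C1 f" and g: "C1 g" shows "C1 (\<lambda>p. f p * g p)"
proof (rule C1I[OF has_derivative_mult_C1[OF f g]])
  show "continuous_on UNIV (\<lambda>p. f p * frechet_derivative g (at p) h + frechet_derivative f (at p) h * g p)" for h
    by (intro continuous_on_add continuous_on_mult C1_continuous_deriv C1_continuous f g)
qed

lemma C1_compose_real:
  fixes \<theta> :: "real \<Rightarrow> real"
  assumes f: "C1 f" and d: "\<And>x. (\<theta> has_real_derivative \<theta>' x) (at x)" and c: "continuous_on UNIV \<theta>'"
  shows "C1 (\<lambda>p. \<theta> (f p))"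
proof (rule C1I)
  show "((\<lambda>p. \<theta> (f p)) has_derivative (\<lambda>h. frechet_derivative f (at p) h * \<theta>' (f p))) (at p)" for p
    using DERIV_compose_FDERIV[OF d[of "f p"] C1D[OF f]] .
  show "continuous_on UNIV (\<lambda>p. frechet_derivative f (at p) h * \<theta>' (f p))" for h
    by (intro continuous_on_mult C1_continuous_deriv f continuous_on_compose2[OF c C1_continuous[OF f]]) auto
qed

lemma C1_local:
  assumes loc: "\<And>p. \<exists>U g. open U \<and> p \<in> U \<and> C1 g \<and> (\<forall>x\<in>U. f x = g x)"
  shows "C1 f"
proof -
  have d: "f differentiable (at x) \<and> frechet_derivative f (at x) = frechet_derivative g (at x)"
    if "open U" "x \<in> U" "C1 g" "\<forall>x\<in>U. f x = g x" for U g x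
  proof -
    have "(f has_derivative frechet_derivative g (at x)) (at x)"
      by (rule has_derivative_transform_within_open[OF C1D[OF that(3)] that(1,2)]) (use that(4) in auto)
    then show ?thesis using frechet_derivative_at differentiable_def by metis
  qed
  show ?thesis unfolding C1_def
  proof (intro conjI allI)
    show "f differentiable (at p)" for p using loc[of p] d by blast
    fix h
    have "isCont (\<lambda>p. frechet_derivative f (at p) h) p" for p
    proof -
      obtain U g where U: "open U" "p \<in> U" "C1 g" "\<forall>x\<in>U. f x = g x" using loc[of p] by blast
      have "isCont (\<lambda>p. frechet_derivative g (at p) h) p"
        using C1_continuous_deriv[OF U(3)] by (simp add: continuous_on_eq_continuous_at)
      moreover have "eventually (\<lambda>x. frechet_derivative f (at x) h = frechet_derivative g (at x) h) (nhds p)"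
        using eventually_nhds_in_open[OF U(1,2)] by (rule eventually_mono) (use d[OF U(1) _ U(3,4)] in simp)
      ultimately show ?thesis using isCont_cong by metis
    qed
    then show "continuous_on UNIV (\<lambda>p. frechet_derivative f (at p) h)"
      by (simp add: continuous_at_imp_continuous_on)
  qed
qed

lemma frechet_derivative_zero_off_support:
  assumes "x \<notin> closure {p. f p \<noteq> 0}"
  shows "frechet_derivative f (at x) h = 0"
proof -
  have "(f has_derivative (\<lambda>h. 0)) (at x)"
  proof (rule has_derivative_transform_within_open[of "\<lambda>_. 0"])
    show "x \<in> - closure {p. f p \<noteq> 0}" using assms by simp
    show "0 = f y" if "y \<in> - closure {p. f p \<noteq> 0}" for y
      using that closure_subset[of "{p. f p \<noteq> 0}"] by auto
  qed auto
  then show ?thesis using frechet_derivative_at by metis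
qed

section \<open>Cutoff functions of class C^1\<close>

text \<open>The squared positive part vanishes on a half-line and is still continuously
  differentiable; the cutoffs are built from it.\<close>

lemma pos_part_sq_DERIV: "((\<lambda>z::real. (max 0 z)\<^sup>2) has_real_derivative 2 * max 0 z) (at z)"
proof (cases "z = 0")
  case True
  have "((\<lambda>h::real. (max 0 (0 + h))\<^sup>2 / h) \<longlongrightarrow> 0) (at 0)"
  proof (rule Lim_null_comparison[where g="\<lambda>h. \<bar>h\<bar>"])
    show "eventually (\<lambda>h::real. norm ((max 0 (0 + h))\<^sup>2 / h) \<le> \<bar>h\<bar>) (at 0)"
      by (intro always_eventually allI) (auto simp: max_def power2_eq_square)
    show "((\<lambda>h::real. \<bar>h\<bar>) \<longlongrightarrow> 0) (at 0)" by (rule tendsto_eq_intros refl | simp)+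
  qed
  then show ?thesis using True by (simp add: DERIV_def)
next
  case False
  show ?thesis
  proof (cases "z > 0")
    case True
    have "((\<lambda>z::real. z\<^sup>2) has_real_derivative 2 * z) (at z)" by (auto intro!: derivative_eq_intros)
    then have "((\<lambda>z::real. (max 0 z)\<^sup>2) has_real_derivative 2 * z) (at z)"
      by (rule has_field_derivative_transform_within_open[of _ _ _ "{0<..}"]) (use True in auto)
    then show ?thesis using True by simp
  next
    case F: False
    have "((\<lambda>z::real. 0) has_real_derivative 0) (at z)" by simp
    then have "((\<lambda>z::real. (max 0 z)\<^sup>2) has_real_derivative 0) (at z)"
      by (rule has_field_derivative_transform_within_open[of _ _ _ "{..<0}"]) (use F False in auto)
    then show ?thesis using F by simp
  qed
qed

lemma C1_pos_part_sq: "C1 f \<Longrightarrow> C1 (\<lambda>p. (max 0 (f p))\<^sup>2)"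
  by (rule C1_compose_real[OF _ pos_part_sq_DERIV]) (auto intro!: continuous_intros)

lemma C1_sum: "finite I \<Longrightarrow> (\<And>i. i \<in> I \<Longrightarrow> C1 (f i)) \<Longrightarrow> C1 (\<lambda>p. \<Sum>i\<in>I. f i p)"
  by (induction I rule: finite_induct) (auto intro: C1_const C1_add)

lemma C1_minus: "C1 f \<Longrightarrow> C1 (\<lambda>p. - f p)"
  using C1_mult[OF C1_const[of "-1"], of f] by simp

lemma C1_diff: "C1 f \<Longrightarrow> C1 g \<Longrightarrow> C1 (\<lambda>p. f p - g p)"
  using C1_add[of f "\<lambda>p. - g p"] C1_minus[of g] by simp

lemma C1_norm_sq: "C1 (\<lambda>p::'a::real_inner. (norm (p - a))\<^sup>2)"
proof (rule C1I)
  show "((\<lambda>p. (norm (p - a))\<^sup>2) has_derivative (\<lambda>h. (p - a) \<bullet> h + h \<bullet> (p - a))) (at p)" for p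
    unfolding power2_norm_eq_inner by (auto intro!: derivative_eq_intros)
  show "continuous_on UNIV (\<lambda>p. (p - a) \<bullet> h + h \<bullet> (p - a))" for h by (intro continuous_intros)
qed

text \<open>Finitely many bumps, each the squared positive part of \<open>r^2 - |p - x|^2\<close>,
  add up to a function \<open>b\<close> with a positive minimum \<open>m\<close> on
  \<open>K\<close>. A second truncation flattens it near \<open>K\<close>.\<close>

lemma C1_cutoff:
  fixes K U :: "'a::euclidean_space set"
  assumes K: "compact K" and U: "open U" and KU: "K \<subseteq> U"
  shows "\<exists>\<eta> V. C1 \<eta> \<and> (\<forall>x. 0 \<le> \<eta> x \<and> \<eta> x \<le> 1) \<and> open V \<and> K \<subseteq> V \<and> (\<forall>x\<in>V. \<eta> x = 1) \<and>
     compact (closure {x. \<eta> x \<noteq> 0}) \<and> closure {x. \<eta> x \<noteq> 0} \<subseteq> U"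
proof -
  have "\<forall>x\<in>K. \<exists>r>0. cball x r \<subseteq> U" using U KU open_contains_cball by blast
  then obtain r where r: "\<And>x. x \<in> K \<Longrightarrow> r x > 0 \<and> cball x (r x) \<subseteq> U" by metis
  have "K \<subseteq> (\<Union>x\<in>K. ball x (r x))" using r by force
  then obtain F where F: "F \<subseteq> K" "finite F" "K \<subseteq> (\<Union>x\<in>F. ball x (r x))"
    using compactE_image[OF K, of K "\<lambda>x. ball x (r x)"] by (metis open_ball)
  define b where "b p = (\<Sum>x\<in>F. (max 0 ((r x)\<^sup>2 - (norm (p - x))\<^sup>2))\<^sup>2)" for p
  have bC: "C1 b" unfolding b_def
    by (intro C1_sum F C1_pos_part_sq C1_diff C1_const C1_norm_sq)
  have b0: "0 \<le> b p" for p unfolding b_def by (intro sum_nonneg) auto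
  have bpos: "b p > 0" if "p \<in> K" for p
  proof -
    obtain x where x: "x \<in> F" "p \<in> ball x (r x)" using F(3) \<open>p \<in> K\<close> by blast
    then have "norm (p - x) < r x" by (simp add: dist_norm norm_minus_commute)
    then have "(norm (p - x))\<^sup>2 < (r x)\<^sup>2" by (intro power_strict_mono) auto
    then have "0 < (max 0 ((r x)\<^sup>2 - (norm (p - x))\<^sup>2))\<^sup>2" by simp
    also have "\<dots> \<le> b p" unfolding b_def
      by (rule member_le_sum[OF x(1) _ F(2)]) auto
    finally show ?thesis .
  qed
  have supp: "{p. b p \<noteq> 0} \<subseteq> (\<Union>x\<in>F. cball x (r x))"
  proof
    fix p assume p: "p \<in> {p. b p \<noteq> 0}"
    show "p \<in> (\<Union>x\<in>F. cball x (r x))"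
    proof (rule ccontr)
      assume n: "p \<notin> (\<Union>x\<in>F. cball x (r x))"
      have "(max 0 ((r x)\<^sup>2 - (norm (p - x))\<^sup>2))\<^sup>2 = 0" if "x \<in> F" for x
      proof -
        have "r x < norm (p - x)" using n that by (auto simp: dist_norm norm_minus_commute not_le)
        then have "(r x)\<^sup>2 \<le> (norm (p - x))\<^sup>2" using r[of x] F(1) that by (intro power_mono) (auto simp: less_imp_le)
        then show ?thesis by simp
      qed
      then have "b p = 0" unfolding b_def by (intro sum.neutral) auto
      then show False using p by simp
    qed
  qed
  have comp: "compact (\<Union>x\<in>F. cball x (r x))" using F(2) by (intro compact_UN) auto
  have sub: "(\<Union>x\<in>F. cball x (r x)) \<subseteq> U" using r F(1) by blast
  obtain m where m: "m > 0" "\<And>p. p \<in> K \<Longrightarrow> m \<le> b p"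
  proof (cases "K = {}")
    case False
    obtain p0 where "p0 \<in> K" "\<forall>p\<in>K. b p0 \<le> b p"
      using continuous_attains_inf[OF K False] C1_continuous[OF bC] continuous_on_subset by blast
    then show ?thesis using bpos that[of "b p0"] by blast
  qed (use that[of 1] in auto)
  \<comment> \<open>The factor \<open>2 / m\<close> makes the value exactly 1 wherever
    \<open>b > m / 2\<close>, an open neighbourhood of \<open>K\<close>, so multiplication by the
    cutoff does not change derivatives on \<open>K\<close>.\<close>
  define \<eta> where "\<eta> p = 1 - (max 0 (1 - 2 / m * b p))\<^sup>2" for p
  have g1: "C1 \<eta>" unfolding \<eta>_def
    by (intro C1_diff C1_const C1_pos_part_sq C1_mult bC)
  have g2: "0 \<le> \<eta> x \<and> \<eta> x \<le> 1" for x
  proof -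
    have "0 \<le> 2 / m * b x" using m b0[of x] by simp
    then have "(max 0 (1 - 2 / m * b x))\<^sup>2 \<le> 1\<^sup>2" by (intro power_mono) auto
    then show ?thesis unfolding \<eta>_def by simp
  qed
  have g3: "open {x. m / 2 < b x}"
    by (intro open_Collect_less continuous_intros C1_continuous[OF bC])
  have g4: "K \<subseteq> {x. m / 2 < b x}" using m by force
  have g5: "\<forall>x\<in>{x. m / 2 < b x}. \<eta> x = 1" unfolding \<eta>_def using m(1) by (auto simp: field_simps)
  have cs: "closure {x. \<eta> x \<noteq> 0} \<subseteq> (\<Union>x\<in>F. cball x (r x))"
  proof (rule closure_minimal)
    have "{x. \<eta> x \<noteq> 0} \<subseteq> {x. b x \<noteq> 0}" unfolding \<eta>_def by auto
    then show "{x. \<eta> x \<noteq> 0} \<subseteq> (\<Union>x\<in>F. cball x (r x))" using supp by blast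
  qed (rule compact_imp_closed[OF comp])
  have g6: "compact (closure {x. \<eta> x \<noteq> 0})"
    unfolding compact_closure
    by (rule bounded_subset[OF compact_imp_bounded[OF comp] order_trans[OF closure_subset cs]])
  show ?thesis
  proof (rule exI[of _ \<eta>], rule exI[of _ "{x. m / 2 < b x}"], intro conjI)
    show "\<forall>x. 0 \<le> \<eta> x \<and> \<eta> x \<le> 1" using g2 by blast
    show "closure {x. \<eta> x \<noteq> 0} \<subseteq> U" using cs sub by (rule order_trans)
  qed (fact g1 g3 g4 g5 g6)+
qed

section \<open>Gauss-Green formulas\<close>

text \<open>On each line in direction \<open>t\<close> the map is a translation, so Fubini gives
  invariance of volume. The change to left coordinates is such a shear, and so are the flows of X
  and Y up to translations.\<close>

lemma distr_shear:
  fixes c :: "real \<Rightarrow> real \<Rightarrow> real"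
  assumes [measurable]: "(\<lambda>(x, y). c x y) \<in> borel_measurable (lborel \<Otimes>\<^sub>M lborel)"
  shows "distr lborel borel (\<lambda>p::hpt. (fst p, fst (snd p), snd (snd p) + c (fst p) (fst (snd p)))) = lborel"
proof (rule measure_eqI)
  let ?T = "\<lambda>p::hpt. (fst p, fst (snd p), snd (snd p) + c (fst p) (fst (snd p)))"
  have eq: "(lborel :: hpt measure) = lborel \<Otimes>\<^sub>M (lborel \<Otimes>\<^sub>M lborel)" by (simp add: lborel_prod)
  have T[measurable]: "?T \<in> measurable (lborel \<Otimes>\<^sub>M (lborel \<Otimes>\<^sub>M lborel)) (lborel \<Otimes>\<^sub>M (lborel \<Otimes>\<^sub>M lborel))"
    by measurable
  have T': "?T \<in> measurable lborel borel" using T unfolding eq[symmetric] by simp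
  show "sets (distr lborel borel ?T) = sets lborel" by simp
  fix A assume "A \<in> sets (distr lborel borel ?T)"
  then have A: "A \<in> sets borel" by simp
  have A2[measurable]: "A \<in> sets (lborel \<Otimes>\<^sub>M (lborel \<Otimes>\<^sub>M lborel :: (real \<times> real) measure))"
    using A unfolding eq[symmetric] by simp
  have fub: "(\<integral>\<^sup>+p. f p \<partial>lborel) = (\<integral>\<^sup>+x. (\<integral>\<^sup>+y. (\<integral>\<^sup>+t. f (x, y, t) \<partial>lborel) \<partial>lborel) \<partial>lborel)"
    if f[measurable]: "f \<in> borel_measurable (lborel \<Otimes>\<^sub>M (lborel \<Otimes>\<^sub>M lborel))" for f :: "hpt \<Rightarrow> ennreal"
  proof -
    have "(\<integral>\<^sup>+p. f p \<partial>lborel) = (\<integral>\<^sup>+x. (\<integral>\<^sup>+z. f (x, z) \<partial>lborel) \<partial>lborel)"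
    proof -
      have "f \<in> borel_measurable (lborel \<Otimes>\<^sub>M lborel)" using f unfolding lborel_prod .
      from lborel.nn_integral_fst[OF this] show ?thesis unfolding lborel_prod by simp
    qed
    also have "\<dots> = (\<integral>\<^sup>+x. (\<integral>\<^sup>+y. (\<integral>\<^sup>+t. f (x, y, t) \<partial>lborel) \<partial>lborel) \<partial>lborel)"
    proof (rule nn_integral_cong)
      fix x
      have "(\<lambda>z. f (x, z)) \<in> borel_measurable (lborel \<Otimes>\<^sub>M lborel)" by measurable
      from lborel.nn_integral_fst[OF this] show "(\<integral>\<^sup>+z. f (x, z) \<partial>lborel) = (\<integral>\<^sup>+y. (\<integral>\<^sup>+t. f (x, y, t) \<partial>lborel) \<partial>lborel)"
        unfolding lborel_prod by simp
    qed
    finally show ?thesis .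
  qed
  have "emeasure (distr lborel borel ?T) A = (\<integral>\<^sup>+p. indicator A (?T p) \<partial>lborel)"
    using nn_integral_distr[OF T', of "indicator A"] A by simp
  also have "\<dots> = (\<integral>\<^sup>+x. (\<integral>\<^sup>+y. (\<integral>\<^sup>+t. indicator A (x, y, t + c x y) \<partial>lborel) \<partial>lborel) \<partial>lborel)"
  proof -
    have "(\<lambda>p. indicator A (?T p) :: ennreal) \<in> borel_measurable (lborel \<Otimes>\<^sub>M (lborel \<Otimes>\<^sub>M lborel))"
      by (rule measurable_compose[OF T borel_measurable_indicator[OF A2]])
    from fub[OF this] show ?thesis by simp
  qed
  also have "\<dots> = (\<integral>\<^sup>+x. (\<integral>\<^sup>+y. (\<integral>\<^sup>+t. indicator A (x, y, t) \<partial>lborel) \<partial>lborel) \<partial>lborel)"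
  proof (rule nn_integral_cong, rule nn_integral_cong)
    fix x y
    have "(\<lambda>t. indicator A (x, y, t) :: ennreal) \<in> borel_measurable lborel" by measurable
    then show "(\<integral>\<^sup>+t. indicator A (x, y, t + c x y) \<partial>lborel) = (\<integral>\<^sup>+t. indicator A (x, y, t) \<partial>lborel)"
      using nn_integral_real_affine[of "\<lambda>t. indicator A (x, y, t)" 1 "c x y"] by (simp add: add.commute)
  qed
  also have "\<dots> = (\<integral>\<^sup>+p. indicator A p \<partial>lborel)"
    using fub[OF borel_measurable_indicator[OF A2]] by simp
  also have "\<dots> = emeasure lborel A" using A by simp
  finally show "emeasure (distr lborel borel ?T) A = emeasure lborel A" .
qed

lemma integral_shear:
  fixes c :: "real \<Rightarrow> real \<Rightarrow> real" and \<phi> :: "hpt \<Rightarrow> real"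
  assumes c: "continuous_on UNIV (\<lambda>(x, y). c x y)" and f: "\<phi> \<in> borel_measurable borel"
  shows "(\<integral>p. \<phi> (fst p, fst (snd p), snd (snd p) + c (fst p) (fst (snd p))) \<partial>lborel) = (\<integral>p. \<phi> p \<partial>lborel)"
    and "integrable lborel (\<lambda>p. \<phi> (fst p, fst (snd p), snd (snd p) + c (fst p) (fst (snd p)))) \<longleftrightarrow> integrable lborel \<phi>"
proof -
  let ?T = "\<lambda>p::hpt. (fst p, fst (snd p), snd (snd p) + c (fst p) (fst (snd p)))"
  have "(\<lambda>(x, y). c x y) \<in> borel_measurable (lborel \<Otimes>\<^sub>M lborel)"
    using borel_measurable_continuous_onI[OF c] unfolding lborel_prod by simp
  note D = distr_shear[OF this]
  have pr: "continuous_on UNIV (\<lambda>p::hpt. (fst p, fst (snd p)))" by (intro continuous_intros)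
  have "continuous_on UNIV (\<lambda>p::hpt. c (fst p) (fst (snd p)))"
    using continuous_on_compose2[OF c pr] by simp
  then have "continuous_on UNIV ?T" by (intro continuous_intros)
  then have T: "?T \<in> measurable lborel borel" using borel_measurable_continuous_onI by simp
  show "(\<integral>p. \<phi> (?T p) \<partial>lborel) = (\<integral>p. \<phi> p \<partial>lborel)"
    using integral_distr[OF T f] unfolding D by simp
  show "integrable lborel (\<lambda>p. \<phi> (?T p)) \<longleftrightarrow> integrable lborel \<phi>"
    using integrable_distr_eq[OF T f] unfolding D by simp
qed

lemma integrable_bounded_compact_support:
  fixes f :: "'a::euclidean_space \<Rightarrow> real"
  assumes "f \<in> borel_measurable borel" "\<And>x. \<bar>f x\<bar> \<le> N" "compact K" "\<And>x. x \<notin> K \<Longrightarrow> f x = 0"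
  shows "integrable lborel f"
proof (rule integrableI_bounded_set[where A=K and B=N])
  show "emeasure lborel K < \<infinity>" by (rule emeasure_compact_finite[OF assms(3)])
qed (use assms in \<open>auto simp: compact_imp_closed\<close>)

lemma continuous_compact_support_bounded:
  fixes f :: "'a::euclidean_space \<Rightarrow> real"
  assumes "continuous_on UNIV f" "compact K" "\<And>x. x \<notin> K \<Longrightarrow> f x = 0"
  shows "\<exists>N\<ge>0. \<forall>x. \<bar>f x\<bar> \<le> N"
proof -
  have "compact (f ` K)" using assms by (intro compact_continuous_image) (auto intro: continuous_on_subset)
  then obtain N where N: "\<forall>x\<in>f ` K. norm x \<le> N" using compact_imp_bounded bounded_iff by metis
  have "\<bar>f x\<bar> \<le> max 0 N" for x using N assms(3)[of x] by (cases "x \<in> K") (auto simp: max_def)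
  then show ?thesis by (intro exI[of _ "max 0 N"]) auto
qed

section \<open>First variation of half-lines and epigraphs\<close>

lemma halfline_diff:
  fixes c d :: real
  shows "indicat_real {c<..} s - indicat_real {d<..} s = indicat_real {c<..d} s - indicat_real {d<..c} s"
    and "\<bar>indicat_real {c<..} s - indicat_real {d<..} s\<bar> = indicat_real {c<..d} s + indicat_real {d<..c} s"
  by (auto simp: indicator_def)

lemma integral_halfline_diff:
  fixes c d :: real
  shows "integrable lborel (\<lambda>s. indicat_real {c<..} s - indicat_real {d<..} s)"
    and "(\<integral>s. indicat_real {c<..} s - indicat_real {d<..} s \<partial>lborel) = d - c"
    and "(\<integral>s. \<bar>indicat_real {c<..} s - indicat_real {d<..} s\<bar> \<partial>lborel) = \<bar>d - c\<bar>"
proof -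
  have i: "integrable lborel (indicat_real {a<..b})" for a b :: real
    by (rule integrable_real_indicator) (cases "a \<le> b"; simp)+
  have m: "measure lborel {a<..b} = max 0 (b - a)" for a b :: real
    by (cases "a \<le> b") auto
  show "integrable lborel (\<lambda>s. indicat_real {c<..} s - indicat_real {d<..} s)"
    unfolding halfline_diff using i by simp
  show "(\<integral>s. indicat_real {c<..} s - indicat_real {d<..} s \<partial>lborel) = d - c"
    unfolding halfline_diff using i by (simp add: m)
  show "(\<integral>s. \<bar>indicat_real {c<..} s - indicat_real {d<..} s\<bar> \<partial>lborel) = \<bar>d - c\<bar>"
    unfolding halfline_diff(2) using i by (simp add: m)
qed

lemma weighted_halfline_diff_le:
  fixes c c' :: real
  assumes V: "\<And>x. \<bar>x - c\<bar> \<le> \<bar>c - c'\<bar> \<Longrightarrow> \<bar>V x\<bar> \<le> \<epsilon>"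
  shows "\<bar>V s * (indicat_real {c'<..} s - indicat_real {c<..} s)\<bar> \<le> \<epsilon> * \<bar>indicat_real {c'<..} s - indicat_real {c<..} s\<bar>"
proof -
  consider "c' < s" "c < s" | "\<not> c' < s" "\<not> c < s" | "c' < s" "\<not> c < s" | "\<not> c' < s" "c < s" by blast
  then show ?thesis
  proof cases
    case 3
    then have "\<bar>V s\<bar> \<le> \<epsilon>" by (intro V) linarith
    then show ?thesis using 3 by simp
  next
    case 4
    then have "\<bar>V s\<bar> \<le> \<epsilon>" by (intro V) linarith
    then show ?thesis using 4 by simp
  qed simp_all
qed

text \<open>On one fibre the moved set is the half-line above \<open>c - a * h\<close> up to an
  uncertain zone of length \<open>O(h^2)\<close>. The displacement contributes
  \<open>a * h * W c\<close> to first order, because \<open>W\<close> is continuous; the uncertain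
  zone contributes \<open>O(h^2)\<close>, because \<open>W\<close> is bounded.\<close>

lemma flux_limit_1d:
  fixes W :: "real \<Rightarrow> real" and \<xi> :: "nat \<Rightarrow> real \<Rightarrow> real"
  assumes cW: "continuous_on UNIV W" and N: "\<And>s. \<bar>W s\<bar> \<le> N" and S: "\<And>s. \<bar>s\<bar> > S \<Longrightarrow> W s = 0"
    and h: "\<And>n. h n > 0" "h \<longlonglongrightarrow> 0"
    and chi[measurable]: "\<And>n. \<xi> n \<in> borel_measurable borel" and chi01: "\<And>n s. \<xi> n s \<in> {0, 1}"
    and k: "0 \<le> \<kappa>"
    and ev: "eventually (\<lambda>n. \<forall>s. \<bar>s\<bar> \<le> S \<longrightarrow> \<kappa> * (h n)\<^sup>2 < \<bar>s - (c - a * h n)\<bar> \<longrightarrow> \<xi> n s = indicat_real {c - a * h n<..} s) sequentially"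
  shows "(\<lambda>n. (\<integral>s. W s * (\<xi> n s - indicat_real {c<..} s) \<partial>lborel) / h n) \<longlonglongrightarrow> a * W c"
proof -
  have [measurable]: "W \<in> borel_measurable borel" using cW by (rule borel_measurable_continuous_onI)
  have N0: "0 \<le> N" using N[of 0] by linarith
  have cmp: "compact {-S..S}" by simp
  have WS: "W s = 0" if "s \<notin> {-S..S}" for s using S[of s] that by auto
  let ?H = "\<lambda>d s. indicat_real {d<..} s"
  have i1: "integrable lborel (\<lambda>s. W s * (\<xi> n s - ?H d s))" for n d
  proof (rule integrable_bounded_compact_support[OF _ _ cmp, where N=N])
    show "\<bar>W s * (\<xi> n s - ?H d s)\<bar> \<le> N" for s
      using N[of s] N0 chi01[of n s] by (auto simp: indicator_def abs_mult)
    show "W s * (\<xi> n s - ?H d s) = 0" if "s \<notin> {-S..S}" for s using WS[OF that] by simp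
  qed measurable
  have i2: "integrable lborel (\<lambda>s. W s * (?H d s - ?H e s))" for d e
  proof (rule integrable_bounded_compact_support[OF _ _ cmp, where N=N])
    show "\<bar>W s * (?H d s - ?H e s)\<bar> \<le> N" for s
      using N[of s] N0 by (auto simp: indicator_def abs_mult)
    show "W s * (?H d s - ?H e s) = 0" if "s \<notin> {-S..S}" for s using WS[OF that] by simp
  qed measurable
  have "(\<lambda>n. (\<integral>s. W s * (\<xi> n s - ?H c s) \<partial>lborel) / h n - a * W c) \<longlonglongrightarrow> 0"
  proof (rule tendstoI)
    fix e :: real assume e: "e > 0"
    \<comment> \<open>The oscillation of \<open>W\<close> over the displaced interval may use half
      of \<open>e\<close>; the uncertain zone gets the other half.\<close>
    define \<epsilon> where "\<epsilon> = e / (2 * (\<bar>a\<bar> + 1))"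
    have ep: "\<epsilon> > 0" "\<bar>a\<bar> * \<epsilon> \<le> e / 2" using e unfolding \<epsilon>_def by (auto simp: field_simps)
    have "isCont W c" using cW by (simp add: continuous_on_eq_continuous_at)
    then obtain \<delta> where dl: "\<delta> > 0" "\<And>s. \<bar>s - c\<bar> < \<delta> \<Longrightarrow> \<bar>W s - W c\<bar> < \<epsilon>"
      using ep(1) unfolding continuous_at_eps_delta dist_real_def by blast
    have t1: "(\<lambda>n. \<bar>a\<bar> * h n) \<longlonglongrightarrow> 0" using tendsto_mult[OF tendsto_const[of "\<bar>a\<bar>"] h(2)] by simp
    have t2: "(\<lambda>n. (2 * N * \<kappa>) * h n) \<longlonglongrightarrow> 0" using tendsto_mult[OF tendsto_const[of "2 * N * \<kappa>"] h(2)] by simp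
    have e1: "eventually (\<lambda>n. \<bar>a\<bar> * h n < \<delta>) sequentially" using order_tendstoD(2)[OF t1 dl(1)] .
    have e2: "eventually (\<lambda>n. (2 * N * \<kappa>) * h n < e / 2) sequentially" using order_tendstoD(2)[OF t2, of "e / 2"] e half_gt_zero by blast
    show "eventually (\<lambda>n. dist ((\<integral>s. W s * (\<xi> n s - ?H c s) \<partial>lborel) / h n - a * W c) 0 < e) sequentially"
      using ev e1 e2
    proof eventually_elim
      case (elim n)
      define c' where "c' = c - a * h n"
      have "c - c' = a * h n" unfolding c'_def by simp
      then have cc: "\<bar>c - c'\<bar> = \<bar>a\<bar> * h n"
        using abs_of_pos[OF h(1)[of n]] by (metis abs_mult)
      define r where "r = \<kappa> * (h n)\<^sup>2"
      have r0: "0 \<le> r" unfolding r_def using k by simp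
      have A: "\<bar>\<integral>s. W s * (\<xi> n s - ?H c' s) \<partial>lborel\<bar> \<le> 2 * N * r"
      proof -
        have ii: "integrable lborel (\<lambda>s. N * indicat_real {c' - r..c' + r} s)"
          by (intro integrable_mult_right integrable_real_indicator) (auto simp: emeasure_lborel_Icc_eq)
        have "\<bar>\<integral>s. W s * (\<xi> n s - ?H c' s) \<partial>lborel\<bar> \<le> (\<integral>s. \<bar>W s * (\<xi> n s - ?H c' s)\<bar> \<partial>lborel)"
          using integral_norm_bound[of lborel "\<lambda>s. W s * (\<xi> n s - ?H c' s)"] by simp
        also have "\<dots> \<le> (\<integral>s. N * indicat_real {c' - r..c' + r} s \<partial>lborel)"
        proof (rule integral_mono[OF integrable_abs[OF i1] ii])
          fix s
          show "\<bar>W s * (\<xi> n s - ?H c' s)\<bar> \<le> N * indicat_real {c' - r..c' + r} s"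
          proof (cases "s \<in> {c' - r..c' + r}")
            case True
            then show ?thesis using N[of s] N0 chi01[of n s] by (auto simp: indicator_def abs_mult)
          next
            case False
            then have "r < \<bar>s - c'\<bar>" by auto
            then have "\<bar>s\<bar> \<le> S \<Longrightarrow> \<xi> n s = ?H c' s" using elim(1) unfolding r_def c'_def by blast
            then have z: "W s * (\<xi> n s - ?H c' s) = 0" using S[of s] by (cases "\<bar>s\<bar> \<le> S") auto
            show ?thesis unfolding z using N0 by simp
          qed
        qed
        also have "\<dots> = 2 * N * r" using r0 by simp
        finally show ?thesis .
      qed
      have B: "\<bar>(\<integral>s. W s * (?H c' s - ?H c s) \<partial>lborel) - a * h n * W c\<bar> \<le> \<epsilon> * (\<bar>a\<bar> * h n)"
      proof -
        note j = integral_halfline_diff[of c' c]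
        have q0: "integrable lborel (\<lambda>s. W s * (?H c' s - ?H c s) - W c * (?H c' s - ?H c s))"
          using i2[of c' c] j(1) by simp
        then have q1: "integrable lborel (\<lambda>s. \<bar>W s * (?H c' s - ?H c s) - W c * (?H c' s - ?H c s)\<bar>)"
          by (rule integrable_abs)
        have "integrable lborel (\<lambda>s. \<bar>?H c' s - ?H c s\<bar>)" using j(1) by (rule integrable_abs)
        then have q2: "integrable lborel (\<lambda>s. \<epsilon> * \<bar>?H c' s - ?H c s\<bar>)" by simp
        have "a * h n * W c = (\<integral>s. W c * (?H c' s - ?H c s) \<partial>lborel)"
          using j(2) unfolding c'_def by (simp add: mult.commute)
        then have eq1: "(\<integral>s. W s * (?H c' s - ?H c s) \<partial>lborel) - a * h n * W c = (\<integral>s. W s * (?H c' s - ?H c s) - W c * (?H c' s - ?H c s) \<partial>lborel)"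
          using Bochner_Integration.integral_diff[OF i2 integrable_mult_right[OF j(1), of "W c"], of c' c] by simp
        have "\<bar>\<integral>s. W s * (?H c' s - ?H c s) - W c * (?H c' s - ?H c s) \<partial>lborel\<bar> \<le> (\<integral>s. \<bar>W s * (?H c' s - ?H c s) - W c * (?H c' s - ?H c s)\<bar> \<partial>lborel)"
          using integral_norm_bound[of lborel "\<lambda>s. W s * (?H c' s - ?H c s) - W c * (?H c' s - ?H c s)"] by simp
        also have "\<dots> \<le> (\<integral>s. \<epsilon> * \<bar>?H c' s - ?H c s\<bar> \<partial>lborel)"
        proof (rule integral_mono[OF q1 q2])
          fix s
          have "\<bar>(W s - W c) * (?H c' s - ?H c s)\<bar> \<le> \<epsilon> * \<bar>?H c' s - ?H c s\<bar>"
          proof (rule weighted_halfline_diff_le[of c c' "\<lambda>x. W x - W c" \<epsilon> s])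
            fix x assume "\<bar>x - c\<bar> \<le> \<bar>c - c'\<bar>"
            then have "\<bar>x - c\<bar> \<le> \<bar>a\<bar> * h n" unfolding cc .
            then have "\<bar>x - c\<bar> < \<delta>" using elim(2) by (rule order_le_less_trans)
            then show "\<bar>W x - W c\<bar> \<le> \<epsilon>" by (rule less_imp_le[OF dl(2)])
          qed
          then show "\<bar>W s * (?H c' s - ?H c s) - W c * (?H c' s - ?H c s)\<bar> \<le> \<epsilon> * \<bar>?H c' s - ?H c s\<bar>"
            by (simp only: left_diff_distrib)
        qed
        also have "\<dots> = \<epsilon> * \<bar>c - c'\<bar>" using j(3) by simp
        finally show ?thesis unfolding cc eq1 .
      qed
      have "(\<integral>s. W s * (\<xi> n s - ?H c s) \<partial>lborel) = (\<integral>s. W s * (\<xi> n s - ?H c' s) + W s * (?H c' s - ?H c s) \<partial>lborel)"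
        by (intro Bochner_Integration.integral_cong refl) (simp add: algebra_simps)
      also have "\<dots> = (\<integral>s. W s * (\<xi> n s - ?H c' s) \<partial>lborel) + (\<integral>s. W s * (?H c' s - ?H c s) \<partial>lborel)"
        by (rule Bochner_Integration.integral_add[OF i1 i2])
      finally have "\<bar>(\<integral>s. W s * (\<xi> n s - ?H c s) \<partial>lborel) - a * h n * W c\<bar> \<le> 2 * N * r + \<epsilon> * (\<bar>a\<bar> * h n)"
        using A B by linarith
      moreover have "2 * N * r + \<epsilon> * (\<bar>a\<bar> * h n) = ((2 * N * \<kappa>) * h n + \<bar>a\<bar> * \<epsilon>) * h n"
        unfolding r_def by (simp add: algebra_simps power2_eq_square)
      moreover have "((2 * N * \<kappa>) * h n + \<bar>a\<bar> * \<epsilon>) * h n < e * h n"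
        using elim(3) ep(2) h(1)[of n] by (intro mult_strict_right_mono) auto
      ultimately have m: "\<bar>(\<integral>s. W s * (\<xi> n s - ?H c s) \<partial>lborel) - a * h n * W c\<bar> < e * h n" by linarith
      have "(\<integral>s. W s * (\<xi> n s - ?H c s) \<partial>lborel) / h n - a * W c = ((\<integral>s. W s * (\<xi> n s - ?H c s) \<partial>lborel) - a * h n * W c) / h n"
        using h(1)[of n] by (simp add: field_simps)
      then show ?case using m h(1)[of n] by (simp add: abs_divide pos_divide_less_eq)
    qed
  qed
  then show ?thesis by (simp add: LIM_zero_iff)
qed

text \<open>The fibre limits are integrated by dominated convergence. The crude linear bound
  \<open>far\<close>, uniform in \<open>q\<close>, supplies the dominating function; the quadratic
  bound \<open>ev\<close>, whose constant may depend on \<open>q\<close>, supplies the pointwise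
  limit.\<close>

lemma flux_limit:
  fixes W :: "real \<times> (real \<times> real) \<Rightarrow> real" and \<xi> :: "nat \<Rightarrow> real \<times> (real \<times> real) \<Rightarrow> real" and u a :: "real \<times> real \<Rightarrow> real"
  assumes cW: "continuous_on UNIV W" and N: "\<And>p. \<bar>W p\<bar> \<le> N" and S: "\<And>s q. \<bar>s\<bar> > S \<Longrightarrow> W (s, q) = 0"
    and K: "compact K" "\<And>s q. q \<notin> K \<Longrightarrow> W (s, q) = 0"
    and h: "\<And>n. h n > 0" "h \<longlonglongrightarrow> 0"
    and cu: "continuous_on UNIV u"
    and am: "(\<lambda>q. a q * W (u q, q)) \<in> borel_measurable borel"
    and chi[measurable]: "\<And>n. \<xi> n \<in> borel_measurable borel" and chi01: "\<And>n p. \<xi> n p \<in> {0, 1}"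
    and far: "\<And>n s q. \<bar>s\<bar> \<le> S \<Longrightarrow> \<kappa>' * h n < \<bar>s - u q\<bar> \<Longrightarrow> \<xi> n (s, q) = indicat_real {u q<..} s" and k': "0 \<le> \<kappa>'"
    and ev: "\<And>q. q \<in> K \<Longrightarrow> \<exists>\<kappa>\<ge>0. eventually (\<lambda>n. \<forall>s. \<bar>s\<bar> \<le> S \<longrightarrow> \<kappa> * (h n)\<^sup>2 < \<bar>s - (u q - a q * h n)\<bar> \<longrightarrow> \<xi> n (s, q) = indicat_real {u q - a q * h n<..} s) sequentially"
  shows "(\<lambda>n. (\<integral>p. W p * (\<xi> n p - indicat_real {u (snd p)<..} (fst p)) \<partial>lborel) / h n) \<longlonglongrightarrow> (\<integral>q. a q * W (u q, q) \<partial>lborel)"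
proof -
  have Wm[measurable]: "W \<in> borel_measurable borel" using cW by (rule borel_measurable_continuous_onI)
  have um[measurable]: "u \<in> borel_measurable borel" using cu by (rule borel_measurable_continuous_onI)
  have N0: "0 \<le> N" using N[of "(0,0)"] by linarith
  let ?F = "\<lambda>n p. W p * (\<xi> n p - indicat_real {u (snd p)<..} (fst p))"
  have Hm: "(\<lambda>p::real \<times> real \<times> real. indicat_real {u (snd p)<..} (fst p)) \<in> borel_measurable borel"
  proof -
    have "{p::real \<times> real \<times> real. u (snd p) < fst p} \<in> sets borel"
      by (intro borel_open open_Collect_less continuous_intros continuous_on_compose2[OF cu]) auto
    then have "indicat_real {p::real \<times> real \<times> real. u (snd p) < fst p} \<in> borel_measurable borel" by simp
    moreover have "indicat_real {p::real \<times> real \<times> real. u (snd p) < fst p} = (\<lambda>p. indicat_real {u (snd p)<..} (fst p))"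
      by (auto simp: indicator_def)
    ultimately show ?thesis by simp
  qed
  have Fm: "?F n \<in> borel_measurable borel" for n using Hm by measurable
  have Fb: "\<bar>?F n p\<bar> \<le> N" for n p using N[of p] N0 chi01[of n p] by (auto simp: indicator_def abs_mult)
  have Fi: "integrable lborel (?F n)" for n
  proof (rule integrable_bounded_compact_support[OF Fm Fb, of "{-S..S} \<times> K"])
    show "compact ({-S..S} \<times> K)" using K(1) by (intro compact_Times) auto
    show "?F n p = 0" if "p \<notin> {-S..S} \<times> K" for p
      using that S[of "fst p" "snd p"] K(2)[of "snd p" "fst p"] by (cases p) auto
  qed
  have chis[measurable]: "(\<lambda>s. \<xi> n (s, q)) \<in> borel_measurable borel" for n q
    by (rule measurable_compose[OF _ chi]) (intro borel_measurable_continuous_onI continuous_intros)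
  have Ws: "continuous_on UNIV (\<lambda>s. W (s, q))" for q
    by (rule continuous_on_compose2[OF cW]) (auto intro!: continuous_intros)
  define G where "G n q = (\<integral>s. W (s, q) * (\<xi> n (s, q) - indicat_real {u q<..} s) \<partial>lborel)" for n q
  have Fi': "integrable (lborel \<Otimes>\<^sub>M lborel) (\<lambda>(s, q). ?F n (s, q))" for n
    using Fi[of n] unfolding lborel_prod by (simp add: split_beta')
  have fub: "(\<integral>p. ?F n p \<partial>lborel) = (\<integral>q. G n q \<partial>lborel)" for n
    using lborel_pair.integral_snd[OF Fi'[of n]] unfolding lborel_prod G_def by (simp add: split_beta')
  have Gm: "G n \<in> borel_measurable borel" for n
  proof -
    have "integrable lborel (\<lambda>q. \<integral>s. ?F n (s, q) \<partial>lborel)" by (rule lborel_pair.integrable_snd[OF Fi'])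
    then show ?thesis unfolding G_def by (simp add: borel_measurable_integrable)
  qed
  have Gb: "\<bar>G n q\<bar> \<le> N * (2 * \<kappa>' * h n) * indicat_real K q" for n q
  proof (cases "q \<in> K")
    case True
    have ii: "integrable lborel (\<lambda>s. N * indicat_real {u q - \<kappa>' * h n..u q + \<kappa>' * h n} s)"
      by (intro integrable_mult_right integrable_real_indicator) (auto simp: emeasure_lborel_Icc_eq)
    have i1: "integrable lborel (\<lambda>s. W (s, q) * (\<xi> n (s, q) - indicat_real {u q<..} s))"
    proof (rule integrable_bounded_compact_support[where N=N and K="{-S..S}"])
      show "(\<lambda>s. W (s, q) * (\<xi> n (s, q) - indicat_real {u q<..} s)) \<in> borel_measurable borel"
        using borel_measurable_continuous_onI[OF Ws[of q]] by measurable
      show "\<bar>W (s, q) * (\<xi> n (s, q) - indicat_real {u q<..} s)\<bar> \<le> N" for s using Fb[where n=n and p="(s, q)"] by simp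
      show "W (s, q) * (\<xi> n (s, q) - indicat_real {u q<..} s) = 0" if "s \<notin> {-S..S}" for s
        using S[of s q] that by auto
    qed simp
    have "\<bar>G n q\<bar> \<le> (\<integral>s. \<bar>W (s, q) * (\<xi> n (s, q) - indicat_real {u q<..} s)\<bar> \<partial>lborel)"
      unfolding G_def using integral_norm_bound[of lborel "\<lambda>s. W (s, q) * (\<xi> n (s, q) - indicat_real {u q<..} s)"] by simp
    also have "\<dots> \<le> (\<integral>s. N * indicat_real {u q - \<kappa>' * h n..u q + \<kappa>' * h n} s \<partial>lborel)"
    proof (rule integral_mono[OF integrable_abs[OF i1] ii])
      fix s
      show "\<bar>W (s, q) * (\<xi> n (s, q) - indicat_real {u q<..} s)\<bar> \<le> N * indicat_real {u q - \<kappa>' * h n..u q + \<kappa>' * h n} s"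
      proof (cases "s \<in> {u q - \<kappa>' * h n..u q + \<kappa>' * h n}")
        case True then show ?thesis using Fb[where n=n and p="(s, q)"] by simp
      next
        case False
        then have "\<kappa>' * h n < \<bar>s - u q\<bar>" by auto
        then have "\<bar>s\<bar> \<le> S \<Longrightarrow> \<xi> n (s, q) = indicat_real {u q<..} s" using far by blast
        then have z: "W (s, q) * (\<xi> n (s, q) - indicat_real {u q<..} s) = 0" using S[of s q] by (cases "\<bar>s\<bar> \<le> S") auto
        show ?thesis unfolding z using N0 by simp
      qed
    qed
    also have "\<dots> = N * (2 * \<kappa>' * h n)" using k' h(1)[of n] by simp
    finally show ?thesis using True by simp
  next
    case False
    then show ?thesis unfolding G_def using K(2)[OF False] by simp
  qed
  have "(\<lambda>n. \<integral>q. G n q / h n \<partial>lborel) \<longlonglongrightarrow> (\<integral>q. a q * W (u q, q) \<partial>lborel)"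
  proof (rule integral_dominated_convergence[where w="\<lambda>q. N * (2 * \<kappa>') * indicat_real K q"])
    show "(\<lambda>q. a q * W (u q, q)) \<in> borel_measurable lborel" using am by simp
    show "(\<lambda>q. G n q / h n) \<in> borel_measurable lborel" for n using Gm by simp
    show "integrable lborel (\<lambda>q. N * (2 * \<kappa>') * indicat_real K q)"
      using emeasure_compact_finite[OF K(1)] K(1) by (intro integrable_mult_right integrable_real_indicator) (auto simp: compact_imp_closed)
    show "AE q in lborel. (\<lambda>n. G n q / h n) \<longlonglongrightarrow> a q * W (u q, q)"
    proof (rule AE_I2)
      fix q
      show "(\<lambda>n. G n q / h n) \<longlonglongrightarrow> a q * W (u q, q)"
      proof (cases "q \<in> K")
        case True
        obtain \<kappa> where k: "\<kappa> \<ge> 0" "eventually (\<lambda>n. \<forall>s. \<bar>s\<bar> \<le> S \<longrightarrow> \<kappa> * (h n)\<^sup>2 < \<bar>s - (u q - a q * h n)\<bar> \<longrightarrow> \<xi> n (s, q) = indicat_real {u q - a q * h n<..} s) sequentially"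
          using ev[OF True] by blast
        show ?thesis unfolding G_def
          by (rule flux_limit_1d[OF Ws N S h chis chi01 k])
      next
        case False
        then show ?thesis unfolding G_def using K(2)[OF False] by simp
      qed
    qed
    show "AE q in lborel. norm (G n q / h n) \<le> N * (2 * \<kappa>') * indicat_real K q" for n
      using Gb[of n] h(1)[of n] by (intro AE_I2) (simp add: abs_divide pos_divide_le_eq algebra_simps)
  qed
  then show ?thesis unfolding fub by simp
qed

lemma abs_indicator_mult_le: "\<bar>x\<bar> \<le> N \<Longrightarrow> \<bar>indicat_real A p * x\<bar> \<le> N"
  by (auto simp: indicator_def)

text \<open>The epigraph of a Lipschitz function is too rough to integrate by parts directly; instead the
  volume preserving flow of the field is differentiated, moving the difference quotient from the test
  function to the set.\<close>

lemma flow_derivative_integral: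
  fixes Z :: "hpt \<Rightarrow> hpt" and w :: "hpt \<Rightarrow> real"
  assumes w: "C1 w" and cs: "compact (closure {p. w p \<noteq> 0})" and cZ: "continuous_on UNIV Z"
    and Zi: "\<And>p h. Z (p + h *\<^sub>R Z p) = Z p"
    and mp: "\<And>(\<phi> :: hpt \<Rightarrow> real) h. \<phi> \<in> borel_measurable borel \<Longrightarrow> (\<integral>p. \<phi> (p + h *\<^sub>R Z p) \<partial>lborel) = (\<integral>p. \<phi> p \<partial>lborel)"
    and cD: "continuous_on UNIV (\<lambda>p. frechet_derivative w (at p) (Z p))"
    and E: "E \<in> sets borel" and h: "\<And>n. 0 < h n" "\<And>n. h n \<le> 1" "h \<longlonglongrightarrow> 0"
  shows "(\<lambda>n. (\<integral>p. w p * (indicat_real E (p + (- h n) *\<^sub>R Z p) - indicat_real E p) \<partial>lborel) / h n)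
     \<longlonglongrightarrow> (\<integral>p. indicat_real E p * frechet_derivative w (at p) (Z p) \<partial>lborel)"
proof -
  let ?K = "closure {p. w p \<noteq> 0}"
  let ?D = "\<lambda>p. frechet_derivative w (at p) (Z p)"
  note [measurable] = E
  have cw: "continuous_on UNIV w" using w by (rule C1_continuous)
  have [measurable]: "w \<in> borel_measurable borel" "?D \<in> borel_measurable borel"
    using cw cD by (auto intro: borel_measurable_continuous_onI)
  have Tm[measurable]: "(\<lambda>p. p + z *\<^sub>R Z p) \<in> borel_measurable borel" for z
    using cZ by (intro borel_measurable_continuous_onI continuous_intros)
  have w0: "w p = 0" if "p \<notin> ?K" for p using that closure_subset[of "{p. w p \<noteq> 0}"] by auto
  have D0: "?D p = 0" if "p \<notin> ?K" for p using frechet_derivative_zero_off_support[OF that] .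
  obtain B where B: "B \<ge> 0" "\<And>p. \<bar>?D p\<bar> \<le> B" using continuous_compact_support_bounded[OF cD cs D0] by blast
  obtain N where N: "N \<ge> 0" "\<And>p. \<bar>w p\<bar> \<le> N" using continuous_compact_support_bounded[OF cw cs w0] by blast
  \<comment> \<open>As \<open>Z\<close> is constant along its own lines, the flow is affine in time,
    and time \<open>- z\<close> undoes time \<open>z\<close>.\<close>
  have inv: "(p + z *\<^sub>R Z p) + (- z) *\<^sub>R Z (p + z *\<^sub>R Z p) = p" for p z unfolding Zi by simp
  have der: "((\<lambda>z. w (p + z *\<^sub>R Z p)) has_real_derivative ?D (p + z *\<^sub>R Z p)) (at z)" for p z
  proof -
    have "((\<lambda>z. p + z *\<^sub>R Z p) has_vector_derivative Z p) (at z)"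
      by (auto intro!: derivative_eq_intros)
    then have "((\<lambda>z. p + z *\<^sub>R Z p) has_derivative (\<lambda>x. x *\<^sub>R Z p)) (at z)"
      unfolding has_vector_derivative_def .
    from has_derivative_compose[OF this C1D[OF w]]
    have "((\<lambda>z. w (p + z *\<^sub>R Z p)) has_derivative (\<lambda>x. frechet_derivative w (at (p + z *\<^sub>R Z p)) (x *\<^sub>R Z p))) (at z)" .
    moreover have "frechet_derivative w (at (p + z *\<^sub>R Z p)) (x *\<^sub>R Z p) = ?D (p + z *\<^sub>R Z p) * x" for x
      using linear_scale[OF has_derivative_linear[OF C1D[OF w]]] unfolding Zi by simp
    ultimately show ?thesis unfolding has_field_derivative_def by simp
  qed
  \<comment> \<open>The support of \<open>w\<close> swept backwards for times up to 1: outside this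
    compact set neither \<open>w\<close> nor its shifted copies contribute.\<close>
  define K2 where "K2 = (\<lambda>(z, p). p + (- z) *\<^sub>R Z p) ` ({0..1} \<times> ?K)"
  have K2: "compact K2" unfolding K2_def
  proof (rule compact_continuous_image)
    show "continuous_on ({0..1} \<times> ?K) (\<lambda>(z, p). p + (- z) *\<^sub>R Z p)"
      unfolding split_beta' by (intro continuous_intros continuous_on_compose2[OF cZ]) auto
    show "compact ({0..1::real} \<times> ?K)" using cs by (intro compact_Times) auto
  qed
  have inK2: "p \<in> K2" if "p + z *\<^sub>R Z p \<in> ?K" "0 \<le> z" "z \<le> 1" for p z
  proof -
    have "p = (\<lambda>(z, p). p + (- z) *\<^sub>R Z p) (z, p + z *\<^sub>R Z p)" using inv[of p z] by simp
    then show ?thesis unfolding K2_def using that by (intro image_eqI[of _ _ "(z, p + z *\<^sub>R Z p)"]) auto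
  qed
  have qb: "\<bar>w (p + z *\<^sub>R Z p) - w p\<bar> \<le> B * z * indicat_real K2 p" if z: "0 < z" "z \<le> 1" for p z
  proof (cases "p \<in> K2")
    case True
    obtain x where "w (p + z *\<^sub>R Z p) - w (p + 0 *\<^sub>R Z p) = (z - 0) * ?D (p + x *\<^sub>R Z p)"
      using MVT2[of 0 z "\<lambda>z. w (p + z *\<^sub>R Z p)" "\<lambda>z. ?D (p + z *\<^sub>R Z p)"] z(1) der by blast
    then show ?thesis using B(2)[of "p + x *\<^sub>R Z p"] z True by (simp add: abs_mult mult.commute mult_right_mono)
  next
    case False
    have "p + z *\<^sub>R Z p \<notin> ?K" using inK2[of p z] z False by auto
    moreover have "p \<notin> ?K" using inK2[of p 0] False by auto
    ultimately show ?thesis using w0[of "p + z *\<^sub>R Z p"] w0[of p] False by simp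
  qed
  have K2f: "emeasure lborel K2 < \<infinity>" by (rule emeasure_compact_finite[OF K2])
  have K2m: "K2 \<in> sets borel" using K2 by (simp add: compact_imp_closed)
  have lim: "(\<lambda>n. \<integral>p. indicat_real E p * ((w (p + h n *\<^sub>R Z p) - w p) / h n) \<partial>lborel) \<longlonglongrightarrow> (\<integral>p. indicat_real E p * ?D p \<partial>lborel)"
  proof (rule integral_dominated_convergence[where w="\<lambda>p. B * indicat_real K2 p"])
    show "integrable lborel (\<lambda>p. B * indicat_real K2 p)"
      using K2m K2f by (intro integrable_mult_right integrable_real_indicator) auto
    show "AE p in lborel. (\<lambda>n. indicat_real E p * ((w (p + h n *\<^sub>R Z p) - w p) / h n)) \<longlonglongrightarrow> indicat_real E p * ?D p"
    proof (intro AE_I2 tendsto_mult tendsto_const)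
      fix p
      have "((\<lambda>z. (w (p + (0 + z) *\<^sub>R Z p) - w (p + 0 *\<^sub>R Z p)) / z) \<longlongrightarrow> ?D (p + 0 *\<^sub>R Z p)) (at 0)"
        using der[of p 0] unfolding DERIV_def .
      then have "((\<lambda>z. (w (p + z *\<^sub>R Z p) - w p) / z) \<longlongrightarrow> ?D p) (at 0)" by simp
      moreover have "filterlim h (at 0) sequentially" using h by (auto simp: filterlim_at less_imp_neq[symmetric])
      ultimately show "(\<lambda>n. (w (p + h n *\<^sub>R Z p) - w p) / h n) \<longlonglongrightarrow> ?D p" by (rule filterlim_compose)
    qed
    show "AE p in lborel. norm (indicat_real E p * ((w (p + h n *\<^sub>R Z p) - w p) / h n)) \<le> B * indicat_real K2 p" for n
    proof (rule AE_I2)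
      fix p
      have "\<bar>(w (p + h n *\<^sub>R Z p) - w p) / h n\<bar> \<le> B * indicat_real K2 p"
        using qb[OF h(1)[of n] h(2)[of n], of p] h(1)[of n] by (simp add: abs_divide pos_divide_le_eq mult_ac)
      then show "norm (indicat_real E p * ((w (p + h n *\<^sub>R Z p) - w p) / h n)) \<le> B * indicat_real K2 p"
        using B(1) by (auto simp: indicator_def)
    qed
  qed measurable
  have eq: "(\<integral>p. indicat_real E p * ((w (p + h n *\<^sub>R Z p) - w p) / h n) \<partial>lborel) = (\<integral>p. w p * (indicat_real E (p + (- h n) *\<^sub>R Z p) - indicat_real E p) \<partial>lborel) / h n" for n
  proof -
    have i1: "integrable lborel (\<lambda>p. indicat_real E (p + (- h n) *\<^sub>R Z p) * w p)"
    proof (rule integrable_bounded_compact_support[OF _ abs_indicator_mult_le[OF N(2)] cs])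
      show "(\<lambda>p. indicat_real E (p + (- h n) *\<^sub>R Z p) * w p) \<in> borel_measurable borel" by measurable
      show "indicat_real E (p + (- h n) *\<^sub>R Z p) * w p = 0" if "p \<notin> ?K" for p unfolding w0[OF that] by simp
    qed
    have i2: "integrable lborel (\<lambda>p. indicat_real E p * w p)"
    proof (rule integrable_bounded_compact_support[OF _ abs_indicator_mult_le[OF N(2)] cs])
      show "(\<lambda>p. indicat_real E p * w p) \<in> borel_measurable borel" by measurable
      show "indicat_real E p * w p = 0" if "p \<notin> ?K" for p unfolding w0[OF that] by simp
    qed
    have i3: "integrable lborel (\<lambda>p. indicat_real E p * w (p + h n *\<^sub>R Z p))"
    proof (rule integrable_bounded_compact_support[OF _ abs_indicator_mult_le[OF N(2)] K2])
      show "indicat_real E p * w (p + h n *\<^sub>R Z p) = 0" if "p \<notin> K2" for p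
      proof -
        have "p + h n *\<^sub>R Z p \<notin> ?K" using that inK2[of p "h n"] h(1,2)[of n] by auto
        then show ?thesis using w0[of "p + h n *\<^sub>R Z p"] by simp
      qed
    qed measurable
    \<comment> \<open>Volume preservation, applied to the integrand with the set moved backwards,
      carries the shift from \<open>w\<close> to the set.\<close>
    have "(\<integral>p. indicat_real E p * w (p + h n *\<^sub>R Z p) \<partial>lborel) = (\<integral>p. indicat_real E (p + (- h n) *\<^sub>R Z p) * w p \<partial>lborel)"
    proof -
      have "(\<lambda>p. indicat_real E (p + (- h n) *\<^sub>R Z p) * w p) \<in> borel_measurable borel" by measurable
      from mp[OF this, of "h n"] show ?thesis unfolding inv .
    qed
    then have "(\<integral>p. indicat_real E p * w (p + h n *\<^sub>R Z p) - indicat_real E p * w p \<partial>lborel) = (\<integral>p. indicat_real E (p + (- h n) *\<^sub>R Z p) * w p - indicat_real E p * w p \<partial>lborel)"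
      using i1 i2 i3 by simp
    moreover have "(\<integral>p. indicat_real E p * ((w (p + h n *\<^sub>R Z p) - w p) / h n) \<partial>lborel) = (\<integral>p. (indicat_real E p * w (p + h n *\<^sub>R Z p) - indicat_real E p * w p) / h n \<partial>lborel)"
      by (intro Bochner_Integration.integral_cong refl) (simp add: right_diff_distrib)
    moreover have "(\<integral>p. w p * (indicat_real E (p + (- h n) *\<^sub>R Z p) - indicat_real E p) \<partial>lborel) = (\<integral>p. indicat_real E (p + (- h n) *\<^sub>R Z p) * w p - indicat_real E p * w p \<partial>lborel)"
      by (intro Bochner_Integration.integral_cong refl) (simp add: algebra_simps)
    ultimately show ?thesis by simp
  qed
  show ?thesis using lim unfolding eq .
qed

section \<open>Coset coordinates\<close>

text \<open>\<open>leftq\<close> and \<open>rightq\<close> send a point to the representative in the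
  vertical plane of its left and of its right coset of the x-axis. Graphs, epigraphs and cylinders,
  given by existential parametrisations, become conditions on these projections.\<close>

definition leftq :: "hpt \<Rightarrow> real \<times> real" where
  "leftq p = (fst (snd p), snd (snd p) - 2 * fst p * fst (snd p))"

definition rightq :: "hpt \<Rightarrow> real \<times> real" where
  "rightq p = (fst (snd p), snd (snd p) + 2 * fst p * fst (snd p))"

definition lift_left :: "real \<Rightarrow> real \<times> real \<Rightarrow> hpt" where
  "lift_left s q = (s, fst q, snd q + 2 * fst q * s)"

definition lift_right :: "real \<Rightarrow> real \<times> real \<Rightarrow> hpt" where
  "lift_right s r = (s, fst r, snd r - 2 * fst r * s)"

lemma lift_simps [simp]:
  "leftq (lift_left s q) = q" "fst (lift_left s q) = s" "lift_left (fst p) (leftq p) = p"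
  "rightq (lift_right s q) = q" "fst (lift_right s q) = s" "lift_right (fst p) (rightq p) = p"
  unfolding leftq_def rightq_def lift_left_def lift_right_def by (cases q; cases p; simp)+

lemma cylL_eq: "cylL D = {p. leftq p \<in> D}"
  unfolding cylL_def leftq_def by (auto simp: algebra_simps) (metis add_diff_cancel_left' diff_add_cancel)

lemma cylR_eq: "cylR D = {p. rightq p \<in> D}"
proof -
  have "p \<in> cylR D" if "rightq p \<in> D" for p
    unfolding cylR_def using that
    by (intro CollectI exI[of _ "fst p"] exI[of _ "fst (snd p)"] exI[of _ "snd (snd p) + 2 * fst p * fst (snd p)"])
       (auto simp: rightq_def)
  then show ?thesis unfolding cylR_def rightq_def by (auto simp: algebra_simps)
qed

lemma Eepi_eq: "Eepi D u = {p. leftq p \<in> D \<and> u (leftq p) < fst p}"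
proof -
  have "p \<in> Eepi D u" if "leftq p \<in> D" "u (leftq p) < fst p" for p
    unfolding Eepi_def using that
    by (intro CollectI exI[of _ "fst p"] exI[of _ "fst (snd p)"] exI[of _ "snd (snd p) - 2 * fst p * fst (snd p)"])
       (auto simp: leftq_def)
  then show ?thesis unfolding Eepi_def leftq_def by (auto simp: algebra_simps)
qed

lemma EepiR_eq: "EepiR D u = {p. rightq p \<in> D \<and> u (rightq p) < fst p}"
proof -
  have "p \<in> EepiR D u" if "rightq p \<in> D" "u (rightq p) < fst p" for p
    unfolding EepiR_def using that
    by (intro CollectI exI[of _ "fst p"] exI[of _ "fst (snd p)"] exI[of _ "snd (snd p) + 2 * fst p * fst (snd p)"])
       (auto simp: rightq_def)
  then show ?thesis unfolding EepiR_def rightq_def by (auto simp: algebra_simps)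
qed

lemma Sgraph_eq: "Sgraph D u = {p. leftq p \<in> D \<and> fst p = u (leftq p)}"
proof -
  have "p \<in> Sgraph D u" if "leftq p \<in> D" "fst p = u (leftq p)" for p
    unfolding Sgraph_def using that
    by (intro CollectI exI[of _ "fst (snd p)"] exI[of _ "snd (snd p) - 2 * fst p * fst (snd p)"])
       (cases p, auto simp: leftq_def)
  then show ?thesis unfolding Sgraph_def leftq_def by (auto simp: algebra_simps)
qed

lemma SgraphR_eq: "SgraphR D u = {p. rightq p \<in> D \<and> fst p = u (rightq p)}"
proof -
  have "p \<in> SgraphR D u" if "rightq p \<in> D" "fst p = u (rightq p)" for p
    unfolding SgraphR_def using that
    by (intro CollectI exI[of _ "fst (snd p)"] exI[of _ "snd (snd p) + 2 * fst p * fst (snd p)"])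
       (cases p, auto simp: rightq_def)
  then show ?thesis unfolding SgraphR_def rightq_def by (auto simp: algebra_simps)
qed

lemma continuous_leftq: "continuous_on S leftq" unfolding leftq_def by (intro continuous_intros)
lemma continuous_rightq: "continuous_on S rightq" unfolding rightq_def by (intro continuous_intros)

lemma open_cylL: "open D \<Longrightarrow> open (cylL D)"
  unfolding cylL_eq using open_vimage[of D leftq] continuous_leftq[of UNIV] by (simp add: vimage_def)

lemma open_cylR: "open D \<Longrightarrow> open (cylR D)"
  unfolding cylR_eq using open_vimage[of D rightq] continuous_rightq[of UNIV] by (simp add: vimage_def)

section \<open>The flows of X and Y and Gauss-Green on the left epigraph\<close>

definition Xv :: "hpt \<Rightarrow> hpt" where "Xv p = (1, 0, 2 * fst (snd p))"
definition Yv :: "hpt \<Rightarrow> hpt" where "Yv p = (0, 1, - 2 * fst p)"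

lemma Xop_eq: "Xop f p = frechet_derivative f (at p) (Xv p)" unfolding Xop_def Xv_def ..
lemma Yop_eq: "Yop f p = frechet_derivative f (at p) (Yv p)" unfolding Yop_def Yv_def ..

text \<open>The flow for time \<open>h\<close> is a shear in \<open>t\<close> followed by a
  translation, hence it preserves volume.\<close>

lemma Xv_flow:
  "continuous_on UNIV Xv" "Xv (p + h *\<^sub>R Xv p) = Xv p"
  "\<phi> \<in> borel_measurable borel \<Longrightarrow> (\<integral>p. (\<phi> :: hpt \<Rightarrow> real) (p + h *\<^sub>R Xv p) \<partial>lborel) = (\<integral>p. \<phi> p \<partial>lborel)"
proof -
  show "continuous_on UNIV Xv" unfolding Xv_def by (intro continuous_intros)
  show "Xv (p + h *\<^sub>R Xv p) = Xv p" unfolding Xv_def by simp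
  assume f: "\<phi> \<in> borel_measurable borel"
  have "(\<integral>p. \<phi> (p + h *\<^sub>R Xv p) \<partial>lborel) = (\<integral>p. \<phi> ((h, 0, 0) + (fst p, fst (snd p), snd (snd p) + 2 * h * fst (snd p))) \<partial>lborel)"
    by (intro Bochner_Integration.integral_cong refl arg_cong[of _ _ \<phi>]) (auto simp: Xv_def prod_eq_iff)
  also have "\<dots> = (\<integral>p. \<phi> ((h, 0, 0) + p) \<partial>lborel)"
  proof (rule integral_shear(1)[of "\<lambda>x y. 2 * h * y" "\<lambda>p. \<phi> ((h, 0, 0) + p)"])
    show "continuous_on UNIV (\<lambda>(x :: real, y). 2 * h * y)" unfolding split_beta' by (intro continuous_intros)
    show "(\<lambda>p. \<phi> ((h, 0, 0) + p)) \<in> borel_measurable borel"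
      by (rule measurable_compose[OF _ f]) (intro borel_measurable_continuous_onI continuous_intros)
  qed
  also have "\<dots> = (\<integral>p. \<phi> p \<partial>lborel)" by (rule lborel_integral_translation[OF f])
  finally show "(\<integral>p. \<phi> (p + h *\<^sub>R Xv p) \<partial>lborel) = (\<integral>p. \<phi> p \<partial>lborel)" .
qed

lemma Yv_flow:
  "continuous_on UNIV Yv" "Yv (p + h *\<^sub>R Yv p) = Yv p"
  "\<phi> \<in> borel_measurable borel \<Longrightarrow> (\<integral>p. (\<phi> :: hpt \<Rightarrow> real) (p + h *\<^sub>R Yv p) \<partial>lborel) = (\<integral>p. \<phi> p \<partial>lborel)"
proof -
  show "continuous_on UNIV Yv" unfolding Yv_def by (intro continuous_intros)
  show "Yv (p + h *\<^sub>R Yv p) = Yv p" unfolding Yv_def by simp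
  assume f: "\<phi> \<in> borel_measurable borel"
  have "(\<integral>p. \<phi> (p + h *\<^sub>R Yv p) \<partial>lborel) = (\<integral>p. \<phi> ((0, h, 0) + (fst p, fst (snd p), snd (snd p) + (- 2 * h * fst p))) \<partial>lborel)"
    by (intro Bochner_Integration.integral_cong refl arg_cong[of _ _ \<phi>]) (auto simp: Yv_def prod_eq_iff)
  also have "\<dots> = (\<integral>p. \<phi> ((0, h, 0) + p) \<partial>lborel)"
  proof (rule integral_shear(1)[of "\<lambda>x y. - 2 * h * x" "\<lambda>p. \<phi> ((0, h, 0) + p)"])
    show "continuous_on UNIV (\<lambda>(x, y :: real). - 2 * h * x)" unfolding split_beta' by (intro continuous_intros)
    show "(\<lambda>p. \<phi> ((0, h, 0) + p)) \<in> borel_measurable borel"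
      by (rule measurable_compose[OF _ f]) (intro borel_measurable_continuous_onI continuous_intros)
  qed
  also have "\<dots> = (\<integral>p. \<phi> p \<partial>lborel)" by (rule lborel_integral_translation[OF f])
  finally show "(\<integral>p. \<phi> (p + h *\<^sub>R Yv p) \<partial>lborel) = (\<integral>p. \<phi> p \<partial>lborel)" .
qed

lemma continuous_Xop: "C1 w \<Longrightarrow> continuous_on UNIV (\<lambda>p. frechet_derivative w (at p) (Xv p))"
proof -
  assume w: "C1 w"
  have "frechet_derivative w (at p) (Xv p) = frechet_derivative w (at p) (1, 0, 0) + (2 * fst (snd p)) * frechet_derivative w (at p) (0, 0, 1)" for p
  proof -
    have lin: "linear (frechet_derivative w (at p))" using has_derivative_linear[OF C1D[OF w]] .
    have xe: "Xv p = (1, 0, 0) + (2 * fst (snd p)) *\<^sub>R (0, 0, 1)" by (simp add: Xv_def)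
    show ?thesis unfolding xe linear_add[OF lin] linear_scale[OF lin] real_scaleR_def ..
  qed
  then show ?thesis by (simp only:) (intro continuous_intros C1_continuous_deriv[OF w])
qed

lemma continuous_Yop: "C1 w \<Longrightarrow> continuous_on UNIV (\<lambda>p. frechet_derivative w (at p) (Yv p))"
proof -
  assume w: "C1 w"
  have "frechet_derivative w (at p) (Yv p) = frechet_derivative w (at p) (0, 1, 0) + (- 2 * fst p) * frechet_derivative w (at p) (0, 0, 1)" for p
  proof -
    have lin: "linear (frechet_derivative w (at p))" using has_derivative_linear[OF C1D[OF w]] .
    have xe: "Yv p = (0, 1, 0) + (- 2 * fst p) *\<^sub>R (0, 0, 1)" by (simp add: Yv_def)
    show ?thesis unfolding xe linear_add[OF lin] linear_scale[OF lin] real_scaleR_def ..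
  qed
  then show ?thesis by (simp only:) (intro continuous_intros C1_continuous_deriv[OF w])
qed

lemma continuous_lift_left: "continuous_on S (\<lambda>p. lift_left (fst p) (snd p))"
  unfolding lift_left_def by (intro continuous_intros)

text \<open>In left coordinates, a change of variables with Jacobian 1, the epigraph is a half-line
  over each \<open>q\<close>. The flow moves the end of this half-line from \<open>u q\<close> to
  \<open>u q - a q * h\<close> up to \<open>O(h^2)\<close>. Computed fibre by fibre, the limit of
  the quotients is the integral over the graph; computed with the flow, it is the integral over the
  epigraph.\<close>

lemma green_flow:
  fixes Z :: "hpt \<Rightarrow> hpt" and w :: "hpt \<Rightarrow> real" and u a :: "real \<times> real \<Rightarrow> real"
  assumes cu: "continuous_on UNIV u" and w: "C1c w (cylL D)"
    and cZ: "continuous_on UNIV Z" and Zi: "\<And>p h. Z (p + h *\<^sub>R Z p) = Z p"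
    and mp: "\<And>(\<phi> :: hpt \<Rightarrow> real) h. \<phi> \<in> borel_measurable borel \<Longrightarrow> (\<integral>p. \<phi> (p + h *\<^sub>R Z p) \<partial>lborel) = (\<integral>p. \<phi> p \<partial>lborel)"
    and cD: "continuous_on UNIV (\<lambda>p. frechet_derivative w (at p) (Z p))"
    and h: "\<And>n. 0 < h n" "\<And>n. h n \<le> 1" "h \<longlonglongrightarrow> 0"
    and am: "(\<lambda>q. a q * w (lift_left (u q) q)) \<in> borel_measurable borel"
    and far: "\<And>S. 0 \<le> S \<Longrightarrow> \<exists>\<kappa>\<ge>0. \<forall>n s q. \<bar>s\<bar> \<le> S \<longrightarrow> \<kappa> * h n < \<bar>s - u q\<bar> \<longrightarrow>
        (u (leftq (lift_left s q + (- h n) *\<^sub>R Z (lift_left s q))) < fst (lift_left s q + (- h n) *\<^sub>R Z (lift_left s q)) \<longleftrightarrow> u q < s)"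
    and ev: "\<And>q S. q \<in> D \<Longrightarrow> 0 \<le> S \<Longrightarrow> \<exists>\<kappa>\<ge>0. eventually (\<lambda>n. \<forall>s. \<bar>s\<bar> \<le> S \<longrightarrow> \<kappa> * (h n)\<^sup>2 < \<bar>s - (u q - a q * h n)\<bar> \<longrightarrow>
        (u (leftq (lift_left s q + (- h n) *\<^sub>R Z (lift_left s q))) < fst (lift_left s q + (- h n) *\<^sub>R Z (lift_left s q)) \<longleftrightarrow> u q - a q * h n < s)) sequentially"
  shows "(\<integral>p. indicat_real (Eepi D u) p * frechet_derivative w (at p) (Z p) \<partial>lborel) = (\<integral>q. a q * w (lift_left (u q) q) \<partial>lborel)"
proof -
  let ?K = "closure {p. w p \<noteq> 0}"
  have wC: "C1 w" and wK: "compact ?K" and wD: "?K \<subseteq> cylL D" using w unfolding C1c_iff by auto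
  \<comment> \<open>The epigraph over the whole plane replaces \<open>Eepi D u\<close>, since flowed
    points may leave the cylinder over \<open>D\<close>; off the support of \<open>w\<close> both
    integrands vanish.\<close>
  define E where "E = {p. u (leftq p) < fst p}"
  have "open E" unfolding E_def
    by (intro open_Collect_less continuous_intros continuous_on_compose2[OF cu continuous_leftq]) auto
  then have E: "E \<in> sets borel" by simp
  have cw: "continuous_on UNIV w" using wC by (rule C1_continuous)
  have w0: "w p = 0" if "p \<notin> ?K" for p using that closure_subset[of "{p. w p \<noteq> 0}"] by auto
  have eqE: "indicat_real (Eepi D u) p * frechet_derivative w (at p) (Z p) = indicat_real E p * frechet_derivative w (at p) (Z p)" for p
  proof (cases "p \<in> ?K")
    case True
    then have "leftq p \<in> D" using wD unfolding cylL_eq by auto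
    then show ?thesis unfolding Eepi_eq E_def by (simp add: indicator_def)
  next
    case False
    show ?thesis unfolding frechet_derivative_zero_off_support[OF False] by simp
  qed
  have L1: "(\<lambda>n. (\<integral>p. w p * (indicat_real E (p + (- h n) *\<^sub>R Z p) - indicat_real E p) \<partial>lborel) / h n)
     \<longlonglongrightarrow> (\<integral>p. indicat_real E p * frechet_derivative w (at p) (Z p) \<partial>lborel)"
    by (rule flow_derivative_integral[OF wC wK cZ Zi mp cD E h])
  define W where "W p = w (lift_left (fst p) (snd p))" for p
  define \<xi> where "\<xi> n p = indicat_real E (lift_left (fst p) (snd p) + (- h n) *\<^sub>R Z (lift_left (fst p) (snd p)))" for n p
  have Zm: "(\<lambda>p. p + z *\<^sub>R Z p) \<in> borel_measurable borel" for z
    using cZ by (intro borel_measurable_continuous_onI continuous_intros)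
  have liftm: "(\<lambda>p. lift_left (fst p) (snd p)) \<in> borel_measurable borel"
    by (intro borel_measurable_continuous_onI continuous_lift_left)
  have xim: "\<xi> n \<in> borel_measurable borel" for n
  proof -
    have "(\<lambda>p. indicat_real E (p + (- h n) *\<^sub>R Z p)) \<in> borel_measurable borel"
      by (rule measurable_compose[OF Zm borel_measurable_indicator[OF E]])
    from measurable_compose[OF liftm this] show ?thesis unfolding \<xi>_def .
  qed
  have eq: "(\<integral>p. w p * (indicat_real E (p + (- h n) *\<^sub>R Z p) - indicat_real E p) \<partial>lborel)
     = (\<integral>p. W p * (\<xi> n p - indicat_real {u (snd p)<..} (fst p)) \<partial>lborel)" for n
  proof -
    let ?f = "\<lambda>p. w p * (indicat_real E (p + (- h n) *\<^sub>R Z p) - indicat_real E p)"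
    have fm: "?f \<in> borel_measurable borel"
      by (rule borel_measurable_times[OF borel_measurable_continuous_onI[OF cw]
            borel_measurable_diff[OF measurable_compose[OF Zm borel_measurable_indicator[OF E]] borel_measurable_indicator[OF E]]])
    have "(\<integral>p. ?f p \<partial>lborel) = (\<integral>p. ?f (fst p, fst (snd p), snd (snd p) + 2 * fst (snd p) * fst p) \<partial>lborel)"
      by (rule integral_shear(1)[symmetric, of "\<lambda>x y. 2 * y * x", OF _ fm]) (auto simp: split_beta' intro!: continuous_intros)
    also have "\<dots> = (\<integral>p. W p * (\<xi> n p - indicat_real {u (snd p)<..} (fst p)) \<partial>lborel)"
    proof (intro Bochner_Integration.integral_cong refl)
      fix p :: "real \<times> real \<times> real"
      have l: "(fst p, fst (snd p), snd (snd p) + 2 * fst (snd p) * fst p) = lift_left (fst p) (snd p)"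
        unfolding lift_left_def by simp
      have "indicat_real E (lift_left (fst p) (snd p)) = indicat_real {u (snd p)<..} (fst p)"
        unfolding E_def by (simp add: indicator_def)
      then show "?f (fst p, fst (snd p), snd (snd p) + 2 * fst (snd p) * fst p) = W p * (\<xi> n p - indicat_real {u (snd p)<..} (fst p))"
        unfolding l W_def \<xi>_def by simp
    qed
    finally show ?thesis .
  qed
  obtain N where N: "N \<ge> 0" "\<And>p. \<bar>w p\<bar> \<le> N" using continuous_compact_support_bounded[OF cw wK w0] by blast
  obtain S where S: "\<forall>x\<in>fst ` ?K. norm x \<le> S"
    using compact_imp_bounded[OF compact_continuous_image[OF _ wK, of fst]] continuous_on_fst[OF continuous_on_id]
    unfolding bounded_iff by blast
  define S' where "S' = max 0 S"
  have S': "S' \<ge> 0" "\<And>p. p \<in> ?K \<Longrightarrow> \<bar>fst p\<bar> \<le> S'" using S unfolding S'_def by force+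
  have lK: "compact (leftq ` ?K)" using compact_continuous_image[OF continuous_leftq wK] .
  have lKD: "leftq ` ?K \<subseteq> D" using wD unfolding cylL_eq by auto
  obtain \<kappa>' where k': "\<kappa>' \<ge> 0" "\<forall>n s q. \<bar>s\<bar> \<le> S' \<longrightarrow> \<kappa>' * h n < \<bar>s - u q\<bar> \<longrightarrow>
        (u (leftq (lift_left s q + (- h n) *\<^sub>R Z (lift_left s q))) < fst (lift_left s q + (- h n) *\<^sub>R Z (lift_left s q)) \<longleftrightarrow> u q < s)"
    using far[OF S'(1)] by blast
  have "(\<lambda>n. (\<integral>p. W p * (\<xi> n p - indicat_real {u (snd p)<..} (fst p)) \<partial>lborel) / h n) \<longlonglongrightarrow> (\<integral>q. a q * W (u q, q) \<partial>lborel)"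
  proof (rule flux_limit[where N=N and S=S' and K="leftq ` ?K" and \<kappa>'=\<kappa>'])
    show "continuous_on UNIV W" unfolding W_def by (rule continuous_on_compose2[OF cw continuous_lift_left]) auto
    show "\<bar>W p\<bar> \<le> N" for p unfolding W_def by (rule N)
    show "W (s, q) = 0" if "S' < \<bar>s\<bar>" for s q
    proof -
      have "lift_left s q \<notin> ?K" using S'(2)[of "lift_left s q"] that by auto
      then show ?thesis unfolding W_def using w0[of "lift_left s q"] by simp
    qed
    show "W (s, q) = 0" if "q \<notin> leftq ` ?K" for s q
    proof -
      have "lift_left s q \<notin> ?K" using that image_eqI[of q leftq "lift_left s q" ?K] by auto
      then show ?thesis unfolding W_def using w0[of "lift_left s q"] by simp
    qed
    show "(\<lambda>q. a q * W (u q, q)) \<in> borel_measurable borel" unfolding W_def using am by simp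
    show "\<xi> n p \<in> {0, 1}" for n p unfolding \<xi>_def by (simp add: indicator_def)
    show "\<xi> n (s, q) = indicat_real {u q<..} s" if "\<bar>s\<bar> \<le> S'" "\<kappa>' * h n < \<bar>s - u q\<bar>" for n s q
    proof -
      have iff: "(u (leftq (lift_left s q + (- h n) *\<^sub>R Z (lift_left s q))) < fst (lift_left s q + (- h n) *\<^sub>R Z (lift_left s q))) = (u q < s)"
        using k'(2) that by blast
      show ?thesis unfolding \<xi>_def E_def indicator_def mem_Collect_eq fst_conv snd_conv greaterThan_iff iff ..
    qed
    show "\<exists>\<kappa>\<ge>0. eventually (\<lambda>n. \<forall>s. \<bar>s\<bar> \<le> S' \<longrightarrow> \<kappa> * (h n)\<^sup>2 < \<bar>s - (u q - a q * h n)\<bar> \<longrightarrow> \<xi> n (s, q) = indicat_real {u q - a q * h n<..} s) sequentially"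
      if "q \<in> leftq ` ?K" for q
    proof -
      have "q \<in> D" using that lKD by blast
      from ev[OF this S'(1)] obtain \<kappa> where k: "\<kappa> \<ge> 0" "eventually (\<lambda>n. \<forall>s. \<bar>s\<bar> \<le> S' \<longrightarrow> \<kappa> * (h n)\<^sup>2 < \<bar>s - (u q - a q * h n)\<bar> \<longrightarrow>
        (u (leftq (lift_left s q + (- h n) *\<^sub>R Z (lift_left s q))) < fst (lift_left s q + (- h n) *\<^sub>R Z (lift_left s q)) \<longleftrightarrow> u q - a q * h n < s)) sequentially"
        by blast
      have "eventually (\<lambda>n. \<forall>s. \<bar>s\<bar> \<le> S' \<longrightarrow> \<kappa> * (h n)\<^sup>2 < \<bar>s - (u q - a q * h n)\<bar> \<longrightarrow> \<xi> n (s, q) = indicat_real {u q - a q * h n<..} s) sequentially"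
        using k(2)
      proof (rule eventually_mono, intro allI impI)
        fix n s
        assume "\<forall>s. \<bar>s\<bar> \<le> S' \<longrightarrow> \<kappa> * (h n)\<^sup>2 < \<bar>s - (u q - a q * h n)\<bar> \<longrightarrow>
          (u (leftq (lift_left s q + (- h n) *\<^sub>R Z (lift_left s q))) < fst (lift_left s q + (- h n) *\<^sub>R Z (lift_left s q)) \<longleftrightarrow> u q - a q * h n < s)"
          "\<bar>s\<bar> \<le> S'" "\<kappa> * (h n)\<^sup>2 < \<bar>s - (u q - a q * h n)\<bar>"
        then have iff: "(u (leftq (lift_left s q + (- h n) *\<^sub>R Z (lift_left s q))) < fst (lift_left s q + (- h n) *\<^sub>R Z (lift_left s q))) = (u q - a q * h n < s)"
          by blast
        show "\<xi> n (s, q) = indicat_real {u q - a q * h n<..} s"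
          unfolding \<xi>_def E_def indicator_def mem_Collect_eq fst_conv snd_conv greaterThan_iff iff ..
      qed
      then show ?thesis using k(1) by blast
    qed
  qed (use h lK cu xim k'(1) in auto)
  then have "(\<lambda>n. (\<integral>p. w p * (indicat_real E (p + (- h n) *\<^sub>R Z p) - indicat_real E p) \<partial>lborel) / h n) \<longlonglongrightarrow> (\<integral>q. a q * W (u q, q) \<partial>lborel)"
    unfolding eq .
  from LIMSEQ_unique[OF L1 this] show ?thesis unfolding eqE W_def by simp
qed

text \<open>The backward flow of X keeps the left coordinates and lowers the first coordinate by
  \<open>h\<close>, so the end of each half-line rises by exactly \<open>h\<close>, which is the
  case \<open>a = - 1\<close>.\<close>

lemma green_X:
  assumes cu: "continuous_on UNIV u" and w: "C1c w (cylL D)"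
  shows "(\<integral>p. indicat_real (Eepi D u) p * Xop w p \<partial>lborel) = (\<integral>q. - w (lift_left (u q) q) \<partial>lborel)"
proof -
  have wC: "C1 w" using w unfolding C1c_iff by simp
  define h where "h n = inverse (real (Suc n))" for n
  have h: "0 < h n" "h n \<le> 1" "h \<longlonglongrightarrow> 0" for n
    unfolding h_def using LIMSEQ_inverse_real_of_nat by (auto simp: inverse_le_1_iff)
  have st: "leftq (lift_left s q + (- z) *\<^sub>R Xv (lift_left s q)) = q" "fst (lift_left s q + (- z) *\<^sub>R Xv (lift_left s q)) = s - z" for s q z
    unfolding leftq_def lift_left_def Xv_def by (cases q, simp add: algebra_simps)+
  have "(\<integral>p. indicat_real (Eepi D u) p * frechet_derivative w (at p) (Xv p) \<partial>lborel) = (\<integral>q. (\<lambda>_. - 1) q * w (lift_left (u q) q) \<partial>lborel)"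
  proof (rule green_flow[OF cu w Xv_flow continuous_Xop[OF wC] h])
    show "(\<lambda>q. (- 1) * w (lift_left (u q) q)) \<in> borel_measurable borel"
    proof (intro borel_measurable_continuous_onI continuous_intros continuous_on_compose2[OF C1_continuous[OF wC]])
      show "continuous_on UNIV (\<lambda>q. lift_left (u q) q)" unfolding lift_left_def by (intro continuous_intros cu)
    qed auto
    show "\<exists>\<kappa>\<ge>0. \<forall>n s q. \<bar>s\<bar> \<le> S \<longrightarrow> \<kappa> * h n < \<bar>s - u q\<bar> \<longrightarrow>
        (u (leftq (lift_left s q + (- h n) *\<^sub>R Xv (lift_left s q))) < fst (lift_left s q + (- h n) *\<^sub>R Xv (lift_left s q)) \<longleftrightarrow> u q < s)" for S
      unfolding st
    proof (intro exI[of _ 1] conjI allI impI)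
      fix n s q assume "1 * h n < \<bar>s - u q\<bar>"
      then show "(u q < s - h n) = (u q < s)" using h(1)[of n] by linarith
    qed simp
    show "\<exists>\<kappa>\<ge>0. eventually (\<lambda>n. \<forall>s. \<bar>s\<bar> \<le> S \<longrightarrow> \<kappa> * (h n)\<^sup>2 < \<bar>s - (u q - (- 1) * h n)\<bar> \<longrightarrow>
        (u (leftq (lift_left s q + (- h n) *\<^sub>R Xv (lift_left s q))) < fst (lift_left s q + (- h n) *\<^sub>R Xv (lift_left s q)) \<longleftrightarrow> u q - (- 1) * h n < s)) sequentially" for q S
      unfolding st
    proof (intro exI[of _ 0] conjI always_eventually allI impI)
      fix n s show "(u q < s - h n) = (u q - (- 1) * h n < s)" by linarith
    qed simp
  qed
  then show ?thesis unfolding Xop_eq by simp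
qed

text \<open>The backward flow of Y takes height \<open>s\<close> over \<open>q\<close> to the same
  height over \<open>(fst q - h, snd q + 4 * h * s)\<close>. For \<open>s\<close> near
  \<open>u q\<close> this base point is close to the arc through \<open>q\<close> at time
  \<open>- h\<close>, where \<open>u\<close> has the value \<open>u q - \<beta> q * h\<close>. Hence
  \<open>a\<close> is the slope, found without a derivative of \<open>u\<close>.\<close>

lemma green_Y:
  assumes lip: "C-lipschitz_on UNIV u" and op: "open D" and arcs: "local_arcs D u \<beta>" and w: "C1c w (cylL D)"
  shows "(\<integral>p. indicat_real (Eepi D u) p * Yop w p \<partial>lborel) = (\<integral>q. indicat_real D q * (\<beta> q * w (lift_left (u q) q)) \<partial>lborel)"
proof -
  have cu: "continuous_on UNIV u" using lip by (rule lipschitz_on_continuous_on)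
  have C0: "C \<ge> 0" using lip by (rule lipschitz_on_nonneg)
  have uL: "\<bar>u p - u q\<bar> \<le> C * dist p q" for p q using lipschitz_onD[OF lip, of p q] by (simp add: dist_real_def)
  have wC: "C1 w" using w unfolding C1c_iff by simp
  have wD: "w p = 0" if "leftq p \<notin> D" for p
    using that w closure_subset[of "{p. w p \<noteq> 0}"] unfolding C1c_iff cylL_eq by blast
  define h where "h n = inverse (real (Suc n))" for n
  have h: "0 < h n" "h n \<le> 1" "h \<longlonglongrightarrow> 0" for n
    unfolding h_def using LIMSEQ_inverse_real_of_nat by (auto simp: inverse_le_1_iff)
  have st: "leftq (lift_left s q + (- z) *\<^sub>R Yv (lift_left s q)) = (fst q - z, snd q + 4 * z * s)" "fst (lift_left s q + (- z) *\<^sub>R Yv (lift_left s q)) = s" for s q z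
    unfolding leftq_def lift_left_def Yv_def by (cases q, simp add: algebra_simps)+
  have "(\<integral>p. indicat_real (Eepi D u) p * frechet_derivative w (at p) (Yv p) \<partial>lborel) = (\<integral>q. \<beta> q * w (lift_left (u q) q) \<partial>lborel)"
  proof (rule green_flow[OF cu w Yv_flow continuous_Yop[OF wC] h])
    have cl: "continuous_on UNIV (\<lambda>q. w (lift_left (u q) q))"
    proof (rule continuous_on_compose2[OF C1_continuous[OF wC]])
      show "continuous_on UNIV (\<lambda>q. lift_left (u q) q)" unfolding lift_left_def by (intro continuous_intros cu)
    qed auto
    have "(\<lambda>q. indicat_real D q *\<^sub>R (\<beta> q * w (lift_left (u q) q))) \<in> borel_measurable borel"
      using op by (intro borel_measurable_continuous_on_indicator continuous_on_mult local_arcs_continuous[OF arcs] continuous_on_subset[OF cl]) auto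
    moreover have "(\<lambda>q. indicat_real D q *\<^sub>R (\<beta> q * w (lift_left (u q) q))) = (\<lambda>q. \<beta> q * w (lift_left (u q) q))"
    proof
      fix q show "indicat_real D q *\<^sub>R (\<beta> q * w (lift_left (u q) q)) = \<beta> q * w (lift_left (u q) q)"
        using wD[of "lift_left (u q) q"] by (cases "q \<in> D") auto
    qed
    ultimately show "(\<lambda>q. \<beta> q * w (lift_left (u q) q)) \<in> borel_measurable borel" by (simp only:)
    show "\<exists>\<kappa>\<ge>0. \<forall>n s q. \<bar>s\<bar> \<le> S \<longrightarrow> \<kappa> * h n < \<bar>s - u q\<bar> \<longrightarrow>
        (u (leftq (lift_left s q + (- h n) *\<^sub>R Yv (lift_left s q))) < fst (lift_left s q + (- h n) *\<^sub>R Yv (lift_left s q)) \<longleftrightarrow> u q < s)" if S: "0 \<le> S" for S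
      unfolding st
    proof (intro exI[of _ "C * (1 + 4 * S)"] conjI allI impI)
      show "0 \<le> C * (1 + 4 * S)" using C0 S by simp
      fix n s q assume s: "\<bar>s\<bar> \<le> S" and f: "C * (1 + 4 * S) * h n < \<bar>s - u q\<bar>"
      have "dist (fst q - h n, snd q + 4 * h n * s) q \<le> h n + 4 * h n * \<bar>s\<bar>"
        unfolding dist_norm using norm_pair_le[of "- h n" "4 * h n * s"] h(1)[of n]
        by (cases q) (simp add: abs_mult)
      also have "\<dots> \<le> (1 + 4 * S) * h n" using s h(1)[of n] by (simp add: algebra_simps mult_left_mono)
      finally have "C * dist (fst q - h n, snd q + 4 * h n * s) q \<le> C * ((1 + 4 * S) * h n)" using C0 by (rule mult_left_mono)
      then have "\<bar>u (fst q - h n, snd q + 4 * h n * s) - u q\<bar> \<le> C * (1 + 4 * S) * h n"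
        using uL[of "(fst q - h n, snd q + 4 * h n * s)" q] by (simp add: mult.assoc)
      then show "(u (fst q - h n, snd q + 4 * h n * s) < s) = (u q < s)" using f by linarith
    qed
    show "\<exists>\<kappa>\<ge>0. eventually (\<lambda>n. \<forall>s. \<bar>s\<bar> \<le> S \<longrightarrow> \<kappa> * (h n)\<^sup>2 < \<bar>s - (u q - \<beta> q * h n)\<bar> \<longrightarrow>
        (u (leftq (lift_left s q + (- h n) *\<^sub>R Yv (lift_left s q))) < fst (lift_left s q + (- h n) *\<^sub>R Yv (lift_left s q)) \<longleftrightarrow> u q - \<beta> q * h n < s)) sequentially"
      if q: "q \<in> D" for q S
      unfolding st
    \<comment> \<open>With \<open>d = s - (u q - \<beta> q * h)\<close> the base point misses the
      arc by \<open>\<bar>4 * h * d - 2 * \<beta> q * h\<^sup>2\<bar>\<close>. Once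
      \<open>8 * C * h < 1\<close>, the Lipschitz error is at most \<open>\<bar>d\<bar> / 2 + 2 * C
      * \<bar>\<beta> q\<bar> * h\<^sup>2\<close>, which is below \<open>\<bar>d\<bar>\<close>
      beyond this threshold; the sign of \<open>d\<close> then decides the side.\<close>
    proof (intro exI[of _ "4 * C * \<bar>\<beta> q\<bar>"] conjI)
      show "0 \<le> 4 * C * \<bar>\<beta> q\<bar>" using C0 by simp
      obtain \<eta> where eta: "\<eta> > 0" "\<And>h. \<bar>h\<bar> < \<eta> \<Longrightarrow> u (arc_pt u (\<beta> q) q h) = u q + \<beta> q * h"
        using arcs q unfolding local_arcs_def by (metis centre_in_ball)
      have e1: "eventually (\<lambda>n. h n < \<eta>) sequentially" using order_tendstoD(2)[OF h(3) eta(1)] .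
      have "(\<lambda>n. (8 * C) * h n) \<longlonglongrightarrow> 0" using tendsto_mult[OF tendsto_const[of "8 * C"] h(3)] by simp
      then have e2: "eventually (\<lambda>n. (8 * C) * h n < 1) sequentially" by (rule order_tendstoD(2)) simp
      show "eventually (\<lambda>n. \<forall>s. \<bar>s\<bar> \<le> S \<longrightarrow> 4 * C * \<bar>\<beta> q\<bar> * (h n)\<^sup>2 < \<bar>s - (u q - \<beta> q * h n)\<bar> \<longrightarrow>
        (u (fst q - h n, snd q + 4 * h n * s) < s) = (u q - \<beta> q * h n < s)) sequentially"
        using e1 e2
      proof (eventually_elim, intro allI impI)
        fix n s
        assume n1: "h n < \<eta>" and n2: "8 * C * h n < 1" and f: "4 * C * \<bar>\<beta> q\<bar> * (h n)\<^sup>2 < \<bar>s - (u q - \<beta> q * h n)\<bar>"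
        define d where "d = s - (u q - \<beta> q * h n)"
        define B where "B = C * \<bar>\<beta> q\<bar> * (h n)\<^sup>2"
        have ua: "u (arc_pt u (\<beta> q) q (- h n)) = u q - \<beta> q * h n" using eta(2)[of "- h n"] n1 h(1)[of n] by simp
        have "dist (fst q - h n, snd q + 4 * h n * s) (arc_pt u (\<beta> q) q (- h n)) = \<bar>4 * h n * d - 2 * \<beta> q * (h n)\<^sup>2\<bar>"
        proof -
          define k where "k = 4 * h n * d - 2 * \<beta> q * (h n)\<^sup>2"
          have "arc_pt u (\<beta> q) q (- h n) = (fst q - h n, snd q + 4 * h n * s - k)"
            unfolding arc_pt_def k_def d_def by (simp add: algebra_simps power2_eq_square)
          then show ?thesis unfolding k_def[symmetric] by (simp add: dist_Pair_Pair dist_real_def)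
        qed
        also have "\<dots> \<le> 4 * h n * \<bar>d\<bar> + 2 * (\<bar>\<beta> q\<bar> * (h n)\<^sup>2)"
        proof -
          have "\<bar>4 * h n * d\<bar> = 4 * h n * \<bar>d\<bar>" "\<bar>2 * \<beta> q * (h n)\<^sup>2\<bar> = 2 * (\<bar>\<beta> q\<bar> * (h n)\<^sup>2)" using h(1)[of n] by (simp_all add: abs_mult)
          then show ?thesis using abs_triangle_ineq4[of "4 * h n * d" "2 * \<beta> q * (h n)\<^sup>2"] by linarith
        qed
        finally have "C * dist (fst q - h n, snd q + 4 * h n * s) (arc_pt u (\<beta> q) q (- h n)) \<le> C * (4 * h n * \<bar>d\<bar> + 2 * (\<bar>\<beta> q\<bar> * (h n)\<^sup>2))"
          using C0 by (rule mult_left_mono)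
        then have "\<bar>u (fst q - h n, snd q + 4 * h n * s) - (u q - \<beta> q * h n)\<bar> \<le> C * (4 * h n * \<bar>d\<bar> + 2 * (\<bar>\<beta> q\<bar> * (h n)\<^sup>2))"
          using uL[of "(fst q - h n, snd q + 4 * h n * s)" "arc_pt u (\<beta> q) q (- h n)"] unfolding ua by linarith
        also have "\<dots> = (8 * C * h n) * (\<bar>d\<bar> / 2) + 2 * B" unfolding B_def by (simp add: algebra_simps)
        also have "\<dots> \<le> 1 * (\<bar>d\<bar> / 2) + 2 * B" using n2 by (intro add_right_mono mult_right_mono) auto
        finally have "\<bar>u (fst q - h n, snd q + 4 * h n * s) - (u q - \<beta> q * h n)\<bar> \<le> \<bar>d\<bar> / 2 + 2 * B" by simp
        moreover have "4 * B < \<bar>d\<bar>" using f unfolding B_def d_def by (simp add: mult.assoc)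
        ultimately have "\<bar>u (fst q - h n, snd q + 4 * h n * s) - (u q - \<beta> q * h n)\<bar> < \<bar>d\<bar>" by linarith
        then show "(u (fst q - h n, snd q + 4 * h n * s) < s) = (u q - \<beta> q * h n < s)" unfolding d_def by linarith
      qed
    qed
  qed
  also have "\<dots> = (\<integral>q. indicat_real D q * (\<beta> q * w (lift_left (u q) q)) \<partial>lborel)"
  proof (intro Bochner_Integration.integral_cong refl)
    fix q show "\<beta> q * w (lift_left (u q) q) = indicat_real D q * (\<beta> q * w (lift_left (u q) q))"
      using wD[of "lift_left (u q) q"] by (cases "q \<in> D") auto
  qed
  finally show ?thesis unfolding Yop_eq .
qed

lemma lift_left_in_Sgraph: "q \<in> D \<Longrightarrow> lift_left (u q) q \<in> Sgraph D u"
  unfolding Sgraph_eq by simp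

lemma continuous_on_lift_left:
  "continuous_on S f \<Longrightarrow> continuous_on S g \<Longrightarrow> continuous_on S (\<lambda>x. lift_left (f x) (g x))"
  unfolding lift_left_def by (intro continuous_intros)

lemma continuous_on_lift_right:
  "continuous_on S f \<Longrightarrow> continuous_on S g \<Longrightarrow> continuous_on S (\<lambda>x. lift_right (f x) (g x))"
  unfolding lift_right_def by (intro continuous_intros)

section \<open>Comparison of the two epigraphs near the graph\<close>

text \<open>Left coordinates split a neighbourhood of a graph point into two connected halves. On
  each half \<open>fst x - v (rightq x)\<close> has no zero, as both graphs are the same set, so its
  sign is constant there; and both signs occur. So the sides either match or are exchanged.\<close>

lemma graph_sides_dichotomy:
  fixes u v :: "real \<times> real \<Rightarrow> real"
  assumes op: "open D" and cu: "continuous_on D u" and opr: "open Dr" and cv: "continuous_on Dr v"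
    and gr: "Sgraph D u = SgraphR Dr v" and q: "q \<in> D"
  shows "\<exists>U. open U \<and> lift_left (u q) q \<in> U \<and> U \<subseteq> cylL D \<inter> cylR Dr \<and>
     ((\<forall>x\<in>U - Sgraph D u. u (leftq x) < fst x \<longleftrightarrow> v (rightq x) < fst x) \<or>
      (\<forall>x\<in>U - Sgraph D u. u (leftq x) < fst x \<longleftrightarrow> \<not> v (rightq x) < fst x))"
proof -
  define Om where "Om = cylL D \<inter> cylR Dr"
  have Om: "open Om" unfolding Om_def using open_cylL[OF op] open_cylR[OF opr] by blast
  have S0: "x \<in> Sgraph D u \<longleftrightarrow> fst x = u (leftq x)" "x \<in> Sgraph D u \<longleftrightarrow> fst x = v (rightq x)" if "x \<in> Om" for x
  proof -
    show "x \<in> Sgraph D u \<longleftrightarrow> fst x = u (leftq x)"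
      using that unfolding Om_def cylL_eq Sgraph_eq by simp
    show "x \<in> Sgraph D u \<longleftrightarrow> fst x = v (rightq x)"
      using that unfolding gr Om_def cylR_eq SgraphR_eq by simp
  qed
  let ?p0 = "lift_left (u q) q"
  have p0S: "?p0 \<in> Sgraph D u" by (rule lift_left_in_Sgraph[OF q])
  have p0O: "?p0 \<in> Om" using p0S unfolding Om_def cylL_eq cylR_eq
    using p0S[unfolded gr SgraphR_eq] p0S[unfolded Sgraph_eq] by simp
  \<comment> \<open>\<open>\<Psi>\<close> straightens the graph: its second argument is the height
    above it, so the two halves are images of products of connected sets.\<close>
  define \<Psi> where "\<Psi> x = lift_left (u (fst x) + snd x) (fst x)" for x :: "(real \<times> real) \<times> real"
  have cPsi: "continuous_on (D \<times> UNIV) \<Psi>" unfolding \<Psi>_def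
    by (intro continuous_on_lift_left continuous_intros continuous_on_compose2[OF cu]) auto
  have "open ((D \<times> UNIV) \<inter> \<Psi> -` Om)"
    using continuous_open_preimage[OF cPsi _ Om] op open_Times by blast
  moreover have "(q, 0) \<in> (D \<times> UNIV) \<inter> \<Psi> -` Om" using q p0O unfolding \<Psi>_def by simp
  ultimately obtain A B where AB: "open A" "open B" "(q, 0) \<in> A \<times> B" "A \<times> B \<subseteq> (D \<times> UNIV) \<inter> \<Psi> -` Om"
    by (rule open_prod_elim)
  have qA: "q \<in> A" and zB: "0 \<in> B" using AB(3) by auto
  obtain r where r: "r > 0" "ball q r \<subseteq> A" using AB(1) qA by (rule openE)
  obtain \<epsilon> where ep: "\<epsilon> > 0" "ball 0 \<epsilon> \<subseteq> B" using AB(2) zB by (rule openE)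
  have sub: "ball q r \<subseteq> D" using r(2) AB(4) zB by blast
  have PO: "\<Psi> (x, z) \<in> Om" if "x \<in> ball q r" "\<bar>z\<bar> < \<epsilon>" for x z
  proof -
    have "z \<in> ball 0 \<epsilon>" using that by simp
    then show ?thesis using that r ep AB(4) by blast
  qed
  define U where "U = {x. leftq x \<in> ball q r} \<inter> {x \<in> cylL D. \<bar>fst x - u (leftq x)\<bar> < \<epsilon>}"
  have cF: "continuous_on (cylL D) (\<lambda>x. \<bar>fst x - u (leftq x)\<bar>)"
    by (intro continuous_intros continuous_on_compose2[OF cu continuous_leftq]) (auto simp: cylL_eq)
  have "open {x \<in> cylL D. \<bar>fst x - u (leftq x)\<bar> < \<epsilon>}"
  proof -
    have "{x \<in> cylL D. \<bar>fst x - u (leftq x)\<bar> < \<epsilon>} = cylL D \<inter> (\<lambda>x. \<bar>fst x - u (leftq x)\<bar>) -` {..<\<epsilon>}" by auto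
    then show ?thesis using continuous_open_preimage[OF cF open_cylL[OF op] open_lessThan] by simp
  qed
  moreover have "open {x. leftq x \<in> ball q r}"
    using open_cylL[OF open_ball[of q r]] unfolding cylL_eq .
  ultimately have opU: "open U" unfolding U_def by blast
  have p0U: "?p0 \<in> U" unfolding U_def cylL_eq using q r ep by simp
  have Urep: "\<exists>y z. x = \<Psi> (y, z) \<and> y \<in> ball q r \<and> z = fst x - u (leftq x) \<and> \<bar>z\<bar> < \<epsilon>" if "x \<in> U" for x
    using that unfolding U_def \<Psi>_def
    by (intro exI[of _ "leftq x"] exI[of _ "fst x - u (leftq x)"]) auto
  have UO: "U \<subseteq> Om" using Urep PO by blast
  have PU: "\<Psi> (y, z) \<in> U" "fst (\<Psi> (y, z)) - u (leftq (\<Psi> (y, z))) = z" if "y \<in> ball q r" "\<bar>z\<bar> < \<epsilon>" for y z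
    using that sub unfolding U_def \<Psi>_def cylL_eq by auto
  define F where "F x = fst x - v (rightq x)" for x
  have cFr: "continuous_on Om F" unfolding F_def
    by (intro continuous_intros continuous_on_compose2[OF cv continuous_rightq]) (auto simp: Om_def cylR_eq)
  have sgn: "(\<forall>x\<in>\<Psi> ` (ball q r \<times> Z). F x > 0) \<or> (\<forall>x\<in>\<Psi> ` (ball q r \<times> Z). F x < 0)"
    if Z: "connected Z" "\<And>z. z \<in> Z \<Longrightarrow> \<bar>z\<bar> < \<epsilon> \<and> z \<noteq> 0" for Z
  proof -
    let ?T = "\<Psi> ` (ball q r \<times> Z)"
    have TO: "?T \<subseteq> Om" using PO Z(2) by auto
    have "connected ?T"
    proof (rule connected_continuous_image)
      show "continuous_on (ball q r \<times> Z) \<Psi>" by (rule continuous_on_subset[OF cPsi]) (use sub in auto)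
      show "connected (ball q r \<times> Z)" by (intro connected_Times Z(1)) simp
    qed
    then have cT: "connected (F ` ?T)" by (rule connected_continuous_image[OF continuous_on_subset[OF cFr TO]])
    have nz: "F x \<noteq> 0" if xT: "x \<in> ?T" for x
    proof -
      obtain y z where yz: "x = \<Psi> (y, z)" "y \<in> ball q r" "z \<in> Z" using xT by blast
      then have "fst x \<noteq> u (leftq x)" using PU(2)[of y z] Z(2)[of z] by auto
      then show ?thesis using S0[of x] TO xT unfolding F_def by auto
    qed
    show ?thesis
    proof (rule ccontr)
      assume "\<not> ?thesis"
      then obtain x y where "x \<in> ?T" "\<not> F x > 0" "y \<in> ?T" "\<not> F y < 0" by blast
      then have "F x \<in> F ` ?T" "F y \<in> F ` ?T" "F x \<le> 0" "0 \<le> F y" by (simp_all add: not_less)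
      then have "0 \<in> F ` ?T" using connectedD_interval[OF cT] by blast
      then obtain x where "0 = F x" "x \<in> ?T" by (rule imageE)
      then show False using nz by metis
    qed
  qed
  have sp: "(\<forall>x\<in>\<Psi> ` (ball q r \<times> {0<..<\<epsilon>}). F x > 0) \<or> (\<forall>x\<in>\<Psi> ` (ball q r \<times> {0<..<\<epsilon>}). F x < 0)"
    by (rule sgn) auto
  have sm: "(\<forall>x\<in>\<Psi> ` (ball q r \<times> {-\<epsilon><..<0}). F x > 0) \<or> (\<forall>x\<in>\<Psi> ` (ball q r \<times> {-\<epsilon><..<0}). F x < 0)"
    by (rule sgn) auto
  have Uc: "x \<in> \<Psi> ` (ball q r \<times> {0<..<\<epsilon>}) \<and> u (leftq x) < fst x \<or> x \<in> \<Psi> ` (ball q r \<times> {-\<epsilon><..<0}) \<and> fst x < u (leftq x)"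
    if xU: "x \<in> U" "x \<notin> Sgraph D u" for x
  proof -
    obtain y z where yz: "x = \<Psi> (y, z)" "y \<in> ball q r" "z = fst x - u (leftq x)" "\<bar>z\<bar> < \<epsilon>" using Urep[OF xU(1)] by blast
    have "z \<noteq> 0" using S0(1)[OF subsetD[OF UO xU(1)]] xU(2) yz(3) by simp
    then consider "z > 0" | "z < 0" by linarith
    then show ?thesis
    proof cases
      case 1
      then have "(y, z) \<in> ball q r \<times> {0<..<\<epsilon>}" using yz(2,4) by simp
      then have "x \<in> \<Psi> ` (ball q r \<times> {0<..<\<epsilon>})" unfolding yz(1) by (rule imageI)
      moreover have "u (leftq x) < fst x" using 1 yz(3) by linarith
      ultimately show ?thesis by (intro disjI1 conjI)
    next
      case 2
      then have "(y, z) \<in> ball q r \<times> {-\<epsilon><..<0}" using yz(2,4) by simp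
      then have "x \<in> \<Psi> ` (ball q r \<times> {-\<epsilon><..<0})" unfolding yz(1) by (rule imageI)
      moreover have "fst x < u (leftq x)" using 2 yz(3) by linarith
      ultimately show ?thesis by (intro disjI2 conjI)
    qed
  qed
  \<comment> \<open>The line through the graph point along its right coset. On it
    \<open>fst x - v (rightq x)\<close> equals the parameter, so both signs are taken near the
    point.\<close>
  define \<Theta> where "\<Theta> z = lift_right (u q + z) (rightq ?p0)" for z
  have vr: "v (rightq ?p0) = u q" "rightq ?p0 \<in> Dr" using p0S unfolding gr SgraphR_eq by auto
  have "\<Theta> 0 = ?p0" using lift_simps(6)[of ?p0] unfolding \<Theta>_def by simp
  moreover have "continuous_on UNIV \<Theta>" unfolding \<Theta>_def by (intro continuous_on_lift_right continuous_intros)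
  ultimately have "open (\<Theta> -` U)" "0 \<in> \<Theta> -` U" using open_vimage[OF opU] p0U by auto
  then obtain d where d: "d > 0" "ball 0 d \<subseteq> \<Theta> -` U" using open_contains_ball by blast
  have FT: "F (\<Theta> z) = z" for z unfolding F_def \<Theta>_def by (simp add: vr)
  have "d / 2 \<in> ball 0 d" "- (d / 2) \<in> ball 0 d" using d by auto
  then have T: "\<Theta> (d / 2) \<in> U" "\<Theta> (- (d / 2)) \<in> U" using d(2) by blast+
  have TS: "\<Theta> (d / 2) \<notin> Sgraph D u" "\<Theta> (- (d / 2)) \<notin> Sgraph D u"
    using S0(2)[OF subsetD[OF UO T(1)]] S0(2)[OF subsetD[OF UO T(2)]] FT[of "d / 2"] FT[of "- (d / 2)"] d(1) unfolding F_def by linarith+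
  have Fp: "F (\<Theta> (d / 2)) > 0" "F (\<Theta> (- (d / 2))) < 0" using FT[of "d / 2"] FT[of "- (d / 2)"] d(1) by auto
  have Fv: "v (rightq x) < fst x \<longleftrightarrow> F x > 0" for x unfolding F_def by simp
  have res: "(\<forall>x\<in>U - Sgraph D u. u (leftq x) < fst x \<longleftrightarrow> v (rightq x) < fst x) \<or>
      (\<forall>x\<in>U - Sgraph D u. u (leftq x) < fst x \<longleftrightarrow> \<not> v (rightq x) < fst x)"
  proof (cases "\<forall>x\<in>\<Psi> ` (ball q r \<times> {0<..<\<epsilon>}). F x > 0")
    case True
    have "\<Theta> (- (d / 2)) \<in> \<Psi> ` (ball q r \<times> {-\<epsilon><..<0})"
      using Uc[OF T(2) TS(2)] True Fp(2) by (meson less_asym)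
    then have m: "\<forall>x\<in>\<Psi> ` (ball q r \<times> {-\<epsilon><..<0}). F x < 0" using sm Fp(2) by (meson less_asym)
    have "u (leftq x) < fst x \<longleftrightarrow> v (rightq x) < fst x" if "x \<in> U - Sgraph D u" for x
    proof -
      have x: "x \<in> U" "x \<notin> Sgraph D u" using that by auto
      from Uc[OF x] show ?thesis
      proof
        assume "x \<in> \<Psi> ` (ball q r \<times> {0<..<\<epsilon>}) \<and> u (leftq x) < fst x"
        then show ?thesis using True unfolding Fv by blast
      next
        assume a: "x \<in> \<Psi> ` (ball q r \<times> {-\<epsilon><..<0}) \<and> fst x < u (leftq x)"
        then have "F x < 0" using m by blast
        then show ?thesis using a unfolding Fv by (meson less_asym)
      qed
    qed
    then show ?thesis by blast
  next
    case False
    then have p: "\<forall>x\<in>\<Psi> ` (ball q r \<times> {0<..<\<epsilon>}). F x < 0" using sp by blast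
    have "\<Theta> (d / 2) \<in> \<Psi> ` (ball q r \<times> {-\<epsilon><..<0})"
      using Uc[OF T(1) TS(1)] p Fp(1) by (meson less_asym)
    then have m: "\<forall>x\<in>\<Psi> ` (ball q r \<times> {-\<epsilon><..<0}). F x > 0" using sm Fp(1) by (meson less_asym)
    have "u (leftq x) < fst x \<longleftrightarrow> \<not> v (rightq x) < fst x" if "x \<in> U - Sgraph D u" for x
    proof -
      have x: "x \<in> U" "x \<notin> Sgraph D u" using that by auto
      from Uc[OF x] show ?thesis
      proof
        assume a: "x \<in> \<Psi> ` (ball q r \<times> {0<..<\<epsilon>}) \<and> u (leftq x) < fst x"
        then have "F x < 0" using p by blast
        then show ?thesis using a unfolding Fv by (meson less_asym)
      next
        assume a: "x \<in> \<Psi> ` (ball q r \<times> {-\<epsilon><..<0}) \<and> fst x < u (leftq x)"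
        then have "F x > 0" using m by blast
        then show ?thesis using a unfolding Fv by (meson less_asym)
      qed
    qed
    then show ?thesis by blast
  qed
  show ?thesis using opU p0U UO res unfolding Om_def by blast
qed

text \<open>Matching and exchanged sides are open conditions on the graph point, and they exclude
  each other because every neighbourhood contains points just above the graph. Connectedness of
  \<open>D\<close> spreads the matching from a point with \<open>y = 0\<close>.\<close>

lemma epigraphs_agree_near_graph:
  fixes u v :: "real \<times> real \<Rightarrow> real"
  assumes op: "open D" and conn: "connected D" and cu: "continuous_on D u" and opr: "open Dr" and cv: "continuous_on Dr v"
    and gr: "Sgraph D u = SgraphR Dr v" and q1: "q1 \<in> D" "fst q1 = 0"
  shows "\<exists>U. open U \<and> Sgraph D u \<subseteq> U \<and> U \<subseteq> cylL D \<inter> cylR Dr \<and> (\<forall>x\<in>U. x \<in> Eepi D u \<longleftrightarrow> x \<in> EepiR Dr v)"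
proof -
  let ?S = "Sgraph D u"
  define good where "good U \<longleftrightarrow> open U \<and> U \<subseteq> cylL D \<inter> cylR Dr \<and> (\<forall>x\<in>U - ?S. u (leftq x) < fst x \<longleftrightarrow> v (rightq x) < fst x)" for U
  define bad where "bad U \<longleftrightarrow> open U \<and> U \<subseteq> cylL D \<inter> cylR Dr \<and> (\<forall>x\<in>U - ?S. u (leftq x) < fst x \<longleftrightarrow> \<not> v (rightq x) < fst x)" for U
  define \<sigma> where "\<sigma> q = lift_left (u q) q" for q
  have cs: "continuous_on D \<sigma>" unfolding \<sigma>_def by (intro continuous_on_lift_left cu continuous_on_id)
  have pre: "open (D \<inter> \<sigma> -` U)" if "open U" for U using continuous_open_preimage[OF cs op that] .
  define G where "G = (\<Union>U\<in>Collect good. D \<inter> \<sigma> -` U)"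
  define B where "B = (\<Union>U\<in>Collect bad. D \<inter> \<sigma> -` U)"
  have oG: "open G" unfolding G_def by (intro open_UN ballI pre) (simp add: good_def)
  have oB: "open B" unfolding B_def by (intro open_UN ballI pre) (simp add: bad_def)
  have cov: "D \<subseteq> G \<union> B"
  proof
    fix q assume q: "q \<in> D"
    from graph_sides_dichotomy[OF op cu opr cv gr q] obtain U where
      "open U" "\<sigma> q \<in> U" "U \<subseteq> cylL D \<inter> cylR Dr"
      "(\<forall>x\<in>U - ?S. u (leftq x) < fst x \<longleftrightarrow> v (rightq x) < fst x) \<or> (\<forall>x\<in>U - ?S. u (leftq x) < fst x \<longleftrightarrow> \<not> v (rightq x) < fst x)"
      unfolding \<sigma>_def by blast
    then have "(good U \<or> bad U) \<and> q \<in> D \<inter> \<sigma> -` U" using q unfolding good_def bad_def by auto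
    then show "q \<in> G \<union> B" unfolding G_def B_def by blast
  qed
  have above: "\<exists>x\<in>U - ?S. leftq x = q \<and> u q < fst x" if U: "open U" "\<sigma> q \<in> U" and q: "q \<in> D" for U q
  proof -
    have "continuous_on UNIV (\<lambda>z. lift_left (u q + z) q)" by (intro continuous_on_lift_left continuous_intros)
    then have "open ((\<lambda>z. lift_left (u q + z) q) -` U)" using open_vimage[OF U(1)] by blast
    moreover have "0 \<in> (\<lambda>z. lift_left (u q + z) q) -` U" using U(2) unfolding \<sigma>_def by simp
    ultimately obtain d where d: "d > 0" "ball 0 d \<subseteq> (\<lambda>z. lift_left (u q + z) q) -` U" using open_contains_ball by blast
    have "d / 2 \<in> ball 0 d" using d(1) by simp
    then have "lift_left (u q + d / 2) q \<in> U" using d(2) by blast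
    moreover have "lift_left (u q + d / 2) q \<notin> ?S" unfolding Sgraph_eq using d(1) by simp
    ultimately show ?thesis using d(1) by (intro bexI[of _ "lift_left (u q + d / 2) q"]) auto
  qed
  have dis: "G \<inter> B \<inter> D = {}"
  proof (rule ccontr)
    assume "\<not> ?thesis"
    then obtain q where "q \<in> D" "q \<in> G" "q \<in> B" by blast
    moreover from \<open>q \<in> G\<close> obtain U where "good U" "\<sigma> q \<in> U" unfolding G_def by blast
    moreover from \<open>q \<in> B\<close> obtain V where "bad V" "\<sigma> q \<in> V" unfolding B_def by blast
    ultimately have q: "q \<in> D" "good U" "\<sigma> q \<in> U" "bad V" "\<sigma> q \<in> V" by blast+
    have "open (U \<inter> V)" "\<sigma> q \<in> U \<inter> V" using q unfolding good_def bad_def by auto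
    from above[OF this q(1)] show False using q(2,4) unfolding good_def bad_def by blast
  qed
  \<comment> \<open>At \<open>y = 0\<close> the left and the right coset are the same line and
    \<open>u\<close> and \<open>v\<close> agree, so a point above one graph is above the
    other.\<close>
  have "q1 \<notin> B"
  proof
    assume "q1 \<in> B"
    then obtain V where V: "bad V" "\<sigma> q1 \<in> V" unfolding B_def by blast
    then have "open V" unfolding bad_def by simp
    from above[OF this V(2) q1(1)] obtain x where x: "x \<in> V - ?S" "leftq x = q1" "u q1 < fst x" by blast
    have "fst (snd x) = 0" using x(2) q1(2) unfolding leftq_def by auto
    then have rx: "rightq x = q1" using x(2) unfolding leftq_def rightq_def by auto
    have "\<sigma> q1 \<in> SgraphR Dr v" unfolding gr[symmetric] \<sigma>_def by (rule lift_left_in_Sgraph[OF q1(1)])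
    moreover have "rightq (\<sigma> q1) = q1" using q1(2) unfolding \<sigma>_def rightq_def lift_left_def by (simp add: prod_eq_iff)
    moreover have "fst (\<sigma> q1) = u q1" unfolding \<sigma>_def by simp
    ultimately have "v q1 = u q1" unfolding SgraphR_eq by simp
    moreover have "u (leftq x) < fst x \<longleftrightarrow> \<not> v (rightq x) < fst x" using V(1) x(1) unfolding bad_def by blast
    ultimately show False using x(2,3) rx by simp
  qed
  then have "q1 \<in> G" using cov q1(1) by blast
  then have "B \<inter> D = {}" using connectedD[OF conn oG oB dis cov] q1(1) by blast
  then have DG: "D \<subseteq> G" using cov by blast
  define U where "U = \<Union>(Collect good)"
  have "open U" unfolding U_def good_def by (intro open_Union) auto
  moreover have "?S \<subseteq> U"
  proof
    fix x assume x: "x \<in> ?S"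
    then have lx: "leftq x \<in> D" "fst x = u (leftq x)" unfolding Sgraph_eq by simp_all
    have "x = \<sigma> (leftq x)" unfolding \<sigma>_def lx(2)[symmetric] by simp
    moreover have "leftq x \<in> G" using lx(1) DG by blast
    then obtain V where "good V" "\<sigma> (leftq x) \<in> V" unfolding G_def by blast
    ultimately show "x \<in> U" unfolding U_def by auto
  qed
  moreover have "U \<subseteq> cylL D \<inter> cylR Dr" unfolding U_def good_def by blast
  moreover have "x \<in> Eepi D u \<longleftrightarrow> x \<in> EepiR Dr v" if xU: "x \<in> U" for x
  proof -
    obtain V where V: "good V" "x \<in> V" using xU unfolding U_def by blast
    then have c: "leftq x \<in> D" "rightq x \<in> Dr" unfolding good_def cylL_eq cylR_eq by blast+
    show ?thesis
    proof (cases "x \<in> ?S")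
      case True
      then have "fst x = u (leftq x)" unfolding Sgraph_eq by blast
      moreover have "fst x = v (rightq x)" using True unfolding gr SgraphR_eq by blast
      ultimately show ?thesis unfolding Eepi_eq EepiR_eq by simp
    next
      case False
      then show ?thesis using V c unfolding good_def Eepi_eq EepiR_eq by blast
    qed
  qed
  ultimately show ?thesis by blast
qed

section \<open>Localisation near the graph\<close>

text \<open>The flow formula for the whole space, where the difference of indicators is identically
  zero.\<close>

lemma integral_Xop_Yop_zero:
  assumes w: "C1 w" and cs: "compact (closure {p. w p \<noteq> 0})"
  shows "(\<integral>p. Xop w p \<partial>lborel) = 0" "(\<integral>p. Yop w p \<partial>lborel) = 0"
proof -
  have h: "0 < inverse (real (Suc n))" "inverse (real (Suc n)) \<le> 1" for n by (auto simp: inverse_le_1_iff)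
  have "(\<lambda>n. 0 / inverse (real (Suc n))) \<longlonglongrightarrow> (\<integral>p. indicat_real UNIV p * frechet_derivative w (at p) (Xv p) \<partial>lborel)"
    using flow_derivative_integral[OF w cs Xv_flow continuous_Xop[OF w] _ h LIMSEQ_inverse_real_of_nat, of UNIV] by simp
  from LIMSEQ_unique[OF this] show "(\<integral>p. Xop w p \<partial>lborel) = 0" unfolding Xop_eq by simp
  have "(\<lambda>n. 0 / inverse (real (Suc n))) \<longlonglongrightarrow> (\<integral>p. indicat_real UNIV p * frechet_derivative w (at p) (Yv p) \<partial>lborel)"
    using flow_derivative_integral[OF w cs Yv_flow continuous_Yop[OF w] _ h LIMSEQ_inverse_real_of_nat, of UNIV] by simp
  from LIMSEQ_unique[OF this] show "(\<integral>p. Yop w p \<partial>lborel) = 0" unfolding Yop_eq by simp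
qed

lemma integrable_indicator_derivative:
  assumes w: "C1 w" and cs: "compact (closure {p. w p \<noteq> 0})" and E: "E \<in> sets borel"
    and c: "continuous_on UNIV (\<lambda>p. frechet_derivative w (at p) (Z p))"
  shows "integrable lborel (\<lambda>p. indicat_real E p * frechet_derivative w (at p) (Z p))"
proof -
  obtain N where N: "\<forall>p. \<bar>frechet_derivative w (at p) (Z p)\<bar> \<le> N"
    using continuous_compact_support_bounded[OF c cs frechet_derivative_zero_off_support] by blast
  show ?thesis
  proof (rule integrable_bounded_compact_support[OF _ abs_indicator_mult_le cs])
    show "(\<lambda>p. indicat_real E p * frechet_derivative w (at p) (Z p)) \<in> borel_measurable borel"
      by (rule borel_measurable_times[OF borel_measurable_indicator[OF E] borel_measurable_continuous_onI[OF c]])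
    show "\<bar>frechet_derivative w (at x) (Z x)\<bar> \<le> N" for x using N by blast
    show "indicat_real E x * frechet_derivative w (at x) (Z x) = 0" if "x \<notin> closure {p. w p \<noteq> 0}" for x
      unfolding frechet_derivative_zero_off_support[OF that] by simp
  qed
qed

text \<open>The discarded part \<open>(1 - \<eta>) * w\<close> vanishes near
  \<open>S \<inter> K\<close>. Its product with the indicator of \<open>E\<close> is therefore again
  of class C^1 with compact support, and its derivatives along X and Y integrate to zero.\<close>

lemma localise_divergence:
  fixes E Om S U K :: "hpt set"
  assumes oE: "open E" and oO: "open Om" and EO: "E \<subseteq> Om" and oL: "open (Om - E - S)" and SE: "S \<inter> E = {}"
    and oU: "open U" and SU: "S \<subseteq> U" and K: "compact K" "K \<subseteq> Om"
  shows "\<exists>\<eta>. (\<forall>x. 0 \<le> \<eta> x \<and> \<eta> x \<le> 1) \<and> (\<forall>w. C1c w Om \<longrightarrow> closure {p. w p \<noteq> 0} \<subseteq> K \<longrightarrow>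
     C1c (\<lambda>x. \<eta> x * w x) U \<and> C1c (\<lambda>x. \<eta> x * w x) Om \<and> (\<forall>x\<in>S. \<eta> x * w x = w x) \<and>
     (\<integral>p. indicat_real E p * Xop w p \<partial>lborel) = (\<integral>p. indicat_real E p * Xop (\<lambda>x. \<eta> x * w x) p \<partial>lborel) \<and>
     (\<integral>p. indicat_real E p * Yop w p \<partial>lborel) = (\<integral>p. indicat_real E p * Yop (\<lambda>x. \<eta> x * w x) p \<partial>lborel))"
proof -
  \<comment> \<open>\<open>S\<close> need not be closed, but inside \<open>K\<close> it is what
    remains after removing the two open sides, hence compact.\<close>
  have SK: "S \<inter> K = K - (E \<union> (Om - E - S))" using K(2) SE EO by blast
  have "compact (S \<inter> K)" unfolding SK by (rule compact_diff[OF K(1)]) (use oE oL in blast)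
  then obtain \<eta> V where eta: "C1 \<eta>" "\<forall>x. 0 \<le> \<eta> x \<and> \<eta> x \<le> 1" "open V" "S \<inter> K \<subseteq> V" "\<forall>x\<in>V. \<eta> x = 1"
    "compact (closure {x. \<eta> x \<noteq> 0})" "closure {x. \<eta> x \<noteq> 0} \<subseteq> U"
    using C1_cutoff[OF _ oU, of "S \<inter> K"] SU by (metis inf.coboundedI1)
  have Em: "E \<in> sets borel" using oE by simp
  have main: "C1c (\<lambda>x. \<eta> x * w x) U \<and> C1c (\<lambda>x. \<eta> x * w x) Om \<and> (\<forall>x\<in>S. \<eta> x * w x = w x) \<and>
     (\<integral>p. indicat_real E p * Xop w p \<partial>lborel) = (\<integral>p. indicat_real E p * Xop (\<lambda>x. \<eta> x * w x) p \<partial>lborel) \<and>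
     (\<integral>p. indicat_real E p * Yop w p \<partial>lborel) = (\<integral>p. indicat_real E p * Yop (\<lambda>x. \<eta> x * w x) p \<partial>lborel)"
    if w: "C1c w Om" and wK: "closure {p. w p \<noteq> 0} \<subseteq> K" for w
  proof -
    have wC: "C1 w" and wc: "compact (closure {p. w p \<noteq> 0})" and wO: "closure {p. w p \<noteq> 0} \<subseteq> Om" using w unfolding C1c_iff by auto
    have w0: "w x = 0" if "x \<notin> K" for x using that wK closure_subset[of "{p. w p \<noteq> 0}"] by auto
    define z where "z x = \<eta> x * w x" for x
    have zC: "C1 z" unfolding z_def by (rule C1_mult[OF eta(1) wC])
    have z1: "closure {p. z p \<noteq> 0} \<subseteq> closure {p. w p \<noteq> 0}" unfolding z_def by (rule closure_mono) auto
    have z2: "closure {p. z p \<noteq> 0} \<subseteq> closure {p. \<eta> p \<noteq> 0}" unfolding z_def by (rule closure_mono) auto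
    have zc: "compact (closure {p. z p \<noteq> 0})" using z1 wc by (metis closed_closure compact_Int_closed inf.absorb_iff2)
    have zU: "C1c z U" unfolding C1c_iff using zC zc z2 eta(7) by blast
    have zO: "C1c z Om" unfolding C1c_iff using zC zc z1 wO by blast
    have zS: "z x = w x" if "x \<in> S" for x
      unfolding z_def using w0[of x] eta(4,5) that by (cases "x \<in> K") auto
    define y where "y x = (1 - \<eta> x) * w x" for x
    have yC: "C1 y" unfolding y_def by (intro C1_mult C1_diff C1_const eta(1) wC)
    define f where "f x = indicat_real E x * y x" for x
    \<comment> \<open>Every point lies in \<open>E\<close>, off \<open>K\<close>, near
      \<open>S \<inter> K\<close>, or on the other side of \<open>S\<close>; in the last three cases
      \<open>f\<close> is zero nearby as long as the point is outside \<open>E\<close>.\<close>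
    have floc: "\<exists>U. open U \<and> x \<in> U \<and> ((x \<in> E \<and> (\<forall>p\<in>U. f p = y p)) \<or> (x \<notin> E \<and> (\<forall>p\<in>U. f p = 0)))" for x
    proof (cases "x \<in> E")
      case True
      then show ?thesis using oE unfolding f_def by (intro exI[of _ E]) auto
    next
      case False
      consider "x \<notin> K" | "x \<in> K" "x \<in> S" | "x \<in> K" "x \<notin> S" by blast
      then show ?thesis
      proof cases
        case 1
        then show ?thesis using False K(1) compact_imp_closed w0 unfolding f_def y_def by (intro exI[of _ "- K"]) auto
      next
        case 2
        then show ?thesis using False eta(3,4,5) unfolding f_def y_def by (intro exI[of _ V]) auto
      next
        case 3
        then show ?thesis using False oL K(2) unfolding f_def by (intro exI[of _ "Om - E - S"]) auto
      qed
    qed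
    have fC: "C1 f"
    proof (rule C1_local)
      fix x
      from floc[of x] obtain U where U: "open U" "x \<in> U" "(\<forall>p\<in>U. f p = y p) \<or> (\<forall>p\<in>U. f p = 0)" by blast
      then show "\<exists>U g. open U \<and> x \<in> U \<and> C1 g \<and> (\<forall>p\<in>U. f p = g p)"
        using yC C1_const[of 0] by blast
    qed
    have fc: "compact (closure {p. f p \<noteq> 0})"
    proof -
      have "closure {p. f p \<noteq> 0} \<subseteq> closure {p. w p \<noteq> 0}" unfolding f_def y_def by (rule closure_mono) auto
      then show ?thesis using wc by (metis closed_closure compact_Int_closed inf.absorb_iff2)
    qed
    have fD: "frechet_derivative f (at x) k = indicat_real E x * (frechet_derivative w (at x) k - frechet_derivative z (at x) k)" for x k
    proof -
      have yd: "(y has_derivative (\<lambda>k. frechet_derivative w (at x) k - frechet_derivative z (at x) k)) (at x)"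
      proof -
        have "y = (\<lambda>x. w x - z x)" unfolding y_def z_def by (auto simp: algebra_simps)
        then show ?thesis using has_derivative_diff[OF C1D[OF wC] C1D[OF zC]] by simp
      qed
      from floc[of x] obtain U where U: "open U" "x \<in> U" "(x \<in> E \<and> (\<forall>p\<in>U. f p = y p)) \<or> (x \<notin> E \<and> (\<forall>p\<in>U. f p = 0))" by blast
      from U(3) show ?thesis
      proof
        assume a: "x \<in> E \<and> (\<forall>p\<in>U. f p = y p)"
        have "(f has_derivative (\<lambda>k. frechet_derivative w (at x) k - frechet_derivative z (at x) k)) (at x)"
          by (rule has_derivative_transform_within_open[OF yd U(1,2)]) (use a in auto)
        from frechet_derivative_at[OF this, symmetric] show ?thesis using a by simp
      next
        assume a: "x \<notin> E \<and> (\<forall>p\<in>U. f p = 0)"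
        have "(f has_derivative (\<lambda>k. 0)) (at x)"
          by (rule has_derivative_transform_within_open[OF has_derivative_const U(1,2), of 0]) (use a in auto)
        from frechet_derivative_at[OF this, symmetric] show ?thesis using a by simp
      qed
    qed
    have X: "(\<integral>p. indicat_real E p * Xop w p \<partial>lborel) = (\<integral>p. indicat_real E p * Xop z p \<partial>lborel)"
      using integral_Xop_Yop_zero(1)[OF fC fc]
        integrable_indicator_derivative[OF wC wc Em continuous_Xop[OF wC]] integrable_indicator_derivative[OF zC zc Em continuous_Xop[OF zC]]
      unfolding Xop_eq fD right_diff_distrib by simp
    have Y: "(\<integral>p. indicat_real E p * Yop w p \<partial>lborel) = (\<integral>p. indicat_real E p * Yop z p \<partial>lborel)"
      using integral_Xop_Yop_zero(2)[OF fC fc]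
        integrable_indicator_derivative[OF wC wc Em continuous_Yop[OF wC]] integrable_indicator_derivative[OF zC zc Em continuous_Yop[OF zC]]
      unfolding Yop_eq fD right_diff_distrib by simp
    show ?thesis using zU zO zS X Y unfolding z_def by blast
  qed
  then show ?thesis using eta(2) by blast
qed

section \<open>Box averages\<close>

text \<open>Averaging over boxes needs no weak derivatives: the divergence of the average is itself a flux
  through the boundary of a box.\<close>

definition avg :: "real \<Rightarrow> (real \<times> real \<Rightarrow> real) \<Rightarrow> real \<times> real \<Rightarrow> real" where
  "avg e n q = inverse (4 * e\<^sup>2) * integral {-e..e} (\<lambda>r. integral {-e..e} (\<lambda>s. n (fst q + r, snd q + s)))"

text \<open>Differences of integrals over opposite sides of the box. These are the partial
  derivatives of \<open>avg e n\<close>, and they are continuous when \<open>n\<close> is merely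
  continuous.\<close>

definition avg_y :: "real \<Rightarrow> (real \<times> real \<Rightarrow> real) \<Rightarrow> real \<times> real \<Rightarrow> real" where
  "avg_y e n q = inverse (4 * e\<^sup>2) * (integral {-e..e} (\<lambda>s. n (fst q + e, snd q + s)) - integral {-e..e} (\<lambda>s. n (fst q - e, snd q + s)))"

definition avg_t :: "real \<Rightarrow> (real \<times> real \<Rightarrow> real) \<Rightarrow> real \<times> real \<Rightarrow> real" where
  "avg_t e n q = inverse (4 * e\<^sup>2) * (integral {-e..e} (\<lambda>r. n (fst q + r, snd q + e)) - integral {-e..e} (\<lambda>r. n (fst q + r, snd q - e)))"

lemma window_integral_DERIV:
  fixes k :: "real \<Rightarrow> real"
  assumes k: "continuous_on UNIV k" and e: "e > 0"
  shows "((\<lambda>x. integral {-e..e} (\<lambda>r. k (x + r))) has_real_derivative k (x + e) - k (x - e)) (at x)"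
proof -
  define a b where "a = x - e - 1" and "b = x + e + 1"
  obtain g where g: "\<And>z. z \<in> {a..b} \<Longrightarrow> (g has_vector_derivative k z) (at z within {a..b})"
    using antiderivative_continuous[of a b k] continuous_on_subset[OF k] by blast
  have gi: "(g has_real_derivative k z) (at z)" if "z \<in> {a<..<b}" for z
  proof -
    have "(g has_vector_derivative k z) (at z within {a<..<b})"
      by (rule has_vector_derivative_within_subset[OF g]) (use that in auto)
    then show ?thesis using that by (simp add: has_real_derivative_iff_has_vector_derivative at_within_open[OF that])
  qed
  have eq: "integral {-e..e} (\<lambda>r. k (z + r)) = g (z + e) - g (z - e)" if z: "z \<in> {x - 1<..<x + 1}" for z
  proof -
    have "((\<lambda>r. k (z + r)) has_integral (g (z + e) - g (z + (- e)))) {-e..e}"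
    proof (rule fundamental_theorem_of_calculus)
      show "- e \<le> e" using e by simp
      fix r assume "r \<in> {-e..e}"
      then have "z + r \<in> {a<..<b}" using z unfolding a_def b_def by auto
      from gi[OF this] have "((\<lambda>r. g (z + r)) has_real_derivative k (z + r)) (at r)"
        by (simp add: DERIV_shift add.commute)
      then show "((\<lambda>r. g (z + r)) has_vector_derivative k (z + r)) (at r within {-e..e})"
        using has_real_derivative_iff_has_vector_derivative has_vector_derivative_at_within by blast
    qed
    then show ?thesis by (simp add: integral_unique)
  qed
  have "((\<lambda>z. g (z + e) - g (z - e)) has_real_derivative k (x + e) - k (x - e)) (at x)"
  proof (intro DERIV_diff)
    show "((\<lambda>z. g (z + e)) has_real_derivative k (x + e)) (at x)"
      using gi[of "x + e"] e unfolding a_def b_def by (simp add: DERIV_shift)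
    show "((\<lambda>z. g (z - e)) has_real_derivative k (x - e)) (at x)"
      using gi[of "x + (- e)"] e DERIV_shift[of g "k (x + (- e))" x "- e"] unfolding a_def b_def by simp
  qed
  then show ?thesis
    by (rule has_field_derivative_transform_within_open[of _ _ _ "{x - 1<..<x + 1}"]) (use eq in auto)
qed

lemma continuous_on_slice_integral:
  fixes n :: "real \<times> real \<Rightarrow> real"
  assumes n: "continuous_on UNIV n"
  shows "continuous_on UNIV (\<lambda>q::real \<times> real. integral {-e..e} (\<lambda>s. n (fst q + c, snd q + s)))"
    and "continuous_on UNIV (\<lambda>q::real \<times> real. integral {-e..e} (\<lambda>r. n (fst q + r, snd q + c)))"
proof -
  have "continuous_on UNIV (\<lambda>q::real \<times> real. integral (cbox (-e) e) (\<lambda>s. n (fst q + c, snd q + s)))"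
  proof (rule integral_continuous_on_param)
    show "continuous_on (UNIV \<times> cbox (-e) e) (\<lambda>(q, s). n (fst q + c, snd q + s))"
      unfolding split_beta' by (rule continuous_on_compose2[OF n]) (auto intro!: continuous_intros)
  qed
  then show "continuous_on UNIV (\<lambda>q::real \<times> real. integral {-e..e} (\<lambda>s. n (fst q + c, snd q + s)))" by simp
  have "continuous_on UNIV (\<lambda>q::real \<times> real. integral (cbox (-e) e) (\<lambda>r. n (fst q + r, snd q + c)))"
  proof (rule integral_continuous_on_param)
    show "continuous_on (UNIV \<times> cbox (-e) e) (\<lambda>(q, r). n (fst q + r, snd q + c))"
      unfolding split_beta' by (rule continuous_on_compose2[OF n]) (auto intro!: continuous_intros)
  qed
  then show "continuous_on UNIV (\<lambda>q::real \<times> real. integral {-e..e} (\<lambda>r. n (fst q + r, snd q + c)))" by simp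
qed

lemma continuous_on_avg_partials:
  assumes n: "continuous_on UNIV n"
  shows "continuous_on UNIV (avg_y e n)" "continuous_on UNIV (avg_t e n)"
proof -
  show "continuous_on UNIV (avg_y e n)" unfolding avg_y_def
    using continuous_on_slice_integral(1)[OF n, of e e] continuous_on_slice_integral(1)[OF n, of e "- e"]
    by (intro continuous_intros) simp_all
  show "continuous_on UNIV (avg_t e n)" unfolding avg_t_def
    using continuous_on_slice_integral(2)[OF n, of e e] continuous_on_slice_integral(2)[OF n, of e "- e"]
    by (intro continuous_intros) simp_all
qed

text \<open>Each partial derivative is that of a window integral, for the second variable after
  exchanging the order of integration. Continuity of the second one yields the total
  derivative.\<close>

lemma has_derivative_avg:
  assumes n: "continuous_on UNIV n" and e: "e > 0"
  shows "(avg e n has_derivative (\<lambda>h. avg_y e n q * fst h + avg_t e n q * snd h)) (at q)"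
proof -
  obtain y t where q: "q = (y, t)" by (cases q)
  have swap: "integral {-e..e} (\<lambda>r. integral {-e..e} (\<lambda>s. n (a + r, b + s))) = integral {-e..e} (\<lambda>s. integral {-e..e} (\<lambda>r. n (a + r, b + s)))" for a b
  proof -
    have "continuous_on (cbox (-e, -e) (e, e)) (\<lambda>(r, s). n (a + r, b + s))"
      unfolding split_beta' by (rule continuous_on_compose2[OF n]) (auto intro!: continuous_intros)
    from integral_swap_continuous[OF this] show ?thesis by simp
  qed
  have dy: "((\<lambda>a. avg e n (a, b)) has_real_derivative avg_y e n (a, b)) (at a)" for a b
  proof -
    have "continuous_on UNIV (\<lambda>a. integral {-e..e} (\<lambda>s. n (a, b + s)))"
      using continuous_on_compose2[OF continuous_on_slice_integral(1)[OF n, of e 0], of UNIV "\<lambda>a. (a, b)"]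
      by (simp add: continuous_on_Pair continuous_on_id continuous_on_const)
    from window_integral_DERIV[OF this e, of a] show ?thesis unfolding avg_def avg_y_def fst_conv snd_conv by (rule DERIV_cmult)
  qed
  have dt: "((\<lambda>b. avg e n (a, b)) has_real_derivative avg_t e n (a, b)) (at b)" for a b
  proof -
    have "continuous_on UNIV (\<lambda>b. integral {-e..e} (\<lambda>r. n (a + r, b)))"
      using continuous_on_compose2[OF continuous_on_slice_integral(2)[OF n, of e 0], of UNIV "\<lambda>b. (a, b)"]
      by (simp add: continuous_on_Pair continuous_on_id continuous_on_const)
    from window_integral_DERIV[OF this e, of b] show ?thesis unfolding avg_def avg_t_def fst_conv snd_conv swap by (rule DERIV_cmult)
  qed
  have "((\<lambda>(a, b). avg e n (a, b)) has_derivative (\<lambda>(ta, tb). avg_y e n (y, t) * ta + blinfun_apply (blinfun_mult_right (avg_t e n (y, t))) tb)) (at (y, t) within UNIV \<times> UNIV)"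
  proof (rule has_derivative_partialsI[where fy="\<lambda>a b. blinfun_mult_right (avg_t e n (a, b))"])
    show "((\<lambda>a. avg e n (a, t)) has_derivative (*) (avg_y e n (y, t))) (at y within UNIV)"
      using dy[of t y] unfolding has_field_derivative_def by simp
    show "((\<lambda>b. avg e n (a, b)) has_derivative blinfun_apply (blinfun_mult_right (avg_t e n (a, b)))) (at b within UNIV)" for a b
      using dt[of a b] unfolding has_field_derivative_def by simp
    have "isCont (avg_t e n) (y, t)"
      using continuous_on_avg_partials(2)[OF n, of e] by (simp add: continuous_on_eq_continuous_at)
    then have "continuous (at (y, t)) (\<lambda>x. blinfun_mult_right (avg_t e n x))"
      by (rule bounded_linear.continuous[OF bounded_linear_blinfun_mult_right])
    then show "continuous (at (y, t) within UNIV \<times> UNIV) (\<lambda>(a, b). blinfun_mult_right (avg_t e n (a, b)))"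
      by (simp add: split_beta')
  qed auto
  then show ?thesis unfolding q by (simp add: split_beta')
qed

lemma window_integrable:
  fixes n :: "real \<times> real \<Rightarrow> real"
  assumes n: "continuous_on UNIV n"
  shows "(\<lambda>s. n (a, b + s)) integrable_on {-e..e}"
    and "(\<lambda>r. integral {-e..e} (\<lambda>s. n (a + r, b + s))) integrable_on {-e..e}"
proof -
  show "(\<lambda>s. n (a, b + s)) integrable_on {-e..e}"
    by (intro integrable_continuous_interval continuous_on_compose2[OF n]) (auto intro!: continuous_intros)
  have "continuous_on {-e..e} (\<lambda>r. integral {-e..e} (\<lambda>s. n (a + r, b + s)))"
    using continuous_on_compose2[OF continuous_on_slice_integral(1)[OF n, of e 0], of "{-e..e}" "\<lambda>r. (a + r, b)"]
    by (simp add: continuous_intros)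
  then show "(\<lambda>r. integral {-e..e} (\<lambda>s. n (a + r, b + s))) integrable_on {-e..e}"
    by (rule integrable_continuous_interval)
qed

lemma avg_le:
  assumes n: "continuous_on UNIV n" and e: "e > 0"
    and le: "\<And>r s. \<bar>r\<bar> \<le> e \<Longrightarrow> \<bar>s\<bar> \<le> e \<Longrightarrow> n (fst q + r, snd q + s) \<le> c"
  shows "avg e n q \<le> c"
proof -
  have a: "integral {-e..e} (\<lambda>s. n (fst q + r, snd q + s)) \<le> 2 * e * c" if "r \<in> {-e..e}" for r
  proof -
    have "integral {-e..e} (\<lambda>s. n (fst q + r, snd q + s)) \<le> integral {-e..e} (\<lambda>s. c)"
      by (rule integral_le[OF window_integrable(1)[OF n]]) (use that le in auto)
    then show ?thesis using e by simp
  qed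
  have "integral {-e..e} (\<lambda>r. integral {-e..e} (\<lambda>s. n (fst q + r, snd q + s))) \<le> integral {-e..e} (\<lambda>r. 2 * e * c)"
    by (rule integral_le[OF window_integrable(2)[OF n]]) (use a in auto)
  also have "\<dots> = 4 * e\<^sup>2 * c" using e by (simp add: power2_eq_square)
  finally have "avg e n q \<le> inverse (4 * e\<^sup>2) * (4 * e\<^sup>2 * c)"
    unfolding avg_def by (rule mult_left_mono) simp
  also have "\<dots> = c" using e by simp
  finally show ?thesis .
qed

lemma avg_lincomb:
  assumes n: "continuous_on UNIV n" and m: "continuous_on UNIV m"
  shows "avg e (\<lambda>p. a * n p + b * m p) q = a * avg e n q + b * avg e m q"
proof -
  have "integral {-e..e} (\<lambda>s. a * n (fst q + r, snd q + s) + b * m (fst q + r, snd q + s))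
      = a * integral {-e..e} (\<lambda>s. n (fst q + r, snd q + s)) + b * integral {-e..e} (\<lambda>s. m (fst q + r, snd q + s))" for r
    using window_integrable(1)[OF n, of "fst q + r" "snd q" e] window_integrable(1)[OF m, of "fst q + r" "snd q" e]
    by (simp add: integral_add integrable_on_mult_right)
  moreover have "integral {-e..e} (\<lambda>r. a * integral {-e..e} (\<lambda>s. n (fst q + r, snd q + s)) + b * integral {-e..e} (\<lambda>s. m (fst q + r, snd q + s)))
     = a * integral {-e..e} (\<lambda>r. integral {-e..e} (\<lambda>s. n (fst q + r, snd q + s))) + b * integral {-e..e} (\<lambda>r. integral {-e..e} (\<lambda>s. m (fst q + r, snd q + s)))"
    using window_integrable(2)[OF n, of e "fst q" "snd q"] window_integrable(2)[OF m, of e "fst q" "snd q"]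
    by (simp add: integral_add integrable_on_mult_right)
  ultimately show ?thesis unfolding avg_def by (simp add: algebra_simps)
qed

lemma avg_uminus:
  assumes "continuous_on UNIV n"
  shows "avg e (\<lambda>p. - n p) q = - avg e n q"
  using avg_lincomb[OF assms assms, of e "-1" 0 q] by simp

lemma avg_close:
  assumes n: "continuous_on UNIV n" and e: "e > 0"
    and le: "\<And>r s. \<bar>r\<bar> \<le> e \<Longrightarrow> \<bar>s\<bar> \<le> e \<Longrightarrow> \<bar>n (fst q + r, snd q + s) - c\<bar> \<le> w"
  shows "\<bar>avg e n q - c\<bar> \<le> w"
proof -
  have "avg e n q \<le> c + w"
  proof (rule avg_le[OF n e])
    show "n (fst q + r, snd q + s) \<le> c + w" if "\<bar>r\<bar> \<le> e" "\<bar>s\<bar> \<le> e" for r s using le[OF that] by linarith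
  qed
  moreover have "avg e (\<lambda>p. - n p) q \<le> - c + w"
  proof (rule avg_le[OF continuous_on_minus[OF n] e])
    show "- n (fst q + r, snd q + s) \<le> - c + w" if "\<bar>r\<bar> \<le> e" "\<bar>s\<bar> \<le> e" for r s using le[OF that] by linarith
  qed
  ultimately show ?thesis unfolding avg_uminus[OF n] by linarith
qed

text \<open>With \<open>(a, b)\<close> the averaged vector and \<open>R\<close> its length,
  \<open>R\<^sup>2\<close> is the average of the inner product with \<open>(a, b)\<close>, which
  Cauchy-Schwarz bounds by \<open>R\<close>. Hence \<open>R \<le> 1\<close>, and averages of unit
  fields stay admissible.\<close>

lemma avg_norm_le_1:
  assumes n: "continuous_on UNIV n" and m: "continuous_on UNIV m" and e: "e > 0"
    and le: "\<And>p. (n p)\<^sup>2 + (m p)\<^sup>2 \<le> 1"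
  shows "(avg e n q)\<^sup>2 + (avg e m q)\<^sup>2 \<le> 1"
proof -
  define a b where "a = avg e n q" and "b = avg e m q"
  define R where "R = sqrt (a\<^sup>2 + b\<^sup>2)"
  have R0: "R \<ge> 0" and R2: "R\<^sup>2 = a\<^sup>2 + b\<^sup>2" unfolding R_def by auto
  have "avg e (\<lambda>p. a * n p + b * m p) q \<le> R"
  proof (rule avg_le[OF _ e])
    show "continuous_on UNIV (\<lambda>p. a * n p + b * m p)" by (intro continuous_intros n m)
    fix r s
    let ?p = "(fst q + r, snd q + s)"
    have "a * n ?p + b * m ?p \<le> sqrt (a\<^sup>2 + b\<^sup>2) * sqrt ((n ?p)\<^sup>2 + (m ?p)\<^sup>2)"
    proof -
      have "(a * n ?p + b * m ?p)\<^sup>2 \<le> (a\<^sup>2 + b\<^sup>2) * ((n ?p)\<^sup>2 + (m ?p)\<^sup>2)"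
      proof -
        have "(a\<^sup>2 + b\<^sup>2) * ((n ?p)\<^sup>2 + (m ?p)\<^sup>2) - (a * n ?p + b * m ?p)\<^sup>2 = (a * m ?p - b * n ?p)\<^sup>2"
          by (simp add: power2_eq_square algebra_simps)
        then show ?thesis using zero_le_power2[of "a * m ?p - b * n ?p"] by linarith
      qed
      then show ?thesis using real_le_rsqrt real_sqrt_mult by metis
    qed
    also have "\<dots> \<le> R * 1" unfolding R_def using le[of ?p] by (intro mult_left_mono) auto
    finally show "a * n ?p + b * m ?p \<le> R" by simp
  qed
  then have "R\<^sup>2 \<le> R" unfolding avg_lincomb[OF n m] R2 a_def[symmetric] b_def[symmetric] by (simp add: power2_eq_square)
  then have "R \<le> 1"
  proof (cases "R = 0")
    case False
    then show ?thesis using R0 \<open>R\<^sup>2 \<le> R\<close> by (simp add: power2_eq_square mult_le_cancel_left1)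
  qed simp
  then have "R\<^sup>2 \<le> 1" using R0 by (simp add: power_le_one)
  then show ?thesis unfolding R2 a_def b_def .
qed

text \<open>The flux identity on the box carries the weight \<open>4 * y\<close>, the divergence at
  the centre the weight \<open>4 * fst q\<close>. Their difference is the integral of
  \<open>4 * r * g r\<close> with \<open>\<bar>r\<bar> \<le> e\<close> and
  \<open>\<bar>g r\<bar> \<le> w\<close>; divided by the area \<open>4 * e\<^sup>2\<close> it is at
  most \<open>2 * w\<close>.\<close>

lemma avg_divergence_small:
  fixes n1 n2 :: "real \<times> real \<Rightarrow> real"
  assumes n1: "continuous_on UNIV n1" and n2: "continuous_on UNIV n2" and e: "e > 0"
    and flux: "(LINT t:{snd q - e..snd q + e}|lborel. n2 (fst q + e, t) - n2 (fst q - e, t))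
      + (LINT y:{fst q - e..fst q + e}|lborel. 4 * y * (n1 (y, snd q + e) - n1 (y, snd q - e))) = 0"
    and w: "\<And>r. \<bar>r\<bar> \<le> e \<Longrightarrow> \<bar>n1 (fst q + r, snd q + e) - n1 (fst q + r, snd q - e)\<bar> \<le> w"
  shows "\<bar>avg_y e n2 q + 4 * fst q * avg_t e n1 q\<bar> \<le> 2 * w"
proof -
  have c2: "continuous_on S (\<lambda>t. n2 (a, t))" for S a
    by (rule continuous_on_compose2[OF n2]) (auto intro!: continuous_intros)
  have c1: "continuous_on S (\<lambda>y. n1 (y, b))" for S b
    by (rule continuous_on_compose2[OF n1]) (auto intro!: continuous_intros)
  have li: "(LINT x:{a..b}|lborel. f x) = integral {a..b} f" if "continuous_on {a..b} f" for f :: "real \<Rightarrow> real" and a b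
    using borel_integrable_atLeastAtMost'[OF that] by (rule set_borel_integral_eq_integral(2))
  have sh: "integral {c - e..c + e} f = integral {-e..e} (\<lambda>r. f (c + r))" for f :: "real \<Rightarrow> real" and c
    using integral_shift_Icc_real[of "-e" e f c] by (simp add: o_def add.commute)
  define A where "A = integral {-e..e} (\<lambda>s. n2 (fst q + e, snd q + s)) - integral {-e..e} (\<lambda>s. n2 (fst q - e, snd q + s))"
  define g where "g r = n1 (fst q + r, snd q + e) - n1 (fst q + r, snd q - e)" for r
  have cg: "continuous_on {-e..e} g" unfolding g_def
    by (intro continuous_on_diff continuous_on_compose2[OF n1]) (auto intro!: continuous_intros)
  have A: "(LINT t:{snd q - e..snd q + e}|lborel. n2 (fst q + e, t) - n2 (fst q - e, t)) = A"
    unfolding A_def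
    by (subst li) (auto intro!: continuous_intros c2 simp: sh integral_diff[OF window_integrable(1)[OF n2] window_integrable(1)[OF n2]])
  have B: "(LINT y:{fst q - e..fst q + e}|lborel. 4 * y * (n1 (y, snd q + e) - n1 (y, snd q - e))) = integral {-e..e} (\<lambda>r. 4 * (fst q + r) * g r)"
    unfolding g_def by (subst li) (auto intro!: continuous_intros c1 simp: sh)
  have T: "integral {-e..e} (\<lambda>r. n1 (fst q + r, snd q + e)) - integral {-e..e} (\<lambda>r. n1 (fst q + r, snd q - e)) = integral {-e..e} g"
    unfolding g_def
    by (rule integral_diff[symmetric]; intro integrable_continuous_interval continuous_on_compose2[OF n1]; auto intro!: continuous_intros)
  have ig: "g integrable_on {-e..e}" "(\<lambda>r. r * g r) integrable_on {-e..e}"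
    by (intro integrable_continuous_interval continuous_intros cg)+
  have "integral {-e..e} (\<lambda>r. 4 * (fst q + r) * g r) = 4 * fst q * integral {-e..e} g + 4 * integral {-e..e} (\<lambda>r. r * g r)"
  proof -
    have "integral {-e..e} (\<lambda>r. 4 * (fst q + r) * g r) = integral {-e..e} (\<lambda>r. 4 * fst q * g r + 4 * (r * g r))"
      by (intro integral_cong) (simp add: algebra_simps)
    also have "\<dots> = integral {-e..e} (\<lambda>r. 4 * fst q * g r) + integral {-e..e} (\<lambda>r. 4 * (r * g r))"
      by (intro integral_add integrable_on_mult_right ig)
    finally show ?thesis by simp
  qed
  then have sum: "A + 4 * fst q * integral {-e..e} g = - 4 * integral {-e..e} (\<lambda>r. r * g r)"
    using flux unfolding A B by linarith
  have bd: "\<bar>integral {-e..e} (\<lambda>r. r * g r)\<bar> \<le> integral {-e..e} (\<lambda>r. e * w)"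
  proof -
    have "norm (integral {-e..e} (\<lambda>r. r * g r)) \<le> integral {-e..e} (\<lambda>r. e * w)"
    proof (rule integral_norm_bound_integral[OF ig(2)])
      show "norm (r * g r) \<le> e * w" if "r \<in> {-e..e}" for r
        unfolding g_def real_norm_def abs_mult using that w[of r] e by (intro mult_mono) auto
    qed auto
    then show ?thesis by simp
  qed
  have "avg_y e n2 q + 4 * fst q * avg_t e n1 q = inverse (4 * e\<^sup>2) * (A + 4 * fst q * integral {-e..e} g)"
    unfolding avg_y_def avg_t_def T A_def by (simp add: algebra_simps)
  also have "\<dots> = inverse (4 * e\<^sup>2) * (- 4 * integral {-e..e} (\<lambda>r. r * g r))" unfolding sum ..
  finally have eq: "avg_y e n2 q + 4 * fst q * avg_t e n1 q = inverse (4 * e\<^sup>2) * (- 4 * integral {-e..e} (\<lambda>r. r * g r))" .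
  have "\<bar>avg_y e n2 q + 4 * fst q * avg_t e n1 q\<bar> = inverse (4 * e\<^sup>2) * (4 * \<bar>integral {-e..e} (\<lambda>r. r * g r)\<bar>)"
    unfolding eq by (simp add: abs_mult)
  also have "\<dots> \<le> inverse (4 * e\<^sup>2) * (4 * (2 * e * (e * w)))"
    using bd e by (intro mult_left_mono) auto
  also have "\<dots> = 2 * w" using e by (simp add: power2_eq_square field_simps)
  finally show ?thesis .
qed

section \<open>Fields constant along right cosets\<close>

lemma has_derivative_rightq:
  "(rightq has_derivative (\<lambda>h. (fst (snd h), snd (snd h) + 2 * (fst p * fst (snd h) + fst h * fst (snd p))))) (at p)"
  unfolding rightq_def by (auto intro!: derivative_eq_intros simp: algebra_simps)

text \<open>X moves the right coordinate \<open>t + 2 * x * y\<close> at rate \<open>4 * y\<close>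
  and keeps \<open>y\<close>; Y leaves that coordinate fixed and moves \<open>y\<close> at rate
  1.\<close>

lemma avg_rightq:
  assumes n: "continuous_on UNIV n" and e: "e > 0"
  shows "C1 (\<lambda>p. avg e n (rightq p))"
    and "Xop (\<lambda>p. avg e n (rightq p)) p = 4 * fst (rightq p) * avg_t e n (rightq p)"
    and "Yop (\<lambda>p. avg e n (rightq p)) p = avg_y e n (rightq p)"
proof -
  let ?D = "\<lambda>p h. avg_y e n (rightq p) * fst (snd h) + avg_t e n (rightq p) * (snd (snd h) + 2 * (fst p * fst (snd h) + fst h * fst (snd p)))"
  have d: "((\<lambda>p. avg e n (rightq p)) has_derivative ?D p) (at p)" for p
    using has_derivative_compose[OF has_derivative_rightq has_derivative_avg[OF n e]] by simp
  show "C1 (\<lambda>p. avg e n (rightq p))"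
  proof (rule C1I[OF d])
    fix h
    have "continuous_on UNIV (\<lambda>p. avg_y e n (rightq p))" "continuous_on UNIV (\<lambda>p. avg_t e n (rightq p))"
      by (rule continuous_on_compose2[OF continuous_on_avg_partials(1)[OF n] continuous_rightq], simp)
         (rule continuous_on_compose2[OF continuous_on_avg_partials(2)[OF n] continuous_rightq], simp)
    then show "continuous_on UNIV (\<lambda>p. ?D p h)" by (intro continuous_intros)
  qed
  have fd: "frechet_derivative (\<lambda>p. avg e n (rightq p)) (at p) = ?D p" using frechet_derivative_at[OF d[of p]] by simp
  show "Xop (\<lambda>p. avg e n (rightq p)) p = 4 * fst (rightq p) * avg_t e n (rightq p)"
    unfolding Xop_eq fd Xv_def by (simp add: rightq_def)
  show "Yop (\<lambda>p. avg e n (rightq p)) p = avg_y e n (rightq p)"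
    unfolding Yop_eq fd Yv_def by (simp add: rightq_def)
qed

section \<open>Perimeter and calibration\<close>

lemma C1c_mono: "C1c f U \<Longrightarrow> U \<subseteq> V \<Longrightarrow> C1c f V"
  unfolding C1c_def by blast

lemma abs_lincomb_le_sqrt:
  fixes a b x y :: real
  assumes "x\<^sup>2 + y\<^sup>2 \<le> 1"
  shows "\<bar>a * x + b * y\<bar> \<le> sqrt (a\<^sup>2 + b\<^sup>2)"
proof -
  have "(a * x + b * y)\<^sup>2 \<le> (a\<^sup>2 + b\<^sup>2) * (x\<^sup>2 + y\<^sup>2)"
  proof -
    have "(a\<^sup>2 + b\<^sup>2) * (x\<^sup>2 + y\<^sup>2) - (a * x + b * y)\<^sup>2 = (a * y - b * x)\<^sup>2"
      by (simp add: power2_eq_square algebra_simps)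
    then show ?thesis using zero_le_power2[of "a * y - b * x"] by linarith
  qed
  also have "\<dots> \<le> (a\<^sup>2 + b\<^sup>2) * 1" using assms by (intro mult_left_mono) auto
  finally have "\<bar>a * x + b * y\<bar>\<^sup>2 \<le> a\<^sup>2 + b\<^sup>2" by simp
  then show ?thesis by (rule real_le_rsqrt)
qed

definition divergence :: "hpt set \<Rightarrow> (hpt \<Rightarrow> real) \<Rightarrow> (hpt \<Rightarrow> real) \<Rightarrow> real" where
  "divergence E w1 w2 = (\<integral>p. indicat_real E p * Xop w1 p \<partial>lborel) + (\<integral>p. indicat_real E p * Yop w2 p \<partial>lborel)"

text \<open>The left and the right coordinates agree on the axis $y=0$. A point of $D$ on it decides on which
  side of the graph the two epigraphs lie; without one they could lie on opposite sides.\<close>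

locale arc_graph =
  fixes D Dr :: "(real \<times> real) set" and u \<beta> v :: "real \<times> real \<Rightarrow> real" and C B :: real
  assumes open_D: "open D" and bounded_D: "bounded D" and connected_D: "connected D"
    and meets_axis: "\<exists>q\<in>D. fst q = 0"
    and lip: "C-lipschitz_on UNIV u"
    and arcs: "local_arcs D u \<beta>" and slope_le: "\<And>q. q \<in> D \<Longrightarrow> \<bar>\<beta> q\<bar> \<le> B"
    and open_Dr: "open Dr"
    and loclip: "\<forall>q\<in>Dr. \<exists>e>0. \<exists>C. C-lipschitz_on (ball q e \<inter> Dr) v"
    and graph_eq: "Sgraph D u = SgraphR Dr v"
begin

definition \<sigma> :: "real \<times> real \<Rightarrow> hpt" where "\<sigma> q = lift_left (u q) q"

text \<open>The boundary side of Gauss-Green: \<open>(-1, \<beta>)\<close> is the outward normal of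
  the left epigraph multiplied by the area density
  \<open>sqrt (1 + \<beta>\<^sup>2)\<close>.\<close>

definition surf :: "(hpt \<Rightarrow> real) \<Rightarrow> (hpt \<Rightarrow> real) \<Rightarrow> real" where
  "surf w1 w2 = (\<integral>q. indicat_real D q * (\<beta> q * w2 (\<sigma> q) - w1 (\<sigma> q)) \<partial>lborel)"

definition area :: real where "area = (\<integral>q. indicat_real D q * sqrt (1 + (\<beta> q)\<^sup>2) \<partial>lborel)"

lemma continuous_u: "continuous_on S u"
  using lipschitz_on_continuous_on[OF lip] continuous_on_subset by blast

lemma continuous_\<beta>: "continuous_on D \<beta>" by (rule local_arcs_continuous[OF arcs open_D])

lemma continuous_v: "continuous_on Dr v"
proof (subst continuous_on_eq_continuous_at[OF open_Dr], rule)
  fix q assume q: "q \<in> Dr"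
  then obtain e L where "e > 0" "L-lipschitz_on (ball q e \<inter> Dr) v" using loclip by blast
  then have "continuous_on (ball q e \<inter> Dr) v" "open (ball q e \<inter> Dr)" "q \<in> ball q e \<inter> Dr"
    using q open_Dr by (auto intro: lipschitz_on_continuous_on)
  then show "isCont v q" using continuous_on_eq_continuous_at by blast
qed

lemma continuous_\<sigma>: "continuous_on S \<sigma>"
  unfolding \<sigma>_def[abs_def] by (intro continuous_on_lift_left continuous_u continuous_on_id)

lemma \<sigma>_in_graph: "q \<in> D \<Longrightarrow> \<sigma> q \<in> Sgraph D u" unfolding \<sigma>_def by (rule lift_left_in_Sgraph)

lemma slope_bound_nonneg: "0 \<le> B" using meets_axis slope_le by (metis abs_ge_zero order_trans)

lemma integrable_on_D:
  assumes c: "continuous_on D f" and N: "\<And>q. q \<in> D \<Longrightarrow> \<bar>f q\<bar> \<le> N"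
  shows "integrable lborel (\<lambda>q. indicat_real D q * f q)"
proof (rule integrable_bounded_compact_support[where N=N and K="closure D"])
  show "(\<lambda>q. indicat_real D q * f q) \<in> borel_measurable borel"
    using borel_measurable_continuous_on_indicator[of D f] c open_D by (simp add: borel_open)
  have "0 \<le> N" using meets_axis N by (metis abs_ge_zero order_trans)
  then show "\<bar>indicat_real D q * f q\<bar> \<le> N" for q using N[of q] by (cases "q \<in> D") auto
  show "compact (closure D)" using bounded_D by (simp add: compact_closure)
  show "indicat_real D q * f q = 0" if "q \<notin> closure D" for q
    using that closure_subset[of D] by (auto simp: indicator_def)
qed

lemma sqrt_slope_le: "q \<in> D \<Longrightarrow> sqrt (1 + (\<beta> q)\<^sup>2) \<le> 1 + B"
proof -
  assume q: "q \<in> D"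
  have "sqrt (1 + (\<beta> q)\<^sup>2) \<le> 1 + \<bar>\<beta> q\<bar>"
    using sqrt_add_le_add_sqrt[of 1 "(\<beta> q)\<^sup>2"] by simp
  then show ?thesis using slope_le[OF q] by linarith
qed

lemma integrable_area: "integrable lborel (\<lambda>q. indicat_real D q * sqrt (1 + (\<beta> q)\<^sup>2))"
proof (rule integrable_on_D)
  show "continuous_on D (\<lambda>q. sqrt (1 + (\<beta> q)\<^sup>2))" by (intro continuous_intros continuous_\<beta>)
  show "\<bar>sqrt (1 + (\<beta> q)\<^sup>2)\<bar> \<le> 1 + B" if "q \<in> D" for q using sqrt_slope_le[OF that] by simp
qed

lemma integrable_surf:
  assumes c: "continuous_on UNIV w1" "continuous_on UNIV w2" and le: "\<And>p. \<bar>w1 p\<bar> \<le> N" "\<And>p. \<bar>w2 p\<bar> \<le> N"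
  shows "integrable lborel (\<lambda>q. indicat_real D q * (\<beta> q * w2 (\<sigma> q)))" "integrable lborel (\<lambda>q. indicat_real D q * w1 (\<sigma> q))"
    "integrable lborel (\<lambda>q. indicat_real D q * (\<beta> q * w2 (\<sigma> q) - w1 (\<sigma> q)))"
proof -
  have c1: "continuous_on D (\<lambda>q. w1 (\<sigma> q))" "continuous_on D (\<lambda>q. w2 (\<sigma> q))"
    by (auto intro!: continuous_on_compose2[OF c(1)] continuous_on_compose2[OF c(2)] continuous_\<sigma>)
  show i1: "integrable lborel (\<lambda>q. indicat_real D q * (\<beta> q * w2 (\<sigma> q)))"
  proof (rule integrable_on_D)
    show "continuous_on D (\<lambda>q. \<beta> q * w2 (\<sigma> q))" by (intro continuous_intros continuous_\<beta> c1)
    show "\<bar>\<beta> q * w2 (\<sigma> q)\<bar> \<le> B * N" if "q \<in> D" for q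
      unfolding abs_mult using slope_le[OF that] le(2) slope_bound_nonneg by (intro mult_mono) auto
  qed
  show i2: "integrable lborel (\<lambda>q. indicat_real D q * w1 (\<sigma> q))"
    by (rule integrable_on_D[OF c1(1) le(1)])
  show "integrable lborel (\<lambda>q. indicat_real D q * (\<beta> q * w2 (\<sigma> q) - w1 (\<sigma> q)))"
    unfolding right_diff_distrib by (intro Bochner_Integration.integrable_diff i1[unfolded right_diff_distrib] i2)
qed

lemma C1c_bounded:
  assumes "C1c w1 Om" "C1c w2 Om"
  shows "\<exists>N. (\<forall>p. \<bar>w1 p\<bar> \<le> N) \<and> (\<forall>p. \<bar>w2 p\<bar> \<le> N)"
proof -
  have "\<exists>N\<ge>0. \<forall>p. \<bar>w p\<bar> \<le> N" if "C1c w Om" for w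
  proof (rule continuous_compact_support_bounded)
    show "continuous_on UNIV w" "compact (closure {p. w p \<noteq> 0})" using that C1_continuous unfolding C1c_iff by auto
    show "w p = 0" if "p \<notin> closure {p. w p \<noteq> 0}" for p using that closure_subset[of "{p. w p \<noteq> 0}"] by auto
  qed
  then obtain N1 N2 where "\<forall>p. \<bar>w1 p\<bar> \<le> N1" "\<forall>p. \<bar>w2 p\<bar> \<le> N2" using assms by metis
  then show ?thesis by (intro exI[of _ "max N1 N2"]) (auto simp: le_max_iff_disj)
qed

lemma divergence_Eepi:
  assumes w1: "C1c w1 (cylL D)" and w2: "C1c w2 (cylL D)"
  shows "divergence (Eepi D u) w1 w2 = surf w1 w2"
proof -
  have c: "continuous_on UNIV w1" "continuous_on UNIV w2" using w1 w2 C1_continuous unfolding C1c_iff by auto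
  obtain N where N: "\<And>p. \<bar>w1 p\<bar> \<le> N" "\<And>p. \<bar>w2 p\<bar> \<le> N" using C1c_bounded[OF w1 w2] by blast
  have z: "w1 (\<sigma> q) = 0" if "q \<notin> D" for q
    using that w1 closure_subset[of "{p. w1 p \<noteq> 0}"] unfolding C1c_iff cylL_eq \<sigma>_def by (auto dest!: subsetD)
  have "(\<integral>q. - w1 (\<sigma> q) \<partial>lborel) = (\<integral>q. - (indicat_real D q * w1 (\<sigma> q)) \<partial>lborel)"
    by (intro Bochner_Integration.integral_cong refl) (use z in \<open>auto simp: indicator_def\<close>)
  then have "(\<integral>q. - w1 (\<sigma> q) \<partial>lborel) = - (\<integral>q. indicat_real D q * w1 (\<sigma> q) \<partial>lborel)" by simp
  then have "divergence (Eepi D u) w1 w2 = (\<integral>q. indicat_real D q * (\<beta> q * w2 (\<sigma> q)) \<partial>lborel) - (\<integral>q. indicat_real D q * w1 (\<sigma> q) \<partial>lborel)"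
    unfolding divergence_def green_X[OF continuous_u w1] green_Y[OF lip open_D arcs w2] \<sigma>_def by simp
  also have "\<dots> = surf w1 w2"
    unfolding surf_def right_diff_distrib[of "indicat_real D _"]
    by (rule Bochner_Integration.integral_diff[symmetric]) (rule integrable_surf(1)[OF c N], rule integrable_surf(2)[OF c N])
  finally show ?thesis .
qed

lemma surf_le_area:
  assumes w1: "C1c w1 Om" and w2: "C1c w2 Om" and le: "\<And>p. (w1 p)\<^sup>2 + (w2 p)\<^sup>2 \<le> 1"
  shows "surf w1 w2 \<le> area"
proof -
  have c: "continuous_on UNIV w1" "continuous_on UNIV w2" using w1 w2 C1_continuous unfolding C1c_iff by auto
  obtain N where N: "\<And>p. \<bar>w1 p\<bar> \<le> N" "\<And>p. \<bar>w2 p\<bar> \<le> N" using C1c_bounded[OF w1 w2] by blast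
  show ?thesis unfolding surf_def area_def
  proof (rule integral_mono[OF integrable_surf(3)[OF c N] integrable_area])
    fix q
    have "\<bar>- 1 * w1 (\<sigma> q) + \<beta> q * w2 (\<sigma> q)\<bar> \<le> sqrt ((- 1)\<^sup>2 + (\<beta> q)\<^sup>2)" by (rule abs_lincomb_le_sqrt[OF le])
    then show "indicat_real D q * (\<beta> q * w2 (\<sigma> q) - w1 (\<sigma> q)) \<le> indicat_real D q * sqrt (1 + (\<beta> q)\<^sup>2)"
      by (intro mult_left_mono) auto
  qed
qed

lemma open_EepiR_sides: "open (EepiR Dr v)" "open (cylR Dr - EepiR Dr v - Sgraph D u)"
proof -
  have cF: "continuous_on (cylR Dr) (\<lambda>x. fst x - v (rightq x))"
    by (intro continuous_intros continuous_on_compose2[OF continuous_v continuous_rightq]) (auto simp: cylR_eq)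
  note op = continuous_open_preimage[OF cF open_cylR[OF open_Dr]]
  have "EepiR Dr v = cylR Dr \<inter> (\<lambda>x. fst x - v (rightq x)) -` {0<..}" unfolding EepiR_eq cylR_eq by auto
  then show "open (EepiR Dr v)" using op[of "{0<..}"] by simp
  have "cylR Dr - EepiR Dr v - Sgraph D u = cylR Dr \<inter> (\<lambda>x. fst x - v (rightq x)) -` {..<0}"
    unfolding graph_eq EepiR_eq cylR_eq SgraphR_eq by auto
  then show "open (cylR Dr - EepiR Dr v - Sgraph D u)" using op[of "{..<0}"] by simp
qed

text \<open>The Gauss-Green formula is proved for the left epigraph. A field on the right cylinder,
  cut off to the neighbourhood of the graph where both epigraphs coincide, is a field on the left
  cylinder with the same values on the graph and no larger norm. The cut-off fields are part of the
  conclusion because they also carry the calibration over to the left side.\<close>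

lemma divergence_EepiR:
  assumes w1: "C1c w1 (cylR Dr)" and w2: "C1c w2 (cylR Dr)"
  shows "\<exists>z1 z2. C1c z1 (cylL D) \<and> C1c z2 (cylL D) \<and> (\<forall>p. (z1 p)\<^sup>2 + (z2 p)\<^sup>2 \<le> (w1 p)\<^sup>2 + (w2 p)\<^sup>2) \<and>
    divergence (Eepi D u) z1 z2 = surf w1 w2 \<and> divergence (EepiR Dr v) w1 w2 = surf w1 w2"
proof -
  obtain q1 where q1: "q1 \<in> D" "fst q1 = 0" using meets_axis by blast
  obtain U where U: "open U" "Sgraph D u \<subseteq> U" "U \<subseteq> cylL D \<inter> cylR Dr" "\<forall>x\<in>U. x \<in> Eepi D u \<longleftrightarrow> x \<in> EepiR Dr v"
    using epigraphs_agree_near_graph[OF open_D connected_D continuous_u open_Dr continuous_v graph_eq q1] by blast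
  define K where "K = closure {p. w1 p \<noteq> 0} \<union> closure {p. w2 p \<noteq> 0}"
  have K: "compact K" "K \<subseteq> cylR Dr" using w1 w2 unfolding K_def C1c_iff by auto
  have sub: "EepiR Dr v \<subseteq> cylR Dr" "Sgraph D u \<inter> EepiR Dr v = {}"
    unfolding graph_eq EepiR_eq SgraphR_eq cylR_eq by auto
  from localise_divergence[OF open_EepiR_sides(1) open_cylR[OF open_Dr] sub(1) open_EepiR_sides(2) sub(2) U(1,2) K]
  obtain \<eta> where eta: "\<And>x. 0 \<le> \<eta> x \<and> \<eta> x \<le> 1"
    and loc: "\<And>w. C1c w (cylR Dr) \<Longrightarrow> closure {p. w p \<noteq> 0} \<subseteq> K \<Longrightarrow>
     C1c (\<lambda>x. \<eta> x * w x) U \<and> C1c (\<lambda>x. \<eta> x * w x) (cylR Dr) \<and> (\<forall>x\<in>Sgraph D u. \<eta> x * w x = w x) \<and>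
     (\<integral>p. indicat_real (EepiR Dr v) p * Xop w p \<partial>lborel) = (\<integral>p. indicat_real (EepiR Dr v) p * Xop (\<lambda>x. \<eta> x * w x) p \<partial>lborel) \<and>
     (\<integral>p. indicat_real (EepiR Dr v) p * Yop w p \<partial>lborel) = (\<integral>p. indicat_real (EepiR Dr v) p * Yop (\<lambda>x. \<eta> x * w x) p \<partial>lborel)"
    by blast
  define z1 where "z1 x = \<eta> x * w1 x" for x
  define z2 where "z2 x = \<eta> x * w2 x" for x
  note l1 = loc[OF w1, folded z1_def] and l2 = loc[OF w2, folded z2_def]
  have k1: "closure {p. w1 p \<noteq> 0} \<subseteq> K" and k2: "closure {p. w2 p \<noteq> 0} \<subseteq> K" unfolding K_def by auto
  have zU: "C1c z1 U" "C1c z2 U" using l1[OF k1] l2[OF k2] by auto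
  have zL: "C1c z1 (cylL D)" "C1c z2 (cylL D)" using zU U(3) C1c_mono by blast+
  \<comment> \<open>Inside \<open>U\<close> the two epigraphs agree; outside, the derivatives of the
    cut-off fields vanish.\<close>
  have ind: "indicat_real (EepiR Dr v) p * frechet_derivative z (at p) k = indicat_real (Eepi D u) p * frechet_derivative z (at p) k"
    if "C1c z U" for z p k
  proof (cases "p \<in> U")
    case True
    then show ?thesis using U(4) by (auto simp: indicator_def)
  next
    case False
    then have "p \<notin> closure {p. z p \<noteq> 0}" using that unfolding C1c_iff by blast
    then show ?thesis by (simp add: frechet_derivative_zero_off_support)
  qed
  have "divergence (EepiR Dr v) w1 w2 = divergence (EepiR Dr v) z1 z2" unfolding divergence_def using l1[OF k1] l2[OF k2] by simp
  also have "\<dots> = divergence (Eepi D u) z1 z2" unfolding divergence_def Xop_eq Yop_eq ind[OF zU(1)] ind[OF zU(2)] ..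
  finally have d: "divergence (EepiR Dr v) w1 w2 = divergence (Eepi D u) z1 z2" .
  have "surf z1 z2 = surf w1 w2" unfolding surf_def
  proof (intro Bochner_Integration.integral_cong refl)
    fix q
    show "indicat_real D q * (\<beta> q * z2 (\<sigma> q) - z1 (\<sigma> q)) = indicat_real D q * (\<beta> q * w2 (\<sigma> q) - w1 (\<sigma> q))"
      using l1[OF k1] l2[OF k2] \<sigma>_in_graph[of q] by (cases "q \<in> D") auto
  qed
  then have s: "divergence (Eepi D u) z1 z2 = surf w1 w2" using divergence_Eepi[OF zL] by simp
  have "(z1 p)\<^sup>2 + (z2 p)\<^sup>2 \<le> (w1 p)\<^sup>2 + (w2 p)\<^sup>2" for p
  proof -
    have "(\<eta> p)\<^sup>2 \<le> 1" using eta[of p] by (simp add: power_le_one)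
    then have "(\<eta> p)\<^sup>2 * ((w1 p)\<^sup>2 + (w2 p)\<^sup>2) \<le> 1 * ((w1 p)\<^sup>2 + (w2 p)\<^sup>2)" by (intro mult_right_mono) auto
    then show ?thesis unfolding z1_def z2_def power_mult_distrib by (simp add: algebra_simps)
  qed
  then show ?thesis using zL s d by (intro exI[of _ z1] exI[of _ z2]) auto
qed

end

section \<open>The approximate calibration\<close>

lemma inner_compact:
  fixes D :: "'a::euclidean_space set"
  assumes "open D" "bounded D" "e > 0"
  shows "\<exists>T. compact T \<and> T \<subseteq> D \<and> measure lborel (D - T) < e"
proof -
  have "D \<in> sets lebesgue" using assms(1) by (simp add: borel_open)
  then obtain T where T: "closed T" "T \<subseteq> D" "D - T \<in> lmeasurable" "emeasure lebesgue (D - T) < ennreal e"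
    using sets_lebesgue_inner_closed assms(3) by blast
  have "measure lebesgue (D - T) < e"
    using T(3,4) assms(3) by (simp add: emeasure_eq_measure2 ennreal_less_iff)
  moreover have "measure lebesgue (D - T) = measure lborel (D - T)"
    using assms(1) T(1) by (intro measure_completion) (simp add: borel_open borel_closed sets.Diff)
  moreover have "compact T" using T(1,2) assms(2) bounded_subset by (auto simp: compact_eq_bounded_closed)
  ultimately show ?thesis using T(2) by auto
qed

context arc_graph
begin

definition right_slope :: "real \<times> real \<Rightarrow> real" where "right_slope r = \<beta> (right_to_left v r)"

lemma continuous_right_slope: "continuous_on Dr right_slope"
  unfolding right_slope_def[abs_def]
proof (rule continuous_on_compose2[OF continuous_\<beta>])
  show "continuous_on Dr (right_to_left v)"
    unfolding right_to_left_def[abs_def] by (intro continuous_intros continuous_v)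
  show "right_to_left v ` Dr \<subseteq> D" using right_to_left(1)[OF graph_eq] by blast
qed

text \<open>Three scales limit the box: it must stay where the cutoff is 1, so that \<open>b\<close>
  is the true slope; it must fit into a flux-free ball; and the slope may oscillate by at most
  \<open>w\<close> from its centre. The cutoff extends the slope to a continuous function on the
  plane, as averaging requires.\<close>

lemma smeared_normal:
  assumes R: "compact R" "R \<subseteq> Dr" and w: "w > 0"
  shows "\<exists>n1 n2 e. e > 0 \<and> continuous_on UNIV n1 \<and> continuous_on UNIV n2 \<and> (\<forall>p. (n1 p)\<^sup>2 + (n2 p)\<^sup>2 \<le> 1) \<and>
    (\<forall>r\<in>R. \<bar>avg e n1 r - nu1 (right_slope r)\<bar> \<le> w \<and> \<bar>avg e n2 r - nu2 (right_slope r)\<bar> \<le> w \<and>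
      \<bar>avg_y e n2 r + 4 * fst r * avg_t e n1 r\<bar> \<le> 4 * w)"
proof -
  obtain \<eta> V where eta: "C1 \<eta>" "open V" "R \<subseteq> V" "\<And>x. x \<in> V \<Longrightarrow> \<eta> x = 1" "closure {x. \<eta> x \<noteq> 0} \<subseteq> Dr"
    using C1_cutoff[OF R(1) open_Dr R(2)] by metis
  define b where "b r = \<eta> r * right_slope r" for r
  have bV: "b r = right_slope r" if "r \<in> V" for r using eta(4)[OF that] unfolding b_def by simp
  have cb: "continuous_on UNIV b"
  proof -
    have "continuous_on Dr b" unfolding b_def[abs_def]
      by (intro continuous_on_mult continuous_right_slope continuous_on_subset[OF C1_continuous[OF eta(1)]]) auto
    moreover have "continuous_on (- closure {x. \<eta> x \<noteq> 0}) b"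
    proof (rule continuous_on_eq[OF continuous_on_const[of _ 0]])
      show "0 = b x" if "x \<in> - closure {x. \<eta> x \<noteq> 0}" for x
        using that closure_subset[of "{x. \<eta> x \<noteq> 0}"] unfolding b_def by auto
    qed
    ultimately have "continuous_on (Dr \<union> - closure {x. \<eta> x \<noteq> 0}) b"
      by (intro continuous_on_open_Un open_Dr) auto
    moreover have "Dr \<union> - closure {x. \<eta> x \<noteq> 0} = UNIV" using eta(5) by blast
    ultimately show ?thesis by simp
  qed
  obtain e1 where e1: "e1 > 0" "(\<Union>x\<in>R. cball x e1) \<subseteq> V"
    using compact_subset_open_imp_cball_epsilon_subset[OF R(1) eta(2,3)] by blast
  \<comment> \<open>Balls all of whose rectangles are flux-free. They cover the compact
    \<open>R\<close>, and a Lebesgue number of the cover makes the admissible box size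
    uniform.\<close>
  define G where "G = {ball r0 \<rho> |r0 \<rho>. \<forall>y0 y1 t0 t1. y0 \<le> y1 \<longrightarrow> t0 \<le> t1 \<longrightarrow> cbox (y0, t0) (y1, t1) \<subseteq> ball r0 \<rho> \<longrightarrow>
     box_flux_zero right_slope y0 y1 t0 t1}"
  have "R \<subseteq> \<Union>G"
  proof
    fix r assume "r \<in> R"
    then have "r \<in> Dr" using R(2) by blast
    from right_box_flux[OF graph_eq open_Dr this loclip arcs slope_le, folded right_slope_def]
    obtain \<rho> where "\<rho> > 0" "\<forall>y0 y1 t0 t1. y0 \<le> y1 \<longrightarrow> t0 \<le> t1 \<longrightarrow> cbox (y0, t0) (y1, t1) \<subseteq> ball r \<rho> \<longrightarrow>
       box_flux_zero right_slope y0 y1 t0 t1" by (metis (no_types, lifting) ext)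
    then have "ball r \<rho> \<in> G" unfolding G_def by blast
    moreover have "r \<in> ball r \<rho>" using \<open>\<rho> > 0\<close> by simp
    ultimately show "r \<in> \<Union>G" by blast
  qed
  moreover have "open S" if "S \<in> G" for S using that unfolding G_def by auto
  ultimately obtain e2 where e2: "e2 > 0" "\<And>x. x \<in> R \<Longrightarrow> \<exists>S\<in>G. ball x e2 \<subseteq> S"
    using Heine_Borel_lemma[OF R(1)] by metis
  obtain M where M: "\<And>x. x \<in> R \<Longrightarrow> norm x \<le> M"
    using compact_imp_bounded[OF R(1)] unfolding bounded_iff by blast
  have "uniformly_continuous_on (cball 0 (M + 1)) b"
    by (rule compact_uniformly_continuous[OF continuous_on_subset[OF cb]]) auto
  then obtain d where d: "d > 0" "\<And>x y. x \<in> cball 0 (M + 1) \<Longrightarrow> y \<in> cball 0 (M + 1) \<Longrightarrow> dist y x < d \<Longrightarrow> dist (b y) (b x) < w"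
    using w unfolding uniformly_continuous_on_def by metis
  define m where "m = min (min e1 e2) (min d 1)"
  have m: "m > 0" "m \<le> e1" "m \<le> e2" "m \<le> d" "m \<le> 1" using e1(1) e2(1) d(1) unfolding m_def by auto
  \<comment> \<open>Points of the box with half-side \<open>e\<close> are at distance at most
    \<open>2 * e < m\<close> from its centre.\<close>
  define e where "e = m / 4"
  have e: "e > 0" using m(1) unfolding e_def by simp
  have near: "dist x (fst x + r, snd x + s) < m" if "\<bar>r\<bar> \<le> e" "\<bar>s\<bar> \<le> e" for x :: "real \<times> real" and r s
  proof -
    have "dist x (fst x + r, snd x + s) \<le> \<bar>r\<bar> + \<bar>s\<bar>"
      using norm_pair_le[of "- r" "- s"] by (cases x) (simp add: dist_norm)
    then show ?thesis using that m(1) unfolding e_def by simp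
  qed
  have osc: "\<bar>b (fst x + r, snd x + s) - b x\<bar> \<le> w" if x: "x \<in> R" and rs: "\<bar>r\<bar> \<le> e" "\<bar>s\<bar> \<le> e" for x r s
  proof -
    let ?y = "(fst x + r, snd x + s)"
    have dd: "dist ?y x < m" using near[OF rs, of x] by (simp add: dist_commute)
    have "norm ?y \<le> norm x + dist ?y x" by (metis dist_norm norm_triangle_sub)
    then have "?y \<in> cball 0 (M + 1)" "x \<in> cball 0 (M + 1)" using M[OF x] dd m(5) by auto
    from d(2)[OF this(2,1)] dd m(4) show ?thesis by (simp add: dist_real_def)
  qed
  define n1 where "n1 p = nu1 (b p)" for p
  define n2 where "n2 p = nu2 (b p)" for p
  have "continuous_on UNIV nu1" "continuous_on UNIV nu2"
    using DERIV_isCont[OF nu1_DERIV] DERIV_isCont[OF nu2_DERIV] by (auto simp: continuous_on_eq_continuous_at)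
  then have c1: "continuous_on UNIV n1" and c2: "continuous_on UNIV n2"
    unfolding n1_def[abs_def] n2_def[abs_def] by (auto intro: continuous_on_compose2[OF _ cb])
  have o1: "\<bar>n1 (fst x + r, snd x + s) - n1 x\<bar> \<le> w" and o2: "\<bar>n2 (fst x + r, snd x + s) - n2 x\<bar> \<le> w"
    if "x \<in> R" "\<bar>r\<bar> \<le> e" "\<bar>s\<bar> \<le> e" for x r s
    unfolding n1_def n2_def using osc[OF that] nu1_lipschitz nu2_lipschitz order_trans by blast+
  have "\<bar>avg e n1 r - nu1 (right_slope r)\<bar> \<le> w \<and> \<bar>avg e n2 r - nu2 (right_slope r)\<bar> \<le> w \<and>
      \<bar>avg_y e n2 r + 4 * fst r * avg_t e n1 r\<bar> \<le> 4 * w" if r: "r \<in> R" for r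
  proof -
    have rV: "r \<in> V" using r eta(3) by blast
    have v1: "n1 r = nu1 (right_slope r)" and v2: "n2 r = nu2 (right_slope r)" unfolding n1_def n2_def bV[OF rV] by auto
    have a1: "\<bar>avg e n1 r - n1 r\<bar> \<le> w" by (rule avg_close[OF c1 e o1[OF r]])
    have a2: "\<bar>avg e n2 r - n2 r\<bar> \<le> w" by (rule avg_close[OF c2 e o2[OF r]])
    have box: "cbox (fst r - e, snd r - e) (fst r + e, snd r + e) \<subseteq> ball r m"
    proof
      fix z assume "z \<in> cbox (fst r - e, snd r - e) (fst r + e, snd r + e)"
      then have "\<bar>fst z - fst r\<bar> \<le> e" "\<bar>snd z - snd r\<bar> \<le> e" by (cases z, auto simp: cbox_Pair_eq)+
      from near[OF this, of r] show "z \<in> ball r m" by simp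
    qed
    obtain S where S: "S \<in> G" "ball r e2 \<subseteq> S" using e2(2)[OF r] by blast
    have "cbox (fst r - e, snd r - e) (fst r + e, snd r + e) \<subseteq> S" using box S(2) m(3) by force
    then have fl: "box_flux_zero right_slope (fst r - e) (fst r + e) (snd r - e) (snd r + e)"
      using S(1) e unfolding G_def by auto
    have "box_flux_zero b (fst r - e) (fst r + e) (snd r - e) (snd r + e)"
    proof (subst box_flux_zero_cong[of _ _ _ _ b right_slope])
      fix q assume "q \<in> cbox (fst r - e, snd r - e) (fst r + e, snd r + e)"
      then have "q \<in> cball r e1" using box m(2) by force
      then show "b q = right_slope q" using e1(2) r bV by blast
    qed (use e fl in auto)
    then have flux: "(LINT t:{snd r - e..snd r + e}|lborel. n2 (fst r + e, t) - n2 (fst r - e, t))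
      + (LINT y:{fst r - e..fst r + e}|lborel. 4 * y * (n1 (y, snd r + e) - n1 (y, snd r - e))) = 0"
      unfolding box_flux_zero_def n1_def n2_def .
    \<comment> \<open>Values on opposite sides of the box are each within \<open>w\<close> of the
      central value, so they differ by at most \<open>2 * w\<close>.\<close>
    have "\<bar>avg_y e n2 r + 4 * fst r * avg_t e n1 r\<bar> \<le> 2 * (2 * w)"
    proof (rule avg_divergence_small[OF c1 c2 e flux])
      fix s assume s: "\<bar>s\<bar> \<le> e"
      show "\<bar>n1 (fst r + s, snd r + e) - n1 (fst r + s, snd r - e)\<bar> \<le> 2 * w"
        using o1[OF r s, of e] o1[OF r s, of "- e"] e by simp
    qed
    then show ?thesis using a1 a2 unfolding v1 v2 by simp
  qed
  moreover have "(n1 p)\<^sup>2 + (n2 p)\<^sup>2 \<le> 1" for p unfolding n1_def n2_def by (simp add: nu_sum_squares)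
  ultimately show ?thesis using e c1 c2 by blast
qed

text \<open>The compact set \<open>K\<close> on which the divergence is made small is left to the
  application: it is empty for the left perimeter and the closure of the symmetric difference for a
  competitor.\<close>

lemma calibration:
  assumes K: "compact K" "K \<subseteq> cylR Dr" and \<delta>: "\<delta> > 0"
  shows "\<exists>w1 w2. C1c w1 (cylR Dr) \<and> C1c w2 (cylR Dr) \<and> (\<forall>p. (w1 p)\<^sup>2 + (w2 p)\<^sup>2 \<le> 1) \<and>
    area - \<delta> \<le> surf w1 w2 \<and> (\<forall>p\<in>K. \<bar>Xop w1 p + Yop w2 p\<bar> \<le> \<delta>)"
proof -
  define mD where "mD = measure lborel D"
  have mD: "mD \<ge> 0" unfolding mD_def by simp
  have B1: "1 + B > 0" using slope_bound_nonneg by simp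
  \<comment> \<open>On \<open>D - T\<close> the area density and the flux density are each at most
    \<open>1 + B\<close> in absolute value, so giving up this part costs at most
    \<open>\<delta> / 2\<close>.\<close>
  obtain T where T: "compact T" "T \<subseteq> D" "measure lborel (D - T) < \<delta> / (4 * (1 + B))"
    using inner_compact[OF open_D bounded_D, of "\<delta> / (4 * (1 + B))"] \<delta> B1 by auto
  \<comment> \<open>The first bound makes the divergence, at most \<open>4 * w\<close>, no larger
    than \<open>\<delta>\<close>; the second limits the loss \<open>(1 + B) * w\<close> per unit
    area to \<open>\<delta> / 2\<close> in total.\<close>
  define w where "w = min (\<delta> / 4) (\<delta> / (2 * (1 + B) * (mD + 1)))"
  have w: "w > 0" "4 * w \<le> \<delta>" using \<delta> B1 mD unfolding w_def by auto
  have wD: "(1 + B) * w * mD \<le> \<delta> / 2"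
  proof -
    have "(1 + B) * w * mD \<le> (1 + B) * w * (mD + 1)" using B1 w(1) by (intro mult_left_mono) auto
    also have "\<dots> \<le> (1 + B) * (\<delta> / (2 * (1 + B) * (mD + 1))) * (mD + 1)"
      using B1 mD unfolding w_def by (intro mult_right_mono mult_left_mono) auto
    also have "\<dots> = \<delta> / 2"
    proof -
      have cancel: "c * (d / (2 * c * m)) * m = d / 2" if "c \<noteq> 0" "m \<noteq> 0" for c d m :: real
        using that by simp
      show ?thesis by (rule cancel) (use B1 mD in auto)
    qed
    finally show ?thesis .
  qed
  \<comment> \<open>The cutoff has to be 1 near \<open>K\<close> for the divergence and near the
    surface over \<open>T\<close> for the flux.\<close>
  define K1 where "K1 = K \<union> \<sigma> ` T"
  have K1: "compact K1" unfolding K1_def by (intro compact_Un K(1) compact_continuous_image continuous_\<sigma> T(1))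
  have "\<sigma> q \<in> cylR Dr" if "q \<in> D" for q
    using \<sigma>_in_graph[OF that] unfolding graph_eq SgraphR_eq cylR_eq by blast
  then have K1r: "K1 \<subseteq> cylR Dr" unfolding K1_def using K(2) T(2) by blast
  obtain \<kappa> V where kap: "C1 \<kappa>" "\<And>x. 0 \<le> \<kappa> x \<and> \<kappa> x \<le> 1" "open V" "K1 \<subseteq> V" "\<And>x. x \<in> V \<Longrightarrow> \<kappa> x = 1"
    "compact (closure {x. \<kappa> x \<noteq> 0})" "closure {x. \<kappa> x \<noteq> 0} \<subseteq> cylR Dr"
    using C1_cutoff[OF K1 open_cylR[OF open_Dr] K1r] by (metis (no_types, lifting))
  define R where "R = rightq ` closure {x. \<kappa> x \<noteq> 0}"
  have R: "compact R" "R \<subseteq> Dr"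
    unfolding R_def using kap(6,7) by (auto intro: compact_continuous_image continuous_rightq simp: cylR_eq)
  obtain n1 n2 e where n: "e > 0" "continuous_on UNIV n1" "continuous_on UNIV n2" "\<And>p. (n1 p)\<^sup>2 + (n2 p)\<^sup>2 \<le> 1"
    "\<And>r. r \<in> R \<Longrightarrow> \<bar>avg e n1 r - nu1 (right_slope r)\<bar> \<le> w \<and> \<bar>avg e n2 r - nu2 (right_slope r)\<bar> \<le> w \<and>
      \<bar>avg_y e n2 r + 4 * fst r * avg_t e n1 r\<bar> \<le> 4 * w"
    using smeared_normal[OF R w(1)] by metis
  \<comment> \<open>The minus sign turns the normal with positive first component, which points into
    the epigraph, into the outward normal.\<close>
  define z1 where "z1 p = - avg e n1 (rightq p)" for p
  define z2 where "z2 p = - avg e n2 (rightq p)" for p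
  define w1 where "w1 p = \<kappa> p * z1 p" for p
  define w2 where "w2 p = \<kappa> p * z2 p" for p
  have zC: "C1 z1" "C1 z2" unfolding z1_def[abs_def] z2_def[abs_def] by (intro C1_minus avg_rightq(1) n)+
  have C1cI: "C1c (\<lambda>p. \<kappa> p * z p) (cylR Dr)" if "C1 z" for z
  proof -
    have "closure {p. \<kappa> p * z p \<noteq> 0} \<subseteq> closure {p. \<kappa> p \<noteq> 0}" by (rule closure_mono) auto
    then show ?thesis unfolding C1c_iff using kap(6,7) C1_mult[OF kap(1) that] compact_Int_closed[OF kap(6) closed_closure]
      by (metis (no_types, lifting) dual_order.trans inf.absorb_iff2)
  qed
  have wC: "C1c w1 (cylR Dr)" "C1c w2 (cylR Dr)" unfolding w1_def[abs_def] w2_def[abs_def] using C1cI zC by auto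
  have le: "(w1 p)\<^sup>2 + (w2 p)\<^sup>2 \<le> 1" for p
  proof -
    have "(w1 p)\<^sup>2 + (w2 p)\<^sup>2 = (\<kappa> p)\<^sup>2 * ((avg e n1 (rightq p))\<^sup>2 + (avg e n2 (rightq p))\<^sup>2)"
      unfolding w1_def w2_def z1_def z2_def by (simp add: power_mult_distrib algebra_simps)
    also have "\<dots> \<le> 1 * 1" using kap(2)[of p] avg_norm_le_1[OF n(2,3,1,4)]
      by (intro mult_mono) (auto simp: power_le_one)
    finally show ?thesis by simp
  qed
  have Vr: "rightq p \<in> R" if "p \<in> V" for p
    unfolding R_def
  proof (rule imageI)
    have "p \<in> {x. \<kappa> x \<noteq> 0}" using kap(5)[OF that] by simp
    then show "p \<in> closure {x. \<kappa> x \<noteq> 0}" by (rule subsetD[OF closure_subset])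
  qed
  have loc: "frechet_derivative (\<lambda>p. \<kappa> p * z p) (at p) k = frechet_derivative z (at p) k" if "C1 z" "p \<in> V" for z p k
  proof -
    have "((\<lambda>p. \<kappa> p * z p) has_derivative frechet_derivative z (at p)) (at p)"
      by (rule has_derivative_transform_within_open[OF C1D[OF that(1)] kap(3) that(2)]) (simp add: kap(5))
    from frechet_derivative_at[OF this] show ?thesis by metis
  qed
  have neg: "frechet_derivative (\<lambda>p. - f p) (at p) k = - frechet_derivative f (at p) k" if "C1 f" for f :: "hpt \<Rightarrow> real" and p k
    using frechet_derivative_at[OF has_derivative_minus[OF C1D[OF that]]] by metis
  have div: "\<bar>Xop w1 p + Yop w2 p\<bar> \<le> \<delta>" if p: "p \<in> K" for p
  proof -
    have pV: "p \<in> V" using p kap(4) unfolding K1_def by blast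
    have "Xop w1 p = - (4 * fst (rightq p) * avg_t e n1 (rightq p))"
      unfolding Xop_eq w1_def[abs_def] loc[OF zC(1) pV] unfolding z1_def[abs_def] neg[OF avg_rightq(1)[OF n(2,1)]] Xop_eq[symmetric]
      by (simp add: avg_rightq(2)[OF n(2,1)])
    moreover have "Yop w2 p = - avg_y e n2 (rightq p)"
      unfolding Yop_eq w2_def[abs_def] loc[OF zC(2) pV] unfolding z2_def[abs_def] neg[OF avg_rightq(1)[OF n(3,1)]] Yop_eq[symmetric]
      by (simp add: avg_rightq(3)[OF n(3,1)])
    moreover have "\<bar>avg_y e n2 (rightq p) + 4 * fst (rightq p) * avg_t e n1 (rightq p)\<bar> \<le> 4 * w" using n(5)[OF Vr[OF pV]] by blast
    ultimately show ?thesis using w(2) by linarith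
  qed
  \<comment> \<open>Over \<open>T\<close> each component of the field is within \<open>w\<close> of
    that of the outward normal, whose flux density is exactly
    \<open>sqrt (1 + \<beta>\<^sup>2)\<close>; over \<open>D - T\<close> Cauchy-Schwarz bounds the
    loss.\<close>
  have pt: "indicat_real D q * sqrt (1 + (\<beta> q)\<^sup>2) - ((1 + B) * w * indicat_real D q + 2 * (1 + B) * indicat_real (D - T) q)
      \<le> indicat_real D q * (\<beta> q * w2 (\<sigma> q) - w1 (\<sigma> q))" for q
  proof -
    consider "q \<notin> D" | "q \<in> T" | "q \<in> D - T" by blast
    then show ?thesis
    proof cases
      case 1 then show ?thesis by simp
    next
      case 2
      then have qD: "q \<in> D" using T(2) by blast
      have sV: "\<sigma> q \<in> V" using 2 kap(4) unfolding K1_def by blast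
      have rs: "rightq (\<sigma> q) = left_to_right u q"
        unfolding \<sigma>_def rightq_def lift_left_def left_to_right_def by (simp add: algebra_simps)
      have "right_slope (rightq (\<sigma> q)) = \<beta> q"
        unfolding rs right_slope_def left_to_right(3)[OF graph_eq qD] ..
      then have a: "\<bar>avg e n1 (rightq (\<sigma> q)) - nu1 (\<beta> q)\<bar> \<le> w" "\<bar>avg e n2 (rightq (\<sigma> q)) - nu2 (\<beta> q)\<bar> \<le> w"
        using n(5)[OF Vr[OF sV]] by auto
      define x1 where "x1 = avg e n1 (rightq (\<sigma> q)) - nu1 (\<beta> q)"
      define x2 where "x2 = avg e n2 (rightq (\<sigma> q)) - nu2 (\<beta> q)"
      have ws: "w1 (\<sigma> q) = - (nu1 (\<beta> q) + x1)" "w2 (\<sigma> q) = - (nu2 (\<beta> q) + x2)"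
        unfolding w1_def w2_def z1_def z2_def x1_def x2_def kap(5)[OF sV] by auto
      have "\<beta> q * w2 (\<sigma> q) - w1 (\<sigma> q) = (nu1 (\<beta> q) - \<beta> q * nu2 (\<beta> q)) + (x1 - \<beta> q * x2)"
        unfolding ws by (simp add: algebra_simps)
      moreover have "nu1 (\<beta> q) - \<beta> q * nu2 (\<beta> q) = sqrt (1 + (\<beta> q)\<^sup>2)"
      proof -
        have "nu1 (\<beta> q) - \<beta> q * nu2 (\<beta> q) = (1 + (\<beta> q)\<^sup>2) / sqrt (1 + (\<beta> q)\<^sup>2)"
          unfolding nu1_def nu2_def by (simp add: add_divide_distrib power2_eq_square)
        then show ?thesis using one_plus_sq_pos[of "\<beta> q"] by (simp add: real_div_sqrt)
      qed
      moreover have "\<bar>\<beta> q * x2\<bar> \<le> B * w" unfolding abs_mult x2_def using a(2) slope_le[OF qD] slope_bound_nonneg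
        by (intro mult_mono) auto
      moreover have "\<bar>x1\<bar> \<le> w" using a(1) unfolding x1_def .
      ultimately have "sqrt (1 + (\<beta> q)\<^sup>2) - (1 + B) * w \<le> \<beta> q * w2 (\<sigma> q) - w1 (\<sigma> q)"
        unfolding distrib_right by linarith
      then show ?thesis using 2 qD by simp
    next
      case 3
      have "\<bar>- 1 * w1 (\<sigma> q) + \<beta> q * w2 (\<sigma> q)\<bar> \<le> sqrt ((- 1)\<^sup>2 + (\<beta> q)\<^sup>2)" by (rule abs_lincomb_le_sqrt[OF le])
      then have "- (1 + B) \<le> \<beta> q * w2 (\<sigma> q) - w1 (\<sigma> q)" "sqrt (1 + (\<beta> q)\<^sup>2) \<le> 1 + B" using sqrt_slope_le[of q] 3 by auto
      moreover have "0 \<le> (1 + B) * w" using B1 w(1) by simp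
      moreover have "s - (k + 2 * (1 + B)) \<le> y" if "- (1 + B) \<le> y" "s \<le> 1 + B" "0 \<le> k" for s k y
        using that by argo
      ultimately have "sqrt (1 + (\<beta> q)\<^sup>2) - ((1 + B) * w + 2 * (1 + B)) \<le> \<beta> q * w2 (\<sigma> q) - w1 (\<sigma> q)" by blast
      then show ?thesis using 3 by simp
    qed
  qed
  have fin: "emeasure lborel D < \<infinity>" by (rule emeasure_bounded_finite[OF bounded_D])
  then have finT: "emeasure lborel (D - T) < \<infinity>" using open_D emeasure_mono[of "D - T" D lborel] by (auto simp: borel_open intro: le_less_trans)
  have TB: "T \<in> sets borel" using T(1) by (simp add: borel_compact)
  have iD: "integrable lborel (indicat_real D)" "(\<integral>q. indicat_real D q \<partial>lborel) = mD"
    using fin open_D unfolding mD_def by (auto simp: integrable_real_indicator borel_open)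
  have iT: "integrable lborel (indicat_real (D - T))" "(\<integral>q. indicat_real (D - T) q \<partial>lborel) = measure lborel (D - T)"
    using finT open_D TB by (auto simp: integrable_real_indicator borel_open sets.Diff)
  let ?g = "\<lambda>q. (1 + B) * w * indicat_real D q + 2 * (1 + B) * indicat_real (D - T) q"
  have ig: "integrable lborel ?g" "(\<integral>q. ?g q \<partial>lborel) = (1 + B) * w * mD + 2 * (1 + B) * measure lborel (D - T)"
    using iD iT by auto
  have cw: "continuous_on UNIV w1" "continuous_on UNIV w2" using wC C1_continuous unfolding C1c_iff by auto
  obtain N where N: "\<And>p. \<bar>w1 p\<bar> \<le> N" "\<And>p. \<bar>w2 p\<bar> \<le> N" using C1c_bounded[OF wC] by blast
  have "area - (\<integral>q. ?g q \<partial>lborel) = (\<integral>q. indicat_real D q * sqrt (1 + (\<beta> q)\<^sup>2) - ?g q \<partial>lborel)"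
    unfolding area_def by (rule Bochner_Integration.integral_diff[OF integrable_area ig(1), symmetric])
  also have "\<dots> \<le> surf w1 w2" unfolding surf_def
    by (rule integral_mono[OF Bochner_Integration.integrable_diff[OF integrable_area ig(1)] integrable_surf(3)[OF cw N] pt])
  finally have "area - ((1 + B) * w * mD + 2 * (1 + B) * measure lborel (D - T)) \<le> surf w1 w2" unfolding ig(2) .
  moreover have "2 * (1 + B) * measure lborel (D - T) \<le> \<delta> / 2"
    using T(3) B1 by (simp add: field_simps)
  ultimately have "area - \<delta> \<le> surf w1 w2" using wD by linarith
  then show ?thesis using wC le div by (intro exI[of _ w1] exI[of _ w2]) auto
qed

end

section \<open>Perimeters as suprema of divergence integrals\<close>

lemma H_perimeter_le:
  assumes "\<And>v1 v2. C1c v1 Om \<Longrightarrow> C1c v2 Om \<Longrightarrow> (\<And>p. (v1 p)\<^sup>2 + (v2 p)\<^sup>2 \<le> 1) \<Longrightarrow>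
    (LINT p:E|lebesgue. Xop v1 p + Yop v2 p) \<le> c"
  shows "H_perimeter E Om \<le> ereal c"
  unfolding H_perimeter_def
  by (rule SUP_least) (use assms in \<open>auto simp: real_sqrt_le_1_iff\<close>)

lemma le_H_perimeter:
  assumes "C1c v1 Om" "C1c v2 Om" "\<And>p. (v1 p)\<^sup>2 + (v2 p)\<^sup>2 \<le> 1"
  shows "ereal (LINT p:E|lebesgue. Xop v1 p + Yop v2 p) \<le> H_perimeter E Om"
  unfolding H_perimeter_def
  by (rule SUP_upper2[of "(v1, v2)"]) (use assms in \<open>auto simp: real_sqrt_le_1_iff\<close>)

lemma H_perimeter_ge:
  assumes "\<And>\<delta>. \<delta> > 0 \<Longrightarrow> \<exists>v1 v2. C1c v1 Om \<and> C1c v2 Om \<and> (\<forall>p. (v1 p)\<^sup>2 + (v2 p)\<^sup>2 \<le> 1) \<and>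
     c - \<delta> \<le> (LINT p:E|lebesgue. Xop v1 p + Yop v2 p)"
  shows "ereal c \<le> H_perimeter E Om"
proof (rule ereal_le_epsilon2)
  fix \<delta> :: real assume "0 < \<delta>"
  then obtain v1 v2 where v: "C1c v1 Om" "C1c v2 Om" "\<And>p. (v1 p)\<^sup>2 + (v2 p)\<^sup>2 \<le> 1"
    "c - \<delta> \<le> (LINT p:E|lebesgue. Xop v1 p + Yop v2 p)" using assms by metis
  have "ereal (c - \<delta>) \<le> H_perimeter E Om"
    using le_H_perimeter[OF v(1,2,3), of E] v(4) order_trans ereal_less_eq(3) by metis
  then have "ereal (c - \<delta>) + ereal \<delta> \<le> H_perimeter E Om + ereal \<delta>" by (rule add_right_mono)
  then show "ereal c \<le> H_perimeter E Om + ereal \<delta>" by simp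
qed

lemma integrable_divergence:
  assumes "C1c w1 Om" "C1c w2 Om"
  shows "continuous_on UNIV (\<lambda>p. Xop w1 p + Yop w2 p)" "integrable lborel (\<lambda>p. Xop w1 p + Yop w2 p)"
proof -
  have w: "C1 w1" "C1 w2" "compact (closure {p. w1 p \<noteq> 0})" "compact (closure {p. w2 p \<noteq> 0})"
    using assms unfolding C1c_iff by auto
  show "continuous_on UNIV (\<lambda>p. Xop w1 p + Yop w2 p)"
    unfolding Xop_eq Yop_eq by (intro continuous_on_add continuous_Xop continuous_Yop w)
  show "integrable lborel (\<lambda>p. Xop w1 p + Yop w2 p)"
    using integrable_indicator_derivative[OF w(1,3) _ continuous_Xop[OF w(1)], of UNIV]
      integrable_indicator_derivative[OF w(2,4) _ continuous_Yop[OF w(2)], of UNIV]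
    unfolding Xop_eq Yop_eq by simp
qed

lemma set_integral_divergence:
  assumes w: "C1c w1 Om" "C1c w2 Om" and E: "E \<in> sets borel"
  shows "(LINT p:E|lebesgue. Xop w1 p + Yop w2 p) = divergence E w1 w2"
proof -
  have c: "C1 w1" "C1 w2" "compact (closure {p. w1 p \<noteq> 0})" "compact (closure {p. w2 p \<noteq> 0})"
    using w unfolding C1c_iff by auto
  have "(\<lambda>p. indicat_real E p *\<^sub>R (Xop w1 p + Yop w2 p)) \<in> borel_measurable lborel"
    using borel_measurable_continuous_onI[OF integrable_divergence(1)[OF w]] E by simp
  then have "(LINT p:E|lebesgue. Xop w1 p + Yop w2 p) = (\<integral>p. indicat_real E p * (Xop w1 p + Yop w2 p) \<partial>lborel)"
    unfolding set_lebesgue_integral_def by (simp add: integral_completion)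
  also have "\<dots> = divergence E w1 w2"
    unfolding divergence_def distrib_left Xop_eq Yop_eq
    by (intro Bochner_Integration.integral_add integrable_indicator_derivative c E continuous_Xop continuous_Yop)
  finally show ?thesis .
qed

context arc_graph
begin

lemma open_Eepi: "open (Eepi D u)"
proof -
  have "continuous_on (cylL D) (\<lambda>x. fst x - u (leftq x))"
    by (intro continuous_intros continuous_on_compose2[OF continuous_u continuous_leftq]) auto
  from continuous_open_preimage[OF this open_cylL[OF open_D] open_greaterThan[of 0]]
  have "open (cylL D \<inter> (\<lambda>x. fst x - u (leftq x)) -` {0<..})" .
  moreover have "Eepi D u = cylL D \<inter> (\<lambda>x. fst x - u (leftq x)) -` {0<..}" unfolding Eepi_eq cylL_eq by auto
  ultimately show ?thesis by simp
qed

lemma EepiR_borel: "EepiR Dr v \<in> sets borel" and Eepi_borel: "Eepi D u \<in> sets borel"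
  using open_EepiR_sides(1) open_Eepi by simp_all

lemma perimeter_Eepi: "H_perimeter (Eepi D u) (cylL D) = ereal area"
proof (rule antisym)
  show "H_perimeter (Eepi D u) (cylL D) \<le> ereal area"
  proof (rule H_perimeter_le)
    fix w1 w2 assume w: "C1c w1 (cylL D)" "C1c w2 (cylL D)" "\<And>p. (w1 p)\<^sup>2 + (w2 p)\<^sup>2 \<le> 1"
    show "(LINT p:Eepi D u|lebesgue. Xop w1 p + Yop w2 p) \<le> area"
      unfolding set_integral_divergence[OF w(1,2) Eepi_borel] divergence_Eepi[OF w(1,2)] by (rule surf_le_area[OF w])
  qed
  show "ereal area \<le> H_perimeter (Eepi D u) (cylL D)"
  proof (rule H_perimeter_ge)
    fix \<delta> :: real assume d: "\<delta> > 0"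
    \<comment> \<open>With the empty set no condition is imposed on the divergence; only the flux
      matters here.\<close>
    obtain w1 w2 where w: "C1c w1 (cylR Dr)" "C1c w2 (cylR Dr)" "\<And>p. (w1 p)\<^sup>2 + (w2 p)\<^sup>2 \<le> 1" "area - \<delta> \<le> surf w1 w2"
      using calibration[OF compact_empty empty_subsetI d] by blast
    \<comment> \<open>The calibrating field lives on the right cylinder; its localisation is an
      admissible field on the left one with the same flux.\<close>
    obtain z1 z2 where z: "C1c z1 (cylL D)" "C1c z2 (cylL D)" "\<And>p. (z1 p)\<^sup>2 + (z2 p)\<^sup>2 \<le> (w1 p)\<^sup>2 + (w2 p)\<^sup>2"
      "divergence (Eepi D u) z1 z2 = surf w1 w2" using divergence_EepiR[OF w(1,2)] by blast
    have "area - \<delta> \<le> (LINT p:Eepi D u|lebesgue. Xop z1 p + Yop z2 p)"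
      unfolding set_integral_divergence[OF z(1,2) Eepi_borel] z(4) by (rule w(4))
    moreover have "(z1 p)\<^sup>2 + (z2 p)\<^sup>2 \<le> 1" for p using z(3)[of p] w(3)[of p] by linarith
    ultimately show "\<exists>v1 v2. C1c v1 (cylL D) \<and> C1c v2 (cylL D) \<and> (\<forall>p. (v1 p)\<^sup>2 + (v2 p)\<^sup>2 \<le> 1) \<and>
       area - \<delta> \<le> (LINT p:Eepi D u|lebesgue. Xop v1 p + Yop v2 p)" using z(1,2) by blast
  qed
qed

lemma surf_EepiR:
  assumes "C1c w1 (cylR Dr)" "C1c w2 (cylR Dr)"
  shows "(LINT p:EepiR Dr v|lebesgue. Xop w1 p + Yop w2 p) = surf w1 w2"
  using set_integral_divergence[OF assms EepiR_borel] divergence_EepiR[OF assms] by auto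

text \<open>The two sets differ only inside a compact \<open>K\<close> on which the calibrating
  field has divergence at most \<open>\<epsilon>\<close>, so replacing one by the other changes its
  integral by at most \<open>\<epsilon>\<close> times the measure of \<open>K\<close>.\<close>

lemma perimeter_competitor:
  assumes F: "F \<in> sets lebesgue" and cc: "compactly_contained ((EepiR Dr v - F) \<union> (F - EepiR Dr v)) (cylR Dr)"
  shows "ereal area \<le> H_perimeter F (cylR Dr)"
proof (rule H_perimeter_ge)
  fix \<delta> :: real assume d: "\<delta> > 0"
  let ?E = "EepiR Dr v"
  define K where "K = closure ((?E - F) \<union> (F - ?E))"
  have K: "compact K" "K \<subseteq> cylR Dr" using cc unfolding compactly_contained_def K_def by auto
  define m where "m = measure lebesgue K"
  have m: "m \<ge> 0" unfolding m_def by simp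
  \<comment> \<open>One half of \<open>\<delta>\<close> pays for the defect of the calibration, the
    other for exchanging the sets; the summand 1 avoids a division by zero.\<close>
  define \<epsilon> where "\<epsilon> = min (\<delta> / 2) (\<delta> / (2 * (m + 1)))"
  have ep: "\<epsilon> > 0" "\<epsilon> \<le> \<delta> / 2" using d m unfolding \<epsilon>_def by (simp, intro min.cobounded1)
  have em: "\<epsilon> * m \<le> \<delta> / 2"
  proof -
    have "\<epsilon> * m \<le> \<delta> / (2 * (m + 1)) * (m + 1)" using m d unfolding \<epsilon>_def by (intro mult_mono) auto
    also have "\<dots> = \<delta> / 2"
    proof -
      have cancel: "d / (2 * c) * c = d / 2" if "c \<noteq> 0" for c d :: real using that by simp
      show ?thesis by (rule cancel) (use m in auto)
    qed
    finally show ?thesis .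
  qed
  obtain w1 w2 where w: "C1c w1 (cylR Dr)" "C1c w2 (cylR Dr)" "\<And>p. (w1 p)\<^sup>2 + (w2 p)\<^sup>2 \<le> 1" "area - \<epsilon> \<le> surf w1 w2"
    "\<And>p. p \<in> K \<Longrightarrow> \<bar>Xop w1 p + Yop w2 p\<bar> \<le> \<epsilon>"
    using calibration[OF K ep(1)] by blast
  define f where "f p = Xop w1 p + Yop w2 p" for p
  have fi: "integrable lebesgue f"
    unfolding f_def[abs_def] using integrable_divergence(2)[OF w(1,2)] integrable_divergence(1)[OF w(1,2)]
    by (subst integrable_completion) (auto intro: borel_measurable_continuous_onI)
  have EL: "?E \<in> sets lebesgue" using EepiR_borel by simp
  have iE: "integrable lebesgue (\<lambda>p. indicat_real ?E p * f p)" and iF: "integrable lebesgue (\<lambda>p. indicat_real F p * f p)"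
    using integrable_mult_indicator[OF EL fi] integrable_mult_indicator[OF F fi] by simp_all
  have KL: "K \<in> lmeasurable" using K(1) by (rule lmeasurable_compact)
  have iK: "integrable lebesgue (\<lambda>p. \<epsilon> * indicat_real K p)"
    using KL by (intro integrable_mult_right) (simp add: lmeasurable_iff_integrable)
  have "(\<integral>p. indicat_real ?E p * f p \<partial>lebesgue) - (\<integral>p. indicat_real F p * f p \<partial>lebesgue)
      = (\<integral>p. indicat_real ?E p * f p - indicat_real F p * f p \<partial>lebesgue)"
    by (rule Bochner_Integration.integral_diff[OF iE iF, symmetric])
  also have "\<dots> \<le> (\<integral>p. \<epsilon> * indicat_real K p \<partial>lebesgue)"
  proof (rule integral_mono[OF Bochner_Integration.integrable_diff[OF iE iF] iK])
    fix p
    show "indicat_real ?E p * f p - indicat_real F p * f p \<le> \<epsilon> * indicat_real K p"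
    proof (cases "p \<in> (?E - F) \<union> (F - ?E)")
      case True
      then have "p \<in> K" unfolding K_def by (rule subsetD[OF closure_subset])
      then show ?thesis using w(5)[of p] True ep(1) unfolding f_def by (auto simp: indicator_def)
    next
      case False
      then have "indicat_real ?E p = indicat_real F p" by (auto simp: indicator_def)
      then show ?thesis using ep(1) by simp
    qed
  qed
  also have "\<dots> = \<epsilon> * m" unfolding m_def using KL by (simp add: measure_def lmeasurable_iff_integrable)
  finally have "(LINT p:?E|lebesgue. f p) - (LINT p:F|lebesgue. f p) \<le> \<delta> / 2"
    using em unfolding set_lebesgue_integral_def by simp
  then have "area - \<delta> \<le> (LINT p:F|lebesgue. f p)"
    using surf_EepiR[OF w(1,2)] w(4) ep(2) unfolding f_def by linarith
  then show "\<exists>v1 v2. C1c v1 (cylR Dr) \<and> C1c v2 (cylR Dr) \<and> (\<forall>p. (v1 p)\<^sup>2 + (v2 p)\<^sup>2 \<le> 1) \<and>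
     area - \<delta> \<le> (LINT p:F|lebesgue. Xop v1 p + Yop v2 p)" using w(1-3) unfolding f_def by blast
qed

lemma perimeter_EepiR: "H_perimeter (EepiR Dr v) (cylR Dr) = ereal area"
proof (rule antisym)
  show "H_perimeter (EepiR Dr v) (cylR Dr) \<le> ereal area"
  proof (rule H_perimeter_le)
    fix w1 w2 assume w: "C1c w1 (cylR Dr)" "C1c w2 (cylR Dr)" "\<And>p. (w1 p)\<^sup>2 + (w2 p)\<^sup>2 \<le> 1"
    show "(LINT p:EepiR Dr v|lebesgue. Xop w1 p + Yop w2 p) \<le> area"
      unfolding surf_EepiR[OF w(1,2)] by (rule surf_le_area[OF w])
  qed
  show "ereal area \<le> H_perimeter (EepiR Dr v) (cylR Dr)"
    \<comment> \<open>The epigraph is a competitor of itself, with empty symmetric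
      difference.\<close>
    by (rule perimeter_competitor) (use EepiR_borel in \<open>simp_all add: compactly_contained_def\<close>)
qed

text \<open>A separate \<open>f\<close> appears because the locale works with a function Lipschitz
  on the whole plane, whereas the area belongs to the function given on \<open>D\<close>. Both share
  the slope.\<close>

lemma H_area_eq:
  assumes lp: "L-lipschitz_on D f" and M: "\<And>q. q \<in> D \<Longrightarrow> \<bar>f q\<bar> \<le> M" and ar: "local_arcs D f \<beta>"
  shows "H_area D f = ereal area"
proof -
  have "AE q in lborel. ennreal (sqrt (1 + (Bop f q)\<^sup>2)) * indicator D q = ennreal (indicat_real D q * sqrt (1 + (\<beta> q)\<^sup>2))"
    using AE_Bop_eq[OF open_D lp M slope_le ar] by (rule eventually_mono) (auto simp: indicator_def)
  then have "(\<integral>\<^sup>+ q\<in>D. ennreal (sqrt (1 + (Bop f q)\<^sup>2)) \<partial>lebesgue) = (\<integral>\<^sup>+ q. ennreal (indicat_real D q * sqrt (1 + (\<beta> q)\<^sup>2)) \<partial>lborel)"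
    unfolding nn_integral_completion by (rule nn_integral_cong_AE)
  also have "\<dots> = ennreal area" unfolding area_def
    by (rule nn_integral_eq_integral[OF integrable_area]) simp
  finally have "H_area D f = enn2ereal (ennreal area)" unfolding H_area_def by simp
  moreover have "area \<ge> 0" unfolding area_def by (rule Bochner_Integration.integral_nonneg) simp
  ultimately show ?thesis by simp
qed

end

section \<open>The lens-shaped domain and the conclusion\<close>

lemma has_arc_cong:
  assumes "\<And>q. q \<in> D \<Longrightarrow> f q = g q" "q \<in> D" "has_arc D f q b"
  shows "has_arc D g q b"
proof -
  have "arc_pt g b q h = arc_pt f b q h" for h unfolding arc_pt_def assms(1)[OF assms(2)] ..
  moreover have "g (arc_pt f b q h) = g q + b * h" if "arc_pt f b q h \<in> D" "f (arc_pt f b q h) = f q + b * h" for h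
    using assms(1)[OF that(1)] assms(1)[OF assms(2)] that(2) by simp
  ultimately show ?thesis using assms(3) unfolding has_arc_def by (metis (no_types, lifting))
qed

text \<open>The two boundary curves have to lie in the frontier, where \<phi> is continuous, for the
  boundary functions to be continuous up to the endpoints. The two tips are approached along the
  axis \<open>y = 0\<close>.\<close>

lemma lens_region:
  fixes \<gamma>1 \<gamma>2 :: "real \<Rightarrow> real" and tbar :: real
  assumes tbar: "tbar > 0" and c: "continuous_on {0..tbar} \<gamma>1" "continuous_on {0..tbar} \<gamma>2"
    and sgn: "\<forall>s\<in>{0<..<tbar}. \<gamma>1 s < 0 \<and> 0 < \<gamma>2 s"
    and ends: "\<gamma>1 0 = 0" "\<gamma>1 tbar = 0" "\<gamma>2 0 = 0" "\<gamma>2 tbar = 0"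
    and D: "D = {(y, t). t \<in> {0<..<tbar} \<and> \<gamma>1 t < y \<and> y < \<gamma>2 t}"
  shows "open D" and "bounded D"
    and "s \<in> {0..tbar} \<Longrightarrow> (\<gamma>1 s, s) \<in> frontier D" and "s \<in> {0..tbar} \<Longrightarrow> (\<gamma>2 s, s) \<in> frontier D"
proof -
  let ?I = "UNIV \<times> {0<..<tbar} :: (real \<times> real) set"
  have oI: "open ?I" by (intro open_Times) auto
  have cont: "continuous_on ?I (\<lambda>q. \<gamma> (snd q))" if "continuous_on {0..tbar} \<gamma>" for \<gamma> :: "real \<Rightarrow> real"
    by (rule continuous_on_compose2[OF that continuous_on_snd[OF continuous_on_id]]) auto
  have sides: "open (?I \<inter> (\<lambda>q. fst q - \<gamma>1 (snd q)) -` {0<..})" "open (?I \<inter> (\<lambda>q. \<gamma>2 (snd q) - fst q) -` {0<..})"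
    by (rule continuous_open_preimage[OF _ oI open_greaterThan]; intro continuous_intros cont c)+
  have "D = (?I \<inter> (\<lambda>q. fst q - \<gamma>1 (snd q)) -` {0<..}) \<inter> (?I \<inter> (\<lambda>q. \<gamma>2 (snd q) - fst q) -` {0<..})"
    unfolding D by auto
  then show oD: "open D" using open_Int[OF sides] by metis
  have "compact (\<gamma>1 ` {0..tbar} \<union> \<gamma>2 ` {0..tbar})" by (intro compact_Un compact_continuous_image c) auto
  then obtain G where G: "\<forall>x\<in>\<gamma>1 ` {0..tbar} \<union> \<gamma>2 ` {0..tbar}. norm x \<le> G" using compact_imp_bounded bounded_iff by metis
  have "D \<subseteq> cbox (- G, 0) (G, tbar)"
  proof
    fix q assume "q \<in> D"
    then obtain y t where q: "q = (y, t)" "0 < t" "t < tbar" "\<gamma>1 t < y" "y < \<gamma>2 t" unfolding D by auto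
    then have "norm (\<gamma>1 t) \<le> G" "norm (\<gamma>2 t) \<le> G" using G by auto
    then show "q \<in> cbox (- G, 0) (G, tbar)" unfolding q(1) cbox_Pair_eq using q by auto
  qed
  then show "bounded D" using bounded_cbox bounded_subset by blast
  have axis: "(0, t) \<in> D" if "0 < t" "t < tbar" for t using sgn that unfolding D by auto
  have fr: "p \<in> frontier D" if "p \<notin> D" "\<And>e. e > 0 \<Longrightarrow> \<exists>q\<in>D. dist q p < e" for p
    using that closure_approachable[of p D] interior_open[OF oD] unfolding frontier_def by auto
  have end0: "\<exists>q\<in>D. dist q (0, 0) < e" if "e > 0" for e
    using axis[of "min (e / 2) (tbar / 2)"] that tbar
    by (intro bexI[of _ "(0, min (e / 2) (tbar / 2))"]) (auto simp: dist_Pair_Pair dist_real_def min_def)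
  have end1: "\<exists>q\<in>D. dist q (0, tbar) < e" if "e > 0" for e
    using axis[of "tbar - min (e / 2) (tbar / 2)"] that tbar
    by (intro bexI[of _ "(0, tbar - min (e / 2) (tbar / 2))"]) (auto simp: dist_Pair_Pair dist_real_def min_def)
  have mid: "\<exists>q\<in>D. dist q (\<gamma>1 s, s) < e" "\<exists>q\<in>D. dist q (\<gamma>2 s, s) < e" if s: "s \<in> {0<..<tbar}" and e: "e > 0" for s e
  proof -
    define h where "h = min (e / 2) ((\<gamma>2 s - \<gamma>1 s) / 2)"
    have w: "\<gamma>1 s < \<gamma>2 s" using sgn s by force
    have h: "0 < h" "h < e" "h < \<gamma>2 s - \<gamma>1 s" using w e unfolding h_def by (auto simp: min_def)
    show "\<exists>q\<in>D. dist q (\<gamma>1 s, s) < e"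
      using s h unfolding D by (intro bexI[of _ "(\<gamma>1 s + h, s)"]) (auto simp: dist_Pair_Pair dist_real_def)
    show "\<exists>q\<in>D. dist q (\<gamma>2 s, s) < e"
      using s h unfolding D by (intro bexI[of _ "(\<gamma>2 s - h, s)"]) (auto simp: dist_Pair_Pair dist_real_def)
  qed
  show "(\<gamma>1 s, s) \<in> frontier D" if s0: "s \<in> {0..tbar}"
  proof (rule fr)
    show "(\<gamma>1 s, s) \<notin> D" unfolding D by simp
    consider "s = 0" | "s = tbar" | "s \<in> {0<..<tbar}" using s0 by force
    then show "\<exists>q\<in>D. dist q (\<gamma>1 s, s) < e" if "e > 0" for e
      by cases (use that end0 end1 mid(1) ends in auto)
  qed
  show "(\<gamma>2 s, s) \<in> frontier D" if s0: "s \<in> {0..tbar}"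
  proof (rule fr)
    show "(\<gamma>2 s, s) \<notin> D" unfolding D by simp
    consider "s = 0" | "s = tbar" | "s \<in> {0<..<tbar}" using s0 by force
    then show "\<exists>q\<in>D. dist q (\<gamma>2 s, s) < e" if "e > 0" for e
      by cases (use that end0 end1 mid(2) ends in auto)
  qed
qed

theorem theorem1p3:
  fixes tbar :: real
    and \<gamma>1 \<gamma>2 :: "real \<Rightarrow> real"
    and D :: "(real \<times> real) set"
    and \<phi> u :: "real \<times> real \<Rightarrow> real"
    and Dr :: "(real \<times> real) set"
    and ur :: "real \<times> real \<Rightarrow> real"
  assumes tbar_pos: "tbar > 0"
    and g1_lip: "\<exists>C. C-lipschitz_on {0<..<tbar} \<gamma>1"
    and g2_lip: "\<exists>C. C-lipschitz_on {0<..<tbar} \<gamma>2"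
    and g1_cont: "continuous_on {0..tbar} \<gamma>1"
    and g2_cont: "continuous_on {0..tbar} \<gamma>2"
    and g_sign: "\<forall>s\<in>{0<..<tbar}. \<gamma>1 s < 0 \<and> 0 < \<gamma>2 s"
    and g_ends: "\<gamma>1 0 = 0" "\<gamma>1 tbar = 0" "\<gamma>2 0 = 0" "\<gamma>2 tbar = 0"
    and D_def: "D = {(y, t). t \<in> {0<..<tbar} \<and> \<gamma>1 t < y \<and> y < \<gamma>2 t}"
    and D_convex: "convex D"
    and phi_cont: "continuous_on (frontier D) \<phi>"
    and phi1_lip: "\<exists>C. C-lipschitz_on {0<..<tbar} (bdry_fun \<phi> \<gamma>1)"
    and phi2_lip: "\<exists>C. C-lipschitz_on {0<..<tbar} (bdry_fun \<phi> \<gamma>2)"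
    and zeta_small: "zeta tbar \<gamma>1 \<gamma>2 \<phi> < (sqrt 721 - 25) / 48"
    and u_lip: "\<exists>C. C-lipschitz_on D u"
    and u_cont: "continuous_on (closure D) u"
    and u_bdry: "\<forall>q\<in>frontier D. u q = \<phi> q"
    and u_graph: "Sgraph D u = R_phi tbar \<gamma>1 \<gamma>2 \<phi>"
    and Dr_open: "open Dr"
    and ur_loclip: "\<forall>q\<in>Dr. \<exists>e>0. \<exists>C. C-lipschitz_on (ball q e \<inter> Dr) ur"
    and ur_graph: "Sgraph D u = SgraphR Dr ur"
  shows "H_area D u = H_perimeter (Eepi D u) (cylL D)
    \<and> H_perimeter (Eepi D u) (cylL D) = H_perimeter (EepiR Dr ur) (cylR Dr)
    \<and> (\<forall>F \<in> sets lebesgue.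
         compactly_contained ((EepiR Dr ur - F) \<union> (F - EepiR Dr ur)) (cylR Dr)
         \<longrightarrow> H_perimeter (EepiR Dr ur) (cylR Dr) \<le> H_perimeter F (cylR Dr))"
proof -
  let ?I = "{0<..<tbar}" and ?f1 = "bdry_fun \<phi> \<gamma>1" and ?f2 = "bdry_fun \<phi> \<gamma>2"
  note region = lens_region[OF tbar_pos g1_cont g2_cont g_sign g_ends D_def]
  have f_cont: "continuous_on {0..tbar} (bdry_fun \<phi> \<gamma>)"
    if "continuous_on {0..tbar} \<gamma>" "\<And>s. s \<in> {0..tbar} \<Longrightarrow> (\<gamma> s, s) \<in> frontier D" for \<gamma>
    unfolding bdry_fun_def[abs_def]
    by (rule continuous_on_compose2[OF phi_cont]) (use that in \<open>auto intro!: continuous_intros\<close>)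
  have f1_cont: "continuous_on {0..tbar} ?f1" and f2_cont: "continuous_on {0..tbar} ?f2"
    using f_cont[OF g1_cont region(3)] f_cont[OF g2_cont region(4)] by blast+
  define Lg where "Lg = max (lip_const ?I \<gamma>1) (lip_const ?I \<gamma>2)"
  define Lf where "Lf = max (lip_const ?I ?f1) (lip_const ?I ?f2)"
  define G where "G = max (sup_norm ?I \<gamma>1) (sup_norm ?I \<gamma>2)"
  define P where "P = max (sup_norm ?I ?f1) (sup_norm ?I ?f2)"
  have lip_g1: "Lg-lipschitz_on ?I \<gamma>1" and lip_g2: "Lg-lipschitz_on ?I \<gamma>2"
    and lip_f1: "Lf-lipschitz_on ?I ?f1" and lip_f2: "Lf-lipschitz_on ?I ?f2"
    unfolding Lg_def Lf_def
    using lipschitz_on_le[OF lip_const_lipschitz_on[OF g1_lip]] lipschitz_on_le[OF lip_const_lipschitz_on[OF g2_lip]]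
      lipschitz_on_le[OF lip_const_lipschitz_on[OF phi1_lip]] lipschitz_on_le[OF lip_const_lipschitz_on[OF phi2_lip]]
    by simp_all
  have bounds: "\<bar>\<gamma>1 s\<bar> \<le> G" "\<bar>\<gamma>2 s\<bar> \<le> G" "\<bar>?f1 s\<bar> \<le> P" "\<bar>?f2 s\<bar> \<le> P" if "s \<in> ?I" for s
    using abs_le_sup_norm[OF lip_g1 that] abs_le_sup_norm[OF lip_g2 that] abs_le_sup_norm[OF lip_f1 that] abs_le_sup_norm[OF lip_f2 that]
    unfolding G_def P_def by linarith+
  \<comment> \<open>As \<open>73 = 25 + 48\<close>, this puts the bound on \<open>zeta\<close> below
    1.\<close>
  have "sqrt 721 < 73" by (rule real_less_lsqrt) auto
  then have "(sqrt 721 - 25) / 48 < (1::real)" by simp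
  then have small: "4 * (G + Lg) * (P + Lf) < 1"
    using zeta_small unfolding zeta_def Let_def G_def[symmetric] Lg_def[symmetric] P_def[symmetric] Lf_def[symmetric] by linarith
  have lam: "lam tbar \<gamma>1 \<gamma>2 \<phi> s \<in> ?I \<and>
      lam tbar \<gamma>1 \<gamma>2 \<phi> s - s + 2 * (\<gamma>2 (lam tbar \<gamma>1 \<gamma>2 \<phi> s) - \<gamma>1 s) * (?f1 s + ?f2 (lam tbar \<gamma>1 \<gamma>2 \<phi> s)) = 0"
    if s: "s \<in> ?I" for s
  proof (rule lam_solution[OF s g_ends])
    show "Lg-lipschitz_on {0..tbar} \<gamma>1" "Lg-lipschitz_on {0..tbar} \<gamma>2" "Lf-lipschitz_on {0..tbar} ?f2"
      by (rule lipschitz_on_closed_interval[OF lip_g1 g1_cont tbar_pos] lipschitz_on_closed_interval[OF lip_g2 g2_cont tbar_pos]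
        lipschitz_on_closed_interval[OF lip_f2 f2_cont tbar_pos])+
    show "\<bar>\<gamma>2 l\<bar> \<le> G" if "l \<in> {0..tbar}" for l by (rule abs_le_closed_interval[OF g2_cont tbar_pos bounds(2) that])
    show "\<bar>?f2 l\<bar> \<le> P" if "l \<in> {0..tbar}" for l by (rule abs_le_closed_interval[OF f2_cont tbar_pos bounds(4) that])
  qed (use bounds(1,3)[OF s] small in auto)
  have "\<forall>q\<in>D. \<exists>b. has_arc D u q b" using ruled_graph_has_arc[OF g_sign D_def u_graph lam] by blast
  then obtain \<beta> where \<beta>: "\<And>q. q \<in> D \<Longrightarrow> has_arc D u q (\<beta> q)" by metis
  obtain C where C: "C-lipschitz_on D u" using u_lip by blast
  have axis: "(0, tbar / 2) \<in> D" using g_sign tbar_pos unfolding D_def by simp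
  have "closure D \<noteq> {}" using axis closure_subset by blast
  \<comment> \<open>The flows in the Gauss-Green formulas lead out of \<open>D\<close>, so the
    function has to be defined beyond it. Convexity of \<open>closure D\<close> gives an extension
    with the same Lipschitz constant.\<close>
  from lipschitz_extension_convex[OF convex_closure[OF D_convex] this lipschitz_on_closure[OF C u_cont] closed_closure]
  obtain g where g: "C-lipschitz_on UNIV g" "\<And>q. q \<in> closure D \<Longrightarrow> g q = u q" by blast
  have gu: "g q = u q" if "q \<in> D" for q using g(2) closure_subset that by blast
  have "compact (u ` closure D)" by (rule compact_continuous_image[OF u_cont compact_closure[THEN iffD2, OF region(2)]])
  then obtain M where M0: "\<forall>x\<in>u ` closure D. norm x \<le> M" using compact_imp_bounded bounded_iff by metis
  have M: "\<bar>u q\<bar> \<le> M" if "q \<in> D" for q using M0 closure_subset that by fastforce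
  have Mg: "\<bar>g q\<bar> \<le> M" if "q \<in> D" for q using M[OF that] gu[OF that] by simp
  have arc_g: "has_arc D g q (\<beta> q)" if "q \<in> D" for q using has_arc_cong[OF gu[symmetric] that \<beta>[OF that]] .
  have slope: "\<bar>\<beta> q\<bar> \<le> 2 * C * (1 + 4 * M)" if "q \<in> D" for q
    by (rule has_arc_slope_bound[OF C that M[OF that] \<beta>[OF that]])
  have S: "Sgraph D g = Sgraph D u" and E: "Eepi D g = Eepi D u"
    unfolding Sgraph_eq Eepi_eq using gu by (metis (no_types, lifting))+
  interpret arc_graph D Dr g \<beta> ur C "2 * C * (1 + 4 * M)"
  proof
    show "open D" "bounded D" by (rule region)+
    show "connected D" using D_convex by (rule convex_connected)
    show "\<exists>q\<in>D. fst q = 0" using axis by force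
    show "C-lipschitz_on UNIV g" by (rule g(1))
    show "local_arcs D g \<beta>" by (rule local_arcsI[OF region(1) lipschitz_on_subset[OF g(1)] Mg arc_g]) auto
    show "\<bar>\<beta> q\<bar> \<le> 2 * C * (1 + 4 * M)" if "q \<in> D" for q by (rule slope[OF that])
    show "open Dr" "\<forall>q\<in>Dr. \<exists>e>0. \<exists>C. C-lipschitz_on (ball q e \<inter> Dr) ur" by (rule Dr_open ur_loclip)+
    show "Sgraph D g = SgraphR Dr ur" unfolding S by (rule ur_graph)
  qed
  \<comment> \<open>The area is evaluated for \<open>u\<close> itself, while the perimeters come
    from the extension \<open>g\<close>, which has the same epigraph over \<open>D\<close>.\<close>
  have "H_area D u = ereal area" by (rule H_area_eq[OF C M local_arcsI[OF region(1) C M \<beta>]])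
  then show ?thesis using perimeter_Eepi perimeter_EepiR perimeter_competitor unfolding E by metis
qed

end
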